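(* Let $\rho\in(0,1)$ and $\theta>0$. Let $\eta\in L^2_{\mathbb C}$ and $\xi\in U_{p,q}$. Then $$T_{\nu_{\rho,\theta}}\big(\delta(\langle\cdot,\eta\rangle)\big)(\xi)=\frac{e^{-k}}{\sqrt{2\pi\langle\eta,\eta\rangle}\,\Gamma(\rho,\theta)}\,\Psi\!\left(1-\rho,\tfrac12-\rho;k\right),$$ where $$k=\theta+\frac12\left(\langle\xi,\xi\rangle-\frac{\langle\eta,\xi\rangle^2}{\langle\eta,\eta\rangle}\right).$$
   Context: $\mathcal S=\mathcal S(\mathbb R)$ is the real Schwartz space, $\mathcal S'$ its dual, $\mathcal S_{\mathbb C}$ the complexification of $\mathcal S$, and $L^2_{\mathbb C}$ the complexification of the real space $L^2=L^2(\mathbb R)$. $\langle\cdot,\cdot\rangle$ denotes the dual pairing and the real $L^2$ inner product, extended bilinearly (not sesquilinearly) to complexifications; $\|\cdot\|$ is the $L^2$ norm. $\Gamma(\rho,z)=\int_z^\infty e^{-t}t^{\rho-1}\,dt$ is the upper incomplete gamma function (principal branch; the path does not cross the negative real axis). For $\rho\in(0,1]$, $\theta>0$, the Gamma-grey measure $\nu_{\rho,\theta}$ is the probability measure on $\mathcal S'$ (with its Borel/cylinder $\sigma$-algebra) with $\int_{\mathcal S'}e^{i\langle\omega,\phi\rangle}\,d\nu_{\rho,\theta}(\omega)=\Gamma(\rho,\theta+\tfrac12\langle\phi,\phi\rangle)/\Gamma(\rho,\theta)$ for $\phi\in\mathcal S$. For real $\eta\in L^2$, $\langle\cdot,\eta\rangle$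 is the $L^2(\nu_{\rho,\theta})$-limit of $\langle\cdot,\phi_n\rangle$ for $\phi_n\in\mathcal S$, $\phi_n\to\eta$ in $L^2$; for $\eta=\eta_1+i\eta_2\in L^2_{\mathbb C}$ with $\eta_1,\eta_2\in L^2$, $\langle\cdot,\eta\rangle=\langle\cdot,\eta_1\rangle+i\langle\cdot,\eta_2\rangle$. Let $(|\cdot|_p)_{p\in\mathbb N}$ be an increasing family of Hilbertian norms defining the nuclear topology of $\mathcal S$, dominating the $L^2$ norm, and extended to $\mathcal S_{\mathbb C}$ and to tensor powers. $U_{p,q}=\{\xi\in\mathcal S_{\mathbb C}:2^q|\xi|_p^2<1\}$, where $p,q\in\mathbb N$ are fixed large enough that $U_{p,q}\subset\mathcal U_\theta:=\{\xi_1+i\xi_2:\xi_1,\xi_2\in\mathcal S,\ \|\xi_1\|<\sqrt\theta,\ \|\xi_2\|<\sqrt\theta\}$ and that the transforms below are defined on $U_{p,q}$. Distribution space: let $\ell(\xi)=\int_{\mathcal S'}e^{\langle\omega,\xi\rangle}d\nu_{\rho,\theta}(\omega)=\Gamma(\rho,\theta-\frac12\langle\xi,\xi\rangle)/\Gamma(\rho,\theta)$ for $\xi\in\mathcal U_\theta$, and define the Appell polynomials $P_n$ by $e^{\langle\omega,\xi\rangle}/\ell(\xi)=\sum_{n\ge0}\frac1{n!}\langle P_n(\omega),\xi^{\otimes n}\rangle$ near $\xi=0$. For polynomials $\varphi=\sum_n\langle P_n,\varphi^{(n)}\rangle$ put $\|\varphi\|_{p,q}^2=\sum_n(n!)^22^{nq}|\varphi^{(n)}|_p^2$.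 The test space $(\mathcal S)^1_{\nu_{\rho,\theta}}$ is the projective limit over $p,q$ of the completions, and $(\mathcal S)^{-1}_{\nu_{\rho,\theta}}$ is its dual, with pairing $\langle\langle\cdot,\cdot\rangle\rangle_{\nu_{\rho,\theta}}$ the bilinear extension of the inner product of $L^2(\nu_{\rho,\theta})$. $T$-transform: for $\Phi\in(\mathcal S)^{-1}_{\nu_{\rho,\theta}}$ and $\xi\in U_{p,q}$, $(T_{\nu_{\rho,\theta}}\Phi)(\xi)=\langle\langle\Phi,e^{i\langle\cdot,\xi\rangle}\rangle\rangle_{\nu_{\rho,\theta}}$, also written $\int_{\mathcal S'}e^{i\langle\omega,\xi\rangle}\Phi(\omega)\,\nu_{\rho,\theta}(d\omega)$. Donsker's delta is the weak integral $\delta(\langle\cdot,\eta\rangle)=\frac1{2\pi}\int_{\mathbb R}e^{is\langle\cdot,\eta\rangle}\,ds$ in $(\mathcal S)^{-1}_{\nu_{\rho,\theta}}$, i.e. the element whose $T$-transform at $\xi$ is $\frac1{2\pi}\int_{\mathbb R}T_{\nu_{\rho,\theta}}(e^{is\langle\cdot,\eta\rangle})(\xi)\,ds$. $\Psi$ is the Tricomi confluent hypergeometric function $\Psi(a,c;z)=\frac{\Gamma(1-c)}{\Gamma(1+a-c)}\,{}_1F_1(a;c;z)+\frac{\Gamma(c-1)}{\Gamma(a)}z^{1-c}\,{}_1F_1(1+a-c;2-c;z)$ (principal branch, extended by continuity in $c$ to integer $c$), with ${}_1F_1(a;c;z)=\sum_{n\ge0}\frac{(a)_n}{(c)_n}\frac{z^n}{n!}$,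 where $(\cdot)_n$ is the Pochhammer symbol and $\Gamma(\cdot)$ with one argument is the gamma function. *)

theory Defs
  imports "HOL-Probability.Probability" "HOL-Complex_Analysis.Complex_Analysis"
begin

section \<open>Schwartz space, its dual, and the real and complex \<open>L\<^sup>2\<close> spaces\<close>

definition schwartz :: "(real \<Rightarrow> real) set" where
  "schwartz = {f. \<forall>n. (\<forall>x. (deriv ^^ n) f field_differentiable at x) \<and>
                     (\<forall>m. bounded (range (\<lambda>x. x ^ m * (deriv ^^ n) f x)))}"

definition schwartz_seminorm :: "nat \<Rightarrow> nat \<Rightarrow> (real \<Rightarrow> real) \<Rightarrow> real" where
  "schwartz_seminorm m n f = (SUP x. \<bar>x ^ m * (deriv ^^ n) f x\<bar>)"

definition schwartz_dual :: "((real \<Rightarrow> real) \<Rightarrow> real) set" where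
  "schwartz_dual = {\<omega> \<in> extensional schwartz.
     (\<forall>f\<in>schwartz. \<forall>g\<in>schwartz. \<forall>a. \<omega> (\<lambda>x. a * f x + g x) = a * \<omega> f + \<omega> g) \<and>
     (\<exists>C N. \<forall>f\<in>schwartz. \<bar>\<omega> f\<bar> \<le> C * (\<Sum>m\<le>N. \<Sum>n\<le>N. schwartz_seminorm m n f))}"

definition schwartz_dual_algebra :: "((real \<Rightarrow> real) \<Rightarrow> real) measure" where
  "schwartz_dual_algebra =
     sigma schwartz_dual {{\<omega> \<in> schwartz_dual. \<omega> f \<in> B} | f B. f \<in> schwartz \<and> B \<in> sets borel}"

definition L2 :: "(real \<Rightarrow> real) set" where
  "L2 = {f \<in> borel_measurable lborel. integrable lborel (\<lambda>x. (f x)\<^sup>2)}"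

definition L2_norm :: "(real \<Rightarrow> real) \<Rightarrow> real" where
  "L2_norm f = sqrt (LINT x|lborel. (f x)\<^sup>2)"

definition complexify :: "(real \<Rightarrow> real) set \<Rightarrow> (real \<Rightarrow> complex) set" where
  "complexify A = {\<xi>. Re \<circ> \<xi> \<in> A \<and> Im \<circ> \<xi> \<in> A}"

text \<open>Bilinear, not sesquilinear: no complex conjugation.\<close>

definition bilin :: "(real \<Rightarrow> complex) \<Rightarrow> (real \<Rightarrow> complex) \<Rightarrow> complex" where
  "bilin f g = (CLINT x|lborel. f x * g x)"

definition dual_pair :: "((real \<Rightarrow> real) \<Rightarrow> real) \<Rightarrow> (real \<Rightarrow> complex) \<Rightarrow> complex" where
  "dual_pair \<omega> \<xi> = of_real (\<omega> (Re \<circ> \<xi>)) + \<i> * of_real (\<omega> (Im \<circ> \<xi>))"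


section \<open>Special functions\<close>

text \<open>The path of integration is the horizontal ray from \<open>z\<close> to \<open>z + \<infinity>\<close>, which does not meet the
  negative real axis unless \<open>z\<close> lies on it.\<close>

definition upper_Gamma :: "complex \<Rightarrow> complex \<Rightarrow> complex" where
  "upper_Gamma a z =
     (CLINT x:{0<..}|lborel. exp (- (z + of_real x)) * (z + of_real x) powr (a - 1))"

definition hyp1F1 :: "complex \<Rightarrow> complex \<Rightarrow> complex \<Rightarrow> complex" where
  "hyp1F1 a c z = (\<Sum>n. pochhammer a n / pochhammer c n * (z ^ n / fact n))"

definition tricomi_nonint :: "complex \<Rightarrow> complex \<Rightarrow> complex \<Rightarrow> complex" where
  "tricomi_nonint a c z =
     Gamma (1 - c) / Gamma (1 + a - c) * hyp1F1 a c z +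
     Gamma (c - 1) / Gamma a * z powr (1 - c) * hyp1F1 (1 + a - c) (2 - c) z"

definition tricomi :: "complex \<Rightarrow> complex \<Rightarrow> complex \<Rightarrow> complex" where
  "tricomi a c z =
     (if c \<in> \<int> then Lim (at c) (\<lambda>c'. tricomi_nonint a c' z) else tricomi_nonint a c z)"


section \<open>The Gamma-grey measure\<close>

text \<open>By the uniqueness part of the Bochner--Minlos theorem at most one measure satisfies this
  predicate.\<close>

definition gamma_grey_measure ::
    "real \<Rightarrow> real \<Rightarrow> ((real \<Rightarrow> real) \<Rightarrow> real) measure \<Rightarrow> bool" where
  "gamma_grey_measure \<rho> \<theta> \<nu> \<longleftrightarrow>
     prob_space \<nu> \<and> sets \<nu> = sets schwartz_dual_algebra \<and>
     (\<forall>\<phi>\<in>schwartz. (CLINT \<omega>|\<nu>. exp (\<i> * of_real (\<omega> \<phi>))) =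
        upper_Gamma (of_real \<rho>) (of_real (\<theta> + (1/2) * (LINT x|lborel. \<phi> x * \<phi> x))) /
        upper_Gamma (of_real \<rho>) (of_real \<theta>))"

text \<open>\<open>X\<close> is a version of the random variable \<open>\<langle>\<cdot>, \<eta>\<rangle>\<close>, first for real and then for complex \<open>\<eta>\<close>.
  It is determined up to \<open>\<nu>\<close>-null sets.\<close>

definition real_L2_pairing ::
    "((real \<Rightarrow> real) \<Rightarrow> real) measure \<Rightarrow> (real \<Rightarrow> real) \<Rightarrow> (((real \<Rightarrow> real) \<Rightarrow> real) \<Rightarrow> real) \<Rightarrow> bool" where
  "real_L2_pairing \<nu> \<eta> X \<longleftrightarrow>
     X \<in> borel_measurable \<nu> \<and>
     (\<exists>\<phi>. (\<forall>n. \<phi> n \<in> schwartz) \<and>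
          (\<lambda>n. L2_norm (\<lambda>x. \<phi> n x - \<eta> x)) \<longlonglongrightarrow> 0 \<and>
          (\<forall>n. integrable \<nu> (\<lambda>\<omega>. (\<omega> (\<phi> n) - X \<omega>)\<^sup>2)) \<and>
          (\<lambda>n. LINT \<omega>|\<nu>. (\<omega> (\<phi> n) - X \<omega>)\<^sup>2) \<longlonglongrightarrow> 0)"

definition L2_pairing ::
    "((real \<Rightarrow> real) \<Rightarrow> real) measure \<Rightarrow> (real \<Rightarrow> complex) \<Rightarrow> (((real \<Rightarrow> real) \<Rightarrow> real) \<Rightarrow> complex) \<Rightarrow> bool" where
  "L2_pairing \<nu> \<eta> X \<longleftrightarrow>
     real_L2_pairing \<nu> (Re \<circ> \<eta>) (Re \<circ> X) \<and> real_L2_pairing \<nu> (Im \<circ> \<eta>) (Im \<circ> X)"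


section \<open>Hilbertian norms and neighbourhoods of zero\<close>

text \<open>\<open>ip p\<close> is the inner product belonging to the Hilbertian norm \<open>|\<cdot>|\<^sub>p\<close>; its positive
  definiteness follows from the domination of the \<open>L\<^sup>2\<close> norm. The last two clauses say that the
  norms generate the topology of the Schwartz space.\<close>

definition hilbertian_family :: "(nat \<Rightarrow> (real \<Rightarrow> real) \<Rightarrow> (real \<Rightarrow> real) \<Rightarrow> real) \<Rightarrow> bool" where
  "hilbertian_family ip \<longleftrightarrow>
     (\<forall>p. \<forall>f\<in>schwartz. \<forall>g\<in>schwartz. ip p f g = ip p g f) \<and>
     (\<forall>p. \<forall>f\<in>schwartz. \<forall>g\<in>schwartz. \<forall>h\<in>schwartz. \<forall>a.
        ip p (\<lambda>x. a * f x + g x) h = a * ip p f h + ip p g h) \<and>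
     (\<forall>p. \<forall>f\<in>schwartz. ip p f f \<le> ip (Suc p) f f) \<and>
     (\<forall>p. \<forall>f\<in>schwartz. L2_norm f \<le> sqrt (ip p f f)) \<and>
     (\<forall>p. \<exists>C N. \<forall>f\<in>schwartz. sqrt (ip p f f) \<le> C * (\<Sum>m\<le>N. \<Sum>n\<le>N. schwartz_seminorm m n f)) \<and>
     (\<forall>m n. \<exists>C p. \<forall>f\<in>schwartz. schwartz_seminorm m n f \<le> C * sqrt (ip p f f))"

text \<open>The Hermitian extension of \<open>ip p\<close> to the complexification, linear in the first argument.\<close>

definition herm ::
    "(nat \<Rightarrow> (real \<Rightarrow> real) \<Rightarrow> (real \<Rightarrow> real) \<Rightarrow> real) \<Rightarrow> nat \<Rightarrow> (real \<Rightarrow> complex) \<Rightarrow> (real \<Rightarrow> complex) \<Rightarrow> complex" where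
  "herm ip p \<xi> \<zeta> =
     Complex (ip p (Re \<circ> \<xi>) (Re \<circ> \<zeta>) + ip p (Im \<circ> \<xi>) (Im \<circ> \<zeta>))
             (ip p (Im \<circ> \<xi>) (Re \<circ> \<zeta>) - ip p (Re \<circ> \<xi>) (Im \<circ> \<zeta>))"

definition U_nbhd ::
    "(nat \<Rightarrow> (real \<Rightarrow> real) \<Rightarrow> (real \<Rightarrow> real) \<Rightarrow> real) \<Rightarrow> nat \<Rightarrow> nat \<Rightarrow> (real \<Rightarrow> complex) set" where
  "U_nbhd ip p q = {\<xi> \<in> complexify schwartz. 2 ^ q * Re (herm ip p \<xi> \<xi>) < 1}"

definition U_theta :: "real \<Rightarrow> (real \<Rightarrow> complex) set" where
  "U_theta \<theta> = {\<xi> \<in> complexify schwartz. L2_norm (Re \<circ> \<xi>) < sqrt \<theta> \<and> L2_norm (Im \<circ> \<xi>) < sqrt \<theta>}"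


section \<open>Appell polynomials and the distribution space\<close>

definition laplace :: "((real \<Rightarrow> real) \<Rightarrow> real) measure \<Rightarrow> (real \<Rightarrow> complex) \<Rightarrow> complex" where
  "laplace \<nu> \<xi> = (CLINT \<omega>|\<nu>. exp (dual_pair \<omega> \<xi>))"

text \<open>\<open>appell \<nu> n \<xi> \<omega>\<close> is \<open>\<langle>P\<^sub>n(\<omega>), \<xi>\<^sup>\<otimes>\<^sup>n\<rangle>\<close>, the \<open>n\<close>-th Taylor coefficient (times \<open>n!\<close>) of
  \<open>z \<mapsto> exp \<langle>\<omega>, z\<xi>\<rangle> / \<ell>(z\<xi>)\<close> at zero.\<close>

definition appell ::
    "((real \<Rightarrow> real) \<Rightarrow> real) measure \<Rightarrow> nat \<Rightarrow> (real \<Rightarrow> complex) \<Rightarrow> ((real \<Rightarrow> real) \<Rightarrow> real) \<Rightarrow> complex" where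
  "appell \<nu> n \<xi> \<omega> =
     (deriv ^^ n) (\<lambda>z. exp (z * dual_pair \<omega> \<xi>) / laplace \<nu> (\<lambda>x. z * \<xi> x)) 0"

text \<open>A list \<open>[(c\<^sub>1, \<xi>\<^sub>1), \<dots>, (c\<^sub>m, \<xi>\<^sub>m)]\<close> in position \<open>n\<close> of \<open>K\<close> stands for the symmetric tensor
  \<open>\<phi>\<^sup>(\<^sup>n\<^sup>) = \<Sum>\<^sub>j c\<^sub>j \<xi>\<^sub>j\<^sup>\<otimes>\<^sup>n\<close>; by polarization these exhaust the algebraic symmetric tensor power
  of the complexified Schwartz space, which is dense in its completions.\<close>

type_synonym kernels = "(complex \<times> (real \<Rightarrow> complex)) list list"

definition kernels :: "kernels set" where
  "kernels = {K. \<forall>k\<in>set K. \<forall>(c, \<xi>)\<in>set k. \<xi> \<in> complexify schwartz}"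

definition appell_poly ::
    "((real \<Rightarrow> real) \<Rightarrow> real) measure \<Rightarrow> kernels \<Rightarrow> ((real \<Rightarrow> real) \<Rightarrow> real) \<Rightarrow> complex" where
  "appell_poly \<nu> K \<omega> = (\<Sum>n<length K. \<Sum>(c, \<xi>)\<leftarrow>K ! n. c * appell \<nu> n \<xi> \<omega>)"

text \<open>Tensor norms come from \<open>(\<xi>\<^sup>\<otimes>\<^sup>n | \<zeta>\<^sup>\<otimes>\<^sup>n)\<^sub>p = (\<xi> | \<zeta>)\<^sub>p\<^sup>n\<close>.\<close>

definition kernel_norm_sq ::
    "(nat \<Rightarrow> (real \<Rightarrow> real) \<Rightarrow> (real \<Rightarrow> real) \<Rightarrow> real) \<Rightarrow> nat \<Rightarrow> nat \<Rightarrow> (complex \<times> (real \<Rightarrow> complex)) list \<Rightarrow> real" where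
  "kernel_norm_sq ip p n k =
     Re (\<Sum>(c, \<xi>)\<leftarrow>k. \<Sum>(d, \<zeta>)\<leftarrow>k. c * cnj d * herm ip p \<xi> \<zeta> ^ n)"

definition test_norm ::
    "(nat \<Rightarrow> (real \<Rightarrow> real) \<Rightarrow> (real \<Rightarrow> real) \<Rightarrow> real) \<Rightarrow> nat \<Rightarrow> nat \<Rightarrow> kernels \<Rightarrow> real" where
  "test_norm ip p q K =
     sqrt (\<Sum>n<length K. (fact n)\<^sup>2 * 2 ^ (n * q) * kernel_norm_sq ip p n (K ! n))"

definition polys :: "((real \<Rightarrow> real) \<Rightarrow> real) measure \<Rightarrow> (((real \<Rightarrow> real) \<Rightarrow> real) \<Rightarrow> complex) set" where
  "polys \<nu> = appell_poly \<nu> ` kernels"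

text \<open>The dual of the completion of the polynomials with respect to \<open>\<parallel>\<cdot>\<parallel>\<^sub>p\<^sub>,\<^sub>q\<close>. A continuous
  functional is given by its values on the dense subspace of polynomials, and the dual of the
  projective limit is the union of these spaces over all \<open>p\<close> and \<open>q\<close>.\<close>

definition distrib_pq ::
    "((real \<Rightarrow> real) \<Rightarrow> real) measure \<Rightarrow> (nat \<Rightarrow> (real \<Rightarrow> real) \<Rightarrow> (real \<Rightarrow> real) \<Rightarrow> real) \<Rightarrow> nat \<Rightarrow> nat
      \<Rightarrow> ((((real \<Rightarrow> real) \<Rightarrow> real) \<Rightarrow> complex) \<Rightarrow> complex) set" where
  "distrib_pq \<nu> ip p q = {\<Phi>.
     (\<forall>f\<in>polys \<nu>. \<forall>g\<in>polys \<nu>. \<forall>a. \<Phi> (\<lambda>\<omega>. a * f \<omega> + g \<omega>) = a * \<Phi> f + \<Phi> g) \<and>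
     (\<exists>C. \<forall>K\<in>kernels. cmod (\<Phi> (appell_poly \<nu> K)) \<le> C * test_norm ip p q K)}"

text \<open>For \<open>\<xi> \<in> U_nbhd ip p q\<close> the exponential \<open>exp (\<i>\<langle>\<cdot>, \<xi>\<rangle>)\<close> is the limit, in the completion with
  respect to \<open>\<parallel>\<cdot>\<parallel>\<^sub>p\<^sub>,\<^sub>q\<close>, of the partial sums of its Appell expansion
  \<open>\<ell>(\<i>\<xi>) \<Sum>\<^sub>n \<langle>P\<^sub>n, (\<i>\<xi>)\<^sup>\<otimes>\<^sup>n\<rangle> / n!\<close>; the pairing with \<open>\<Phi> \<in> distrib_pq \<nu> ip p q\<close> is extended to it
  by continuity.\<close>

definition T_transform ::
    "((real \<Rightarrow> real) \<Rightarrow> real) measure \<Rightarrow> ((((real \<Rightarrow> real) \<Rightarrow> real) \<Rightarrow> complex) \<Rightarrow> complex)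
      \<Rightarrow> (real \<Rightarrow> complex) \<Rightarrow> complex" where
  "T_transform \<nu> \<Phi> \<xi> =
     lim (\<lambda>N. \<Phi> (\<lambda>\<omega>. laplace \<nu> (\<lambda>x. \<i> * \<xi> x) *
                    (\<Sum>n<N. appell \<nu> n (\<lambda>x. \<i> * \<xi> x) \<omega> / fact n)))"


section \<open>Donsker's delta\<close>

text \<open>\<open>E s\<close> is \<open>exp (\<i>s\<langle>\<cdot>, \<eta>\<rangle>)\<close> as an element of the distribution space. Whenever this random
  variable lies in \<open>L\<^sup>2(\<nu>)\<close> -- for all \<open>s\<close> if \<open>\<eta>\<close> is real -- it acts by the bilinear \<open>L\<^sup>2(\<nu>)\<close>
  pairing. For nonreal \<open>\<eta>\<close> it is not \<open>\<nu>\<close>-integrable for large \<open>|s|\<close>, and \<open>E\<close> is then the (unique) weakly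
  real-analytic continuation in \<open>s\<close>.\<close>

definition exp_family ::
    "((real \<Rightarrow> real) \<Rightarrow> real) measure \<Rightarrow> (nat \<Rightarrow> (real \<Rightarrow> real) \<Rightarrow> (real \<Rightarrow> real) \<Rightarrow> real) \<Rightarrow> nat \<Rightarrow> nat
      \<Rightarrow> (real \<Rightarrow> complex) \<Rightarrow> (real \<Rightarrow> (((real \<Rightarrow> real) \<Rightarrow> real) \<Rightarrow> complex) \<Rightarrow> complex) \<Rightarrow> bool" where
  "exp_family \<nu> ip p q \<eta> E \<longleftrightarrow>
     (\<forall>s. E s \<in> distrib_pq \<nu> ip p q) \<and>
     (\<forall>\<phi>\<in>polys \<nu>. \<exists>F. F analytic_on \<real> \<and> (\<forall>s. E s \<phi> = F (of_real s))) \<and>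
     (\<exists>X. L2_pairing \<nu> \<eta> X \<and>
        (\<forall>s. integrable \<nu> (\<lambda>\<omega>. (cmod (exp (\<i> * of_real s * X \<omega>)))\<^sup>2) \<longrightarrow>
           (\<forall>\<phi>\<in>polys \<nu>. E s \<phi> = (CLINT \<omega>|\<nu>. exp (\<i> * of_real s * X \<omega>) * \<phi> \<omega>))))"

text \<open>The integrability clause is the existence of the weak integral. It forces
  \<open>Re (bilin \<eta> \<eta>) > 0\<close>; for real \<open>\<eta>\<close> this just says that \<open>\<eta>\<close> is nonzero.\<close>

definition donsker_delta ::
    "((real \<Rightarrow> real) \<Rightarrow> real) measure \<Rightarrow> (nat \<Rightarrow> (real \<Rightarrow> real) \<Rightarrow> (real \<Rightarrow> real) \<Rightarrow> real) \<Rightarrow> nat \<Rightarrow> nat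
      \<Rightarrow> (real \<Rightarrow> complex) \<Rightarrow> ((((real \<Rightarrow> real) \<Rightarrow> real) \<Rightarrow> complex) \<Rightarrow> complex) \<Rightarrow> bool" where
  "donsker_delta \<nu> ip p q \<eta> \<Delta> \<longleftrightarrow>
     \<Delta> \<in> distrib_pq \<nu> ip p q \<and>
     (\<exists>E. exp_family \<nu> ip p q \<eta> E \<and>
        (\<forall>\<xi>\<in>U_nbhd ip p q.
           integrable lborel (\<lambda>s. T_transform \<nu> (E s) \<xi>) \<and>
           T_transform \<nu> \<Delta> \<xi> = 1 / (2 * of_real pi) * (CLINT s|lborel. T_transform \<nu> (E s) \<xi>)))"

end

theory Submission
  imports Defs
begin

text \<open>Write \<open>A = \<langle>\<eta>, \<eta>\<rangle>\<close>, \<open>B = \<langle>\<eta>, \<xi>\<rangle>\<close>, \<open>X = \<langle>\<xi>, \<xi>\<rangle>\<close>. For small \<open>s\<close> and \<open>z\<close> the transform of \<open>exp (\<i>s\<langle>\<cdot>, \<eta>\<rangle>)\<close>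
  at \<open>z\<xi>\<close> is \<open>\<Gamma>(\<rho>, W s z) / \<Gamma>(\<rho>, \<theta>)\<close> with \<open>W s z = \<theta> + (z\<^sup>2 X + 2 s z B + s\<^sup>2 A) / 2\<close>. Its Taylor
  coefficients at \<open>z = 0\<close> are real analytic in \<open>s\<close>, so the identity persists as an identity of germs in \<open>z\<close>
  for every real \<open>s\<close>, and the transform is holomorphic for \<open>|z| < R\<close> with some \<open>R > 1\<close>. As \<open>\<Gamma>(\<rho>, \<cdot>)\<close> cannot be
  continued holomorphically along a simple zero of its argument, \<open>W\<close> has no zeros there. Together
  with the integrability in \<open>s\<close> this gives first \<open>Re A > 0\<close>, since otherwise \<open>|\<Gamma>(\<rho>, W s 1)|\<close> stays away from zero
  for a suitable \<open>\<xi>\<close>, and then \<open>Re k > 0\<close>. For small \<open>z\<close> the Laplace representation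
  \<open>\<Gamma>(1 - \<rho>) \<Gamma>(\<rho>, w) = exp (- w) \<integral>\<^sub>0\<^sup>\<infinity> exp (- w t) t powr (- \<rho>) / (1 + t) dt\<close> turns the integral over \<open>s\<close> into a Gaussian
  one and leaves the Laplace integral of \<open>\<Psi>\<close>; analytic continuation in \<open>z\<close> to \<open>z = 1\<close> gives the formula.\<close>


section \<open>Holomorphic parameter integrals\<close>

text \<open>For nonreal \<open>\<eta>\<close> and large |s| the variable exp(is<., \<eta>>) is not
  integrable, so the only data within direct reach are the Taylor coefficients in \<open>z\<close>
  at 0 for small \<open>s\<close>; analyticity carries exactly these to all real \<open>s\<close>.
  What appears at z = 1 is then a continuation of \<Gamma>(\<rho>, .) along \<open>W\<close>, which
  need not be the principal value, since \<open>W\<close> may cross the negative real axis. Hence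
  the incomplete gamma function is pulled back under exp to an entire function and composed with
  continuous logarithms of \<open>W\<close>. The condition \<rho> < 1 makes the Laplace
  representation converge, and it makes the exponent \<rho> - 1 negative, an order that no power
  series can have. A radius R > 1 exists because the inequality that defines \<open>U_nbhd\<close>
  is strict. The parameters of \<Psi> come from a = 1 - \<rho> and 1 + a - c = 3/2: one power of
  1/(1 + t) belongs to the Laplace representation, another half to the Gaussian integral.\<close>

lemma has_field_derivative_integral_dominated:
  fixes h :: "complex \<Rightarrow> 'a \<Rightarrow> complex" and M :: "'a measure"
  assumes D: "open D" "z \<in> D"
    and meas: "\<And>u. u \<in> D \<Longrightarrow> h u \<in> borel_measurable M"
    and holo: "\<And>x. x \<in> space M \<Longrightarrow> (\<lambda>u. h u x) holomorphic_on D"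
    and r: "r > 0" and g: "integrable M g"
    and dom: "\<And>u x. u \<in> D \<Longrightarrow> dist z u < r \<Longrightarrow> x \<in> space M \<Longrightarrow> norm (h u x) \<le> g x"
  shows "((\<lambda>u. LINT x|M. h u x) has_field_derivative (LINT x|M. deriv (\<lambda>u. h u x) z)) (at z)"
    and "integrable M (\<lambda>x. deriv (\<lambda>u. h u x) z)"
proof -
  obtain r1 where r1: "r1 > 0" "ball z r1 \<subseteq> D" using D open_contains_ball by blast
  \<comment> \<open>A closed disc of radius \<open>d\<close> about any point of
    \<open>ball z d\<close> stays within 2 d < \<open>min r r1\<close> of \<open>z\<close>, so
    holomorphy and the bound \<open>g\<close> are both available on it.\<close>
  define d where "d = min r r1 / 3"
  have d: "d > 0" using r r1 by (simp add: d_def)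
  have sub: "cball v d \<subseteq> D" "\<And>u. u \<in> cball v d \<Longrightarrow> dist z u < r" if "v \<in> ball z d" for v
  proof -
    have *: "dist z u < min r r1" if u: "u \<in> cball v d" for u
    proof -
      have "dist z u \<le> dist z v + dist v u" by (rule dist_triangle)
      also have "\<dots> < d + d" using \<open>v \<in> ball z d\<close> u by (intro add_less_le_mono) auto
      also have "\<dots> < min r r1" using d unfolding d_def by linarith
      finally show ?thesis .
    qed
    show "cball v d \<subseteq> D" using * r1 by (auto simp: subset_iff)
    show "\<And>u. u \<in> cball v d \<Longrightarrow> dist z u < r" using * by auto
  qed
  have ballD: "ball z d \<subseteq> D" using sub(1) d by (force simp: subset_iff)
  have int: "integrable M (h u)" if "u \<in> ball z d" for u
  proof (rule Bochner_Integration.integrable_bound[OF g])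
    show "h u \<in> borel_measurable M" using meas ballD that by auto
    show "AE x in M. norm (h u x) \<le> norm (g x)"
    proof (intro AE_I2)
      fix x assume "x \<in> space M"
      then have "norm (h u x) \<le> g x"
        using dom[of u x] that ballD sub(2)[OF that, of u] d by auto
      then show "norm (h u x) \<le> norm (g x)" by simp
    qed
  qed
  \<comment> \<open>Only \<open>h\<close> itself is dominated by hypothesis. Cauchy's estimate on a
    disc of radius \<open>d\<close> turns this into a bound for the derivative, and the mean value
    inequality into one for the difference quotients.\<close>
  have derb: "norm (deriv (\<lambda>u. h u x) v) \<le> g x / d" if "v \<in> ball z d" "x \<in> space M" for v x
  proof -
    have "cmod ((deriv ^^ 1) (\<lambda>u. h u x) v) \<le> fact 1 * g x / d ^ 1"
    proof (rule Cauchy_inequality)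
      show "(\<lambda>u. h u x) holomorphic_on ball v d"
        by (rule holomorphic_on_subset[OF holo[OF that(2)]]) (use sub(1)[OF that(1)] in auto)
      show "continuous_on (cball v d) (\<lambda>u. h u x)"
        by (rule holomorphic_on_imp_continuous_on, rule holomorphic_on_subset[OF holo[OF that(2)]])
           (use sub(1)[OF that(1)] in auto)
      show "0 < d" by fact
      fix u assume "cmod (v - u) = d"
      then have "u \<in> cball v d" by (auto simp: dist_norm)
      with sub[OF that(1)] show "cmod (h u x) \<le> g x" by (intro dom that) auto
    qed
    then show ?thesis by simp
  qed
  have fd: "((\<lambda>u. h u x) has_field_derivative deriv (\<lambda>u. h u x) v) (at v)"
    if "v \<in> D" "x \<in> space M" for v x
    using holomorphic_derivI[OF holo[OF that(2)] D(1) that(1)] .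
  have lip: "norm (h u x - h z x) \<le> g x / d * norm (u - z)" if "u \<in> ball z d" "x \<in> space M" for u x
  proof (rule field_differentiable_bound[of "ball z d" _ "deriv (\<lambda>u. h u x)"])
    fix v assume "v \<in> ball z d"
    then show "((\<lambda>u. h u x) has_field_derivative deriv (\<lambda>u. h u x) v) (at v within ball z d)"
      using fd that(2) ballD by (meson has_field_derivative_at_within subsetD)
    show "cmod (deriv (\<lambda>u. h u x) v) \<le> g x / d" by (rule derb) fact+
  qed (use that d in auto)
  have zb: "z \<in> ball z d" using d by simp
  define q where "q = (\<lambda>u x. (h u x - h z x) / (u - z))"
  \<comment> \<open>Dominated convergence speaks of sequences, so the limit is taken along an
    arbitrary sequence that tends to \<open>z\<close> and avoids it.\<close>
  have key: "(\<lambda>n. LINT x|M. q (X n) x) \<longlonglongrightarrow> (LINT x|M. deriv (\<lambda>u. h u x) z) \<and>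
       integrable M (\<lambda>x. deriv (\<lambda>u. h u x) z)"
    if X: "\<And>n. X n \<in> ball z d" "\<And>n. X n \<noteq> z" "X \<longlonglongrightarrow> z" for X
  proof -
    have qlim: "(\<lambda>n. q (X n) x) \<longlonglongrightarrow> deriv (\<lambda>u. h u x) z" if "x \<in> space M" for x
    proof -
      have "((\<lambda>u. q u x) \<longlongrightarrow> deriv (\<lambda>u. h u x) z) (at z)"
        using fd[OF D(2) that] unfolding has_field_derivative_iff q_def .
      moreover have "filterlim X (at z) sequentially"
        using X by (auto simp: filterlim_at)
      ultimately show ?thesis by (rule filterlim_compose)
    qed
    have qm: "\<And>n. (\<lambda>x. q (X n) x) \<in> borel_measurable M"
      unfolding q_def using meas[OF subsetD[OF ballD X(1)]] meas[OF D(2)]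
      by (intro borel_measurable_divide borel_measurable_diff) auto
    have dm: "(\<lambda>x. deriv (\<lambda>u. h u x) z) \<in> borel_measurable M"
      by (rule borel_measurable_LIMSEQ_metric[of "\<lambda>n x. q (X n) x"]) (use qm qlim in auto)
    have "(\<lambda>n. LINT x|M. q (X n) x) \<longlonglongrightarrow> (LINT x|M. deriv (\<lambda>u. h u x) z)"
    proof (rule integral_dominated_convergence[where w = "\<lambda>x. g x / d"])
      show "integrable M (\<lambda>x. g x / d)" using g by simp
      show "AE x in M. (\<lambda>n. q (X n) x) \<longlonglongrightarrow> deriv (\<lambda>u. h u x) z" using qlim by auto
      show "AE x in M. norm (q (X n) x) \<le> g x / d" for n
      proof (intro AE_I2)
        fix x assume "x \<in> space M"
        from lip[OF X(1)[of n] this] X(2)[of n] show "norm (q (X n) x) \<le> g x / d"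
          using d by (simp add: q_def norm_divide field_simps)
      qed
    qed (use dm qm in auto)
    moreover have "integrable M (\<lambda>x. deriv (\<lambda>u. h u x) z)"
    proof (rule Bochner_Integration.integrable_bound[of M "\<lambda>x. g x / d"])
      show "AE x in M. norm (deriv (\<lambda>u. h u x) z) \<le> norm (g x / d)"
        using order_trans[OF derb[OF zb] abs_ge_self] by (intro AE_I2) (simp only: real_norm_def)
    qed (use g dm in auto)
    ultimately show ?thesis by blast
  qed
  have intq: "(LINT x|M. q u x) = ((LINT x|M. h u x) - (LINT x|M. h z x)) / (u - z)" if "u \<in> ball z d" for u
    unfolding q_def using int[OF that] int[OF zb] by simp
  have "((\<lambda>u. ((LINT x|M. h u x) - (LINT x|M. h z x)) / (u - z)) \<longlongrightarrow> (LINT x|M. deriv (\<lambda>u. h u x) z)) (at z)"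
    unfolding tendsto_at_iff_sequentially
  proof (intro allI impI)
    fix X assume X: "\<forall>i. X i \<in> UNIV - {z}" "X \<longlonglongrightarrow> z"
    then have "eventually (\<lambda>n. X n \<in> ball z d) sequentially"
      using d by (intro topological_tendstoD) auto
    then obtain N where N: "\<And>n. n \<ge> N \<Longrightarrow> X n \<in> ball z d" by (auto simp: eventually_sequentially)
    have "(\<lambda>n. LINT x|M. q (X (n + N)) x) \<longlonglongrightarrow> (LINT x|M. deriv (\<lambda>u. h u x) z)"
      using key[of "\<lambda>n. X (n + N)"] X N by (auto intro: LIMSEQ_ignore_initial_segment)
    then have "(\<lambda>n. ((LINT x|M. h (X (n+N)) x) - (LINT x|M. h z x)) / (X (n+N) - z)) \<longlonglongrightarrow> (LINT x|M. deriv (\<lambda>u. h u x) z)"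
      using intq N by simp
    then show "((\<lambda>u. ((LINT x|M. h u x) - (LINT x|M. h z x)) / (u - z)) \<circ> X) \<longlonglongrightarrow> (LINT x|M. deriv (\<lambda>u. h u x) z)"
      using LIMSEQ_offset[of "\<lambda>n. ((LINT x|M. h (X n) x) - (LINT x|M. h z x)) / (X n - z)" N] by (simp add: o_def)
  qed
  then show "((\<lambda>u. LINT x|M. h u x) has_field_derivative (LINT x|M. deriv (\<lambda>u. h u x) z)) (at z)"
    by (simp add: has_field_derivative_iff)
  \<comment> \<open>The integrability part of \<open>key\<close> needs one admissible sequence; the
    offset 2 keeps its first member strictly inside \<open>ball z d\<close>.\<close>
  define X where "X = (\<lambda>n. z + of_real (d / (2 + real n)))"
  have "integrable M (\<lambda>x. deriv (\<lambda>u. h u x) z)"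
  proof -
    have "X n \<in> ball z d" for n
    proof -
      have "d / (2 + real n) < d" using d by (simp add: divide_less_eq add_pos_nonneg)
      then show ?thesis using d by (simp add: X_def dist_norm del: of_real_divide of_real_add)
    qed
    moreover have "X n \<noteq> z" for n using d by (auto simp: X_def simp del: of_real_divide of_real_add)
    moreover have "X \<longlonglongrightarrow> z"
    proof -
      have "(\<lambda>n. d / (2 + real n)) \<longlonglongrightarrow> 0" by real_asymp
      then have "(\<lambda>n. z + of_real (d / (2 + real n))) \<longlonglongrightarrow> z + of_real 0" by (intro tendsto_intros)
      then show ?thesis by (simp add: X_def)
    qed
    ultimately show ?thesis using key[of X] by blast
  qed
  then show "integrable M (\<lambda>x. deriv (\<lambda>u. h u x) z)" .
qed

lemma holomorphic_integral_dominated: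
  fixes h :: "complex \<Rightarrow> 'a \<Rightarrow> complex" and M :: "'a measure"
  assumes D: "open D"
    and meas: "\<And>u. u \<in> D \<Longrightarrow> h u \<in> borel_measurable M"
    and holo: "\<And>x. x \<in> space M \<Longrightarrow> (\<lambda>u. h u x) holomorphic_on D"
    and dom: "\<And>z. z \<in> D \<Longrightarrow> \<exists>r>0. \<exists>g. integrable M g \<and>
       (\<forall>u\<in>D. dist z u < r \<longrightarrow> (\<forall>x\<in>space M. norm (h u x) \<le> g x))"
  shows "(\<lambda>u. LINT x|M. h u x) holomorphic_on D"
  unfolding holomorphic_on_open[OF D]
proof
  fix z assume z: "z \<in> D"
  from dom[OF z] obtain r g where rg: "r > 0" "integrable M g"
    "\<And>u x. u \<in> D \<Longrightarrow> dist z u < r \<Longrightarrow> x \<in> space M \<Longrightarrow> norm (h u x) \<le> g x" by blast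
  show "\<exists>f'. ((\<lambda>u. LINT x|M. h u x) has_field_derivative f') (at z)"
    using has_field_derivative_integral_dominated(1)[OF D z meas holo rg] by blast
qed

text \<open>The substitution w = exp l turns -exp(-w) w^(a-1) dw into -exp(a l - exp l) dl, which is
  entire. So the multivalued \<Gamma>(a, w) becomes an entire function of l.\<close>

lemma upper_Gamma_primitive:
  fixes a :: complex
  shows "\<exists>G. \<forall>l. (G has_field_derivative - exp (a * l - exp l)) (at l)"
proof -
  have "(\<lambda>l. - exp (a * l - exp l)) holomorphic_on UNIV" by (intro holomorphic_intros)
  then obtain G where "\<And>x. x \<in> UNIV \<Longrightarrow> (G has_field_derivative - exp (a * x - exp x)) (at x within UNIV)"
    using holomorphic_convex_primitive'[of UNIV "\<lambda>l. - exp (a * l - exp l)"] by auto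
  then show ?thesis by auto
qed


section \<open>The Laplace integral of the Tricomi function\<close>

text \<open>A measure on the half-line in place of set integrals: results for arbitrary measures
  then apply, and membership in the space already supplies t > 0.\<close>

abbreviation pos_lborel :: "real measure" where
  "pos_lborel \<equiv> restrict_space lborel {0<..}"

lemma borel_measurable_pos_lborel_continuous:
  fixes f :: "real \<Rightarrow> 'b::topological_space"
  assumes "continuous_on {0<..} f"
  shows "f \<in> borel_measurable pos_lborel"
proof -
  have "sets pos_lborel = sets (restrict_space borel {0<..})" by (rule sets_restrict_space_cong) simp
  then have "borel_measurable pos_lborel = (borel_measurable (restrict_space borel {0<..}) :: (real \<Rightarrow> 'b) set)"
    by (rule measurable_cong_sets) simp
  with borel_measurable_continuous_on_restrict[OF assms] show ?thesis by simp
qed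

lemma integral_pos_lborel:
  fixes f :: "real \<Rightarrow> 'b::{banach, second_countable_topology}"
  shows "(LINT x:{0<..}|lborel. f x) = (LINT x|pos_lborel. f x)"
  by (simp add: set_lebesgue_integral_def integral_restrict_space)

lemma integrable_pos_lborel:
  fixes f :: "real \<Rightarrow> 'b::{banach, second_countable_topology}"
  shows "set_integrable lborel {0<..} f \<longleftrightarrow> integrable pos_lborel f"
  by (intro set_integrable_eq) simp

lemma integral_pos_lborel_scale:
  fixes f :: "real \<Rightarrow> complex"
  assumes "c > 0"
  shows "(LINT x|pos_lborel. f x) = of_real c * (LINT x|pos_lborel. f (c * x))"
proof -
  have "(LINT x|pos_lborel. f x) = (LINT x|lborel. indicat_real {0<..} x *\<^sub>R f x)"
    by (simp add: integral_restrict_space)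
  also have "\<dots> = \<bar>c\<bar> *\<^sub>R (LINT x|lborel. indicat_real {0<..} (0 + c * x) *\<^sub>R f (0 + c * x))"
    using assms by (intro lborel_integral_real_affine) simp
  also have "(\<lambda>x. indicat_real {0<..} (0 + c * x) *\<^sub>R f (0 + c * x)) = (\<lambda>x. indicat_real {0<..} x *\<^sub>R f (c * x))"
    using assms by (auto simp: indicator_def zero_less_mult_iff)
  also have "\<bar>c\<bar> *\<^sub>R (LINT x|lborel. indicat_real {0<..} x *\<^sub>R f (c * x)) = of_real c * (LINT x|pos_lborel. f (c * x))"
    using assms by (simp add: integral_restrict_space scaleR_conv_of_real)
  finally show ?thesis .
qed

lemma integrable_Gamma_kernel:
  fixes a k :: real
  assumes "a > 0" "k > 0"
  shows "integrable pos_lborel (\<lambda>t. t powr (a - 1) * exp (- (k * t)))"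
proof -
  let ?f = "\<lambda>t. complex_of_real t powr (of_real a - 1) / complex_of_real (exp (k * t))"
  have "set_integrable lebesgue {0<..} ?f"
    using absolutely_integrable_Gamma_integral[of "of_real a" k] assms by simp
  then have "set_integrable lborel {0<..} ?f"
    unfolding set_integrable_def
    by (subst (asm) integrable_completion) (measurable; simp)
  then have "integrable pos_lborel ?f" by (simp add: integrable_pos_lborel)
  then have "integrable pos_lborel (\<lambda>t. cmod (?f t))" by simp
  also have "?this \<longleftrightarrow> ?thesis"
  proof (rule Bochner_Integration.integrable_cong)
    fix t assume "t \<in> space pos_lborel"
    then have "t > 0" by simp
    then show "cmod (?f t) = t powr (a - 1) * exp (- (k * t))"
      by (simp add: norm_divide norm_powr_real_powr exp_minus divide_inverse norm_mult norm_inverse del: of_real_exp)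
  qed simp
  finally show ?thesis .
qed

lemma integral_Gamma_kernel_real:
  fixes a :: real
  assumes "a > 0"
  shows "(LINT t|pos_lborel. t powr (a - 1) * exp (- t)) = Gamma a"
proof -
  have i: "set_integrable lborel {0<..} (\<lambda>t. t powr (a - 1) * exp (- t))"
    using integrable_Gamma_kernel[of a 1] assms by (simp add: integrable_pos_lborel)
  have "((\<lambda>t. t powr (a - 1) * exp (- t)) has_integral Gamma a) {0..}"
    using Gamma_integral_real[OF assms] by (simp add: exp_minus divide_inverse)
  also have "?this \<longleftrightarrow> ((\<lambda>t. t powr (a - 1) * exp (- t)) has_integral Gamma a) {0<..}"
  proof (rule has_integral_spike_set_eq)
    have "{x \<in> {0..} - {0<..}. x powr (a - 1) * exp (- x) \<noteq> 0} = {}"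
         "{x \<in> {0<..} - {0..}. x powr (a - 1) * exp (- x) \<noteq> 0} = {}" by auto
    then show "negligible {x \<in> {0..} - {0<..}. x powr (a - 1) * exp (- x) \<noteq> 0}"
      "negligible {x \<in> {0<..} - {0..}. x powr (a - 1) * exp (- x) \<noteq> 0}" by (metis negligible_empty)+
  qed
  finally have "(LINT t:{0<..}|lborel. t powr (a - 1) * exp (- t)) = Gamma a"
    using set_borel_integral_eq_integral(2)[OF i] by (simp add: integral_unique)
  then show ?thesis by (simp add: integral_pos_lborel)
qed

text \<open>The tangent inequality ln u \<le> u - 1 at u = d (1 + t). The slope \<open>d\<close> is
  free, so a power of 1 + t costs an arbitrarily small part of an exponential decay.\<close>

lemma ln_one_plus_le:
  assumes "(d::real) > 0" "t > 0"
  shows "ln (1 + t) \<le> d * t + (d - 1 - ln d)"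
proof -
  have "ln (d * (1 + t)) \<le> d * (1 + t) - 1" using assms by (intro ln_le_minus_one) simp
  then show ?thesis using assms by (subst (asm) ln_mult) (auto simp: algebra_simps)
qed

lemma integrable_tricomi_kernel:
  fixes a k m :: real
  assumes "a > 0" "k > 0"
  shows "integrable pos_lborel (\<lambda>t. exp (- (k * t)) * t powr (a - 1) * (1 + t) powr m)"
proof -
  \<comment> \<open>A positive exponent that dominates \<open>m\<close>. The slope \<open>d\<close>
    below satisfies n d = k/2: half of the decay pays for the power of 1 + t, the other half keeps
    the gamma integral convergent.\<close>
  define n where "n = \<bar>m\<bar> + 1"
  have n: "n > 0" "m \<le> n" by (auto simp: n_def)
  define d where "d = k / (2 * n)"
  have d: "d > 0" using assms n by (simp add: d_def)
  have le: "(1 + t) powr m \<le> exp (n * (d - 1 - ln d)) * exp (k / 2 * t)" if "t > 0" for t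
  proof -
    have "(1 + t) powr m \<le> (1 + t) powr n" using that n by (intro powr_mono) auto
    also have "\<dots> = exp (n * ln (1 + t))" using that by (simp add: powr_def)
    also have "\<dots> \<le> exp (n * (d * t + (d - 1 - ln d)))"
      using ln_one_plus_le[OF d that] n by simp
    also have "\<dots> = exp (n * (d - 1 - ln d)) * exp (k / 2 * t)"
      using n by (simp add: d_def exp_add[symmetric] field_simps)
    finally show ?thesis .
  qed
  have "integrable pos_lborel (\<lambda>t. exp (n * (d - 1 - ln d)) * (t powr (a - 1) * exp (- (k/2 * t))))"
    using integrable_Gamma_kernel[of a "k/2"] assms by simp
  then show ?thesis
  proof (rule Bochner_Integration.integrable_bound)
    show "(\<lambda>t. exp (- (k * t)) * t powr (a - 1) * (1 + t) powr m) \<in> borel_measurable pos_lborel"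
      by (intro borel_measurable_pos_lborel_continuous continuous_intros) auto
    show "AE t in pos_lborel. norm (exp (- (k * t)) * t powr (a - 1) * (1 + t) powr m)
      \<le> norm (exp (n * (d - 1 - ln d)) * (t powr (a - 1) * exp (- (k / 2 * t))))"
    proof (intro AE_I2)
      fix t assume "t \<in> space pos_lborel"
      then have t: "t > 0" by simp
      have "exp (- (k * t)) * t powr (a - 1) * (1 + t) powr m
         \<le> exp (- (k * t)) * t powr (a - 1) * (exp (n * (d - 1 - ln d)) * exp (k / 2 * t))"
        using le[OF t] by (intro mult_left_mono) auto
      also have "\<dots> = exp (n * (d - 1 - ln d)) * (t powr (a - 1) * (exp (- (k * t)) * exp (k / 2 * t)))"
        by (simp add: algebra_simps)
      also have "exp (- (k * t)) * exp (k / 2 * t) = exp (- (k / 2 * t))"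
        by (simp add: exp_add[symmetric])
      finally show "norm (exp (- (k * t)) * t powr (a - 1) * (1 + t) powr m)
        \<le> norm (exp (n * (d - 1 - ln d)) * (t powr (a - 1) * exp (- (k / 2 * t))))"
        by (simp add: abs_mult)
    qed
  qed
qed

text \<open>The integrand of Euler's integral for \<Psi>, with \<open>b\<close> standing for 1 + a -
  c: its integral will turn out to be \<Gamma>(a) \<Psi>(a, 1 + a - b; k). Holomorphy and special
  values are simpler to state in \<open>b\<close> than in \<open>c\<close>.\<close>

definition tricomi_kernel :: "real \<Rightarrow> complex \<Rightarrow> complex \<Rightarrow> real \<Rightarrow> complex" where
  "tricomi_kernel a b k t = exp (- (k * of_real t)) * of_real (t powr (a - 1)) * of_real (1 + t) powr (- b)"

definition tricomi_integral :: "real \<Rightarrow> complex \<Rightarrow> complex \<Rightarrow> complex" where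
  "tricomi_integral a b k = (LINT t|pos_lborel. tricomi_kernel a b k t)"

lemma norm_tricomi_kernel:
  "t > 0 \<Longrightarrow> norm (tricomi_kernel a b k t) = exp (- (Re k * t)) * t powr (a - 1) * (1 + t) powr (- Re b)"
  by (simp add: tricomi_kernel_def norm_mult norm_powr_real_powr)

lemma measurable_tricomi_kernel [measurable]: "tricomi_kernel a b k \<in> borel_measurable pos_lborel"
  unfolding tricomi_kernel_def
  by (intro borel_measurable_pos_lborel_continuous continuous_intros) (auto simp: complex_nonpos_Reals_iff complex_eq_iff)

lemma integrable_tricomi_integral:
  assumes "a > 0" "Re k > 0"
  shows "integrable pos_lborel (tricomi_kernel a b k)"
proof (rule Bochner_Integration.integrable_bound[OF integrable_tricomi_kernel[OF assms, of "- Re b"]])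
  show "AE t in pos_lborel. norm (tricomi_kernel a b k t) \<le> norm (exp (- (Re k * t)) * t powr (a - 1) * (1 + t) powr - Re b)"
    by (intro AE_I2) (simp add: norm_tricomi_kernel)
qed measurable

lemma open_halfspace: "open {k::complex. 0 < Re k}"
  using open_halfspace_Re_gt[of 0] by simp

lemma convex_halfspace: "convex {k::complex. 0 < Re k}"
  using convex_halfspace_Re_gt[of 0] by simp

text \<open>One majorant for small changes of both parameters: half of \<open>Re k\<close> is given
  away to \<open>k'\<close> and one unit of the exponent to \<open>b'\<close>. It serves holomorphy
  in \<open>k\<close> as well as in \<open>b\<close>.\<close>

lemma tricomi_kernel_dominated:
  fixes a :: real and b k :: complex
  assumes k: "Re k > 0"
  shows "dist k k' < Re k / 2 \<Longrightarrow> dist b b' < 1 \<Longrightarrow> t > 0 \<Longrightarrow>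
     norm (tricomi_kernel a b' k' t) \<le> exp (- (Re k / 2 * t)) * t powr (a - 1) * (1 + t) powr (1 - Re b)"
proof -
  assume *: "dist k k' < Re k / 2" "dist b b' < 1" "t > 0"
  have "\<bar>Re (k - k')\<bar> < Re k / 2" using *(1) abs_Re_le_cmod[of "k - k'"] by (simp add: dist_norm)
  then have "Re k / 2 \<le> Re k'" unfolding minus_complex.simps by linarith
  moreover have "\<bar>Re (b - b')\<bar> < 1" using *(2) abs_Re_le_cmod[of "b - b'"] by (simp add: dist_norm)
  then have "- Re b' \<le> 1 - Re b" by simp
  ultimately have "exp (- (Re k' * t)) \<le> exp (- (Re k / 2 * t))" "(1 + t) powr - Re b' \<le> (1 + t) powr (1 - Re b)"
    using * by (auto intro: powr_mono)
  then show ?thesis using * by (simp add: norm_tricomi_kernel mult_mono)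
qed

text \<open>Differentiation in \<open>k\<close> brings down a factor -t, which raises the exponent a
  - 1 by one.\<close>

lemma tricomi_integral_has_derivative:
  assumes a: "a > 0" and k: "Re k > 0"
  shows "(tricomi_integral a b has_field_derivative - tricomi_integral (a + 1) b k) (at k)"
proof -
  have "((\<lambda>u. LINT t|pos_lborel. tricomi_kernel a b u t) has_field_derivative
     (LINT t|pos_lborel. deriv (\<lambda>u. tricomi_kernel a b u t) k)) (at k)"
  proof (rule has_field_derivative_integral_dominated(1))
    show "open {k::complex. 0 < Re k}" by (rule open_halfspace)
    show "Re k / 2 > 0" using k by simp
    show "integrable pos_lborel (\<lambda>t. exp (- (Re k / 2 * t)) * t powr (a - 1) * (1 + t) powr (1 - Re b))"
      using integrable_tricomi_kernel[of a "Re k / 2"] a k by simp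
    show "\<And>u x. dist k u < Re k / 2 \<Longrightarrow> x \<in> space pos_lborel \<Longrightarrow> cmod (tricomi_kernel a b u x)
           \<le> exp (- (Re k / 2 * x)) * x powr (a - 1) * (1 + x) powr (1 - Re b)"
      using tricomi_kernel_dominated[OF k] by simp
    show "\<And>x. x \<in> space pos_lborel \<Longrightarrow> (\<lambda>u. tricomi_kernel a b u x) holomorphic_on {k. 0 < Re k}"
      unfolding tricomi_kernel_def by (intro holomorphic_intros)
  qed (use k in auto)
  also have "(LINT t|pos_lborel. deriv (\<lambda>u. tricomi_kernel a b u t) k) = (LINT t|pos_lborel. - tricomi_kernel (a + 1) b k t)"
  proof (rule Bochner_Integration.integral_cong)
    fix t assume "t \<in> space pos_lborel"
    then have t: "t > 0" by simp
    then have p: "t powr a = t powr (a - 1) * t" by (simp add: powr_diff)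
    have "((\<lambda>u. tricomi_kernel a b u t) has_field_derivative - tricomi_kernel (a + 1) b k t) (at k)"
      unfolding tricomi_kernel_def by (auto intro!: derivative_eq_intros simp: p)
    then show "deriv (\<lambda>u. tricomi_kernel a b u t) k = - tricomi_kernel (a + 1) b k t"
      by (rule DERIV_imp_deriv)
  qed simp
  finally show ?thesis by (simp add: tricomi_integral_def[abs_def])
qed

lemma tricomi_integral_holomorphic_k:
  assumes "a > 0"
  shows "tricomi_integral a b holomorphic_on {k. 0 < Re k}"
  unfolding holomorphic_on_open[OF open_halfspace] using tricomi_integral_has_derivative[OF assms] by blast

lemma tricomi_integral_holomorphic_b:
  assumes a: "a > 0" and k: "Re k > 0"
  shows "(\<lambda>b. tricomi_integral a b k) holomorphic_on UNIV"
  unfolding tricomi_integral_def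
proof (rule holomorphic_integral_dominated)
  fix b :: complex
  let ?g = "\<lambda>t. exp (- (Re k / 2 * t)) * t powr (a - 1) * (1 + t) powr (1 - Re b)"
  have "integrable pos_lborel ?g" using a k by (intro integrable_tricomi_kernel) auto
  moreover have "\<forall>u\<in>UNIV. dist b u < 1 \<longrightarrow> (\<forall>x\<in>space pos_lborel. cmod (tricomi_kernel a u k x) \<le> ?g x)"
    using tricomi_kernel_dominated[OF k, of k b] k by simp
  ultimately show "\<exists>r>0. \<exists>g. integrable pos_lborel g \<and>
      (\<forall>u\<in>UNIV. dist b u < r \<longrightarrow> (\<forall>x\<in>space pos_lborel. cmod (tricomi_kernel a u k x) \<le> g x))"
    using zero_less_one by blast
  fix x assume "x \<in> space pos_lborel"
  then show "(\<lambda>u. tricomi_kernel a u k x) holomorphic_on UNIV"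
    unfolding tricomi_kernel_def by (intro holomorphic_intros)
qed auto

text \<open>For b = 0 the power of 1 + t disappears, and scaling the variable by \<open>k\<close>
  leaves the complete gamma integral.\<close>

lemma tricomi_integral_b0_real:
  assumes a: "a > 0" and k: "k > 0"
  shows "tricomi_integral a 0 (of_real k) = of_real (Gamma a) * of_real k powr (- of_real a)"
proof -
  have kk: "k powr (a - 1) * (k * k powr (-a)) = 1" using k by (simp add: powr_diff powr_minus field_simps)
  have "tricomi_integral a 0 (of_real k) = of_real (k powr (- a)) * (of_real k * (LINT t|pos_lborel. of_real ((k * t) powr (a - 1) * exp (- (k * t)))))"
    unfolding tricomi_integral_def integral_mult_right_zero[symmetric]
  proof (rule Bochner_Integration.integral_cong)
    fix t assume "t \<in> space pos_lborel"
    then have t: "t > 0" by simp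
    have "t powr (a - 1) * exp (- (k * t)) = (k powr (a - 1) * (k * k powr (-a))) * (t powr (a - 1) * exp (- (k * t)))"
      by (simp only: kk)
    also have "\<dots> = k powr (- a) * (k * ((k * t) powr (a - 1) * exp (- (k * t))))"
      using k t by (simp add: powr_mult)
    finally show "tricomi_kernel a 0 (complex_of_real k) t = of_real (k powr - a) * (of_real k * of_real ((k * t) powr (a - 1) * exp (- (k * t))))"
      unfolding tricomi_kernel_def using t
      by (simp add: complex_eq_iff[of "1 + of_real t" 0] exp_of_real mult_ac flip: of_real_mult of_real_minus)
  qed simp
  also have "of_real k * (LINT t|pos_lborel. of_real ((k * t) powr (a - 1) * exp (- (k * t)))) = (LINT t|pos_lborel. complex_of_real (t powr (a - 1) * exp (- t)))"
    by (rule integral_pos_lborel_scale[OF k, symmetric])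
  also have "\<dots> = of_real (Gamma a)" using integral_Gamma_kernel_real[OF a] by (simp add: integral_complex_of_real del: of_real_mult)
  finally show ?thesis using k by (simp add: powr_of_real mult.commute del: of_real_minus add: of_real_minus[symmetric])
qed

lemma halfspace_eqI:
  assumes "f holomorphic_on {k. 0 < Re k}" "g holomorphic_on {k. 0 < Re k}"
    "\<And>x. x > 0 \<Longrightarrow> f (of_real x) = g (of_real x)" "Re k > 0"
  shows "f k = g k"
proof -
  have "f k - g k = 0"
  proof (rule analytic_continuation[of "\<lambda>k. f k - g k" "{k. 0 < Re k}" "of_real ` {0<..}" 1])
    show "(1::complex) islimpt of_real ` {0::real<..}"
      unfolding islimpt_sequential
    proof (intro exI[of _ "\<lambda>n. of_real (1 + 1 / (1 + real n))"] conjI allI)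
      have "(\<lambda>n. 1 + 1 / (1 + real n)) \<longlonglongrightarrow> 1" by real_asymp
      then show "(\<lambda>n. complex_of_real (1 + 1 / (1 + real n))) \<longlonglongrightarrow> 1"
        using tendsto_of_real[of "\<lambda>n. 1 + 1 / (1 + real n)" 1 sequentially, where 'a = complex] by (simp only: of_real_1)
      fix n
      have "1 + 1 / (1 + real n) > 0" "1 + 1 / (1 + real n) \<noteq> 1" by (auto simp: add_pos_nonneg add_pos_pos)
      then show "complex_of_real (1 + 1 / (1 + real n)) \<in> complex_of_real ` {0<..} - {1}"
        by (auto simp del: of_real_add of_real_divide)
    qed
  qed (use assms open_halfspace convex_halfspace in \<open>auto intro!: holomorphic_intros convex_connected\<close>)
  then show ?thesis by simp
qed

lemma tricomi_integral_b0:
  assumes a: "a > 0" and k: "Re k > 0"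
  shows "tricomi_integral a 0 k = of_real (Gamma a) * k powr (- of_real a)"
proof (rule halfspace_eqI[OF _ _ _ k])
  show "(\<lambda>k. of_real (Gamma a) * k powr (- of_real a)) holomorphic_on {k. 0 < Re k}"
    by (intro holomorphic_intros) (auto simp: complex_nonpos_Reals_iff)
qed (use tricomi_integral_holomorphic_k tricomi_integral_b0_real a in auto)


section \<open>The upper incomplete gamma function\<close>

definition upper_Gamma_kernel :: "real \<Rightarrow> complex \<Rightarrow> real \<Rightarrow> complex" where
  "upper_Gamma_kernel \<rho> w x = exp (- (w + of_real x)) * (w + of_real x) powr (of_real \<rho> - 1)"

lemma upper_Gamma_eq: "upper_Gamma (of_real \<rho>) w = (LINT x|pos_lborel. upper_Gamma_kernel \<rho> w x)"
  by (simp add: upper_Gamma_def upper_Gamma_kernel_def integral_pos_lborel)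

lemma slit_plane_add_real:
  fixes w :: complex
  assumes "w \<notin> \<real>\<^sub>\<le>\<^sub>0" "x \<ge> 0"
  shows "w + of_real x \<notin> \<real>\<^sub>\<le>\<^sub>0"
  using assms by (auto simp: complex_nonpos_Reals_iff)

text \<open>The horizontal ray from \<open>w\<close> keeps its distance from 0: by
  \<open>Re w\<close> if \<open>w\<close> is a positive real number, by the height |Im w| otherwise.
  This bounds the factor with the negative exponent \<rho> - 1 in the integrand.\<close>

lemma slit_plane_dist:
  assumes "w \<notin> \<real>\<^sub>\<le>\<^sub>0"
  obtains d where "d > 0" "\<And>x::real. x \<ge> 0 \<Longrightarrow> d \<le> cmod (w + of_real x)"
proof (cases "Im w = 0")
  case True
  then have "Re w > 0" using assms by (auto simp: complex_nonpos_Reals_iff)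
  then show ?thesis
    by (intro that[of "Re w"]) (auto intro: order_trans[OF _ complex_Re_le_cmod])
next
  case False
  then show ?thesis
    by (intro that[of "\<bar>Im w\<bar>"]) (use abs_Im_le_cmod[of "w + of_real x" for x] in auto)
qed

lemma norm_upper_Gamma_kernel:
  "cmod (upper_Gamma_kernel \<rho> w x) = exp (- Re w) * exp (- x) * cmod (w + of_real x) powr (\<rho> - 1)"
proof -
  have "of_real \<rho> - 1 = complex_of_real (\<rho> - 1)" by simp
  then show ?thesis
    unfolding upper_Gamma_kernel_def norm_mult
    by (subst norm_powr_real_powr') (auto simp: exp_diff exp_minus field_simps norm_divide norm_mult)
qed

lemma continuous_upper_Gamma_kernel:
  assumes "w \<notin> \<real>\<^sub>\<le>\<^sub>0"
  shows "continuous_on {0..} (upper_Gamma_kernel \<rho> w)"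
proof -
  have *: "(0 \<le> Re w + x \<or> Im w \<noteq> 0) \<and> w + of_real x \<noteq> 0" if "x \<ge> 0" for x
    using assms that by (auto simp: complex_nonpos_Reals_iff complex_eq_iff)
  show ?thesis unfolding upper_Gamma_kernel_def
    by (intro continuous_intros) (use * in auto)
qed

lemma measurable_upper_Gamma_kernel:
  assumes "w \<notin> \<real>\<^sub>\<le>\<^sub>0"
  shows "upper_Gamma_kernel \<rho> w \<in> borel_measurable pos_lborel"
  by (intro borel_measurable_pos_lborel_continuous continuous_on_subset[OF continuous_upper_Gamma_kernel[OF assms]]) auto

lemma integrable_exp_minus: "integrable pos_lborel (\<lambda>x. exp (- x))"
  and integral_exp_minus: "(LINT x|pos_lborel. exp (- x)) = 1"
proof -
  have *: "\<And>x. x \<in> space pos_lborel \<Longrightarrow> x powr (1 - 1) * exp (- (1 * x)) = exp (- x)" by auto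
  have "integrable pos_lborel (\<lambda>x. x powr (1 - 1) * exp (- (1 * x)))"
    by (rule integrable_Gamma_kernel) auto
  then show "integrable pos_lborel (\<lambda>x. exp (- x))"
    by (subst (asm) Bochner_Integration.integrable_cong[OF refl *])
  have "(LINT x|pos_lborel. x powr (1 - 1) * exp (- x)) = 1"
    using integral_Gamma_kernel_real[of 1] by simp
  also have "(LINT x|pos_lborel. x powr (1 - 1) * exp (- x)) = (LINT x|pos_lborel. exp (- x))"
    using * by (intro Bochner_Integration.integral_cong) auto
  finally show "(LINT x|pos_lborel. exp (- x)) = 1" .
qed

context
  fixes \<rho> :: real
  assumes rho: "0 < \<rho>" "\<rho> < 1"
begin

lemma upper_Gamma_kernel_bound:
  assumes "d > 0" "d \<le> cmod (w + of_real x)"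
  shows "cmod (upper_Gamma_kernel \<rho> w x) \<le> exp (- Re w) * d powr (\<rho> - 1) * exp (- x)"
proof -
  have "cmod (w + of_real x) powr (\<rho> - 1) \<le> d powr (\<rho> - 1)"
    using assms rho by (intro powr_mono2') auto
  then have "exp (- Re w) * exp (- x) * cmod (w + of_real x) powr (\<rho> - 1) \<le> exp (- Re w) * exp (- x) * d powr (\<rho> - 1)"
    by (intro mult_left_mono) auto
  then show ?thesis by (simp add: norm_upper_Gamma_kernel mult_ac)
qed

lemma integrable_upper_Gamma_kernel:
  assumes "w \<notin> \<real>\<^sub>\<le>\<^sub>0"
  shows "integrable pos_lborel (upper_Gamma_kernel \<rho> w)"
proof -
  obtain d where d: "d > 0" "\<And>x::real. x \<ge> 0 \<Longrightarrow> d \<le> cmod (w + of_real x)"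
    using slit_plane_dist[OF assms] by blast
  have "integrable pos_lborel (\<lambda>x. exp (- Re w) * d powr (\<rho> - 1) * exp (- x))"
    using integrable_exp_minus by simp
  then show ?thesis
  proof (rule Bochner_Integration.integrable_bound)
    show "AE x in pos_lborel. cmod (upper_Gamma_kernel \<rho> w x) \<le> norm (exp (- Re w) * d powr (\<rho> - 1) * exp (- x))"
      using d upper_Gamma_kernel_bound[OF d(1)] by (intro AE_I2) (auto simp: abs_mult)
  qed (rule measurable_upper_Gamma_kernel[OF assms])
qed

lemma norm_upper_Gamma_le:
  assumes "d > 0" "Re w \<ge> d"
  shows "cmod (upper_Gamma (of_real \<rho>) w) \<le> exp (- Re w) * d powr (\<rho> - 1)"
proof -
  have w: "w \<notin> \<real>\<^sub>\<le>\<^sub>0" using assms by (auto simp: complex_nonpos_Reals_iff)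
  have "cmod (upper_Gamma (of_real \<rho>) w) \<le> (LINT x|pos_lborel. cmod (upper_Gamma_kernel \<rho> w x))"
    unfolding upper_Gamma_eq by (rule integral_norm_bound)
  also have "\<dots> \<le> (LINT x|pos_lborel. exp (- Re w) * d powr (\<rho> - 1) * exp (- x))"
  proof (rule integral_mono)
    show "integrable pos_lborel (\<lambda>x. exp (- Re w) * d powr (\<rho> - 1) * exp (- x))"
      using integrable_exp_minus by simp
    fix x assume "x \<in> space pos_lborel"
    then have "d \<le> cmod (w + of_real x)"
      using complex_Re_le_cmod[of "w + of_real x"] assms by auto
    then show "cmod (upper_Gamma_kernel \<rho> w x) \<le> exp (- Re w) * d powr (\<rho> - 1) * exp (- x)"
      by (rule upper_Gamma_kernel_bound[OF assms(1)])
  qed (use integrable_upper_Gamma_kernel[OF w] in simp)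
  also have "\<dots> = exp (- Re w) * d powr (\<rho> - 1)"
    using integral_exp_minus by simp
  finally show ?thesis .
qed

text \<open>Along a ray the primitive composed with \<open>Ln\<close> is an antiderivative of minus
  the integrand, so \<Gamma>(\<rho>, w) is its value at \<open>w\<close> minus its limit at
  infinity. That limit is the same for all \<open>w\<close> and is subtracted once and for
  all.\<close>

lemma upper_Gamma_lift_ex:
  "\<exists>G. (\<forall>l. (G has_field_derivative - exp (of_real \<rho> * l - exp l)) (at l)) \<and>
     (\<forall>w. w \<notin> \<real>\<^sub>\<le>\<^sub>0 \<longrightarrow> upper_Gamma (of_real \<rho>) w = G (Ln w))"
proof -
  obtain G0 :: "complex \<Rightarrow> complex" where G0: "\<And>l. (G0 has_field_derivative - exp (of_real \<rho> * l - exp l)) (at l)"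
    using upper_Gamma_primitive[of "of_real \<rho>"] by blast
  have dG: "((\<lambda>u. G0 (Ln u)) has_field_derivative - (exp (- u) * u powr (of_real \<rho> - 1))) (at u)"
    if "u \<notin> \<real>\<^sub>\<le>\<^sub>0" for u
  proof -
    have u: "u \<noteq> 0" using that by auto
    have "((\<lambda>u. G0 (Ln u)) has_field_derivative - exp (of_real \<rho> * Ln u - exp (Ln u)) * (1 / u)) (at u)"
      using that by (intro DERIV_chain2[OF G0]) (auto intro!: derivative_eq_intros simp: divide_inverse)
    moreover have "- exp (of_real \<rho> * Ln u - exp (Ln u)) * (1 / u) = - (exp (- u) * u powr (of_real \<rho> - 1))"
      using u by (simp add: powr_def exp_diff exp_minus algebra_simps) (simp add: field_simps)
    ultimately show ?thesis by simp
  qed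
  define F where "F = (\<lambda>w x. G0 (Ln (w + of_real x)))"
  have dF: "((\<lambda>x. F w x) has_vector_derivative - upper_Gamma_kernel \<rho> w x) (at x)"
    if "w \<notin> \<real>\<^sub>\<le>\<^sub>0" "x \<ge> 0" for w x
  proof -
    have "((\<lambda>z. G0 (Ln (w + z))) has_field_derivative - (exp (- (w + of_real x)) * (w + of_real x) powr (of_real \<rho> - 1)) * 1) (at (of_real x))"
      by (intro DERIV_chain2[OF dG]) (use slit_plane_add_real[OF that] in \<open>auto intro!: derivative_eq_intros\<close>)
    then have "((\<lambda>z. G0 (Ln (w + z))) has_field_derivative - upper_Gamma_kernel \<rho> w x) (at (of_real x))"
      by (simp add: upper_Gamma_kernel_def)
    then show ?thesis unfolding F_def by (rule has_vector_derivative_real_field)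
  qed
  have limF: "(\<lambda>n. F w (real n)) \<longlonglongrightarrow> F w 0 - upper_Gamma (of_real \<rho>) w" if w: "w \<notin> \<real>\<^sub>\<le>\<^sub>0" for w
  proof -
    let ?f = "upper_Gamma_kernel \<rho> w"
    have "(\<lambda>n. LINT x|pos_lborel. indicat_real {0..real n} x *\<^sub>R ?f x) \<longlonglongrightarrow> (LINT x|pos_lborel. ?f x)"
    proof (rule integral_dominated_convergence[where w = "\<lambda>x. cmod (?f x)"])
      show "?f \<in> borel_measurable pos_lborel" by (rule measurable_upper_Gamma_kernel[OF w])
      have m: "(\<lambda>x::real. x) \<in> measurable pos_lborel borel" by (intro borel_measurable_pos_lborel_continuous) auto
      show "(\<lambda>x. indicat_real {0..real n} x *\<^sub>R ?f x) \<in> borel_measurable pos_lborel" for n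
        by (intro borel_measurable_scaleR measurable_upper_Gamma_kernel[OF w] measurable_compose[OF m]) simp
      show "integrable pos_lborel (\<lambda>x. cmod (?f x))" using integrable_upper_Gamma_kernel[OF w] by simp
      show "AE x in pos_lborel. (\<lambda>n. indicat_real {0..real n} x *\<^sub>R ?f x) \<longlonglongrightarrow> ?f x"
      proof (intro AE_I2 tendsto_eventually)
        fix x assume "x \<in> space pos_lborel"
        then show "\<forall>\<^sub>F n in sequentially. indicat_real {0..real n} x *\<^sub>R ?f x = ?f x"
          using eventually_ge_at_top[of "nat \<lceil>x\<rceil>"]
          by (elim eventually_mono) (auto simp: indicator_def nat_le_iff ceiling_le_iff)
      qed
    qed (auto simp: indicator_def)
    moreover have "(LINT x|pos_lborel. indicat_real {0..real n} x *\<^sub>R ?f x) = F w 0 - F w (real n)" for n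
    proof -
      have "continuous_on {0..real n} (\<lambda>x. - ?f x)"
        by (intro continuous_on_minus continuous_on_subset[OF continuous_upper_Gamma_kernel[OF w]]) auto
      then have "integral\<^sup>L lborel (\<lambda>x. indicat_real {0..real n} x *\<^sub>R (- ?f x)) = F w (real n) - F w 0"
        using dF[OF w] by (intro integral_FTC_atLeastAtMost) (auto intro: has_vector_derivative_at_within)
      then have *: "integral\<^sup>L lborel (\<lambda>x. indicat_real {0..real n} x *\<^sub>R ?f x) = F w 0 - F w (real n)"
        by (simp add: algebra_simps)
      have "(LINT x|pos_lborel. indicat_real {0..real n} x *\<^sub>R ?f x) = integral\<^sup>L lborel (\<lambda>x. indicat_real {0<..} x *\<^sub>R indicat_real {0..real n} x *\<^sub>R ?f x)"
        by (simp add: integral_restrict_space)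
      also have "\<dots> = integral\<^sup>L lborel (\<lambda>x. indicat_real {0..real n} x *\<^sub>R ?f x)"
      proof (rule integral_cong_AE)
        have "?f \<in> borel_measurable lborel"
          unfolding upper_Gamma_kernel_def powr_def by measurable
        then show "(\<lambda>x. indicat_real {0<..} x *\<^sub>R indicat_real {0..real n} x *\<^sub>R ?f x) \<in> borel_measurable lborel"
          "(\<lambda>x. indicat_real {0..real n} x *\<^sub>R ?f x) \<in> borel_measurable lborel" by measurable
        show "AE x in lborel. indicat_real {0<..} x *\<^sub>R indicat_real {0..real n} x *\<^sub>R ?f x = indicat_real {0..real n} x *\<^sub>R ?f x"
          using AE_lborel_singleton[of "0::real"] by eventually_elim (auto simp: indicator_def)
      qed
      finally show ?thesis using * by simp
    qed
    ultimately have "(\<lambda>n. F w 0 - F w (real n)) \<longlonglongrightarrow> upper_Gamma (of_real \<rho>) w"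
      by (simp add: upper_Gamma_eq)
    then have "(\<lambda>n. F w 0 - (F w 0 - F w (real n))) \<longlonglongrightarrow> F w 0 - upper_Gamma (of_real \<rho>) w"
      by (intro tendsto_intros)
    then show ?thesis by simp
  qed
  have lim0: "(\<lambda>n. F w (real n) - F 1 (real n)) \<longlonglongrightarrow> 0" if w: "w \<notin> \<real>\<^sub>\<le>\<^sub>0" for w
  proof -
    \<comment> \<open>Both w + n and 1 + n lie in the half-plane Re u \<ge> n - c, where exp(-u) is
      at most exp(-(n - c)) in modulus. For n \<ge> c + 1 also |u| \<ge> 1 there, so the factor of
      exponent \<rho> - 1 is at most 1.\<close>
    define c where "c = cmod w + 1"
    have "eventually (\<lambda>n. norm (F w (real n) - F 1 (real n)) \<le> exp (- (real n - c)) * cmod (w - 1)) sequentially"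
      using eventually_ge_at_top[of "nat \<lceil>c + 1\<rceil>"]
    proof eventually_elim
      case (elim n)
      then have n: "real n \<ge> c + 1" by (metis nat_ceiling_le_eq)
      have "cmod (G0 (Ln (w + of_real (real n))) - G0 (Ln (1 + of_real (real n)))) \<le> exp (- (real n - c)) * cmod ((w + of_real (real n)) - (1 + of_real (real n)))"
      proof (rule field_differentiable_bound[where S = "{u. Re u \<ge> real n - c}"])
        fix u assume "u \<in> {u. Re u \<ge> real n - c}"
        then have u: "Re u \<ge> real n - c" "Re u \<ge> 1" using n by auto
        then have u': "u \<notin> \<real>\<^sub>\<le>\<^sub>0" by (auto simp: complex_nonpos_Reals_iff)
        then show "((\<lambda>u. G0 (Ln u)) has_field_derivative - (exp (- u) * u powr (of_real \<rho> - 1))) (at u within {u. Re u \<ge> real n - c})"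
          using has_field_derivative_at_within[OF dG[OF u']] by blast
        have "cmod u \<ge> 1" using complex_Re_le_cmod[of u] u by linarith
        then have "cmod u powr (\<rho> - 1) \<le> 1 powr (\<rho> - 1)" using rho by (intro powr_mono2') auto
        moreover have "cmod (u powr (of_real \<rho> - 1)) = cmod u powr (\<rho> - 1)"
          using norm_powr_real_powr'[of "of_real \<rho> - 1" u] by simp
        ultimately show "cmod (- (exp (- u) * u powr (of_real \<rho> - 1))) \<le> exp (- (real n - c))"
          using u by (simp add: norm_mult) (smt (verit) exp_ge_zero exp_le_cancel_iff mult_left_le)
      next
        show "convex {u. Re u \<ge> real n - c}" by (rule convex_halfspace_Re_ge)
        show "w + complex_of_real (real n) \<in> {u. Re u \<ge> real n - c}"
          using abs_Re_le_cmod[of w] by (simp add: c_def abs_le_iff)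
        show "1 + complex_of_real (real n) \<in> {u. Re u \<ge> real n - c}" using norm_ge_zero[of w] unfolding c_def by (simp del: norm_ge_zero)
      qed
      then show ?case by (simp add: F_def)
    qed
    moreover have "(\<lambda>n. exp (- (real n - c)) * cmod (w - 1)) \<longlonglongrightarrow> 0" by real_asymp
    ultimately show ?thesis by (rule Lim_null_comparison)
  qed
  define c where "c = F 1 0 - upper_Gamma (of_real \<rho>) 1"
  have eq: "G0 (Ln w) - upper_Gamma (of_real \<rho>) w = c" if w: "w \<notin> \<real>\<^sub>\<le>\<^sub>0" for w
  proof -
    have "(\<lambda>n. F w (real n) - F 1 (real n)) \<longlonglongrightarrow> (F w 0 - upper_Gamma (of_real \<rho>) w) - c"
      unfolding c_def by (intro tendsto_diff limF w) auto
    from LIMSEQ_unique[OF this lim0[OF w]] show ?thesis by (simp add: F_def)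
  qed
  show ?thesis
  proof (intro exI[of _ "\<lambda>l. G0 l - c"] conjI allI impI)
    show "((\<lambda>l. G0 l - c) has_field_derivative - exp (of_real \<rho> * l - exp l)) (at l)" for l
      by (auto intro!: derivative_eq_intros G0)
  qed (use eq in \<open>simp add: algebra_simps\<close>)
qed

end

text \<open>The pull-back of \<Gamma>(\<rho>, .) under exp. At a logarithm of \<open>w\<close> other
  than \<open>Ln w\<close> it gives the value at \<open>w\<close> of another branch, the one reached
  by continuation along the corresponding path around 0.\<close>

definition upper_Gamma_lift :: "real \<Rightarrow> complex \<Rightarrow> complex" where
  "upper_Gamma_lift \<rho> = (SOME G. (\<forall>l. (G has_field_derivative - exp (of_real \<rho> * l - exp l)) (at l)) \<and>
     (\<forall>w. w \<notin> \<real>\<^sub>\<le>\<^sub>0 \<longrightarrow> upper_Gamma (of_real \<rho>) w = G (Ln w)))"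

context
  fixes \<rho> :: real
  assumes rho: "0 < \<rho>" "\<rho> < 1"
begin

lemma upper_Gamma_lift_deriv: "(upper_Gamma_lift \<rho> has_field_derivative - exp (of_real \<rho> * l - exp l)) (at l)"
  and upper_Gamma_lift_Ln: "w \<notin> \<real>\<^sub>\<le>\<^sub>0 \<Longrightarrow> upper_Gamma_lift \<rho> (Ln w) = upper_Gamma (of_real \<rho>) w"
  using someI_ex[OF upper_Gamma_lift_ex[OF rho], folded upper_Gamma_lift_def] by auto

lemma upper_Gamma_deriv:
  assumes "w \<notin> \<real>\<^sub>\<le>\<^sub>0"
  shows "(upper_Gamma (of_real \<rho>) has_field_derivative - (exp (- w) * w powr (of_real \<rho> - 1))) (at w)"
proof -
  have w: "w \<noteq> 0" using assms by auto
  have "((\<lambda>u. upper_Gamma_lift \<rho> (Ln u)) has_field_derivative - exp (of_real \<rho> * Ln w - exp (Ln w)) * (1 / w)) (at w)"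
    using assms by (intro DERIV_chain2[OF upper_Gamma_lift_deriv]) (auto intro!: derivative_eq_intros simp: divide_inverse)
  moreover have "- exp (of_real \<rho> * Ln w - exp (Ln w)) * (1 / w) = - (exp (- w) * w powr (of_real \<rho> - 1))"
    using w by (simp add: powr_def exp_diff exp_minus algebra_simps) (simp add: field_simps)
  ultimately have "((\<lambda>u. upper_Gamma_lift \<rho> (Ln u)) has_field_derivative - (exp (- w) * w powr (of_real \<rho> - 1))) (at w)"
    by simp
  then show ?thesis
    by (rule has_field_derivative_transform_within_open[of _ _ _ "- \<real>\<^sub>\<le>\<^sub>0"])
       (use assms upper_Gamma_lift_Ln in \<open>auto simp: open_Compl\<close>)
qed

lemma upper_Gamma_holomorphic: "upper_Gamma (of_real \<rho>) holomorphic_on (- \<real>\<^sub>\<le>\<^sub>0)"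
  using upper_Gamma_deriv by (subst holomorphic_on_open) (auto simp: open_Compl)

text \<open>Both sides have the same derivative up to checking one identity: 1/(1+t) + t/(1+t) = 1
  adds the integral and its \<open>a + 1\<close> companion up to the case b = 0, which is
  \<Gamma>(a) w^(-a). The remaining constant is 0 because both sides decay at infinity.\<close>

lemma upper_Gamma_eq_tricomi_integral:
  assumes w: "Re w > 0"
  shows "of_real (Gamma (1 - \<rho>)) * upper_Gamma (of_real \<rho>) w = exp (- w) * tricomi_integral (1 - \<rho>) 1 w"
proof -
  define a where "a = 1 - \<rho>"
  have a: "a > 0" using rho by (simp add: a_def)
  let ?g = "\<lambda>w. exp (- w) * tricomi_integral a 1 w - of_real (Gamma a) * upper_Gamma (of_real \<rho>) w"
  have rec: "tricomi_integral a 1 w + tricomi_integral (a + 1) 1 w = tricomi_integral a 0 w" if "Re w > 0" for w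
    unfolding tricomi_integral_def
  proof (subst Bochner_Integration.integral_add[symmetric])
    show "(LINT t|pos_lborel. tricomi_kernel a 1 w t + tricomi_kernel (a + 1) 1 w t) = (LINT t|pos_lborel. tricomi_kernel a 0 w t)"
    proof (rule Bochner_Integration.integral_cong)
      fix t assume "t \<in> space pos_lborel"
      then have t: "t > 0" by simp
      then have p: "t powr a = t powr (a - 1) * t" by (simp add: powr_diff)
      have n: "1 + complex_of_real t \<noteq> 0" using t by (simp add: complex_eq_iff)
      have "tricomi_kernel a 1 w t + tricomi_kernel (a + 1) 1 w t =
        exp (- (w * of_real t)) * of_real (t powr (a - 1)) * ((1 + of_real t) * inverse (1 + of_real t))"
        unfolding tricomi_kernel_def using n by (simp add: p powr_minus algebra_simps)
      then show "tricomi_kernel a 1 w t + tricomi_kernel (a + 1) 1 w t = tricomi_kernel a 0 w t"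
        using n by (simp add: tricomi_kernel_def)
    qed simp
  qed (use that a integrable_tricomi_integral in auto)
  have "(?g has_field_derivative 0) (at w within {w. Re w > 0})" if "Re w > 0" for w
  proof -
    have *: "w \<notin> \<real>\<^sub>\<le>\<^sub>0" using that by (auto simp: complex_nonpos_Reals_iff)
    have "(?g has_field_derivative - exp (- w) * tricomi_integral a 1 w + exp (- w) * (- tricomi_integral (a + 1) 1 w)
       - of_real (Gamma a) * (- (exp (- w) * w powr (of_real \<rho> - 1)))) (at w)"
      by (auto intro!: derivative_eq_intros tricomi_integral_has_derivative a that upper_Gamma_deriv *)
    also have "- exp (- w) * tricomi_integral a 1 w + exp (- w) * (- tricomi_integral (a + 1) 1 w)
       - of_real (Gamma a) * (- (exp (- w) * w powr (of_real \<rho> - 1))) =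
       - exp (- w) * (tricomi_integral a 1 w + tricomi_integral (a + 1) 1 w) + of_real (Gamma a) * exp (- w) * w powr (of_real \<rho> - 1)"
      by (simp add: algebra_simps)
    also have "\<dots> = 0"
      unfolding rec[OF that] tricomi_integral_b0[OF a that] by (simp add: a_def)
    finally show ?thesis by (rule has_field_derivative_at_within)
  qed
  then obtain c where c: "\<And>w. Re w > 0 \<Longrightarrow> ?g w = c"
    using has_field_derivative_zero_constant[OF convex_halfspace, of ?g] by auto
  \<comment> \<open>The constant is evaluated along the positive integers: the Laplace integral is
    bounded there by its absolute value at 1, and the exponential factor tends to 0.\<close>
  have "(\<lambda>n. ?g (of_real (real (Suc n)))) \<longlonglongrightarrow> 0"
  proof (rule Lim_null_comparison)
    define C where "C = (LINT t|pos_lborel. cmod (tricomi_kernel a 1 1 t))"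
    show "\<forall>\<^sub>F n in sequentially. norm (?g (of_real (real (Suc n)))) \<le> exp (- real (Suc n)) * C + \<bar>Gamma a\<bar> * exp (- real (Suc n))"
    proof (intro always_eventually allI)
      fix n
      have "cmod (tricomi_integral a 1 (of_real (real (Suc n)))) \<le> (LINT t|pos_lborel. cmod (tricomi_kernel a 1 (of_real (real (Suc n))) t))"
        unfolding tricomi_integral_def by (rule integral_norm_bound)
      also have "\<dots> \<le> C"
        unfolding C_def
      proof (rule integral_mono)
        fix t assume "t \<in> space pos_lborel"
        then have t: "t > 0" by simp
        then show "cmod (tricomi_kernel a 1 (of_real (real (Suc n))) t) \<le> cmod (tricomi_kernel a 1 1 t)"
          by (simp add: norm_tricomi_kernel mult_right_mono divide_right_mono powr_minus)
      qed (use integrable_tricomi_integral a in auto)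
      finally have 1: "cmod (tricomi_integral a 1 (of_real (real (Suc n)))) \<le> C" .
      have 2: "cmod (upper_Gamma (of_real \<rho>) (of_real (real (Suc n)))) \<le> exp (- real (Suc n))"
        using norm_upper_Gamma_le[OF rho, of 1 "of_real (real (Suc n))"] by simp
      have "norm (?g (of_real (real (Suc n)))) \<le> exp (- real (Suc n)) * cmod (tricomi_integral a 1 (of_real (real (Suc n)))) + \<bar>Gamma a\<bar> * cmod (upper_Gamma (of_real \<rho>) (of_real (real (Suc n))))"
        by (rule order_trans[OF norm_triangle_ineq4]) (simp add: norm_mult)
      also have "\<dots> \<le> exp (- real (Suc n)) * C + \<bar>Gamma a\<bar> * exp (- real (Suc n))"
        using 1 2 by (intro add_mono mult_left_mono) auto
      finally show "norm (?g (of_real (real (Suc n)))) \<le> exp (- real (Suc n)) * C + \<bar>Gamma a\<bar> * exp (- real (Suc n))" .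
    qed
    show "(\<lambda>n. exp (- real (Suc n)) * C + \<bar>Gamma a\<bar> * exp (- real (Suc n))) \<longlonglongrightarrow> 0" by real_asymp
  qed
  moreover have "(\<lambda>n. ?g (of_real (real (Suc n)))) = (\<lambda>n. c)" by (intro ext c) simp
  ultimately have "c = 0" using LIMSEQ_unique tendsto_const by metis
  then show ?thesis using c[OF w] by (simp add: a_def)
qed

text \<open>The leading term \<Gamma>(\<rho>, w) ~ exp(-w) w^(\<rho>-1) in sectors off the real
  axis, including those with negative real part. An imaginary part comparable to |w| gives |w + x|
  \<ge> c |w| along the whole ray, hence the integrable majorant c^(\<rho>-1) exp(-x).\<close>

lemma upper_Gamma_asymptotic:
  fixes w :: "nat \<Rightarrow> complex"
  assumes lim: "filterlim (\<lambda>n. \<bar>Im (w n)\<bar>) at_top sequentially"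
    and c: "c > 0" "\<And>n. c * cmod (w n) \<le> \<bar>Im (w n)\<bar>" and nz: "\<And>n. Im (w n) \<noteq> 0"
  shows "(\<lambda>n. exp (w n) * w n powr (1 - of_real \<rho>) * upper_Gamma (of_real \<rho>) (w n)) \<longlonglongrightarrow> 1"
proof -
  \<comment> \<open>The normalised integrand exp(-x) ((w + x)/w)^(\<rho>-1), written with a
    difference of logarithms so that no branch of the quotient has to be discussed.\<close>
  let ?q = "\<lambda>n x. exp (- of_real x) * exp ((of_real \<rho> - 1) * (Ln (w n + of_real x) - Ln (w n)))"
  have nr': "w n + of_real x \<notin> \<real>\<^sub>\<le>\<^sub>0" "w n + of_real x \<noteq> 0" "w n \<noteq> 0" for n and x :: real
    using nz[of n] by (auto simp: complex_nonpos_Reals_iff complex_eq_iff)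
  have eq: "exp (w n) * w n powr (1 - of_real \<rho>) * upper_Gamma (of_real \<rho>) (w n) = (LINT x|pos_lborel. ?q n x)" for n
    unfolding upper_Gamma_eq integral_mult_right_zero[symmetric]
  proof (rule Bochner_Integration.integral_cong)
    fix x
    have "exp (w n) * w n powr (1 - of_real \<rho>) * upper_Gamma_kernel \<rho> (w n) x =
       (exp (w n) * exp (- (w n + of_real x))) * (exp ((1 - of_real \<rho>) * Ln (w n)) * exp ((of_real \<rho> - 1) * Ln (w n + of_real x)))"
      using nr'(2)[of n x] nr'(3)[of n] by (simp add: upper_Gamma_kernel_def powr_def mult_ac)
    also have "exp (w n) * exp (- (w n + of_real x)) = exp (- of_real x)"
      by (simp add: exp_add[symmetric])
    also have "exp ((1 - of_real \<rho>) * Ln (w n)) * exp ((of_real \<rho> - 1) * Ln (w n + of_real x)) = exp ((of_real \<rho> - 1) * (Ln (w n + of_real x) - Ln (w n)))"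
      by (simp add: exp_add[symmetric] algebra_simps)
    finally show "exp (w n) * w n powr (1 - of_real \<rho>) * upper_Gamma_kernel \<rho> (w n) x = ?q n x" .
  qed simp
  have bd: "cmod (?q n x) \<le> c powr (\<rho> - 1) * exp (- x)" for n x
  proof -
    have "c * cmod (w n) \<le> cmod (w n + of_real x)"
      using c(2)[of n] abs_Im_le_cmod[of "w n + of_real x"] by simp
    then have "c \<le> cmod (w n + of_real x) / cmod (w n)" using nr'(3)[of n] by (simp add: field_simps)
    then have "(cmod (w n + of_real x) / cmod (w n)) powr (\<rho> - 1) \<le> c powr (\<rho> - 1)"
      using c rho by (intro powr_mono2') auto
    moreover have "cmod (exp ((of_real \<rho> - 1) * (Ln (w n + of_real x) - Ln (w n)))) = (cmod (w n + of_real x) / cmod (w n)) powr (\<rho> - 1)"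
      using nr'(1,2)[of n x] nr'(3)[of n] by (simp add: powr_def ln_div algebra_simps)
    ultimately show ?thesis by (simp add: norm_mult)
  qed
  have "(\<lambda>n. LINT x|pos_lborel. ?q n x) \<longlonglongrightarrow> (LINT x|pos_lborel. exp (- of_real x))"
  proof (rule integral_dominated_convergence[where w = "\<lambda>x. c powr (\<rho> - 1) * exp (- x)"])
    show "(\<lambda>x. exp (- complex_of_real x)) \<in> borel_measurable pos_lborel"
      by (intro borel_measurable_pos_lborel_continuous continuous_intros)
    show "(\<lambda>x. ?q n x) \<in> borel_measurable pos_lborel" for n
      by (intro borel_measurable_pos_lborel_continuous continuous_intros) (use nr' in auto)
    show "integrable pos_lborel (\<lambda>x. c powr (\<rho> - 1) * exp (- x))" using integrable_exp_minus by simp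
    show "AE x in pos_lborel. cmod (?q n x) \<le> c powr (\<rho> - 1) * exp (- x)" for n using bd by auto
    show "AE x in pos_lborel. (\<lambda>n. ?q n x) \<longlonglongrightarrow> exp (- of_real x)"
    proof (intro AE_I2)
      fix x assume "x \<in> space pos_lborel"
      then have x: "x > 0" by simp
      have "(\<lambda>n. Ln (w n + of_real x) - Ln (w n)) \<longlonglongrightarrow> 0"
      proof (rule Lim_null_comparison)
        show "\<forall>\<^sub>F n in sequentially. cmod (Ln (w n + of_real x) - Ln (w n)) \<le> inverse \<bar>Im (w n)\<bar> * x"
        proof (intro always_eventually allI)
          fix n
          \<comment> \<open>On the horizontal line through \<open>w n\<close>, which misses the
            slit, the derivative of \<open>Ln\<close> is at most 1/|Im (w n)|.\<close>
          have "cmod (Ln (w n + of_real x) - Ln (w n)) \<le> inverse \<bar>Im (w n)\<bar> * cmod (w n + of_real x - w n)"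
          proof (rule field_differentiable_bound[where S = "{u. Im u = Im (w n)}"])
            show "convex {u. Im u = Im (w n)}" by (auto simp: convex_def algebra_simps simp flip: distrib_right)
            fix u assume "u \<in> {u. Im u = Im (w n)}"
            then have u: "Im u = Im (w n)" by simp
            then have "u \<notin> \<real>\<^sub>\<le>\<^sub>0" using nz[of n] by (auto simp: complex_nonpos_Reals_iff)
            then show "(Ln has_field_derivative inverse u) (at u within {u. Im u = Im (w n)})"
              by (rule has_field_derivative_Ln[THEN has_field_derivative_at_within])
            have "\<bar>Im (w n)\<bar> \<le> cmod u" using abs_Im_le_cmod[of u] u by simp
            then show "cmod (inverse u) \<le> inverse \<bar>Im (w n)\<bar>" using nz[of n]
              by (simp add: norm_inverse le_imp_inverse_le)
          qed auto
          then show "cmod (Ln (w n + of_real x) - Ln (w n)) \<le> inverse \<bar>Im (w n)\<bar> * x" using x by simp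
        qed
        have "(\<lambda>n. inverse \<bar>Im (w n)\<bar>) \<longlonglongrightarrow> 0"
          by (rule tendsto_inverse_0_at_top[OF lim])
        then show "(\<lambda>n. inverse \<bar>Im (w n)\<bar> * x) \<longlonglongrightarrow> 0"
          by (rule tendsto_mult_left_zero)
      qed
      then have "(\<lambda>n. ?q n x) \<longlonglongrightarrow> exp (- of_real x) * exp ((of_real \<rho> - 1) * 0)"
        by (intro tendsto_intros)
      then show "(\<lambda>n. ?q n x) \<longlonglongrightarrow> exp (- of_real x)" by simp
    qed
  qed
  moreover have "(LINT x|pos_lborel. exp (- complex_of_real x)) = 1"
  proof -
    have "(LINT x|pos_lborel. exp (- complex_of_real x)) = (LINT x|pos_lborel. complex_of_real (exp (- x)))"
      by (intro Bochner_Integration.integral_cong) (auto simp flip: exp_of_real)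
    then show ?thesis by (simp add: integral_exp_minus)
  qed
  ultimately show ?thesis unfolding eq by simp
qed

end


section \<open>Kummer's differential equation\<close>

text \<open>Each factor is (a + j)/(c + j) = 1 + (a - c)/(c + j). The resulting geometric bound
  compares the hypergeometric series with an exponential series, uniformly for parameters that keep
  the distance \<open>d\<close> from the poles.\<close>

lemma norm_pochhammer_ratio_le:
  fixes a c :: complex
  assumes d: "d > 0" and dist: "\<And>j. d \<le> cmod (c + of_nat j)"
  shows "cmod (pochhammer a n / pochhammer c n) \<le> (1 + cmod (a - c) / d) ^ n"
proof (induction n)
  case 0
  show ?case by simp
next
  case (Suc n)
  have c0: "c + of_nat n \<noteq> 0" using dist[of n] d by auto
  have "(a + of_nat n) / (c + of_nat n) = 1 + (a - c) / (c + of_nat n)"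
    using c0 by (simp add: field_simps)
  then have "cmod ((a + of_nat n) / (c + of_nat n)) \<le> 1 + cmod (a - c) / cmod (c + of_nat n)"
    by (metis norm_divide norm_one norm_triangle_ineq)
  also have "\<dots> \<le> 1 + cmod (a - c) / d"
    using d dist[of n] by (intro add_left_mono divide_left_mono mult_pos_pos) auto
  finally have *: "cmod ((a + of_nat n) / (c + of_nat n)) \<le> 1 + cmod (a - c) / d" .
  have "pochhammer a (Suc n) / pochhammer c (Suc n) = (pochhammer a n / pochhammer c n) * ((a + of_nat n) / (c + of_nat n))"
    by (simp add: pochhammer_Suc)
  then have "cmod (pochhammer a (Suc n) / pochhammer c (Suc n)) = cmod (pochhammer a n / pochhammer c n) * cmod ((a + of_nat n) / (c + of_nat n))"
    by (simp only: norm_mult)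
  also have "\<dots> \<le> (1 + cmod (a - c) / d) ^ n * (1 + cmod (a - c) / d)"
    using Suc * d by (intro mult_mono) auto
  finally show ?case by (simp add: mult.commute)
qed

text \<open>Half the radius of a disc free of nonpositive integers serves twice: as the size of the
  neighbourhood of \<open>c\<close> and as the distance of its points from the poles.\<close>

lemma dist_nonpos_Ints:
  fixes c :: complex
  assumes "c \<notin> \<int>\<^sub>\<le>\<^sub>0"
  obtains d where "d > 0" "\<And>j c'. dist c c' < d \<Longrightarrow> d \<le> cmod (c' + of_nat j)"
proof -
  have "open (- \<int>\<^sub>\<le>\<^sub>0 :: complex set)" by (simp add: open_Compl)
  with assms obtain e where e: "e > 0" "ball c e \<subseteq> - \<int>\<^sub>\<le>\<^sub>0" by (metis Compl_iff open_contains_ball)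
  have far: "e \<le> dist c (- of_nat j)" for j
  proof (rule ccontr)
    assume "\<not> e \<le> dist c (- of_nat j)"
    then have "- of_nat j \<in> ball c e" by simp
    with e have "(- of_nat j :: complex) \<notin> \<int>\<^sub>\<le>\<^sub>0" by blast
    then show False by simp
  qed
  show ?thesis
  proof (rule that[of "e / 2"])
    fix j c' assume "dist c c' < e / 2"
    then show "e / 2 \<le> cmod (c' + of_nat j)"
      using far[of j] dist_triangle[of c "- of_nat j" c'] by (simp add: dist_norm)
  qed (use e in simp)
qed

lemma summable_power_over_fact: "summable (\<lambda>n. (x::real) ^ n / fact n)"
  using exp_converges[of x] by (simp add: sums_iff divide_inverse mult.commute)

definition hyp1F1_fps :: "complex \<Rightarrow> complex \<Rightarrow> complex fps" where
  "hyp1F1_fps a c = Abs_fps (\<lambda>n. pochhammer a n / pochhammer c n / fact n)"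

lemma hyp1F1_eval_fps: "hyp1F1 a c = eval_fps (hyp1F1_fps a c)"
  by (simp add: fun_eq_iff hyp1F1_def eval_fps_def hyp1F1_fps_def divide_inverse mult_ac)

lemma conv_radius_hyp1F1_fps:
  assumes "c \<notin> \<int>\<^sub>\<le>\<^sub>0"
  shows "fps_conv_radius (hyp1F1_fps a c) = \<infinity>"
  unfolding fps_conv_radius_def
proof (rule conv_radius_inftyI'')
  fix z :: complex
  obtain d where d: "d > 0" "\<And>j. d \<le> cmod (c + of_nat j)" using dist_nonpos_Ints[OF assms] by (metis dist_self)
  show "summable (\<lambda>n. fps_nth (hyp1F1_fps a c) n * z ^ n)"
  proof (rule summable_comparison_test[OF _ summable_power_over_fact[of "(1 + cmod (a - c) / d) * cmod z"]], intro exI allI impI)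
    fix n
    have "norm (fps_nth (hyp1F1_fps a c) n * z ^ n) = cmod (pochhammer a n / pochhammer c n) * (cmod z ^ n / fact n)"
      by (simp add: hyp1F1_fps_def norm_mult norm_divide norm_power)
    also have "\<dots> \<le> (1 + cmod (a - c) / d) ^ n * (cmod z ^ n / fact n)"
      by (intro mult_right_mono norm_pochhammer_ratio_le[OF d]) auto
    finally show "norm (fps_nth (hyp1F1_fps a c) n * z ^ n) \<le> ((1 + cmod (a - c) / d) * cmod z) ^ n / fact n"
      by (simp add: power_mult_distrib)
  qed
qed

text \<open>Read coefficientwise, Kummer's equation is the two-term recursion of the hypergeometric
  coefficients.\<close>

lemma hyp1F1_fps_ode:
  assumes "c \<notin> \<int>\<^sub>\<le>\<^sub>0"
  shows "fps_X * fps_deriv (fps_deriv (hyp1F1_fps a c)) + (fps_const c - fps_X) * fps_deriv (hyp1F1_fps a c)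
     = fps_const a * hyp1F1_fps a c"
proof (rule fps_ext)
  fix n
  have nz: "c + of_nat n \<noteq> 0" for n
  proof
    assume "c + of_nat n = 0"
    then have "c = - of_nat n" by (simp add: eq_neg_iff_add_eq_0)
    with assms show False by simp
  qed
  have pz: "pochhammer c n \<noteq> 0" for n using nz by (auto simp: pochhammer_eq_0_iff) (metis add.left_inverse)
  have rec: "of_nat (Suc n) * (c + of_nat n) * fps_nth (hyp1F1_fps a c) (Suc n) = (a + of_nat n) * fps_nth (hyp1F1_fps a c) n" for n
  proof -
    have "fps_nth (hyp1F1_fps a c) (Suc n) = pochhammer a n * (a + of_nat n) / (pochhammer c n * (c + of_nat n)) / (of_nat (Suc n) * fact n)"
      by (simp add: hyp1F1_fps_def pochhammer_Suc)
    moreover have "of_nat (Suc n) \<noteq> (0::complex)" by (rule of_nat_neq_0)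
    ultimately show ?thesis using nz[of n] pz[of n]
      by (simp add: hyp1F1_fps_def del: of_nat_Suc)
  qed
  have "fps_nth (fps_X * fps_deriv (fps_deriv (hyp1F1_fps a c)) + (fps_const c - fps_X) * fps_deriv (hyp1F1_fps a c)) n
     = of_nat (Suc n) * (c + of_nat n) * fps_nth (hyp1F1_fps a c) (Suc n) - of_nat n * fps_nth (hyp1F1_fps a c) n"
    by (cases n) (simp_all add: algebra_simps left_diff_distrib)
  also have "\<dots> = a * fps_nth (hyp1F1_fps a c) n"
    unfolding rec by (simp add: algebra_simps)
  finally show "fps_nth (fps_X * fps_deriv (fps_deriv (hyp1F1_fps a c)) + (fps_const c - fps_X) * fps_deriv (hyp1F1_fps a c)) n
     = fps_nth (fps_const a * hyp1F1_fps a c) n" by simp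
qed

text \<open>Kummer's equation k y'' + (c - k) y' = a y on the right half-plane, solved for y''. The
  derivative is carried along as a function \<open>y'\<close>, so that its behaviour at 0 can be
  formulated separately.\<close>

definition kummer_sol :: "complex \<Rightarrow> complex \<Rightarrow> (complex \<Rightarrow> complex) \<Rightarrow> (complex \<Rightarrow> complex) \<Rightarrow> bool" where
  "kummer_sol a c y y' \<longleftrightarrow> (\<forall>k. Re k > 0 \<longrightarrow> (y has_field_derivative y' k) (at k) \<and>
      (y' has_field_derivative (a * y k - (c - k) * y' k) / k) (at k))"

abbreviation "hyp1F1' a c \<equiv> eval_fps (fps_deriv (hyp1F1_fps a c))"

lemma hyp1F1_derivs:
  assumes "c \<notin> \<int>\<^sub>\<le>\<^sub>0"
  shows "(hyp1F1 a c has_field_derivative hyp1F1' a c k) (at k)"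
    "(hyp1F1' a c has_field_derivative eval_fps (fps_deriv (fps_deriv (hyp1F1_fps a c))) k) (at k)"
    "k * eval_fps (fps_deriv (fps_deriv (hyp1F1_fps a c))) k + (c - k) * hyp1F1' a c k = a * hyp1F1 a c k"
proof -
  let ?F = "hyp1F1_fps a c"
  have r: "fps_conv_radius ?F = \<infinity>" by (rule conv_radius_hyp1F1_fps[OF assms])
  have r1: "fps_conv_radius (fps_deriv ?F) = \<infinity>"
    using fps_conv_radius_deriv[of ?F] r by simp
  have r2: "fps_conv_radius (fps_deriv (fps_deriv ?F)) = \<infinity>"
    using fps_conv_radius_deriv[of "fps_deriv ?F"] r1 by simp
  show "(hyp1F1 a c has_field_derivative hyp1F1' a c k) (at k)"
    unfolding hyp1F1_eval_fps by (rule has_field_derivative_eval_fps) (simp add: r)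
  show "(hyp1F1' a c has_field_derivative eval_fps (fps_deriv (fps_deriv ?F)) k) (at k)"
    by (rule has_field_derivative_eval_fps) (simp add: r1)
  have rc: "fps_conv_radius (fps_const c - fps_X) = \<infinity>"
    using fps_conv_radius_diff[of "fps_const c" "fps_X"] by simp
  have rm1: "fps_conv_radius (fps_X * fps_deriv (fps_deriv ?F)) = \<infinity>"
    using fps_conv_radius_mult[of fps_X "fps_deriv (fps_deriv ?F)"] r2 by simp
  have rm2: "fps_conv_radius ((fps_const c - fps_X) * fps_deriv ?F) = \<infinity>"
    using fps_conv_radius_mult[of "fps_const c - fps_X" "fps_deriv ?F"] r1 rc by simp
  have "k * eval_fps (fps_deriv (fps_deriv ?F)) k + (c - k) * hyp1F1' a c k
     = eval_fps (fps_X * fps_deriv (fps_deriv ?F) + (fps_const c - fps_X) * fps_deriv ?F) k"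
    using rm1 rm2 r1 r2 rc
    by (subst eval_fps_add) (simp_all add: eval_fps_mult eval_fps_diff)
  also have "\<dots> = a * hyp1F1 a c k"
    unfolding hyp1F1_fps_ode[OF assms] hyp1F1_eval_fps by (subst eval_fps_mult) (simp_all add: r)
  finally show "k * eval_fps (fps_deriv (fps_deriv ?F)) k + (c - k) * hyp1F1' a c k = a * hyp1F1 a c k" .
qed

lemma hyp1F1_0: "hyp1F1 a c 0 = 1"
  by (simp add: hyp1F1_eval_fps eval_fps_at_0 hyp1F1_fps_def)

lemma kummer_sol_hyp1F1:
  assumes "c \<notin> \<int>\<^sub>\<le>\<^sub>0"
  shows "kummer_sol a c (hyp1F1 a c) (hyp1F1' a c)"
  unfolding kummer_sol_def
proof (intro allI impI conjI)
  fix k :: complex assume "Re k > 0"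
  then have "k \<noteq> 0" by auto
  then have "eval_fps (fps_deriv (fps_deriv (hyp1F1_fps a c))) k = (a * hyp1F1 a c k - (c - k) * hyp1F1' a c k) / k"
    using hyp1F1_derivs(3)[OF assms, of k a] by (simp add: field_simps)
  then show "(hyp1F1' a c has_field_derivative (a * hyp1F1 a c k - (c - k) * hyp1F1' a c k) / k) (at k)"
    using hyp1F1_derivs(2)[OF assms, of a k] by simp
qed (rule hyp1F1_derivs(1)[OF assms])

text \<open>The Frobenius solution at the origin with exponent 1 - c: the substitution y = k^(1-c) N
  turns the equation for (a, c) into the one for (1 + a - c, 2 - c).\<close>

lemma kummer_sol_second:
  fixes a c :: complex
  assumes "2 - c \<notin> \<int>\<^sub>\<le>\<^sub>0"
  defines "N \<equiv> hyp1F1 (1 + a - c) (2 - c)" and "N' \<equiv> hyp1F1' (1 + a - c) (2 - c)"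
  shows "kummer_sol a c (\<lambda>k. k powr (1 - c) * N k) (\<lambda>k. k powr (- c) * ((1 - c) * N k + k * N' k))"
  unfolding kummer_sol_def
proof (intro allI impI conjI)
  fix k :: complex assume "Re k > 0"
  then have k: "k \<noteq> 0" "k \<notin> \<real>\<^sub>\<le>\<^sub>0" by (auto simp: complex_nonpos_Reals_iff)
  let ?N'' = "eval_fps (fps_deriv (fps_deriv (hyp1F1_fps (1 + a - c) (2 - c)))) k"
  have d: "(N has_field_derivative N' k) (at k)" "(N' has_field_derivative ?N'') (at k)"
    "k * ?N'' + (2 - c - k) * N' k = (1 + a - c) * N k"
    unfolding N_def N'_def by (rule hyp1F1_derivs[OF assms(1)])+
  have p1: "k powr (1 - c) = k powr (- c) * k" using powr_add[of k "- c" 1] k by simp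
  have "((\<lambda>k. k powr (1 - c) * N k) has_field_derivative
       (1 - c) * k powr ((1 - c) - 1) * N k + k powr (1 - c) * N' k) (at k)"
    using k by (auto intro!: derivative_eq_intros d)
  also have "(1 - c) * k powr ((1 - c) - 1) * N k + k powr (1 - c) * N' k = k powr (- c) * ((1 - c) * N k + k * N' k)"
    by (simp add: p1 algebra_simps)
  finally show "((\<lambda>k. k powr (1 - c) * N k) has_field_derivative k powr (- c) * ((1 - c) * N k + k * N' k)) (at k)" .
  have p2: "k powr (- c - 1) = k powr (- c) / k" using powr_diff[of k "- c" 1] k by simp
  have "((\<lambda>k. k powr (- c) * ((1 - c) * N k + k * N' k)) has_field_derivative
       (- c) * k powr (- c - 1) * ((1 - c) * N k + k * N' k) + k powr (- c) * ((1 - c) * N' k + (N' k + k * ?N''))) (at k)"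
    using k by (auto intro!: derivative_eq_intros d simp: algebra_simps)
  also have "(- c) * k powr (- c - 1) * ((1 - c) * N k + k * N' k) + k powr (- c) * ((1 - c) * N' k + (N' k + k * ?N''))
     = k powr (- c) / k * ((- c) * ((1 - c) * N k + k * N' k) + (2 - c) * k * N' k + k * (k * ?N''))"
    unfolding p2 using k by (simp add: field_simps)
  also have "k * ?N'' = (1 + a - c) * N k - (2 - c - k) * N' k" using d(3) by (simp add: algebra_simps)
  also have "k powr (- c) / k * ((- c) * ((1 - c) * N k + k * N' k) + (2 - c) * k * N' k + k * ((1 + a - c) * N k - (2 - c - k) * N' k))
     = (a * (k powr (1 - c) * N k) - (c - k) * (k powr (- c) * ((1 - c) * N k + k * N' k))) / k"
    unfolding p1 using k by (simp add: field_simps)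
  finally show "((\<lambda>k. k powr (- c) * ((1 - c) * N k + k * N' k)) has_field_derivative
     (a * (k powr (1 - c) * N k) - (c - k) * (k powr (- c) * ((1 - c) * N k + k * N' k))) / k) (at k)" .
qed

lemma kummer_sol_linear:
  assumes "kummer_sol a c y y'" "kummer_sol a c z z'"
  shows "kummer_sol a c (\<lambda>k. y k - \<alpha> * z k) (\<lambda>k. y' k - \<alpha> * z' k)"
  unfolding kummer_sol_def
proof (intro allI impI conjI)
  fix k :: complex assume k: "Re k > 0"
  note d = assms[unfolded kummer_sol_def, rule_format, OF k]
  show "((\<lambda>k. y k - \<alpha> * z k) has_field_derivative y' k - \<alpha> * z' k) (at k)"
    using d by (auto intro!: derivative_eq_intros)
  have "((\<lambda>k. y' k - \<alpha> * z' k) has_field_derivative (a * y k - (c - k) * y' k) / k - \<alpha> * ((a * z k - (c - k) * z' k) / k)) (at k)"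
    using d by (auto intro!: derivative_eq_intros)
  moreover have "(a * y k - (c - k) * y' k) / k - \<alpha> * ((a * z k - (c - k) * z' k) / k)
     = (a * (y k - \<alpha> * z k) - (c - k) * (y' k - \<alpha> * z' k)) / k"
    using k by (cases "k = 0") (auto simp: field_simps)
  ultimately show "((\<lambda>k. y' k - \<alpha> * z' k) has_field_derivative (a * (y k - \<alpha> * z k) - (c - k) * (y' k - \<alpha> * z' k)) / k) (at k)"
    by simp
qed

text \<open>The Wronskian of \<open>y\<close> and \<open>hyp1F1 a c\<close>, multiplied by \<open>k powr c * exp (- k)\<close>, is constant and
  tends to zero at the origin.\<close>

lemma kummer_sol_unique:
  assumes sol: "kummer_sol a (of_real c) y y'" and c: "0 < c" "c < 1"
    and lim: "((\<lambda>x. y (of_real x)) \<longlongrightarrow> 0) (at_right 0)"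
    and lim': "((\<lambda>x. of_real (x powr c) * y' (of_real x)) \<longlongrightarrow> 0) (at_right 0)"
    and k: "Re k > 0"
  shows "y k = 0"
proof -
  let ?S = "{k::complex. Re k > 0}"
  have cn: "complex_of_real c \<notin> \<int>\<^sub>\<le>\<^sub>0" using c by (auto elim!: nonpos_Ints_cases simp: complex_eq_iff)
  note M = hyp1F1_derivs(1,2)[OF cn, of a]
  define M where "M = hyp1F1 a (of_real c)"
  define M' where "M' = hyp1F1' a (of_real c)"
  have solM: "kummer_sol a (of_real c) M M'" unfolding M_def M'_def by (rule kummer_sol_hyp1F1[OF cn])
  note dy = sol[unfolded kummer_sol_def, rule_format]
  note dM = solM[unfolded kummer_sol_def, rule_format]
  define V where "V = (\<lambda>k. k powr of_real c * exp (- k) * (M k * y' k - M' k * y k))"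
  have "(V has_field_derivative 0) (at k within ?S)" if k: "k \<in> ?S" for k
  proof -
    have k': "k \<noteq> 0" "k \<notin> \<real>\<^sub>\<le>\<^sub>0" "Re k > 0" using k by (auto simp: complex_nonpos_Reals_iff)
    let ?c = "complex_of_real c"
    have p: "k powr (?c - 1) = k powr ?c / k" using powr_diff[of k ?c 1] k' by simp
    have "(V has_field_derivative (?c * k powr (?c - 1) * exp (- k) - k powr ?c * exp (- k)) * (M k * y' k - M' k * y k)
        + k powr ?c * exp (- k) * (M' k * y' k + M k * ((a * y k - (?c - k) * y' k) / k) - ((a * M k - (?c - k) * M' k) / k * y k + M' k * y' k))) (at k)"
      unfolding V_def using k' dy[OF k'(3)] dM[OF k'(3)]
      by (auto intro!: derivative_eq_intros simp: algebra_simps)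
    also have "(?c * k powr (?c - 1) * exp (- k) - k powr ?c * exp (- k)) * (M k * y' k - M' k * y k)
        + k powr ?c * exp (- k) * (M' k * y' k + M k * ((a * y k - (?c - k) * y' k) / k) - ((a * M k - (?c - k) * M' k) / k * y k + M' k * y' k)) = 0"
      unfolding p using k' by (simp add: field_simps)
    finally show ?thesis by (rule has_field_derivative_at_within)
  qed
  then obtain C where C: "\<And>k. k \<in> ?S \<Longrightarrow> V k = C"
    using has_field_derivative_zero_constant[OF convex_halfspace, of V] by blast
  have contM: "isCont M 0" unfolding M_def using M(1)[of 0] by (rule DERIV_isCont)
  have contM': "isCont M' 0" unfolding M'_def using M(2)[of 0] by (rule DERIV_isCont)
  have M0: "M 0 = 1" by (simp add: M_def hyp1F1_0)
  have l0: "((\<lambda>x::real. complex_of_real x) \<longlongrightarrow> 0) (at_right 0)"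
    using tendsto_of_real[OF tendsto_ident_at[of "0::real" "{0<..}"], where 'a = complex] by simp
  have limM: "((\<lambda>x. M (of_real x)) \<longlongrightarrow> 1) (at_right 0)"
    using isCont_tendsto_compose[OF contM l0] M0 by simp
  have limM': "((\<lambda>x. M' (of_real x)) \<longlongrightarrow> M' 0) (at_right 0)"
    by (rule isCont_tendsto_compose[OF contM' l0])
  have "((\<lambda>x. x powr c) \<longlongrightarrow> 0) (at_right 0)" using c(1) by real_asymp
  then have lc: "((\<lambda>x. complex_of_real (x powr c)) \<longlongrightarrow> of_real 0) (at_right 0)" by (rule tendsto_of_real)
  have le: "((\<lambda>x::real. exp (- complex_of_real x)) \<longlongrightarrow> exp (- of_real 0)) (at_right 0)"
    by (intro tendsto_intros)
  have limV: "((\<lambda>x. exp (- complex_of_real x) * (M (of_real x) * (of_real (x powr c) * y' (of_real x)) - M' (of_real x) * (of_real (x powr c) * y (of_real x))))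
     \<longlongrightarrow> exp (- of_real 0) * (1 * 0 - M' 0 * (of_real 0 * 0))) (at_right 0)"
    by (rule tendsto_mult[OF le tendsto_diff[OF tendsto_mult[OF limM lim'] tendsto_mult[OF limM' tendsto_mult[OF lc lim]]]])
  have "((\<lambda>x. C) \<longlongrightarrow> exp (- of_real 0) * (1 * 0 - M' 0 * (of_real 0 * 0))) (at_right (0::real))"
  proof (rule Lim_transform_eventually[OF limV])
    show "\<forall>\<^sub>F x in at_right 0. exp (- complex_of_real x) * (M (of_real x) * (of_real (x powr c) * y' (of_real x)) - M' (of_real x) * (of_real (x powr c) * y (of_real x))) = C"
      using eventually_at_right_less[of 0]
    proof eventually_elim
      case (elim x)
      have p: "complex_of_real x powr of_real c = of_real (x powr c)"
        by (rule powr_of_real) (use elim in simp)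
      have "C = V (of_real x)" using elim by (intro C[symmetric]) simp
      then show ?case unfolding V_def p by (simp only: right_diff_distrib mult_ac)
    qed
  qed
  then have "((\<lambda>x. C) \<longlongrightarrow> 0) (at_right (0::real))" by (simp only: mult_zero_right mult_zero_left diff_self)
  then have C0: "C = 0" by (rule tendsto_unique[OF trivial_limit_at_right_real tendsto_const])
  \<comment> \<open>Since M(0) = 1, \<open>M\<close> has no zero near the origin. There the
    vanishing Wronskian makes y / M constant, and the limit of \<open>y\<close> makes the constant
    0; the identity theorem then reaches the whole half-plane.\<close>
  obtain e where e: "e > 0" "\<And>z. dist 0 z < e \<Longrightarrow> M z \<noteq> 0"
    using continuous_at_avoid[OF contM, of 0] M0 by auto
  define S where "S = ?S \<inter> ball 0 e"
  have oS: "open S" unfolding S_def by (intro open_Int open_halfspace open_ball)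
  have cS: "convex S" unfolding S_def by (intro convex_Int convex_halfspace convex_ball)
  have MS: "M k \<noteq> 0" if "k \<in> S" for k using that by (intro e(2)) (simp add: S_def)
  have "((\<lambda>k. y k / M k) has_field_derivative 0) (at k within S)" if kS: "k \<in> S" for k
  proof -
    have kk: "Re k > 0" using kS by (simp add: S_def)
    then have k0: "k \<noteq> 0" by auto
    have "V k = 0" using C[of k] kk C0 by auto
    then have "k powr of_real c * exp (- k) * (M k * y' k - M' k * y k) = 0" unfolding V_def .
    moreover have "k powr of_real c * exp (- k) \<noteq> 0" using k0 by (auto simp: powr_def)
    ultimately have "M k * y' k - M' k * y k = 0" by (metis mult_eq_0_iff)
    then have z: "y' k * M k - y k * M' k = 0" by (metis mult.commute)
    have "((\<lambda>k. y k / M k) has_field_derivative (y' k * M k - y k * M' k) / (M k * M k)) (at k)"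
      using dy[OF kk] dM[OF kk] MS[OF kS] by (intro DERIV_divide) auto
    then have "((\<lambda>k. y k / M k) has_field_derivative 0) (at k)" unfolding z by simp
    then show ?thesis by (rule has_field_derivative_at_within)
  qed
  then have "\<exists>D. \<forall>k\<in>S. y k / M k = D"
    by (rule has_field_derivative_zero_constant[OF cS])
  then obtain D where D: "\<And>k. k \<in> S \<Longrightarrow> y k / M k = D" by auto
  have limD: "((\<lambda>x. y (of_real x) / M (of_real x)) \<longlongrightarrow> 0 / 1) (at_right 0)"
    by (intro tendsto_divide lim limM) simp
  have "((\<lambda>x. D) \<longlongrightarrow> 0 / 1) (at_right (0::real))"
  proof (rule Lim_transform_eventually[OF limD])
    show "\<forall>\<^sub>F x in at_right 0. y (of_real x) / M (of_real x) = D"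
      using eventually_at_right_real[OF e(1)]
    proof eventually_elim
      case (elim x)
      then show ?case by (intro D) (auto simp: S_def)
    qed
  qed
  then have "D = 0" by (simp add: tendsto_const_iff)
  then have y0: "y k = 0" if "k \<in> S" for k using D[OF that] MS[OF that] by simp
  show ?thesis
  proof (rule analytic_continuation_open[of S ?S y "\<lambda>_. 0"])
    show "open S" "open ?S" by (rule oS open_halfspace)+
    have "of_real (e / 2) \<in> S" using e by (simp add: S_def del: of_real_divide)
    then show "S \<noteq> {}" by auto
    show "y holomorphic_on ?S" unfolding holomorphic_on_open[OF open_halfspace] using dy by blast
  qed (use y0 k convex_halfspace in \<open>auto simp: S_def convex_connected\<close>)
qed

section \<open>The Laplace integral as a solution of Kummer's equation, and its behaviour at
  0\<close>

lemma integral_swap: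
  fixes f :: "'a \<Rightarrow> 'b \<Rightarrow> complex"
  assumes "sigma_finite_measure M" "sigma_finite_measure N"
    and m: "(\<lambda>z. f (fst z) (snd z)) \<in> borel_measurable (M \<Otimes>\<^sub>M N)"
    and i: "\<And>x. x \<in> space M \<Longrightarrow> integrable N (f x)"
    and ii: "integrable M (\<lambda>x. LINT y|N. norm (f x y))"
  shows "(LINT x|M. LINT y|N. f x y) = (LINT y|N. LINT x|M. f x y)"
proof -
  interpret pair_sigma_finite M N using assms(1,2) by (rule pair_sigma_finite.intro)
  have "integrable (M \<Otimes>\<^sub>M N) (\<lambda>z. f (fst z) (snd z))"
    by (rule Fubini_integrable) (use m i ii in auto)
  then have "integrable (M \<Otimes>\<^sub>M N) (\<lambda>(x, y). f x y)" by (simp add: case_prod_beta')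
  from Fubini_integral[OF this] show ?thesis by simp
qed

lemma sigma_finite_pos_lborel: "sigma_finite_measure pos_lborel"
  by (rule sigma_finite_measure_restrict_space) (auto intro: sigma_finite_lborel)

lemma measurable_pos_lborel_ident: "(\<lambda>x. x) \<in> measurable pos_lborel borel"
  by (intro borel_measurable_pos_lborel_continuous continuous_intros)

lemma measurable_fst_pos_lborel [measurable]: "fst \<in> measurable (pos_lborel \<Otimes>\<^sub>M N) borel"
  using measurable_compose[OF measurable_fst measurable_pos_lborel_ident] .

lemma measurable_snd_pos_lborel [measurable]: "snd \<in> measurable (N \<Otimes>\<^sub>M pos_lborel) borel"
  using measurable_compose[OF measurable_snd measurable_pos_lborel_ident] .

text \<open>The function exp(-kt) t^a (1+t)^(1-b) vanishes at both ends of the half-line, so its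
  derivative integrates to 0. That derivative is the kernel times a + (1 + a - b - k) t - k
  t^2.\<close>

lemma tricomi_kernel_ibp:
  assumes a: "a > 0" and k: "Re k > 0"
  shows "k * tricomi_integral (a + 2) b k - (1 + of_real a - b - k) * tricomi_integral (a + 1) b k
     = of_real a * tricomi_integral a b k"
proof -
  define g where "g = (\<lambda>t::real. exp (- (k * of_real t)) * of_real (t powr a) * of_real (1 + t) powr (1 - b))"
  define f where "f = (\<lambda>t. - k * tricomi_kernel (a + 2) b k t + (1 + of_real a - b - k) * tricomi_kernel (a + 1) b k t + of_real a * tricomi_kernel a b k t)"
  have int: "integrable pos_lborel f"
    unfolding f_def using integrable_tricomi_integral[of a k b] integrable_tricomi_integral[of "a+1" k b] integrable_tricomi_integral[of "a+2" k b] a k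
    by (intro Bochner_Integration.integrable_add integrable_mult_right) auto
  have norm_g: "norm (g t) = exp (- (Re k * t)) * t powr a * (1 + t) powr (1 - Re b)" if "t > 0" for t
    using that by (simp add: g_def norm_mult norm_powr_real_powr)
  have D: "(g has_vector_derivative f t) (at t)" if t: "t > 0" for t
  proof -
    have n: "1 + complex_of_real t \<notin> \<real>\<^sub>\<le>\<^sub>0" "1 + complex_of_real t \<noteq> 0" using t by (auto simp: complex_nonpos_Reals_iff complex_eq_iff)
    have d1: "((\<lambda>t. exp (- (k * of_real t))) has_vector_derivative (- k * exp (- (k * of_real t)))) (at t)"
      by (rule has_vector_derivative_real_field) (auto intro!: derivative_eq_intros)
    have "((\<lambda>t. t powr a) has_real_derivative (a * t powr (a - 1))) (at t)"
      using t by (auto intro!: derivative_eq_intros simp: powr_diff)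
    then have d2: "((\<lambda>t. complex_of_real (t powr a)) has_vector_derivative of_real (a * t powr (a - 1))) (at t)"
      by (intro has_vector_derivative_of_real) (simp add: has_real_derivative_iff_has_vector_derivative)
    have "((\<lambda>z. (1 + z) powr (1 - b)) has_field_derivative (1 - b) * (1 + of_real t) powr (1 - b - 1)) (at (of_real t))"
      using n by (auto intro!: derivative_eq_intros)
    then have d3: "((\<lambda>t. (1 + of_real t) powr (1 - b)) has_vector_derivative (1 - b) * (1 + of_real t) powr (- b)) (at t)"
      using has_vector_derivative_real_field[of "\<lambda>z. (1 + z) powr (1 - b)"] by simp
    have "(g has_vector_derivative
        (exp (- (k * of_real t)) * of_real (t powr a)) * ((1 - b) * (1 + of_real t) powr (- b))
        + (exp (- (k * of_real t)) * of_real (a * t powr (a - 1)) + (- k * exp (- (k * of_real t))) * of_real (t powr a)) * (1 + of_real t) powr (1 - b)) (at t)"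
      unfolding g_def of_real_add of_real_1 by (intro has_vector_derivative_mult d1 d2 d3)
    also have "(exp (- (k * of_real t)) * of_real (t powr a)) * ((1 - b) * (1 + of_real t) powr (- b))
        + (exp (- (k * of_real t)) * of_real (a * t powr (a - 1)) + (- k * exp (- (k * of_real t))) * of_real (t powr a)) * (1 + of_real t) powr (1 - b) = f t"
    proof -
      have p: "t powr a = t powr (a - 1) * t" "t powr (a + 1) = t powr (a - 1) * t * t" "t powr (1 + a) = t powr (a - 1) * t * t"
        using t by (simp_all add: powr_diff powr_add)
      have q: "(1 + complex_of_real t) powr (1 - b) = (1 + of_real t) powr (- b) * (1 + of_real t)"
        using powr_add[of "1 + complex_of_real t" "- b" 1] n by simp
      show ?thesis
        unfolding f_def tricomi_kernel_def q
        by (simp add: p algebra_simps)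
    qed
    finally show ?thesis .
  qed
  have "(LBINT t=0..\<infinity>. f t) = 0 - 0"
  proof (rule interval_integral_FTC_integrable[where F = g])
    show "(g has_vector_derivative f x) (at x)" if "0 < ereal x" "ereal x < \<infinity>" for x using D that by simp
    show "isCont f x" if "0 < ereal x" "ereal x < \<infinity>" for x
    proof -
      have x: "x > 0" using that by simp
      have "1 + complex_of_real x \<notin> \<real>\<^sub>\<le>\<^sub>0" using x by (auto simp: complex_nonpos_Reals_iff)
      then show ?thesis unfolding f_def tricomi_kernel_def using x
        by (intro continuous_intros) (auto simp: complex_eq_iff)
    qed
    show "set_integrable lborel (einterval 0 \<infinity>) f"
      using int by (simp add: einterval_eq integrable_pos_lborel zero_ereal_def)
    have "(g \<longlongrightarrow> 0) (at_right 0)"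
    proof (rule tendsto_norm_zero_cancel, rule Lim_transform_eventually)
      show "((\<lambda>t. exp (- (Re k * t)) * t powr a * (1 + t) powr (1 - Re b)) \<longlongrightarrow> 0) (at_right 0)"
        using k a by real_asymp
      show "\<forall>\<^sub>F t in at_right 0. exp (- (Re k * t)) * t powr a * (1 + t) powr (1 - Re b) = norm (g t)"
        using eventually_at_right_less[of 0] by eventually_elim (simp add: norm_g)
    qed
    then show "((g \<circ> real_of_ereal) \<longlongrightarrow> 0) (at_right 0)"
      by (simp add: zero_ereal_def ereal_tendsto_simps1)
    have "(g \<longlongrightarrow> 0) at_top"
    proof (rule tendsto_norm_zero_cancel, rule Lim_transform_eventually)
      show "((\<lambda>t. exp (- (Re k * t)) * t powr a * (1 + t) powr (1 - Re b)) \<longlongrightarrow> 0) at_top"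
        using k a by real_asymp
      show "\<forall>\<^sub>F t in at_top. exp (- (Re k * t)) * t powr a * (1 + t) powr (1 - Re b) = norm (g t)"
        using eventually_gt_at_top[of 0] by eventually_elim (simp add: norm_g)
    qed
    then show "((g \<circ> real_of_ereal) \<longlongrightarrow> 0) (at_left \<infinity>)"
      by (simp add: ereal_tendsto_simps1)
  qed simp
  then have "(LINT t|pos_lborel. f t) = 0"
    by (simp add: interval_lebesgue_integral_def einterval_eq zero_ereal_def integral_pos_lborel)
  also have "(LINT t|pos_lborel. f t) = - k * tricomi_integral (a + 2) b k + (1 + of_real a - b - k) * tricomi_integral (a + 1) b k + of_real a * tricomi_integral a b k"
    unfolding f_def tricomi_integral_def
    using integrable_tricomi_integral[of a k b] integrable_tricomi_integral[of "a+1" k b] integrable_tricomi_integral[of "a+2" k b] a k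
    by (subst Bochner_Integration.integral_add Bochner_Integration.integral_mult_right_zero | simp)+
  finally show ?thesis by (simp add: algebra_simps)
qed

lemma kummer_sol_tricomi_integral:
  assumes a: "a > 0"
  shows "kummer_sol (of_real a) c (tricomi_integral a (1 + of_real a - c)) (\<lambda>k. - tricomi_integral (a + 1) (1 + of_real a - c) k)"
  unfolding kummer_sol_def
proof (intro allI impI conjI)
  fix k :: complex assume k: "Re k > 0"
  then have k0: "k \<noteq> 0" by auto
  let ?b = "1 + of_real a - c"
  show "(tricomi_integral a ?b has_field_derivative - tricomi_integral (a + 1) ?b k) (at k)"
    by (rule tricomi_integral_has_derivative[OF a k])
  have "((\<lambda>k. - tricomi_integral (a + 1) ?b k) has_field_derivative - (- tricomi_integral (a + 1 + 1) ?b k)) (at k)"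
    by (intro DERIV_minus tricomi_integral_has_derivative) (use a k in auto)
  moreover have "- (- tricomi_integral (a + 1 + 1) ?b k) = (of_real a * tricomi_integral a ?b k - (c - k) * - tricomi_integral (a + 1) ?b k) / k"
    using tricomi_kernel_ibp[OF a k, of ?b] k0 by (simp add: field_simps)
  ultimately show "((\<lambda>k. - tricomi_integral (a + 1) ?b k) has_field_derivative
     (of_real a * tricomi_integral a ?b k - (c - k) * - tricomi_integral (a + 1) ?b k) / k) (at k)" by simp
qed

text \<open>Writing \<Gamma>(b) (1+t)^(-b) as a gamma integral in a new variable u and integrating
  over t instead moves the parameter \<open>x\<close> into the factor (x+u)^(-a), where the limit x
  \<rightarrow> 0 is visible.\<close>

lemma tricomi_integral_swap:
  assumes a: "a > 0" and b: "b > 0" and x: "x > 0"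
  shows "of_real (Gamma b) * tricomi_integral a (of_real b) (of_real x) =
     of_real (Gamma a) * (LINT u|pos_lborel. of_real (u powr (b - 1) * exp (- u) * (x + u) powr (- a)))"
proof -
  let ?f = "\<lambda>t u. complex_of_real (exp (- (x * t)) * t powr (a - 1) * (u powr (b - 1) * exp (- ((1 + t) * u))))"
  have inner: "(LINT u|pos_lborel. u powr (b - 1) * exp (- (k * u))) = Gamma b * k powr (- b)" if "k > 0" "b > 0" for k b
  proof -
    have "complex_of_real (LINT u|pos_lborel. u powr (b - 1) * exp (- (k * u))) = tricomi_integral b 0 (of_real k)"
      unfolding tricomi_integral_def integral_complex_of_real[symmetric]
    proof (rule Bochner_Integration.integral_cong)
      fix t assume "t \<in> space pos_lborel"
      then have "1 + complex_of_real t \<noteq> 0" by (auto simp: complex_eq_iff)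
      then show "complex_of_real (t powr (b - 1) * exp (- (k * t))) = tricomi_kernel b 0 (complex_of_real k) t"
        by (simp add: tricomi_kernel_def exp_of_real[symmetric] mult.commute)
    qed simp
    also have "\<dots> = of_real (Gamma b * k powr (- b))"
      using tricomi_integral_b0_real[of b k] that by (simp add: powr_of_real flip: of_real_minus)
    finally show ?thesis by (simp only: of_real_eq_iff)
  qed
  have i: "integrable pos_lborel (\<lambda>u. u powr (b - 1) * exp (- (k * u)))" if "k > 0" "b > 0" for k b
    using integrable_Gamma_kernel[OF that(2,1)] .
  have "of_real (Gamma b) * tricomi_integral a (of_real b) (of_real x) = (LINT t|pos_lborel. LINT u|pos_lborel. ?f t u)"
    unfolding tricomi_integral_def integral_mult_right_zero[symmetric]
  proof (rule Bochner_Integration.integral_cong)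
    fix t assume "t \<in> space pos_lborel"
    then have t: "t > 0" by simp
    have "(LINT u|pos_lborel. ?f t u) = of_real (exp (- (x * t)) * t powr (a - 1) * (Gamma b * (1 + t) powr (- b)))"
      using inner[of "1 + t" b] t b by (simp only: integral_complex_of_real integral_mult_right_zero)
    then show "of_real (Gamma b) * tricomi_kernel a (of_real b) (of_real x) t = (LINT u|pos_lborel. ?f t u)"
      using t powr_of_real[of "1 + t" "- b"] by (simp add: tricomi_kernel_def mult_ac exp_of_real[symmetric])
  qed simp
  also have "\<dots> = (LINT u|pos_lborel. LINT t|pos_lborel. ?f t u)"
  proof (rule integral_swap[OF sigma_finite_pos_lborel sigma_finite_pos_lborel])
    show "(\<lambda>z. ?f (fst z) (snd z)) \<in> borel_measurable (pos_lborel \<Otimes>\<^sub>M pos_lborel)" by measurable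
    show "integrable pos_lborel (?f t)" if "t \<in> space pos_lborel" for t
      using that b by (intro integrable_of_real integrable_mult_right i) auto
    have "integrable pos_lborel (\<lambda>t. Gamma b * (exp (- (x * t)) * t powr (a - 1) * (1 + t) powr (- b)))"
      using integrable_tricomi_kernel[OF a x, of "- b"] by simp
    also have "?this \<longleftrightarrow> integrable pos_lborel (\<lambda>t. LINT u|pos_lborel. cmod (?f t u))"
    proof (rule Bochner_Integration.integrable_cong)
      fix t assume "t \<in> space pos_lborel"
      then have t: "t > 0" by simp
      have "(LINT u|pos_lborel. cmod (?f t u)) = (LINT u|pos_lborel. exp (- (x * t)) * t powr (a - 1) * (u powr (b - 1) * exp (- ((1 + t) * u))))"
        by (intro Bochner_Integration.integral_cong) (simp_all only: norm_of_real abs_mult, simp)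
      also have "\<dots> = exp (- (x * t)) * t powr (a - 1) * (Gamma b * (1 + t) powr (- b))"
        using inner[of "1 + t" b] t b by (simp only: integral_mult_right_zero)
      finally show "Gamma b * (exp (- (x * t)) * t powr (a - 1) * (1 + t) powr (- b)) = (LINT u|pos_lborel. cmod (?f t u))" by simp
    qed simp
    finally show "integrable pos_lborel (\<lambda>t. LINT u|pos_lborel. cmod (?f t u))" .
  qed
  also have "\<dots> = (LINT u|pos_lborel. of_real (Gamma a) * of_real (u powr (b - 1) * exp (- u) * (x + u) powr (- a)))"
  proof (rule Bochner_Integration.integral_cong)
    fix u assume "u \<in> space pos_lborel"
    then have u: "u > 0" by simp
    have e: "?f t u = of_real (u powr (b - 1) * exp (- u) * (t powr (a - 1) * exp (- ((x + u) * t))))" for t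
      by (simp add: exp_add[symmetric] algebra_simps exp_diff exp_minus field_simps)
    have "(LINT t|pos_lborel. ?f t u) = of_real (u powr (b - 1) * exp (- u) * (Gamma a * (x + u) powr (- a)))"
      unfolding e using inner[of "x + u" a] u x a by (simp only: integral_complex_of_real integral_mult_right_zero)
    then show "(LINT t|pos_lborel. ?f t u) = of_real (Gamma a) * of_real (u powr (b - 1) * exp (- u) * (x + u) powr (- a))"
      by (simp add: mult_ac)
  qed simp
  finally show ?thesis by (simp only: integral_mult_right_zero)
qed

text \<open>Monotone in \<open>x\<close>, the factor (x+u)^(-r) is dominated by its limit u^(-r);
  the exponent s + r - 1 is chosen so that u^(s-1) remains. This covers both boundary values needed:
  r = a for the integral itself, r = 1 + a - c for its derivative.\<close>

lemma tendsto_Gamma_kernel: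
  fixes s r :: real
  assumes s: "s > 0" and r: "r \<ge> 0"
  shows "((\<lambda>x. LINT u|pos_lborel. complex_of_real (u powr (s + r - 1) * exp (- u) * (x + u) powr (- r))) \<longlongrightarrow> of_real (Gamma s)) (at_right 0)"
  unfolding tendsto_at_iff_sequentially
proof (intro allI impI)
  fix X :: "nat \<Rightarrow> real" assume X: "\<forall>i. X i \<in> {0<..} - {0}" "X \<longlonglongrightarrow> 0"
  note [measurable] = measurable_pos_lborel_ident
  have "(\<lambda>n. LINT u|pos_lborel. complex_of_real (u powr (s + r - 1) * exp (- u) * (X n + u) powr (- r))) \<longlonglongrightarrow>
      (LINT u|pos_lborel. complex_of_real (u powr (s - 1) * exp (- u)))"
  proof (rule integral_dominated_convergence[where w = "\<lambda>u. u powr (s - 1) * exp (- u)"])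
    show "integrable pos_lborel (\<lambda>u. u powr (s - 1) * exp (- u))"
      using integrable_Gamma_kernel[OF s, of 1] by simp
    show "AE u in pos_lborel. (\<lambda>n. complex_of_real (u powr (s + r - 1) * exp (- u) * (X n + u) powr (- r))) \<longlonglongrightarrow> complex_of_real (u powr (s - 1) * exp (- u))"
    proof (intro AE_I2 tendsto_of_real)
      fix u assume "u \<in> space pos_lborel"
      then have u: "u > 0" by simp
      have "(\<lambda>n. u powr (s + r - 1) * exp (- u) * (X n + u) powr (- r)) \<longlonglongrightarrow> u powr (s + r - 1) * exp (- u) * (0 + u) powr (- r)"
        using u by (intro tendsto_intros X(2)) auto
      moreover have "u powr (s + r - 1) * exp (- u) * (0 + u) powr (- r) = u powr (s - 1) * exp (- u)"
        using u powr_add[of u "s + r - 1" "- r"] by simp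
      ultimately have "(\<lambda>n. u powr (s + r - 1) * exp (- u) * (X n + u) powr (- r)) \<longlonglongrightarrow> u powr (s - 1) * exp (- u)"
        by (simp only:)
      then show "(\<lambda>n. u powr (s + r - 1) * exp (- u) * (X n + u) powr (- r)) \<longlonglongrightarrow> u powr (s - 1) * exp (- u)" by simp
    qed
    show "AE u in pos_lborel. cmod (complex_of_real (u powr (s + r - 1) * exp (- u) * (X n + u) powr (- r))) \<le> u powr (s - 1) * exp (- u)" for n
    proof (intro AE_I2)
      fix u assume "u \<in> space pos_lborel"
      then have u: "u > 0" by simp
      have "X n > 0" using X(1) by auto
      then have "(X n + u) powr (- r) \<le> u powr (- r)" using r u by (intro powr_mono2') auto
      then have "u powr (s + r - 1) * exp (- u) * (X n + u) powr (- r) \<le> u powr (s + r - 1) * exp (- u) * u powr (- r)"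
        by (intro mult_left_mono) auto
      also have "\<dots> = u powr (s - 1) * exp (- u)"
        using u powr_add[of u "s + r - 1" "- r"] by simp
      finally show "cmod (complex_of_real (u powr (s + r - 1) * exp (- u) * (X n + u) powr (- r))) \<le> u powr (s - 1) * exp (- u)"
        by (simp only: norm_of_real abs_mult, simp)
    qed
  qed measurable
  also have "(LINT u|pos_lborel. complex_of_real (u powr (s - 1) * exp (- u))) = of_real (Gamma s)"
    using integral_Gamma_kernel_real[OF s] by (simp only: integral_complex_of_real)
  finally show "((\<lambda>x. LINT u|pos_lborel. complex_of_real (u powr (s + r - 1) * exp (- u) * (x + u) powr (- r))) \<circ> X) \<longlonglongrightarrow> of_real (Gamma s)"
    by (simp add: o_def)
qed

lemma tendsto_tricomi_integral_0:
  assumes a: "a > 0" and b: "b > a"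
  shows "((\<lambda>x. tricomi_integral a (of_real b) (of_real x)) \<longlongrightarrow> of_real (Gamma a * Gamma (b - a) / Gamma b)) (at_right 0)"
proof (rule Lim_transform_eventually)
  show "((\<lambda>x. of_real (Gamma a / Gamma b) * (LINT u|pos_lborel. complex_of_real (u powr (b - a + a - 1) * exp (- u) * (x + u) powr (- a)))) \<longlongrightarrow> of_real (Gamma a * Gamma (b - a) / Gamma b)) (at_right 0)"
    using tendsto_mult[OF tendsto_const tendsto_Gamma_kernel[of "b - a" a], of "of_real (Gamma a / Gamma b)"] a b by simp
  show "\<forall>\<^sub>F x in at_right 0. of_real (Gamma a / Gamma b) * (LINT u|pos_lborel. complex_of_real (u powr (b - a + a - 1) * exp (- u) * (x + u) powr (- a))) = tricomi_integral a (of_real b) (of_real x)"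
    using eventually_at_right_less[of 0]
  proof eventually_elim
    case (elim x)
    have "Gamma b > 0" using a b by (intro Gamma_real_pos) auto
    then have gb: "complex_of_real (Gamma b) \<noteq> 0" by simp
    let ?I = "LINT u|pos_lborel. complex_of_real (u powr (b - 1) * exp (- u) * (x + u) powr (- a))"
    have "tricomi_integral a (of_real b) (of_real x) = of_real (Gamma b) * tricomi_integral a (of_real b) (of_real x) / of_real (Gamma b)"
      using gb by simp
    also have "\<dots> = of_real (Gamma a) * ?I / of_real (Gamma b)"
      using tricomi_integral_swap[of a b x] a b elim by simp
    finally show ?case by simp
  qed
qed

text \<open>The derivative blows up like x^(-c); the substitution t = u / x absorbs exactly this
  power and leaves the integral of \<open>tendsto_Gamma_kernel\<close>.\<close>

lemma tendsto_tricomi_integral_deriv_0: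
  assumes a: "a > 0" and c: "0 < c" "c < 1"
  shows "((\<lambda>x. of_real (x powr c) * tricomi_integral (a + 1) (of_real (1 + a - c)) (of_real x)) \<longlongrightarrow> of_real (Gamma c)) (at_right 0)"
proof (rule Lim_transform_eventually)
  show "((\<lambda>x. LINT u|pos_lborel. complex_of_real (u powr (c + (1 + a - c) - 1) * exp (- u) * (x + u) powr (- (1 + a - c)))) \<longlongrightarrow> of_real (Gamma c)) (at_right 0)"
    using a c by (intro tendsto_Gamma_kernel) auto
  show "\<forall>\<^sub>F x in at_right 0. (LINT u|pos_lborel. complex_of_real (u powr (c + (1 + a - c) - 1) * exp (- u) * (x + u) powr (- (1 + a - c))))
     = of_real (x powr c) * tricomi_integral (a + 1) (of_real (1 + a - c)) (of_real x)"
    using eventually_at_right_less[of 0]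
  proof eventually_elim
    case (elim x)
    have "of_real (x powr c) * tricomi_integral (a + 1) (of_real (1 + a - c)) (of_real x) =
       of_real (x powr c) * (of_real (1 / x) * (LINT u|pos_lborel. tricomi_kernel (a + 1) (of_real (1 + a - c)) (of_real x) ((1 / x) * u)))"
      unfolding tricomi_integral_def using elim by (subst integral_pos_lborel_scale[of "1 / x"]) auto
    also have "\<dots> = (LINT u|pos_lborel. complex_of_real (u powr (c + (1 + a - c) - 1) * exp (- u) * (x + u) powr (- (1 + a - c))))"
      unfolding integral_mult_right_zero[symmetric]
    proof (rule Bochner_Integration.integral_cong)
      fix u assume "u \<in> space pos_lborel"
      then have u: "u > 0" by simp
      have p: "1 + 1 / x * u = (x + u) / x" using elim by (simp add: field_simps)
      have k: "tricomi_kernel (a + 1) (of_real (1 + a - c)) (of_real x) ((1 / x) * u) =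
         of_real (exp (- u) * (u / x) powr a * ((x + u) / x) powr (- (1 + a - c)))"
        unfolding tricomi_kernel_def p using elim u powr_of_real[of "(x + u) / x" "- (1 + a - c)"]
        by (simp add: exp_of_real[symmetric] del: of_real_add of_real_diff of_real_divide) simp
      have x1: "x powr c * (1 / x) * x powr (- a) * x powr (1 + a - c) = 1"
      proof -
        have "x powr c * (1 / x) * x powr (- a) * x powr (1 + a - c) = x powr c * x powr (-1) * x powr (- a) * x powr (1 + a - c)"
          using elim by (simp add: powr_minus_divide)
        also have "\<dots> = x powr (c + (-1) + (- a) + (1 + a - c))" by (simp only: powr_add)
        also have "c + (-1) + (- a) + (1 + a - c) = 0" by simp
        also have "x powr 0 = 1" using elim by simp
        finally show ?thesis .
      qed
      have d1: "(u / x) powr a = u powr a * x powr (- a)"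
        using elim u by (simp add: powr_divide powr_minus_divide)
      have d2: "((x + u) / x) powr (- (1 + a - c)) = (x + u) powr (- (1 + a - c)) * x powr (1 + a - c)"
        using elim u by (simp only: powr_divide powr_minus) (simp add: field_simps)
      have "x powr c * (1 / x * (exp (- u) * (u / x) powr a * ((x + u) / x) powr (- (1 + a - c))))
         = (x powr c * (1 / x) * x powr (- a) * x powr (1 + a - c)) * (u powr a * exp (- u) * (x + u) powr (- (1 + a - c)))"
        unfolding d1 d2 by (simp only: mult_ac)
      also have "\<dots> = u powr (c + (1 + a - c) - 1) * exp (- u) * (x + u) powr (- (1 + a - c))"
        unfolding x1 by simp
      finally show "of_real (x powr c) * (of_real (1 / x) * tricomi_kernel (a + 1) (of_real (1 + a - c)) (of_real x) ((1 / x) * u))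
         = complex_of_real (u powr (c + (1 + a - c) - 1) * exp (- u) * (x + u) powr (- (1 + a - c)))"
        unfolding k by (metis of_real_mult)
    qed simp
    finally show ?case by simp
  qed
qed

text \<open>The difference \<open>y\<close> of the two sides solves Kummer's equation, so by
  \<open>kummer_sol_unique\<close> it suffices that \<open>y\<close> and x^c y' tend to 0 at the
  origin. The range 0 < c < 1 is where both limits exist.\<close>

lemma tricomi_nonint_eq_integral_real:
  assumes a: "a > 0" and c: "0 < c" "c < 1" and k: "Re k > 0"
  shows "tricomi_integral a (1 + of_real a - of_real c) k = of_real (Gamma a) * tricomi_nonint (of_real a) (of_real c) k"
proof -
  \<comment> \<open>\<alpha> and \<beta> are \<Gamma>(a) times the two coefficients in the
    definition of \<Psi>. They match the limit of the integral at 0 and that of x^c times its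
    derivative.\<close>
  define \<alpha> where "\<alpha> = complex_of_real (Gamma a * Gamma (1 - c) / Gamma (1 + a - c))"
  define \<beta> where "\<beta> = complex_of_real (Gamma (c - 1))"
  define b where "b = 1 + complex_of_real a - of_real c"
  have b: "b = of_real (1 + a - c)" by (simp add: b_def)
  have cn: "complex_of_real c \<notin> \<int>\<^sub>\<le>\<^sub>0" using c by (auto elim!: nonpos_Ints_cases simp: complex_eq_iff)
  have cn2: "2 - complex_of_real c \<notin> \<int>\<^sub>\<le>\<^sub>0" using c by (auto elim!: nonpos_Ints_cases simp: complex_eq_iff)
  let ?M = "hyp1F1 (of_real a) (of_real c)" and ?M' = "hyp1F1' (of_real a) (of_real c)"
  let ?N = "hyp1F1 (1 + of_real a - of_real c) (2 - of_real c)" and ?N' = "hyp1F1' (1 + of_real a - of_real c) (2 - of_real c)"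
  define y where "y = (\<lambda>k. tricomi_integral a b k - \<alpha> * ?M k - \<beta> * (k powr (1 - of_real c) * ?N k))"
  define y' where "y' = (\<lambda>k. - tricomi_integral (a + 1) b k - \<alpha> * ?M' k - \<beta> * (k powr (- of_real c) * ((1 - of_real c) * ?N k + k * ?N' k)))"
  have sol: "kummer_sol (of_real a) (of_real c) y y'"
    unfolding y_def y'_def b_def
    by (intro kummer_sol_linear kummer_sol_tricomi_integral[OF a] kummer_sol_hyp1F1[OF cn] kummer_sol_second[OF cn2])
  have l0: "((\<lambda>x::real. complex_of_real x) \<longlongrightarrow> 0) (at_right 0)"
    using tendsto_of_real[OF tendsto_ident_at[of "0::real" "{0<..}"], where 'a = complex] by simp
  have cont: "isCont ?M 0" "isCont ?M' 0" "isCont ?N 0" "isCont ?N' 0"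
    by (auto intro: DERIV_isCont hyp1F1_derivs(1)[OF cn] hyp1F1_derivs(2)[OF cn] hyp1F1_derivs(1)[OF cn2] hyp1F1_derivs(2)[OF cn2])
  note lims = cont[THEN isCont_tendsto_compose, OF l0]
  have lc: "((\<lambda>x. complex_of_real (x powr (1 - c))) \<longlongrightarrow> of_real 0) (at_right 0)"
    by (rule tendsto_of_real) (use c in real_asymp)
  have lc': "((\<lambda>x. complex_of_real (x powr c)) \<longlongrightarrow> of_real 0) (at_right 0)"
    by (rule tendsto_of_real) (use c in real_asymp)
  have lT: "((\<lambda>x. tricomi_integral a b (of_real x)) \<longlongrightarrow> \<alpha>) (at_right 0)"
    using tendsto_tricomi_integral_0[of a "1 + a - c"] a c unfolding b \<alpha>_def by simp
  have lT': "((\<lambda>x. of_real (x powr c) * tricomi_integral (a + 1) b (of_real x)) \<longlongrightarrow> of_real (Gamma c)) (at_right 0)"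
    using tendsto_tricomi_integral_deriv_0[OF a c] unfolding b .
  have "((\<lambda>x. tricomi_integral a b (of_real x) - \<alpha> * ?M (of_real x) - \<beta> * (of_real (x powr (1 - c)) * ?N (of_real x))) \<longlongrightarrow> \<alpha> - \<alpha> * ?M 0 - \<beta> * (of_real 0 * ?N 0)) (at_right 0)"
    by (rule tendsto_diff[OF tendsto_diff[OF lT tendsto_mult[OF tendsto_const lims(1)]] tendsto_mult[OF tendsto_const tendsto_mult[OF lc lims(3)]]])
  then have "((\<lambda>x. tricomi_integral a b (of_real x) - \<alpha> * ?M (of_real x) - \<beta> * (of_real (x powr (1 - c)) * ?N (of_real x))) \<longlongrightarrow> 0) (at_right 0)"
    by (simp add: hyp1F1_0)
  then have lim: "((\<lambda>x. y (of_real x)) \<longlongrightarrow> 0) (at_right 0)"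
  proof (rule Lim_transform_eventually)
    show "\<forall>\<^sub>F x in at_right 0. tricomi_integral a b (of_real x) - \<alpha> * ?M (of_real x) - \<beta> * (of_real (x powr (1 - c)) * ?N (of_real x)) = y (of_real x)"
      using eventually_at_right_less[of 0]
    proof eventually_elim
      case (elim x)
      then have "complex_of_real x powr (1 - of_real c) = of_real (x powr (1 - c))" using powr_of_real[of x "1 - c"] by simp
      then show ?case by (simp add: y_def)
    qed
  qed
  \<comment> \<open>In the limit of x^c y' the term -\<Gamma>(c) from the integral meets -\<beta> (1
    - c) = (c - 1) \<Gamma>(c - 1) from the second Frobenius solution; this functional equation
    cancels them.\<close>
  have g: "Gamma c = (c - 1) * Gamma (c - 1)"
  proof -
    have "c - 1 \<notin> \<int>\<^sub>\<le>\<^sub>0" using c by (auto elim!: nonpos_Ints_cases) (smt (verit) of_int_le_iff of_int_less_iff of_int_minus of_int_1 of_int_0)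
    from Gamma_plus1[OF this] show ?thesis by simp
  qed
  have "((\<lambda>x. - (of_real (x powr c) * tricomi_integral (a + 1) b (of_real x)) - of_real (x powr c) * (\<alpha> * ?M' (of_real x)) - \<beta> * ((1 - of_real c) * ?N (of_real x) + of_real x * ?N' (of_real x)))
      \<longlongrightarrow> - of_real (Gamma c) - of_real 0 * (\<alpha> * ?M' 0) - \<beta> * ((1 - of_real c) * ?N 0 + 0 * ?N' 0)) (at_right 0)"
    by (rule tendsto_diff[OF tendsto_diff[OF tendsto_minus[OF lT'] tendsto_mult[OF lc' tendsto_mult[OF tendsto_const lims(2)]]]
         tendsto_mult[OF tendsto_const tendsto_add[OF tendsto_mult[OF tendsto_const lims(3)] tendsto_mult[OF l0 lims(4)]]]])
  also have "- of_real (Gamma c) - of_real 0 * (\<alpha> * ?M' 0) - \<beta> * ((1 - of_real c) * ?N 0 + 0 * ?N' 0) = 0"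
    unfolding g \<beta>_def by (simp add: hyp1F1_0 algebra_simps)
  finally have lim': "((\<lambda>x. of_real (x powr c) * y' (of_real x)) \<longlongrightarrow> 0) (at_right 0)"
  proof (rule Lim_transform_eventually)
    show "\<forall>\<^sub>F x in at_right 0. - (of_real (x powr c) * tricomi_integral (a + 1) b (of_real x)) - of_real (x powr c) * (\<alpha> * ?M' (of_real x)) - \<beta> * ((1 - of_real c) * ?N (of_real x) + of_real x * ?N' (of_real x))
       = of_real (x powr c) * y' (of_real x)"
      using eventually_at_right_less[of 0]
    proof eventually_elim
      case (elim x)
      then have p: "complex_of_real x powr (- of_real c) = of_real (x powr (- c))" using powr_of_real[of x "- c"] by simp
      have "x powr c * x powr (- c) = 1" using elim by (simp add: powr_minus)
      then have q: "complex_of_real (x powr c) * of_real (x powr (- c)) = 1" by (metis of_real_1 of_real_mult)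
      have "of_real (x powr c) * y' (of_real x) = - (of_real (x powr c) * tricomi_integral (a + 1) b (of_real x)) - of_real (x powr c) * (\<alpha> * ?M' (of_real x))
         - \<beta> * ((complex_of_real (x powr c) * of_real (x powr (- c))) * ((1 - of_real c) * ?N (of_real x) + of_real x * ?N' (of_real x)))"
        unfolding y'_def p by (simp add: algebra_simps)
      then show ?case unfolding q by simp
    qed
  qed
  have "y k = 0" by (rule kummer_sol_unique[OF sol c lim lim' k])
  moreover have "of_real (Gamma a) * tricomi_nonint (of_real a) (of_real c) k = \<alpha> * ?M k + \<beta> * (k powr (1 - of_real c) * ?N k)"
  proof -
    have ga: "Gamma a \<noteq> 0" using Gamma_real_pos[OF a] by simp
    have "Gamma (1 - complex_of_real c) = of_real (Gamma (1 - c))" "Gamma (1 + complex_of_real a - of_real c) = of_real (Gamma (1 + a - c))"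
      "Gamma (complex_of_real c - 1) = of_real (Gamma (c - 1))" "Gamma (complex_of_real a) = of_real (Gamma a)"
      by (simp_all flip: Gamma_complex_of_real)
    then show ?thesis unfolding tricomi_nonint_def \<alpha>_def \<beta>_def using ga
      by (simp add: field_simps)
  qed
  ultimately show ?thesis by (simp add: y_def b_def algebra_simps)
qed

text \<open>The series is an integral for the counting measure, so the general result on holomorphic
  parameter integrals applies; the majorant is an exponential series, locally uniform in the
  parameter.\<close>

lemma hyp1F1_holomorphic_params:
  assumes S: "open S" and f: "f holomorphic_on S" and g: "g holomorphic_on S"
    and ng: "\<And>c. c \<in> S \<Longrightarrow> g c \<notin> \<int>\<^sub>\<le>\<^sub>0"
  shows "(\<lambda>c. hyp1F1 (f c) (g c) z) holomorphic_on S"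
proof -
  let ?h = "\<lambda>c n. pochhammer (f c) n / pochhammer (g c) n * (z ^ n / fact n)"
  have dom: "\<exists>r>0. \<exists>G. integrable (count_space UNIV) G \<and> (\<forall>u\<in>S. dist c u < r \<longrightarrow> (\<forall>n\<in>space (count_space UNIV). cmod (?h u n) \<le> G n))"
    if c: "c \<in> S" for c
  proof -
    obtain d where d: "d > 0" "\<And>j c'. dist (g c) c' < d \<Longrightarrow> d \<le> cmod (c' + of_nat j)"
      using dist_nonpos_Ints[OF ng[OF c]] by blast
    have cont: "continuous_on S f" "continuous_on S g" using f g holomorphic_on_imp_continuous_on by auto
    obtain r1 where r1: "r1 > 0" "\<And>u. u \<in> S \<Longrightarrow> dist u c < r1 \<Longrightarrow> dist (g u) (g c) < d"
      using cont(2) c d(1) unfolding continuous_on_iff by blast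
    have "continuous_on S (\<lambda>u. f u - g u)" using cont by (intro continuous_intros)
    then obtain r2 where r2: "r2 > 0" "\<And>u. u \<in> S \<Longrightarrow> dist u c < r2 \<Longrightarrow> dist (f u - g u) (f c - g c) < 1"
      using c unfolding continuous_on_iff by (meson zero_less_one)
    define C where "C = 1 + (cmod (f c - g c) + 1) / d"
    have C: "C \<ge> 1" using d by (simp add: C_def)
    have bd: "cmod (?h u n) \<le> (C * cmod z) ^ n / fact n" if u: "u \<in> S" "dist c u < min r1 r2" for u n
    proof -
      have u': "dist u c < r1" "dist u c < r2" using u(2) dist_commute[of c u] by auto
      have "dist (g c) (g u) < d" using r1(2)[OF u(1) u'(1)] dist_commute[of "g u" "g c"] by simp
      then have "cmod (pochhammer (f u) n / pochhammer (g u) n) \<le> (1 + cmod (f u - g u) / d) ^ n"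
        by (intro norm_pochhammer_ratio_le d)
      also have "\<dots> \<le> C ^ n"
      proof (rule power_mono)
        have "cmod (f u - g u) \<le> cmod (f c - g c) + 1"
          using r2(2)[OF u(1) u'(2)] norm_triangle_ineq2[of "f u - g u" "f c - g c"] by (simp add: dist_norm)
        then show "1 + cmod (f u - g u) / d \<le> C" unfolding C_def using d by (intro add_left_mono divide_right_mono) auto
        show "0 \<le> 1 + cmod (f u - g u) / d" using d by simp
      qed
      finally have *: "cmod (pochhammer (f u) n / pochhammer (g u) n) \<le> C ^ n" .
      have "cmod (?h u n) = cmod (pochhammer (f u) n / pochhammer (g u) n) * (cmod z ^ n / fact n)"
        by (simp only: norm_mult norm_divide norm_power norm_fact)
      also have "\<dots> \<le> C ^ n * (cmod z ^ n / fact n)" by (intro mult_right_mono *) simp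
      finally show ?thesis by (simp add: power_mult_distrib)
    qed
    have "integrable (count_space UNIV) (\<lambda>n. (C * cmod z) ^ n / fact n)"
      unfolding integrable_count_space_nat_iff
      using summable_power_over_fact[of "C * cmod z"] C by (simp add: abs_mult power_abs)
    then show ?thesis using bd r1(1) r2(1) by (intro exI[of _ "min r1 r2"]) auto
  qed
  have pg: "pochhammer (g u) n \<noteq> 0" if "u \<in> S" for u n
    using ng[OF that] by (auto simp: pochhammer_eq_0_iff)
  have "(\<lambda>c. LINT n|count_space UNIV. ?h c n) holomorphic_on S"
  proof (rule holomorphic_integral_dominated[OF S _ _ dom])
    show "(\<lambda>u. ?h u n) holomorphic_on S" for n
      by (intro holomorphic_intros f g) (use pg in \<open>auto simp: pochhammer_prod intro!: holomorphic_intros f g\<close>)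
  qed auto
  also have "?this \<longleftrightarrow> ?thesis"
  proof (rule holomorphic_cong[OF refl])
    fix c assume c: "c \<in> S"
    from dom[OF c] obtain r G where rG: "r > 0" "integrable (count_space UNIV) G"
      and G: "\<forall>u\<in>S. dist c u < r \<longrightarrow> (\<forall>n\<in>space (count_space UNIV). cmod (?h u n) \<le> G n)" by blast
    have G': "cmod (?h c n) \<le> G n" for n using G c rG(1) by simp
    have "integrable (count_space UNIV) (?h c)"
      by (rule Bochner_Integration.integrable_bound[OF rG(2)]) (use order_trans[OF G' abs_ge_self] in \<open>simp_all only: real_norm_def AE_I2, simp\<close>)
    then show "(LINT n|count_space UNIV. ?h c n) = hyp1F1 (f c) (g c) z"
      unfolding hyp1F1_def by (rule integral_count_space_nat)
  qed
  finally show ?thesis .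
qed

text \<open>Both sides are holomorphic in \<open>c\<close> off the integers. Removing a countable
  set leaves the plane connected, so the interval (0, 1) determines them everywhere.\<close>

lemma tricomi_nonint_eq_integral:
  assumes a: "a > 0" and c: "c \<notin> \<int>" and k: "Re k > 0"
  shows "tricomi_integral a (1 + of_real a - c) k = of_real (Gamma a) * tricomi_nonint (of_real a) c k"
proof -
  let ?S = "- (\<int> :: complex set)"
  have oS: "open ?S" by (simp add: open_Compl)
  have "connected ?S"
    using connected_open_diff_countable[of "UNIV :: complex set" \<int>] countable_int connected_UNIV
    by (simp add: Compl_eq_Diff_UNIV)
  have k0: "k \<noteq> 0" using k by auto
  have ni: "c \<notin> \<int>\<^sub>\<le>\<^sub>0" "1 - c \<notin> \<int>\<^sub>\<le>\<^sub>0" "c - 1 \<notin> \<int>\<^sub>\<le>\<^sub>0" "2 - c \<notin> \<int>\<^sub>\<le>\<^sub>0" if "c \<in> ?S" for c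
  proof -
    have c: "c \<notin> \<int>" using that by simp
    then have "1 - c \<notin> \<int>" "c - 1 \<notin> \<int>" "2 - c \<notin> \<int>"
      by (metis Ints_1 Ints_diff add_diff_cancel_left' diff_add_cancel diff_diff_eq2 , metis Ints_1 Ints_add diff_add_cancel, metis Ints_diff Ints_numeral diff_diff_eq2 add_diff_cancel_left')
    with c show "c \<notin> \<int>\<^sub>\<le>\<^sub>0" "1 - c \<notin> \<int>\<^sub>\<le>\<^sub>0" "c - 1 \<notin> \<int>\<^sub>\<le>\<^sub>0" "2 - c \<notin> \<int>\<^sub>\<le>\<^sub>0"
      using nonpos_Ints_Int by blast+
  qed
  let ?d = "\<lambda>c. tricomi_integral a (1 + of_real a - c) k - of_real (Gamma a) * tricomi_nonint (of_real a) c k"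
  have "?d c = 0"
  proof (rule analytic_continuation[of ?d ?S "of_real ` {0<..<1}" "of_real (1/2)"])
    have "(\<lambda>c. tricomi_integral a (1 + of_real a - c) k) holomorphic_on ?S"
      by (rule holomorphic_on_compose_gen[of "\<lambda>c. 1 + of_real a - c" ?S "\<lambda>b. tricomi_integral a b k" UNIV, unfolded o_def])
         (auto intro!: holomorphic_intros tricomi_integral_holomorphic_b[OF a k])
    moreover have "(\<lambda>c. tricomi_nonint (of_real a) c k) holomorphic_on ?S"
      unfolding tricomi_nonint_def divide_inverse rGamma_inverse_Gamma[symmetric]
      by (intro holomorphic_intros hyp1F1_holomorphic_params oS holomorphic_Gamma' holomorphic_rGamma') (use ni k0 in auto)
    ultimately show "?d holomorphic_on ?S" by (intro holomorphic_intros)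
    show "open ?S" "connected ?S" by fact+
    have "complex_of_real x \<notin> \<int>" if "x \<in> {0<..<1}" for x
      using that by (auto elim!: Ints_cases simp: complex_eq_iff)
    then show "of_real ` {0<..<1} \<subseteq> ?S" "of_real (1/2) \<in> ?S" by (auto simp del: of_real_divide)
    show "complex_of_real (1/2) islimpt of_real ` {0::real<..<1}"
      unfolding islimpt_sequential
    proof (intro exI[of _ "\<lambda>n. of_real (1/2 + 1 / (3 + real n))"] conjI allI)
      have "(\<lambda>n. 1/2 + 1 / (3 + real n)) \<longlonglongrightarrow> 1/2" by real_asymp
      then show "(\<lambda>n. complex_of_real (1/2 + 1 / (3 + real n))) \<longlonglongrightarrow> of_real (1/2)" by (rule tendsto_of_real)
      fix n
      have "0 < 1 / (3 + real n)" "1 / (3 + real n) < 1/2" by (auto simp: field_simps)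
      then have "1/2 + 1 / (3 + real n) \<in> {0<..<1} - {1/2}"
        unfolding Diff_iff greaterThanLessThan_iff singleton_iff by linarith
      then show "complex_of_real (1/2 + 1 / (3 + real n)) \<in> complex_of_real ` {0<..<1} - {of_real (1/2)}"
        by (metis (no_types, lifting) DiffD1 DiffD2 DiffI image_eqI of_real_eq_iff singletonD singletonI)
    qed
    show "\<And>z. z \<in> of_real ` {0<..<1} \<Longrightarrow> ?d z = 0"
      using tricomi_nonint_eq_integral_real[OF a _ _ k] by auto
  qed (use c in auto)
  then show ?thesis by simp
qed

text \<open>At an integer \<open>c\<close> the integral is still continuous in \<open>c\<close>, so
  it provides the limit in the definition of \<open>tricomi\<close>. In the application c = 1/2 -
  \<rho>, which is the integer 0 for \<rho> = 1/2 and negative beyond.\<close>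

lemma tricomi_eq_integral:
  assumes a: "a > 0" and k: "Re k > 0"
  shows "of_real (Gamma a) * tricomi (of_real a) c k = tricomi_integral a (1 + of_real a - c) k"
proof (cases "c \<in> \<int>")
  case False
  then show ?thesis using tricomi_nonint_eq_integral[OF a False k] by (simp add: tricomi_def)
next
  case True
  have ga: "complex_of_real (Gamma a) \<noteq> 0" using Gamma_real_pos[OF a] by simp
  let ?F = "\<lambda>c'. tricomi_integral a (1 + of_real a - c') k / of_real (Gamma a)"
  have "isCont (\<lambda>b. tricomi_integral a b k) (1 + of_real a - c)"
    using tricomi_integral_holomorphic_b[OF a k] by (simp add: holomorphic_on_imp_continuous_on continuous_on_eq_continuous_at[OF open_UNIV, THEN iffD1])
  then have "isCont ?F c"
    using isCont_o2[of c "\<lambda>c'. 1 + of_real a - c'" "\<lambda>b. tricomi_integral a b k"] ga by (intro continuous_intros) auto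
  then have "(?F \<longlongrightarrow> ?F c) (at c)" by (simp add: isCont_def)
  then have "((\<lambda>c'. tricomi_nonint (of_real a) c' k) \<longlongrightarrow> ?F c) (at c)"
  proof (rule Lim_transform_eventually)
    have "eventually (\<lambda>c'. c' \<notin> \<int>) (at c)"
    proof -
      have "\<not> c islimpt (\<int> :: complex set)"
        by (rule discrete_imp_not_islimpt[of 1]) (auto elim!: Ints_cases simp: dist_norm simp flip: of_int_diff)
      then show ?thesis by (simp add: islimpt_iff_eventually)
    qed
    then show "\<forall>\<^sub>F c' in at c. ?F c' = tricomi_nonint (of_real a) c' k"
      by eventually_elim (use tricomi_nonint_eq_integral[OF a _ k] ga in simp)
  qed
  then have "Lim (at c) (\<lambda>c'. tricomi_nonint (of_real a) c' k) = ?F c"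
    by (intro tendsto_Lim) auto
  then show ?thesis using True ga by (simp add: tricomi_def)
qed


section \<open>Gaussian integrals\<close>

lemma gaussian_integral_real:
  fixes \<alpha> \<beta> :: real
  assumes "\<alpha> > 0"
  shows "integrable lborel (\<lambda>s. exp (- \<alpha> * s\<^sup>2 / 2 + \<beta> * s))"
    "(LINT s|lborel. exp (- \<alpha> * s\<^sup>2 / 2 + \<beta> * s)) = sqrt (2 * pi / \<alpha>) * exp (\<beta>\<^sup>2 / (2 * \<alpha>))"
proof -
  have eq: "exp (- \<alpha> * s\<^sup>2 / 2 + \<beta> * s) = sqrt (2 * pi / \<alpha>) * exp (\<beta>\<^sup>2 / (2 * \<alpha>)) * normal_density (\<beta> / \<alpha>) (1 / sqrt \<alpha>) s" for s
  proof -
    have e: "- ((s - \<beta> / \<alpha>)\<^sup>2 / (2 * (1 / sqrt \<alpha>)\<^sup>2)) = - \<alpha> * s\<^sup>2 / 2 + \<beta> * s - \<beta>\<^sup>2 / (2 * \<alpha>)"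
      using assms by (simp add: power_divide field_simps power2_eq_square)
    have "normal_density (\<beta> / \<alpha>) (1 / sqrt \<alpha>) s = 1 / sqrt (2 * pi / \<alpha>) * exp (- \<alpha> * s\<^sup>2 / 2 + \<beta> * s - \<beta>\<^sup>2 / (2 * \<alpha>))"
      using assms unfolding normal_density_def minus_divide_left[symmetric] e by (simp add: power_divide)
    then show ?thesis using assms by (simp add: exp_diff)
  qed
  have i: "integrable lborel (normal_density (\<beta> / \<alpha>) (1 / sqrt \<alpha>))"
    by (rule integrable_normal_density) (use assms in simp)
  have ii: "(LINT s|lborel. normal_density (\<beta> / \<alpha>) (1 / sqrt \<alpha>) s) = 1"
    by (rule integral_normal_density) (use assms in simp)
  show "integrable lborel (\<lambda>s. exp (- \<alpha> * s\<^sup>2 / 2 + \<beta> * s))"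
    unfolding eq using i by (rule integrable_mult_right)
  show "(LINT s|lborel. exp (- \<alpha> * s\<^sup>2 / 2 + \<beta> * s)) = sqrt (2 * pi / \<alpha>) * exp (\<beta>\<^sup>2 / (2 * \<alpha>))"
    unfolding eq integral_mult_right_zero ii by simp
qed

lemma integrable_gaussian: "(c::real) > 0 \<Longrightarrow> integrable lborel (\<lambda>s. exp (- c * s\<^sup>2))"
  using gaussian_integral_real(1)[of "2 * c" 0] by simp

text \<open>Analytic continuation in an auxiliary parameter l in place of the imaginary unit: for
  real l the coefficients Re \<alpha> + l Im \<alpha> and Re \<beta> + l Im \<beta> are real and the
  classical formula holds, for l = i they are \<alpha> and \<beta>. The principal square root
  survives because its argument stays in the right half-plane.\<close>

lemma gaussian_integral_complex:
  fixes \<alpha> \<beta> :: complex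
  assumes \<alpha>: "Re \<alpha> > 0"
  shows "(LINT s|lborel. exp (- \<alpha> * (of_real s)\<^sup>2 / 2 + \<beta> * of_real s)) = csqrt (2 * of_real pi / \<alpha>) * exp (\<beta>\<^sup>2 / (2 * \<alpha>))"
proof -
  define a where "a = (\<lambda>l::complex. of_real (Re \<alpha>) + l * of_real (Im \<alpha>))"
  define b where "b = (\<lambda>l::complex. of_real (Re \<beta>) + l * of_real (Im \<beta>))"
  let ?h = "\<lambda>l s::real. exp (- a l * (of_real s)\<^sup>2 / 2 + b l * of_real s)"
  \<comment> \<open>The l for which \<open>a l\<close> has positive real part; 0 and i are among
    them because Re \<alpha> > 0.\<close>
  define D where "D = {l. 0 < Re \<alpha> + Im \<alpha> * Re l}"
  have Rea: "Re (a l) = Re \<alpha> + Im \<alpha> * Re l" for l by (simp add: a_def mult.commute)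
  have Reb: "Re (b l) = Re \<beta> + Im \<beta> * Re l" for l by (simp add: b_def mult.commute)
  have oD: "open D" unfolding D_def by (intro open_Collect_less continuous_intros)
  have cD: "convex D"
  proof (rule convexI)
    fix x y :: complex and u v :: real assume xy: "x \<in> D" "y \<in> D" and uv: "0 \<le> u" "0 \<le> v" "u + v = 1"
    have "0 < u * (Re \<alpha> + Im \<alpha> * Re x) + v * (Re \<alpha> + Im \<alpha> * Re y)"
      using xy uv unfolding D_def mem_Collect_eq
      by (cases "u = 0") (auto intro: add_pos_nonneg)
    also have "\<dots> = (u + v) * Re \<alpha> + Im \<alpha> * Re (u *\<^sub>R x + v *\<^sub>R y)" by (simp add: algebra_simps)
    finally show "u *\<^sub>R x + v *\<^sub>R y \<in> D" using uv by (simp add: D_def)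
  qed
  have nh: "cmod (?h l s) = exp (- Re (a l) * s\<^sup>2 / 2 + Re (b l) * s)" for l s
    by (simp add: of_real_power[symmetric] del: of_real_power)
  have holL: "(\<lambda>l. LINT s|lborel. ?h l s) holomorphic_on D"
  proof (rule holomorphic_integral_dominated[OF oD])
    show "(\<lambda>l. ?h l s) holomorphic_on D" for s unfolding a_def b_def by (intro holomorphic_intros) auto
    fix z assume z: "z \<in> D"
    \<comment> \<open>Within the radius \<open>r\<close> below, Re (a u) loses at most \<kappa>,
      half of its value at \<open>z\<close>, and |Re (b u)| stays below \<open>B\<close>. The two
      signs of \<open>B\<close> in the majorant take care of the two ends of the line.\<close>
    define \<kappa> where "\<kappa> = Re (a z) / 2"
    have \<kappa>: "\<kappa> > 0" using z by (simp add: \<kappa>_def Rea D_def)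
    define r where "r = min 1 (\<kappa> / (\<bar>Im \<alpha>\<bar> + 1))"
    have r: "r > 0" using \<kappa> by (simp add: r_def add_nonneg_pos)
    define B where "B = \<bar>Re (b z)\<bar> + \<bar>Im \<beta>\<bar>"
    let ?g = "\<lambda>s. exp (- \<kappa> * s\<^sup>2 / 2 + B * s) + exp (- \<kappa> * s\<^sup>2 / 2 + (- B) * s)"
    have ig: "integrable lborel ?g" by (intro Bochner_Integration.integrable_add gaussian_integral_real(1) \<kappa>)
    have bd: "cmod (?h u s) \<le> ?g s" if u: "dist z u < r" for u s
    proof -
      have re: "\<bar>Re (u - z)\<bar> < r" using u abs_Re_le_cmod[of "u - z"] dist_norm[of u z] dist_commute[of u z] by linarith
      have "\<bar>Im \<alpha>\<bar> * \<bar>Re (u - z)\<bar> \<le> \<bar>Im \<alpha>\<bar> * (\<kappa> / (\<bar>Im \<alpha>\<bar> + 1))"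
        using re unfolding r_def by (intro mult_left_mono) auto
      also have "\<dots> \<le> \<kappa>" using \<kappa> by (simp add: field_simps add_nonneg_pos)
      finally have "\<bar>Im \<alpha> * Re (u - z)\<bar> \<le> \<kappa>" by (simp add: abs_mult)
      moreover have "Re (a u) = Re (a z) + Im \<alpha> * Re (u - z)" by (simp add: Rea algebra_simps)
      moreover have "Re (a z) = 2 * \<kappa>" by (simp add: \<kappa>_def)
      ultimately have 1: "\<kappa> \<le> Re (a u)" by linarith
      have "\<bar>Im \<beta>\<bar> * \<bar>Re (u - z)\<bar> \<le> \<bar>Im \<beta>\<bar> * 1"
        using re unfolding r_def by (intro mult_left_mono) auto
      then have "\<bar>Im \<beta> * Re (u - z)\<bar> \<le> \<bar>Im \<beta>\<bar>" by (simp add: abs_mult)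
      moreover have "Re (b u) = Re (b z) + Im \<beta> * Re (u - z)" by (simp add: Reb algebra_simps)
      ultimately have 2: "\<bar>Re (b u)\<bar> \<le> B" unfolding B_def by linarith
      have "Re (b u) * s \<le> \<bar>Re (b u)\<bar> * \<bar>s\<bar>" by (metis abs_ge_self abs_mult)
      also have "\<dots> \<le> B * \<bar>s\<bar>" using 2 by (intro mult_right_mono) auto
      finally have 3: "Re (b u) * s \<le> B * \<bar>s\<bar>" .
      have "\<kappa> * s\<^sup>2 \<le> Re (a u) * s\<^sup>2" using 1 by (intro mult_right_mono) auto
      with 3 have "cmod (?h u s) \<le> exp (- \<kappa> * s\<^sup>2 / 2 + B * \<bar>s\<bar>)" unfolding nh by simp
      also have "\<dots> \<le> ?g s" by (cases "s \<ge> 0") auto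
      finally show ?thesis .
    qed
    show "\<exists>r>0. \<exists>g. integrable lborel g \<and> (\<forall>u\<in>D. dist z u < r \<longrightarrow> (\<forall>x\<in>space lborel. cmod (?h u x) \<le> g x))"
      using r ig bd by blast
  qed measurable
  have holR: "(\<lambda>l. csqrt (2 * of_real pi / a l) * exp ((b l)\<^sup>2 / (2 * a l))) holomorphic_on D"
  proof -
    have ra: "Re (a l) > 0" if "l \<in> D" for l using that by (simp add: Rea D_def)
    then have a0: "a l \<noteq> 0" if "l \<in> D" for l using that by (metis less_irrefl zero_complex.sel(1))
    have q: "2 * complex_of_real pi / a l \<notin> \<real>\<^sub>\<le>\<^sub>0" if "l \<in> D" for l
    proof -
      have "Re (2 * complex_of_real pi / a l) = 2 * pi * Re (a l) / (cmod (a l))\<^sup>2"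
        unfolding Re_divide cmod_power2 by simp
      also have "\<dots> > 0" using ra[OF that] a0[OF that] by simp
      finally show ?thesis by (auto simp: complex_nonpos_Reals_iff)
    qed
    have ah: "a holomorphic_on D" "b holomorphic_on D" unfolding a_def b_def by (intro holomorphic_intros)+
    show ?thesis
      by (intro holomorphic_on_mult holomorphic_on_csqrt' holomorphic_intros ah) (use a0 q in auto)
  qed
  have real: "(LINT s|lborel. ?h (of_real l) s) = csqrt (2 * of_real pi / a (of_real l)) * exp ((b (of_real l))\<^sup>2 / (2 * a (of_real l)))"
    if l: "of_real l \<in> D" for l :: real
  proof -
    define ar br where "ar = Re \<alpha> + l * Im \<alpha>" "br = Re \<beta> + l * Im \<beta>"
    have ar: "ar > 0" using l by (simp add: D_def ar_br_def mult.commute)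
    have ab: "a (of_real l) = of_real ar" "b (of_real l) = of_real br" by (simp_all add: a_def b_def ar_br_def)
    have "(LINT s|lborel. ?h (of_real l) s) = (LINT s|lborel. complex_of_real (exp (- ar * s\<^sup>2 / 2 + br * s)))"
      unfolding ab by (intro Bochner_Integration.integral_cong) (auto simp: exp_of_real[symmetric])
    also have "\<dots> = of_real (sqrt (2 * pi / ar) * exp (br\<^sup>2 / (2 * ar)))"
      unfolding integral_complex_of_real gaussian_integral_real(2)[OF ar] ..
    also have "\<dots> = csqrt (of_real (2 * pi / ar)) * exp (of_real (br\<^sup>2 / (2 * ar)))"
    proof -
      have "0 \<le> 2 * pi / ar" using ar by simp
      then show ?thesis by (simp only: of_real_mult of_real_sqrt exp_of_real)
    qed
    finally show ?thesis unfolding ab by simp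
  qed
  have "(LINT s|lborel. ?h l s) - csqrt (2 * of_real pi / a l) * exp ((b l)\<^sup>2 / (2 * a l)) = 0" if l: "l \<in> D" for l
  proof (rule analytic_continuation[of "\<lambda>l. (LINT s|lborel. ?h l s) - csqrt (2 * of_real pi / a l) * exp ((b l)\<^sup>2 / (2 * a l))" D "of_real ` {x. complex_of_real x \<in> D}" 0])
    have D0: "0 \<in> D" using \<alpha> by (simp add: D_def)
    then show "0 \<in> D" .
    have "eventually (\<lambda>l. l \<in> D) (nhds 0)" using oD D0 by (rule eventually_nhds_in_open)
    moreover have X: "(\<lambda>n. complex_of_real (1 / (1 + real n))) \<longlonglongrightarrow> of_real 0" by (rule tendsto_of_real) real_asymp
    then have X0: "(\<lambda>n. complex_of_real (1 / (1 + real n))) \<longlonglongrightarrow> 0" by (simp only: of_real_0)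
    ultimately have "eventually (\<lambda>n. complex_of_real (1 / (1 + real n)) \<in> D) sequentially"
      by (rule eventually_compose_filterlim)
    then obtain N where N: "\<And>n. n \<ge> N \<Longrightarrow> complex_of_real (1 / (1 + real n)) \<in> D" by (auto simp: eventually_sequentially)
    show "0 islimpt complex_of_real ` {x. complex_of_real x \<in> D}"
      unfolding islimpt_sequential
    proof (intro exI[of _ "\<lambda>n. complex_of_real (1 / (1 + real (n + N)))"] conjI allI)
      show "(\<lambda>n. complex_of_real (1 / (1 + real (n + N)))) \<longlonglongrightarrow> 0"
        by (rule LIMSEQ_ignore_initial_segment[OF X0])
      fix n
      have "complex_of_real (1 / (1 + real (n + N))) \<in> D" by (rule N) simp
      moreover have "1 / (1 + real (n + N)) \<noteq> 0" by simp
      ultimately show "complex_of_real (1 / (1 + real (n + N))) \<in> complex_of_real ` {x. complex_of_real x \<in> D} - {0}"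
        by (auto simp del: of_real_divide of_real_add)
    qed
    show "(\<lambda>l. (LINT s|lborel. ?h l s) - csqrt (2 * of_real pi / a l) * exp ((b l)\<^sup>2 / (2 * a l))) holomorphic_on D"
      by (intro holomorphic_intros holL holR)
    show "\<And>z. z \<in> complex_of_real ` {x. complex_of_real x \<in> D} \<Longrightarrow>
         (LINT s|lborel. ?h z s) - csqrt (2 * of_real pi / a z) * exp ((b z)\<^sup>2 / (2 * a z)) = 0"
      using real by auto
    show "open D" by (rule oD)
    show "connected D" using cD by (rule convex_connected)
    show "complex_of_real ` {x. complex_of_real x \<in> D} \<subseteq> D" by auto
    show "l \<in> D" by (rule l)
  qed
  then have "(LINT s|lborel. ?h \<i> s) - csqrt (2 * of_real pi / a \<i>) * exp ((b \<i>)\<^sup>2 / (2 * a \<i>)) = 0"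
    using \<alpha> by (simp add: D_def)
  then have "(LINT s|lborel. ?h \<i> s) = csqrt (2 * of_real pi / a \<i>) * exp ((b \<i>)\<^sup>2 / (2 * a \<i>))"
    by simp
  moreover have "a \<i> = \<alpha>" "b \<i> = \<beta>" by (simp_all add: a_def b_def complex_eq_iff)
  ultimately show ?thesis by simp
qed

lemma csqrt_of_real_mult:
  assumes "x > 0"
  shows "csqrt (of_real x * z) = of_real (sqrt x) * csqrt z"
proof (rule csqrt_unique)
  have "(complex_of_real (sqrt x))\<^sup>2 = of_real x"
    using assms by (simp flip: of_real_power)
  then show "(complex_of_real (sqrt x) * csqrt z)\<^sup>2 = of_real x * z" by (simp add: power_mult_distrib)
  show "0 < Re (complex_of_real (sqrt x) * csqrt z) \<or> Re (complex_of_real (sqrt x) * csqrt z) = 0 \<and> 0 \<le> Im (complex_of_real (sqrt x) * csqrt z)"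
    using csqrt_principal[of z] assms by (auto simp: zero_less_mult_iff)
qed

text \<open>Inserting the Laplace representation and integrating over \<open>s\<close> first leaves,
  with r = 1 + t, a Gaussian with quadratic coefficient r A. It contributes r^(-1/2) and turns the
  exponent into -r k, so the total power of 1 + t is -3/2.\<close>

lemma integral_upper_Gamma_quadratic:
  fixes A B C :: complex
  assumes rho: "0 < \<rho>" "\<rho> < 1" and A: "Re A > 0" and pos: "d > 0" "c > 0"
    and w: "\<And>s::real. d + c * s\<^sup>2 \<le> Re (C + of_real s * B + (of_real s)\<^sup>2 * A / 2)"
  defines "k \<equiv> C - B\<^sup>2 / (2 * A)"
  shows "of_real (Gamma (1 - \<rho>)) * (LINT s|lborel. upper_Gamma (of_real \<rho>) (C + of_real s * B + (of_real s)\<^sup>2 * A / 2))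
     = csqrt (2 * of_real pi / A) * exp (- k) * tricomi_integral (1 - \<rho>) (3/2) k"
proof -
  define a where "a = 1 - \<rho>"
  have a: "a > 0" using rho by (simp add: a_def)
  define W where "W = (\<lambda>s::real. C + of_real s * B + (of_real s)\<^sup>2 * A / 2)"
  have ReW: "d + c * s\<^sup>2 \<le> Re (W s)" for s using w[of s] by (simp add: W_def)
  have ReW0: "Re (W s) > 0" for s
  proof -
    have "0 \<le> c * s\<^sup>2" using pos by simp
    then show ?thesis using ReW[of s] pos by linarith
  qed
  let ?f = "\<lambda>s t::real. exp (- (W s * of_real (1 + t))) * of_real (t powr (a - 1)) * of_real (1 + t) powr (- 1)"
  have f_eq: "?f s t = exp (- W s) * tricomi_kernel a 1 (W s) t" for s t
  proof -
    have "exp (- (W s * of_real (1 + t))) = exp (- W s) * exp (- (W s * of_real t))"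
      unfolding exp_add[symmetric] by (rule arg_cong[of _ _ exp]) (simp add: distrib_left)
    then show ?thesis by (simp only: tricomi_kernel_def mult.assoc)
  qed
  have A0: "A \<noteq> 0" using A by auto
  have "of_real (Gamma a) * (LINT s|lborel. upper_Gamma (of_real \<rho>) (W s)) = (LINT s|lborel. LINT t|pos_lborel. ?f s t)"
    unfolding integral_mult_right_zero[symmetric]
  proof (rule Bochner_Integration.integral_cong)
    fix s
    show "of_real (Gamma a) * upper_Gamma (of_real \<rho>) (W s) = (LINT t|pos_lborel. ?f s t)"
      unfolding f_eq using upper_Gamma_eq_tricomi_integral[OF rho ReW0[of s]]
      by (simp add: a_def tricomi_integral_def)
  qed simp
  also have "\<dots> = (LINT t|pos_lborel. LINT s|lborel. ?f s t)"
  proof (rule integral_swap[OF lborel.sigma_finite_measure_axioms sigma_finite_pos_lborel])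
    show meas: "(\<lambda>z. ?f (fst z) (snd z)) \<in> borel_measurable (lborel \<Otimes>\<^sub>M pos_lborel)"
      unfolding W_def powr_def by measurable
    show i: "integrable pos_lborel (?f s)" for s
      unfolding f_eq using integrable_tricomi_integral[OF a ReW0, of 1 s] by simp
    \<comment> \<open>Dropping the mixed term of (d + c s^2)(1 + t) and bounding 1/(1+t) by 1
      separates the variables: a Gaussian in \<open>s\<close> times a gamma kernel in
      \<open>t\<close>. This is the absolute integrability behind the exchange.\<close>
    have nf: "cmod (?f s t) \<le> exp (- c * s\<^sup>2) * (exp (- (d * t)) * t powr (a - 1) * (1 + t) powr 0)" if t: "t > 0" for s t
    proof -
      have n1: "cmod (complex_of_real (1 + t) powr - 1) \<le> 1"
        using t norm_powr_real_powr[of "complex_of_real (1 + t)" "- 1"] powr_mono[of "-1" 0 "1 + t"] by simp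
      have "d * t + c * s\<^sup>2 \<le> Re (W s) * (1 + t)"
      proof -
        have "(d + c * s\<^sup>2) * (1 + t) \<le> Re (W s) * (1 + t)" using ReW[of s] t by (intro mult_right_mono) auto
        moreover have "d * t + c * s\<^sup>2 \<le> (d + c * s\<^sup>2) * (1 + t)" using pos t by (simp add: algebra_simps)
        ultimately show ?thesis by linarith
      qed
      then have "cmod (exp (- (W s * of_real (1 + t)))) \<le> exp (- c * s\<^sup>2) * exp (- (d * t))"
        by (simp add: exp_add[symmetric])
      then have "cmod (exp (- (W s * of_real (1 + t)))) * t powr (a - 1) * cmod (complex_of_real (1 + t) powr - 1) \<le> exp (- c * s\<^sup>2) * exp (- (d * t)) * t powr (a - 1) * 1"
        using n1 by (intro mult_mono) auto
      then show ?thesis using t by (simp add: norm_mult mult_ac)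
    qed
    let ?K = "LINT t|pos_lborel. exp (- (d * t)) * t powr (a - 1) * (1 + t) powr 0"
    have "integrable lborel (\<lambda>s. exp (- c * s\<^sup>2) * ?K)" using integrable_gaussian[OF pos(2)] by (rule integrable_mult_left)
    then show "integrable lborel (\<lambda>s. LINT t|pos_lborel. cmod (?f s t))"
    proof (rule Bochner_Integration.integrable_bound)
      interpret sigma_finite_measure pos_lborel by (rule sigma_finite_pos_lborel)
      show "(\<lambda>s. LINT t|pos_lborel. cmod (?f s t)) \<in> borel_measurable lborel"
        using measurable_compose[OF meas borel_measurable_norm]
        by (intro borel_measurable_lebesgue_integral) (simp add: case_prod_beta')
      show "AE s in lborel. norm (LINT t|pos_lborel. cmod (?f s t)) \<le> norm (exp (- c * s\<^sup>2) * ?K)"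
      proof (intro AE_I2)
        fix s :: real
        have "(LINT t|pos_lborel. cmod (?f s t)) \<le> (LINT t|pos_lborel. exp (- c * s\<^sup>2) * (exp (- (d * t)) * t powr (a - 1) * (1 + t) powr 0))"
          using i[of s] integrable_tricomi_kernel[OF a pos(1), of 0] nf
          by (intro integral_mono integrable_mult_right integrable_norm) auto
        also have "\<dots> = exp (- c * s\<^sup>2) * ?K" by (rule integral_mult_right_zero)
        finally show "norm (LINT t|pos_lborel. cmod (?f s t)) \<le> norm (exp (- c * s\<^sup>2) * ?K)"
          by (smt (verit) Bochner_Integration.integral_nonneg norm_ge_zero real_norm_def)
      qed
    qed
  qed
  also have "\<dots> = (LINT t|pos_lborel. csqrt (2 * of_real pi / A) * exp (- k) * tricomi_kernel a (3/2) k t)"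
  proof (rule Bochner_Integration.integral_cong)
    fix t assume "t \<in> space pos_lborel"
    then have t: "t > 0" by simp
    define r where "r = 1 + t"
    have r: "r > 0" using t by (simp add: r_def)
    have rA: "Re (of_real r * A) > 0" using r A by simp
    have split: "?f s t = (exp (- (C * of_real r)) * of_real (t powr (a - 1)) * of_real r powr (- 1)) *
        exp (- (of_real r * A) * (of_real s)\<^sup>2 / 2 + (- (of_real r * B)) * of_real s)" for s
    proof -
      have "exp (- (W s * of_real r)) = exp (- (C * of_real r)) * exp (- (of_real r * A) * (of_real s)\<^sup>2 / 2 + (- (of_real r * B)) * of_real s)"
        unfolding W_def exp_add[symmetric] by (rule arg_cong[of _ _ exp]) (simp add: algebra_simps)
      then show ?thesis by (simp add: r_def[symmetric])
    qed
    have "(LINT s|lborel. ?f s t) = (exp (- (C * of_real r)) * of_real (t powr (a - 1)) * of_real r powr (- 1)) *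
        (csqrt (2 * of_real pi / (of_real r * A)) * exp ((- (of_real r * B))\<^sup>2 / (2 * (of_real r * A))))"
      unfolding split integral_mult_right_zero gaussian_integral_complex[OF rA] ..
    also have "csqrt (2 * of_real pi / (of_real r * A)) = of_real (r powr (- (1/2))) * csqrt (2 * of_real pi / A)"
    proof -
      have "2 * of_real pi / (of_real r * A) = of_real (1 / r) * (2 * of_real pi / A)" by simp
      then have "csqrt (2 * of_real pi / (of_real r * A)) = of_real (sqrt (1 / r)) * csqrt (2 * of_real pi / A)"
        using csqrt_of_real_mult[of "1 / r" "2 * of_real pi / A"] r by simp
      also have "sqrt (1 / r) = r powr (- (1/2))" using r by (simp add: powr_minus powr_half_sqrt real_sqrt_divide field_simps)
      finally show ?thesis .
    qed
    also have "(- (of_real r * B))\<^sup>2 / (2 * (of_real r * A)) = of_real r * (B\<^sup>2 / (2 * A))"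
      using r A0 by (simp add: power2_eq_square field_simps)
    also have "(exp (- (C * of_real r)) * of_real (t powr (a - 1)) * of_real r powr (- 1)) *
        (of_real (r powr (- (1/2))) * csqrt (2 * of_real pi / A) * exp (of_real r * (B\<^sup>2 / (2 * A))))
       = csqrt (2 * of_real pi / A) * (exp (- (C * of_real r)) * exp (of_real r * (B\<^sup>2 / (2 * A)))) * of_real (t powr (a - 1)) * (of_real r powr (- 1) * of_real (r powr (- (1/2))))"
      by (simp only: mult_ac)
    also have "exp (- (C * of_real r)) * exp (of_real r * (B\<^sup>2 / (2 * A))) = exp (- k) * exp (- (k * of_real t))"
      unfolding exp_add[symmetric] k_def r_def by (rule arg_cong[of _ _ exp]) (simp add: algebra_simps add_divide_distrib)
    also have "complex_of_real r powr (- 1) * of_real (r powr (- (1/2))) = of_real (1 + t) powr (- (3/2))"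
    proof -
      have "complex_of_real r powr (- 1) = of_real (r powr (-1))" "complex_of_real r powr (- (3/2)) = of_real (r powr (-(3/2)))"
        using r powr_of_real[of r "-1"] powr_of_real[of r "-(3/2)"] by simp_all
      moreover have "r powr (-1) * r powr (- (1/2)) = r powr (-(3/2))"
        using powr_add[of r "-1" "-(1/2)"] by simp
      ultimately show ?thesis by (metis of_real_mult r_def)
    qed
    finally show "(LINT s|lborel. ?f s t) = csqrt (2 * of_real pi / A) * exp (- k) * tricomi_kernel a (3/2) k t"
      by (simp add: tricomi_kernel_def)
  qed simp
  finally show ?thesis by (simp add: W_def a_def tricomi_integral_def)
qed


section \<open>Analytic continuation of the incomplete gamma function\<close>

lemma fps_mult_nth_leading:
  fixes K H :: "'a::comm_ring_1 fps"
  assumes "\<And>i. i < n \<Longrightarrow> fps_nth H i = 0"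
  shows "fps_nth (K * H) n = fps_nth K 0 * fps_nth H n"
proof -
  have "fps_nth (K * H) n = (\<Sum>i=0..n. fps_nth K i * fps_nth H (n - i))" by (simp add: fps_mult_nth)
  also have "\<dots> = (\<Sum>i\<in>{0}. fps_nth K i * fps_nth H (n - i))"
    using assms by (intro sum.mono_neutral_right) auto
  finally show ?thesis by simp
qed

lemma fps_expansion_deriv: "fps_expansion (deriv g) z = fps_deriv (fps_expansion g z)"
proof (rule fps_ext)
  fix n
  have "(deriv ^^ n) (deriv g) z = (deriv ^^ Suc n) g z" by (simp only: funpow_Suc_right o_def)
  moreover have "of_nat (Suc n) \<noteq> (0::complex)" by (rule of_nat_neq_0)
  ultimately show "fps_nth (fps_expansion (deriv g) z) n = fps_nth (fps_deriv (fps_expansion g z)) n"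
    by (simp add: fps_expansion_def del: funpow.simps of_nat_Suc)
qed

text \<open>If \<open>f = upper_Gamma \<rho> \<circ> W\<close> near the origin, then \<open>g = deriv f * exp W\<close> continues \<open>- W powr (\<rho> - 1) * deriv W\<close>,
  so it would vanish to the order \<open>\<rho> - 1\<close> at a simple zero of \<open>W\<close>.\<close>

lemma upper_Gamma_no_simple_zero:
  fixes W f :: "complex \<Rightarrow> complex"
  assumes rho: "0 < \<rho>" "\<rho> < 1"
    and S: "open S" "connected S" "0 \<in> S" "z0 \<in> S"
    and f: "f holomorphic_on S" and W: "W holomorphic_on S" and W0: "W 0 \<notin> \<real>\<^sub>\<le>\<^sub>0"
    and near: "\<forall>\<^sub>F z in nhds 0. f z = upper_Gamma (of_real \<rho>) (W z)"
    and zero: "W z0 = 0" "deriv W z0 \<noteq> 0"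
  shows False
proof -
  let ?r = "complex_of_real \<rho>"
  define W1 where "W1 = deriv W"
  define W2 where "W2 = deriv W1"
  define g where "g = (\<lambda>z. deriv f z * exp (W z))"
  have hW1: "W1 holomorphic_on S" unfolding W1_def by (intro holomorphic_deriv W S)
  have hW2: "W2 holomorphic_on S" unfolding W2_def by (intro holomorphic_deriv hW1 S)
  have hf1: "deriv f holomorphic_on S" by (intro holomorphic_deriv f S)
  have hg: "g holomorphic_on S" unfolding g_def by (intro holomorphic_intros hf1 W)
  have hg1: "deriv g holomorphic_on S" by (intro holomorphic_deriv hg S)
  have dW: "(W has_field_derivative W1 z) (at z)" "(W1 has_field_derivative W2 z) (at z)" if "z \<in> S" for z
    unfolding W2_def using holomorphic_derivI[OF W S(1) that] holomorphic_derivI[OF hW1 S(1) that] by (auto simp: W1_def)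
  obtain N where N: "open N" "0 \<in> N" "N \<subseteq> S" "\<And>z. z \<in> N \<Longrightarrow> f z = upper_Gamma ?r (W z) \<and> W z \<notin> \<real>\<^sub>\<le>\<^sub>0"
  proof -
    have "isCont W 0" using dW(1)[OF S(3)] by (rule DERIV_isCont)
    moreover have "open (- \<real>\<^sub>\<le>\<^sub>0 :: complex set)" "W 0 \<in> - \<real>\<^sub>\<le>\<^sub>0" using W0 by (auto simp: open_Compl)
    ultimately have "\<forall>\<^sub>F z in at 0. W z \<in> - \<real>\<^sub>\<le>\<^sub>0" unfolding isCont_def by (rule topological_tendstoD)
    then have "\<forall>\<^sub>F z in nhds 0. W z \<in> - \<real>\<^sub>\<le>\<^sub>0" using W0 by (simp add: eventually_nhds_conv_at)
    moreover have "\<forall>\<^sub>F z in nhds 0. z \<in> S" using S(1,3) by (rule eventually_nhds_in_open)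
    ultimately have "\<forall>\<^sub>F z in nhds 0. f z = upper_Gamma ?r (W z) \<and> W z \<notin> \<real>\<^sub>\<le>\<^sub>0 \<and> z \<in> S"
      using near by eventually_elim auto
    then obtain N where "open N" "0 \<in> N" "\<forall>z\<in>N. f z = upper_Gamma ?r (W z) \<and> W z \<notin> \<real>\<^sub>\<le>\<^sub>0 \<and> z \<in> S"
      unfolding eventually_nhds by blast
    then show ?thesis by (intro that[of N]) auto
  qed
  have gN: "g z = - (W z powr (?r - 1) * W1 z)" if z: "z \<in> N" for z
  proof -
    have zS: "z \<in> S" using z N(3) by auto
    have "((\<lambda>z. upper_Gamma ?r (W z)) has_field_derivative - (exp (- W z) * W z powr (?r - 1)) * W1 z) (at z)"
      using N(4)[OF z] by (intro DERIV_chain2[OF upper_Gamma_deriv[OF rho] dW(1)[OF zS]]) simp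
    then have "(f has_field_derivative - (exp (- W z) * W z powr (?r - 1)) * W1 z) (at z)"
      by (rule has_field_derivative_transform_within_open[OF _ N(1) z]) (use N(4) in simp)
    then have "deriv f z = - (exp (- W z) * W z powr (?r - 1)) * W1 z" by (rule DERIV_imp_deriv)
    then show ?thesis by (simp add: g_def exp_minus field_simps)
  qed
  \<comment> \<open>The logarithmic derivative of W^(\<rho>-1) W' multiplied by W W': the fractional
    power cancels. What remains relates holomorphic functions on all of \<open>S\<close> and so
    continues from \<open>N\<close> to the zero \<open>z0\<close>.\<close>
  have odeN: "W z * W1 z * deriv g z = ((?r - 1) * (W1 z)\<^sup>2 + W z * W2 z) * g z" if z: "z \<in> N" for z
  proof -
    have zS: "z \<in> S" using z N(3) by auto
    have Wz: "W z \<notin> \<real>\<^sub>\<le>\<^sub>0" "W z \<noteq> 0" using N(4)[OF z] by auto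
    have p: "W z powr (?r - 1 - 1) * W z = W z powr (?r - 1)"
      using powr_diff[of "W z" "?r - 1" 1] Wz(2) by simp
    have "((\<lambda>z. - (W z powr (?r - 1) * W1 z)) has_field_derivative
       - ((?r - 1) * W z powr (?r - 1 - 1) * W1 z * W1 z + W z powr (?r - 1) * W2 z)) (at z)"
      using Wz dW[OF zS] by (auto intro!: derivative_eq_intros simp: algebra_simps)
    then have "(g has_field_derivative - ((?r - 1) * W z powr (?r - 1 - 1) * W1 z * W1 z + W z powr (?r - 1) * W2 z)) (at z)"
      by (rule has_field_derivative_transform_within_open[OF _ N(1) z]) (use gN in simp)
    then have dg: "deriv g z = - ((?r - 1) * W z powr (?r - 1 - 1) * W1 z * W1 z + W z powr (?r - 1) * W2 z)"
      by (rule DERIV_imp_deriv)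
    have "W z * W1 z * deriv g z = - ((?r - 1) * (W z powr (?r - 1 - 1) * W z) * W1 z * W1 z + W z * W z powr (?r - 1) * W2 z) * W1 z"
      unfolding dg by (simp add: algebra_simps)
    also have "\<dots> = ((?r - 1) * (W1 z)\<^sup>2 + W z * W2 z) * g z"
      unfolding p gN[OF z] by (simp add: algebra_simps power2_eq_square)
    finally show ?thesis .
  qed
  have N0: "N \<noteq> {}" using N(2) by auto
  have ode: "W z * W1 z * deriv g z = ((?r - 1) * (W1 z)\<^sup>2 + W z * W2 z) * g z" if "z \<in> S" for z
    by (rule analytic_continuation_open[OF N(1) S(1) N0 S(2) N(3), where f = "\<lambda>z. W z * W1 z * deriv g z"
          and g = "\<lambda>z. ((?r - 1) * (W1 z)\<^sup>2 + W z * W2 z) * g z"])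
       (use that odeN in \<open>auto intro!: holomorphic_intros W hW1 hW2 hg hg1\<close>)
  have an: "F analytic_on {z0}" if "F holomorphic_on S" for F
    using that S(1,4) by (meson analytic_at)
  define G where "G = fps_expansion g z0"
  define P where "P = fps_expansion W z0"
  have eW: "(\<lambda>x. W (z0 + x)) has_fps_expansion P" unfolding P_def by (intro analytic_at_imp_has_fps_expansion an W)
  have eW1: "(\<lambda>x. W1 (z0 + x)) has_fps_expansion fps_deriv P" unfolding P_def W1_def fps_expansion_deriv[symmetric]
    by (intro analytic_at_imp_has_fps_expansion an hW1[unfolded W1_def])
  have eW2: "(\<lambda>x. W2 (z0 + x)) has_fps_expansion fps_deriv (fps_deriv P)" unfolding P_def W1_def W2_def fps_expansion_deriv[symmetric]
    by (intro analytic_at_imp_has_fps_expansion an hW2[unfolded W2_def W1_def])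
  have eg: "(\<lambda>x. g (z0 + x)) has_fps_expansion G" unfolding G_def by (intro analytic_at_imp_has_fps_expansion an hg)
  have eg1: "(\<lambda>x. deriv g (z0 + x)) has_fps_expansion fps_deriv G" unfolding G_def fps_expansion_deriv[symmetric]
    by (intro analytic_at_imp_has_fps_expansion an hg1)
  have eqP: "P * fps_deriv P * fps_deriv G = (fps_const (?r - 1) * (fps_deriv P)\<^sup>2 + P * fps_deriv (fps_deriv P)) * G"
  proof (rule fps_expansion_unique_complex)
    show "(\<lambda>x. W (z0 + x) * W1 (z0 + x) * deriv g (z0 + x)) has_fps_expansion P * fps_deriv P * fps_deriv G"
      by (intro fps_expansion_intros eW eW1 eg1)
    have "(\<lambda>x. ((?r - 1) * (W1 (z0 + x))\<^sup>2 + W (z0 + x) * W2 (z0 + x)) * g (z0 + x)) has_fps_expansion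
        (fps_const (?r - 1) * (fps_deriv P)\<^sup>2 + P * fps_deriv (fps_deriv P)) * G"
      by (intro fps_expansion_intros eW eW1 eW2 eg)
    also have "?this \<longleftrightarrow> (\<lambda>x. W (z0 + x) * W1 (z0 + x) * deriv g (z0 + x)) has_fps_expansion
        (fps_const (?r - 1) * (fps_deriv P)\<^sup>2 + P * fps_deriv (fps_deriv P)) * G"
    proof (rule has_fps_expansion_cong[OF _ refl])
      have "open ((\<lambda>x. z0 + x) -` S)" using S(1) by (intro open_vimage) (auto intro!: continuous_intros)
      then have "\<forall>\<^sub>F x in nhds 0. x \<in> (\<lambda>x. z0 + x) -` S" using S(4) by (intro eventually_nhds_in_open) auto
      then show "\<forall>\<^sub>F x in nhds 0. ((?r - 1) * (W1 (z0 + x))\<^sup>2 + W (z0 + x) * W2 (z0 + x)) * g (z0 + x) = W (z0 + x) * W1 (z0 + x) * deriv g (z0 + x)"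
        by eventually_elim (simp add: ode)
    qed
    finally show "(\<lambda>x. W (z0 + x) * W1 (z0 + x) * deriv g (z0 + x)) has_fps_expansion
        (fps_const (?r - 1) * (fps_deriv P)\<^sup>2 + P * fps_deriv (fps_deriv P)) * G" .
  qed
  define Q where "Q = fps_shift 1 P"
  have P0: "fps_nth P 0 = 0" using zero by (simp add: P_def fps_expansion_def)
  have P1: "fps_nth P 1 = W1 z0" by (simp add: P_def fps_expansion_def W1_def)
  \<comment> \<open>As W(z0) = 0, one factor X splits off and can be paired with the derivative of
    \<open>G\<close>: multiplication of the derivative by X multiplies the i-th coefficient by
    i.\<close>
  have PQ: "P = Q * fps_X"
    by (rule fps_ext) (simp add: Q_def P0)
  define p where "p = W1 z0"
  have p: "p \<noteq> 0" using zero(2) by (simp add: p_def W1_def)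
  \<comment> \<open>If \<open>g\<close> vanished near \<open>z0\<close> it would vanish on
    \<open>S\<close>; on \<open>N\<close> this forces W' = 0 since the power of \<open>W\<close> is
    nonzero there, and then W'(z0) = 0.\<close>
  have "G \<noteq> 0"
  proof
    assume "G = 0"
    then have "\<forall>\<^sub>F x in nhds 0. g (z0 + x) = 0" using eg by (simp add: has_fps_expansion_0_iff)
    then obtain M where M: "open M" "0 \<in> M" "\<And>x. x \<in> M \<Longrightarrow> g (z0 + x) = 0" unfolding eventually_nhds by blast
    define M' where "M' = (\<lambda>x. x - z0) -` M \<inter> S"
    have M': "open M'" "z0 \<in> M'" "M' \<subseteq> S"
      using M S unfolding M'_def by (auto intro!: open_vimage continuous_intros open_Int)
    have M'g: "g x = 0" if "x \<in> M'" for x using M(3)[of "x - z0"] that by (simp add: M'_def)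
    have M'0: "M' \<noteq> {}" using M'(2) by blast
    have gS: "g z = 0" if "z \<in> S" for z
      by (rule analytic_continuation_open[OF M'(1) S(1) M'0 S(2) M'(3) hg, of "\<lambda>_. 0"]) (use that M'g in auto)
    have W1N: "W1 z = 0" if "z \<in> N" for z
    proof -
      have "z \<in> S" "W z \<noteq> 0" using N(3) N(4)[OF that] that by auto
      then show ?thesis using gN[OF that] gS[of z] by simp
    qed
    have "W1 z0 = 0"
      by (rule analytic_continuation_open[OF N(1) S(1) N0 S(2) N(3) hW1, of "\<lambda>_. 0"]) (use W1N S in auto)
    then show False using p by (simp add: p_def)
  qed
  define n where "n = subdegree G"
  have Gn: "fps_nth G n \<noteq> 0" using \<open>G \<noteq> 0\<close> by (simp add: n_def)
  have Gl: "fps_nth G i = 0" if "i < n" for i using that unfolding n_def by (rule nth_less_subdegree_zero)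
  have XG: "fps_nth (fps_X * fps_deriv G) i = of_nat i * fps_nth G i" for i
    by (cases i) auto
  \<comment> \<open>Comparing lowest coefficients: if n is the order of \<open>g\<close> at
    \<open>z0\<close> and p = W'(z0), then p^2 n = p^2 (\<rho> - 1), which is impossible for a
    natural number n.\<close>
  have "fps_nth ((Q * fps_deriv P) * (fps_X * fps_deriv G)) n = fps_nth ((fps_const (?r - 1) * (fps_deriv P)\<^sup>2 + P * fps_deriv (fps_deriv P)) * G) n"
  proof -
    have "P * D * E = (Q * D) * (fps_X * E)" for D E by (subst PQ) (simp only: mult_ac)
    from this[of "fps_deriv P" "fps_deriv G"]
    have "(Q * fps_deriv P) * (fps_X * fps_deriv G) = (fps_const (?r - 1) * (fps_deriv P)\<^sup>2 + P * fps_deriv (fps_deriv P)) * G"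
      unfolding eqP by (rule sym)
    then show ?thesis by (rule arg_cong[of _ _ "\<lambda>F. fps_nth F n"])
  qed
  also have "fps_nth ((Q * fps_deriv P) * (fps_X * fps_deriv G)) n = fps_nth (Q * fps_deriv P) 0 * fps_nth (fps_X * fps_deriv G) n"
    by (rule fps_mult_nth_leading) (simp only: XG Gl mult_zero_right)
  also have "fps_nth ((fps_const (?r - 1) * (fps_deriv P)\<^sup>2 + P * fps_deriv (fps_deriv P)) * G) n
      = fps_nth (fps_const (?r - 1) * (fps_deriv P)\<^sup>2 + P * fps_deriv (fps_deriv P)) 0 * fps_nth G n"
    by (rule fps_mult_nth_leading) (rule Gl)
  also have "fps_nth (Q * fps_deriv P) 0 = p * p" using P1 by (simp add: Q_def p_def)
  also have "fps_nth (fps_const (?r - 1) * (fps_deriv P)\<^sup>2 + P * fps_deriv (fps_deriv P)) 0 = (?r - 1) * (p * p)"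
    using P0 P1 by (simp add: p_def power2_eq_square)
  finally have "p * p * (of_nat n * fps_nth G n) = (?r - 1) * (p * p) * fps_nth G n"
    unfolding XG .
  moreover have "a = b" if "p * p * (a * x) = b * (p * p) * x" "p \<noteq> 0" "x \<noteq> 0" for p x a b :: complex
    using that by simp
  ultimately have "of_nat n = ?r - 1" using p Gn by blast
  then have "Re (of_nat n) = Re (?r - 1)" by (rule arg_cong)
  then have "real n = \<rho> - 1" by simp
  then show False using rho by linarith
qed

section \<open>Continuous logarithms\<close>

lemma log_unique:
  fixes f g :: "'a::topological_space \<Rightarrow> complex"
  assumes T: "connected T" "a \<in> T" and c: "continuous_on T f" "continuous_on T g"
    and e: "\<And>x. x \<in> T \<Longrightarrow> exp (f x) = exp (g x)" and a: "f a = g a" and x: "x \<in> T"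
  shows "f x = g x"
proof -
  let ?d = "\<lambda>x. f x - g x"
  have ints: "\<exists>n::int. ?d x = of_int n * (2 * pi * \<i>)" if x: "x \<in> T" for x
  proof -
    from e[OF x] obtain n where "f x = g x + complex_of_real (real_of_int (2 * n) * pi) * \<i>" unfolding exp_eq by blast
    then show ?thesis by (intro exI[of _ n]) simp
  qed
  have "?d constant_on T"
  proof (rule continuous_discrete_range_constant[OF T(1)])
    show "continuous_on T ?d" by (intro continuous_intros c)
    fix x assume x: "x \<in> T"
    show "\<exists>e>0. \<forall>y. y \<in> T \<and> ?d y \<noteq> ?d x \<longrightarrow> e \<le> norm (?d y - ?d x)"
    proof (intro exI[of _ "2 * pi"] conjI allI impI)
      fix y assume y: "y \<in> T \<and> ?d y \<noteq> ?d x"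
      obtain m where m: "?d y = of_int m * (2 * pi * \<i>)" using ints y by blast
      obtain n where n: "?d x = of_int n * (2 * pi * \<i>)" using ints[OF x] by blast
      note mn = m n
      with y have "m \<noteq> n" by auto
      then have "1 \<le> \<bar>real_of_int (m - n)\<bar>" by linarith
      moreover have "?d y - ?d x = of_int (m - n) * (2 * pi * \<i>)" unfolding mn by (simp add: algebra_simps)
      ultimately show "2 * pi \<le> norm (?d y - ?d x)" by (simp only: norm_mult norm_of_int) simp
    qed simp
  qed
  then obtain c where c: "\<And>x. x \<in> T \<Longrightarrow> ?d x = c" unfolding constant_on_def by blast
  from c[OF T(2)] a have "c = 0" by simp
  with c[OF x] show ?thesis by simp
qed

text \<open>Near \<open>z1\<close> the quotient W / W(z1) stays in the unit disc about 1 and thus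
  off the slit, so its \<open>Ln\<close> shifted by \<open>L z1\<close> is a holomorphic logarithm
  of \<open>W\<close>. By \<open>log_unique\<close> it is \<open>L\<close>.\<close>

lemma continuous_log_holomorphic:
  assumes S: "open S" and W: "W holomorphic_on S" and L: "continuous_on S L"
    and e: "\<And>z. z \<in> S \<Longrightarrow> exp (L z) = W z"
  shows "L holomorphic_on S"
  unfolding holomorphic_on_open[OF S]
proof
  fix z1 assume z1: "z1 \<in> S"
  have W1: "W z1 \<noteq> 0" using e[OF z1] exp_not_eq_zero[of "L z1"] by simp
  let ?q = "\<lambda>z. W z / W z1"
  have hq: "?q holomorphic_on S" using W1 by (intro holomorphic_intros W)
  then have "isCont ?q z1"
    using holomorphic_on_imp_continuous_on[OF hq] continuous_on_eq_continuous_at[OF S, of ?q] z1 by simp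
  then have "(?q \<longlongrightarrow> 1) (at z1)" using W1 by (simp add: isCont_def)
  then have "\<forall>\<^sub>F z in at z1. ?q z \<in> ball 1 1" by (intro topological_tendstoD) auto
  then have "\<forall>\<^sub>F z in nhds z1. ?q z \<in> ball 1 1" using W1 by (simp add: eventually_nhds_conv_at)
  moreover have "\<forall>\<^sub>F z in nhds z1. z \<in> S" using S z1 by (rule eventually_nhds_in_open)
  ultimately have "\<forall>\<^sub>F z in nhds z1. ?q z \<in> ball 1 1 \<and> z \<in> S" by (rule eventually_conj)
  then obtain r where r: "r > 0" "\<And>z. dist z z1 < r \<Longrightarrow> ?q z \<in> ball 1 1 \<and> z \<in> S"
    unfolding eventually_nhds_metric by blast
  have bS: "z \<in> S" "?q z \<notin> \<real>\<^sub>\<le>\<^sub>0" if "z \<in> ball z1 r" for z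
  proof -
    have "dist z z1 < r" using that unfolding mem_ball by (subst dist_commute)
    from r(2)[OF this] have *: "?q z \<in> ball 1 1" "z \<in> S" by auto
    have "\<bar>Re (1 - ?q z)\<bar> < 1" using *(1) abs_Re_le_cmod[of "1 - ?q z"] by (simp only: mem_ball dist_norm)
    then have "Re (?q z) > 0" by (simp only: minus_complex.sel one_complex.sel)
    then show "?q z \<notin> \<real>\<^sub>\<le>\<^sub>0" unfolding complex_nonpos_Reals_iff by linarith
    show "z \<in> S" by (rule *(2))
  qed
  have hk: "(\<lambda>z. Ln (?q z) + L z1) holomorphic_on ball z1 r"
    by (intro holomorphic_on_add holomorphic_on_const holomorphic_on_Ln' holomorphic_on_subset[OF hq] subsetI bS)
  have eq: "Ln (?q z) + L z1 = L z" if z: "z \<in> ball z1 r" for z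
  proof (rule log_unique[of "ball z1 r" z1 "\<lambda>z. Ln (?q z) + L z1" L])
    show "continuous_on (ball z1 r) (\<lambda>z. Ln (?q z) + L z1)" using hk by (rule holomorphic_on_imp_continuous_on)
    show "continuous_on (ball z1 r) L" using bS(1) by (intro continuous_on_subset[OF L] subsetI)
    fix x assume x: "x \<in> ball z1 r"
    then have "?q x \<noteq> 0" using bS(2)[OF x] by auto
    then show "exp (Ln (?q x) + L z1) = exp (L x)" using bS(1)[OF x] z1 W1 e by (simp add: exp_add)
  qed (use r z W1 in auto)
  have "(\<lambda>z. Ln (?q z) + L z1) holomorphic_on ball z1 r \<longleftrightarrow> L holomorphic_on ball z1 r"
    by (rule holomorphic_cong[OF refl eq])
  with hk have "L holomorphic_on ball z1 r" by simp
  then show "\<exists>f'. (L has_field_derivative f') (at z1)"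
    using holomorphic_derivI[OF _ open_ball, of L z1 r z1] r(1) by auto
qed


section \<open>The quadratic argument and its zeros\<close>

definition quad_arg :: "complex \<Rightarrow> complex \<Rightarrow> complex \<Rightarrow> complex \<Rightarrow> complex \<Rightarrow> complex \<Rightarrow> complex" where
  "quad_arg C A B X s z = C + (z\<^sup>2 * X + 2 * s * z * B + s\<^sup>2 * A) / 2"

lemma quad_arg_holomorphic_z: "quad_arg C A B X s holomorphic_on S"
  unfolding quad_arg_def by (intro holomorphic_intros) auto

lemma deriv_quad_arg_z: "deriv (quad_arg C A B X s) z = z * X + s * B"
  unfolding quad_arg_def by (rule DERIV_imp_deriv) (auto intro!: derivative_eq_intros simp: field_simps)

text \<open>The inequality of arithmetic and geometric means splits the cross term and uses up half
  of the coefficient Re A / 2 of s^2. So the real part grows quadratically in \<open>s\<close>,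
  uniformly for bounded \<open>z\<close>.\<close>

lemma Re_quad_arg_ge:
  fixes s \<theta> :: real
  assumes A: "Re A > 0"
  shows "\<theta> - (cmod z)\<^sup>2 * ((cmod B)\<^sup>2 / Re A + cmod X / 2) + (Re A / 4) * s\<^sup>2 \<le> Re (quad_arg (of_real \<theta>) A B X (of_real s) z)"
proof -
  have 1: "- ((cmod z)\<^sup>2 * cmod X) \<le> Re (z\<^sup>2 * X)"
    using abs_Re_le_cmod[of "z\<^sup>2 * X"] by (simp add: norm_mult norm_power abs_le_iff)
  have "\<bar>Re (of_real s * z * B)\<bar> \<le> \<bar>s\<bar> * (cmod z * cmod B)"
    using abs_Re_le_cmod[of "of_real s * z * B"] by (simp add: norm_mult mult.assoc)
  also have "\<bar>s\<bar> * (cmod z * cmod B) \<le> Re A / 4 * s\<^sup>2 + (cmod z * cmod B)\<^sup>2 / Re A"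
  proof -
    have "0 \<le> (Re A / 2 * \<bar>s\<bar> - cmod z * cmod B)\<^sup>2 / Re A" using A by simp
    also have "\<dots> = Re A / 4 * s\<^sup>2 + (cmod z * cmod B)\<^sup>2 / Re A - \<bar>s\<bar> * (cmod z * cmod B)"
      using A by (simp add: power2_diff power2_eq_square field_simps)
    finally show ?thesis by simp
  qed
  finally have 2: "- (Re A / 4 * s\<^sup>2 + (cmod z * cmod B)\<^sup>2 / Re A) \<le> Re (of_real s * z * B)" by linarith
  have "Re (quad_arg (of_real \<theta>) A B X (of_real s) z) = \<theta> + Re (z\<^sup>2 * X) / 2 + Re (of_real s * z * B) + s\<^sup>2 * Re A / 2"
  proof -
    have "quad_arg (of_real \<theta>) A B X (of_real s) z = of_real \<theta> + z\<^sup>2 * X / 2 + of_real s * z * B + of_real (s\<^sup>2) * A / 2"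
      by (simp add: quad_arg_def field_simps)
    moreover have "Re (of_real (s\<^sup>2) * A / 2) = s\<^sup>2 * Re A / 2"
      by (simp only: Re_divide_numeral times_complex.sel Re_complex_of_real Im_complex_of_real) simp
    ultimately show ?thesis by (simp only: plus_complex.sel Re_complex_of_real Re_divide_numeral)
  qed
  with 1 2 show ?thesis by (simp add: field_simps power_mult_distrib)
qed

text \<open>A double zero \<open>z0\<close> of \<open>quad_arg C A B X s0\<close> splits into two simple ones when \<open>s0\<close> is moved.\<close>

lemma quad_arg_simple_zero_nearby:
  fixes s0 \<theta> :: real
  assumes th: "\<theta> > 0" and A: "Re A > 0"
    and z0: "cmod z0 < R" "quad_arg (of_real \<theta>) A B X (of_real s0) z0 = 0"
  shows "\<exists>s1 z1. cmod z1 < R \<and> quad_arg (of_real \<theta>) A B X (of_real s1) z1 = 0 \<and> z1 * X + of_real s1 * B \<noteq> 0"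
proof (cases "z0 * X + of_real s0 * B = 0")
  case False
  with z0 show ?thesis by blast
next
  case True
  have nz: "complex_of_real \<theta> + (of_real s0)\<^sup>2 * A / 2 \<noteq> 0"
  proof -
    have "Re (complex_of_real \<theta> + (of_real s0)\<^sup>2 * A / 2) = \<theta> + s0\<^sup>2 * Re A / 2"
      by (simp flip: of_real_power)
    also have "\<dots> > 0" using th A by (simp add: add_pos_nonneg)
    finally show ?thesis by (metis less_irrefl zero_complex.sel(1))
  qed
  \<comment> \<open>Without the term in z^2 a double zero means s0 B = 0; the argument is then
    constant in \<open>z\<close> with positive real part.\<close>
  have X: "X \<noteq> 0"
  proof
    assume "X = 0"
    with True z0(2) nz show False by (auto simp: quad_arg_def)
  qed
  have eq0: "z0\<^sup>2 * X + 2 * of_real s0 * z0 * B + (of_real s0)\<^sup>2 * A = - 2 * of_real \<theta>"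
    using z0(2) by (simp add: quad_arg_def field_simps add_eq_0_iff)
  \<comment> \<open>A quarter of the discriminant of the quadratic in \<open>z\<close>: at a root,
    (z X + s B)^2 = D(s). The double zero says that D(s0) = 0.\<close>
  define D where "D = (\<lambda>s::complex. s\<^sup>2 * (B\<^sup>2 - X * A) - 2 * of_real \<theta> * X)"
  have D0: "(of_real s0)\<^sup>2 * (B\<^sup>2 - X * A) = 2 * of_real \<theta> * X"
  proof -
    have "(z0 * X + of_real s0 * B)\<^sup>2 = X * (z0\<^sup>2 * X + 2 * of_real s0 * z0 * B + (of_real s0)\<^sup>2 * A) + (of_real s0)\<^sup>2 * (B\<^sup>2 - X * A)"
      by (simp add: power2_eq_square algebra_simps)
    then have "0 = X * (- 2 * of_real \<theta>) + (of_real s0)\<^sup>2 * (B\<^sup>2 - X * A)" unfolding True eq0 by simp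
    then show ?thesis by (simp add: algebra_simps)
  qed
  \<comment> \<open>Scaling \<open>s0\<close> by 1 + e changes the discriminant from 0 to e (2 + e)
    2 \<theta> X, which is nonzero for every e > 0.\<close>
  define sg where "sg = (\<lambda>e::real. (1 + e) * s0)"
  have De: "D (of_real (sg e)) = of_real (e * (2 + e)) * (2 * of_real \<theta> * X)" for e
  proof -
    have "D (of_real (sg e)) = (1 + of_real e)\<^sup>2 * ((of_real s0)\<^sup>2 * (B\<^sup>2 - X * A)) - 2 * of_real \<theta> * X"
      by (simp add: D_def sg_def power_mult_distrib mult.assoc)
    then show ?thesis unfolding D0 by (simp add: power2_eq_square algebra_simps)
  qed
  \<comment> \<open>One of the two roots for \<open>sg e\<close>; either would do, as the square
    root tends to 0 with \<open>e\<close> and both roots tend to \<open>z0\<close>.\<close>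
  define ze where "ze = (\<lambda>e::real. (- of_real (sg e) * B + csqrt (of_real (e * (2 + e)) * (2 * of_real \<theta> * X))) / X)"
  have zX: "ze e * X + of_real (sg e) * B = csqrt (D (of_real (sg e)))" for e
    unfolding De ze_def using X by simp
  have q: "quad_arg (of_real \<theta>) A B X (of_real (sg e)) (ze e) = 0" for e
  proof -
    let ?s = "complex_of_real (sg e)" and ?z = "ze e"
    have "(?z * X + ?s * B)\<^sup>2 = D ?s" unfolding zX by simp
    also have "(?z * X + ?s * B)\<^sup>2 = X * (?z\<^sup>2 * X + 2 * ?s * ?z * B + ?s\<^sup>2 * A) + ?s\<^sup>2 * (B\<^sup>2 - X * A)"
      by (simp add: power2_eq_square algebra_simps)
    finally have "X * (?z\<^sup>2 * X + 2 * ?s * ?z * B + ?s\<^sup>2 * A + 2 * of_real \<theta>) = 0" by (simp add: D_def algebra_simps)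
    then have "?z\<^sup>2 * X + 2 * ?s * ?z * B + ?s\<^sup>2 * A + 2 * of_real \<theta> = 0" using X by (simp only: mult_eq_0_iff) simp
    moreover have "2 * quad_arg (of_real \<theta>) A B X ?s ?z = ?z\<^sup>2 * X + 2 * ?s * ?z * B + ?s\<^sup>2 * A + 2 * of_real \<theta>"
      by (simp add: quad_arg_def)
    ultimately show ?thesis by simp
  qed
  have "((\<lambda>e. csqrt (of_real (e * (2 + e)) * (2 * of_real \<theta> * X))) \<longlongrightarrow> 0) (at_right 0)"
  proof (rule tendsto_norm_zero_cancel)
    have n: "norm (csqrt (of_real (e * (2 + e)) * (2 * of_real \<theta> * X))) = sqrt (\<bar>e * (2 + e)\<bar> * (cmod (2 * of_real \<theta> * X)))" for e
      by (simp only: norm_csqrt norm_mult norm_of_real)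
    have "((\<lambda>e::real. sqrt (\<bar>e * (2 + e)\<bar> * (cmod (2 * of_real \<theta> * X)))) \<longlongrightarrow> sqrt (\<bar>0 * (2 + 0)\<bar> * (cmod (2 * of_real \<theta> * X)))) (at_right 0)"
      by (intro tendsto_intros)
    then show "((\<lambda>e. norm (csqrt (of_real (e * (2 + e)) * (2 * of_real \<theta> * X)))) \<longlongrightarrow> 0) (at_right 0)"
      unfolding n by simp
  qed
  then have "(ze \<longlongrightarrow> (- of_real ((1 + 0) * s0) * B + 0) / X) (at_right 0)"
    unfolding ze_def sg_def using X by (intro tendsto_intros) auto
  moreover have "(- of_real ((1 + 0) * s0) * B + 0) / X = z0" using True X by (simp add: field_simps add_eq_0_iff)
  ultimately have "(ze \<longlongrightarrow> z0) (at_right 0)" by simp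
  then have "((\<lambda>e. cmod (ze e)) \<longlongrightarrow> cmod z0) (at_right 0)" by (rule tendsto_norm)
  then have "\<forall>\<^sub>F e in at_right 0. cmod (ze e) < R" using z0(1) by (rule order_tendstoD)
  moreover have "\<forall>\<^sub>F e::real in at_right 0. e > 0" by (rule eventually_at_right_less)
  ultimately have "\<forall>\<^sub>F e in at_right 0. cmod (ze e) < R \<and> e > 0" by (rule eventually_conj)
  then obtain e where e: "cmod (ze e) < R" "e > 0"
    using eventually_happens'[OF trivial_limit_at_right_real[of 0]] by blast
  have "e * (2 + e) \<noteq> 0" using e(2) by simp
  then have "D (of_real (sg e)) \<noteq> 0" unfolding De using th X by (simp only: mult_eq_0_iff of_real_eq_0_iff) simp
  then have "ze e * X + of_real (sg e) * B \<noteq> 0" unfolding zX by simp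
  with e q show ?thesis by blast
qed

text \<open>If \<open>k = 0\<close> were possible at some \<open>z0\<close> in the unit disc, then along the segment from \<open>0\<close> to \<open>z0\<close> one
  of the two roots in \<open>s\<close> of the quadratic would cross the real axis.\<close>

lemma Re_k_pos:
  fixes \<theta> :: real
  assumes th: "\<theta> > 0" and A: "Re A > 0"
    and nz: "\<And>(s::real) z. cmod z \<le> 1 \<Longrightarrow> quad_arg (of_real \<theta>) A B X (of_real s) z \<noteq> 0"
  shows "cmod ((X - B\<^sup>2 / A) / 2) < \<theta>"
proof (rule ccontr)
  define K where "K = (X - B\<^sup>2 / A) / 2"
  assume "\<not> cmod ((X - B\<^sup>2 / A) / 2) < \<theta>"
  then have K: "cmod K \<ge> \<theta>" by (simp add: K_def)
  then have K0: "K \<noteq> 0" using th by auto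
  have A0: "A \<noteq> 0" using A by auto
  \<comment> \<open>Chosen so that \<theta> + z0^2 K = 0; it lies in the closed unit disc because
    |K| \<ge> \<theta>.\<close>
  define z0 where "z0 = csqrt (- of_real \<theta> / K)"
  have z02: "z0\<^sup>2 * K = - of_real \<theta>" using K0 by (simp add: z0_def)
  have z0n: "cmod z0 \<le> 1"
    using K th K0 by (simp add: z0_def norm_divide divide_le_eq real_sqrt_le_1_iff)
  define m where "m = Im (- z0 * B / A)"
  \<comment> \<open>For t = 0 the imaginary part of the root \<open>sc t\<close> has the sign of
    \<sigma>; for t = 1 the square root term is gone and the imaginary part is \<open>m\<close>.
    With \<sigma> opposite to the sign of \<open>m\<close>, it passes through 0 in between.\<close>
  define \<sigma> :: real where "\<sigma> = (if m \<ge> 0 then - 1 else 1)"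
  have sig: "\<sigma>\<^sup>2 = 1" by (simp add: \<sigma>_def)
  define rt where "rt = 1 / csqrt A"
  have rt2: "rt\<^sup>2 = 1 / A" by (simp add: rt_def power_divide)
  have rtp: "Re rt > 0"
  proof -
    have "Re (csqrt A) \<noteq> 0"
    proof
      assume z: "Re (csqrt A) = 0"
      have "Re A = Re ((csqrt A)\<^sup>2)" by simp
      also have "\<dots> = (Re (csqrt A))\<^sup>2 - (Im (csqrt A))\<^sup>2" by (rule Re_power2)
      also have "\<dots> \<le> 0" unfolding z by simp
      finally show False using A by simp
    qed
    then have "Re (csqrt A) > 0" using csqrt_principal[of A] by blast
    moreover have "Re rt = Re (csqrt A) / ((Re (csqrt A))\<^sup>2 + (Im (csqrt A))\<^sup>2)"
      unfolding rt_def by (simp only: inverse_eq_divide[symmetric] inverse_complex.sel)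
    ultimately show ?thesis by (simp only:) (intro divide_pos_pos add_pos_nonneg, auto)
  qed
  \<comment> \<open>At z = t z0 the completed square reads \<theta> (1 - t^2) + (A/2) (s + z B /
    A)^2. Solving for \<open>s\<close> gives \<open>sc t\<close>, with i \<open>h t\<close>
    \<open>rt\<close> as a root of -2 \<theta> (1 - t^2) / A.\<close>
  define h where "h = (\<lambda>t::real. sqrt (2 * \<theta> * (1 - t\<^sup>2)))"
  define sc where "sc = (\<lambda>t::real. - of_real t * z0 * B / A + of_real (\<sigma> * h t) * \<i> * rt)"
  have root: "quad_arg (of_real \<theta>) A B X (sc t) (of_real t * z0) = 0" if t: "0 \<le> t" "t \<le> 1" for t
  proof -
    have t2: "t\<^sup>2 \<le> 1" using t by (simp add: power_le_one)
    have h2: "(h t)\<^sup>2 = 2 * \<theta> * (1 - t\<^sup>2)" using t2 th by (simp add: h_def)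
    let ?z = "of_real t * z0" and ?s = "sc t"
    have "quad_arg (of_real \<theta>) A B X ?s ?z = of_real \<theta> + ?z\<^sup>2 * K + A / 2 * (?s + ?z * B / A)\<^sup>2"
      unfolding quad_arg_def K_def using A0 by (simp add: power2_eq_square field_simps)
    also have "?s + ?z * B / A = of_real (\<sigma> * h t) * \<i> * rt" by (simp add: sc_def)
    also have "(of_real (\<sigma> * h t) * \<i> * rt)\<^sup>2 = - of_real (2 * \<theta> * (1 - t\<^sup>2)) / A"
    proof -
      have "(of_real (\<sigma> * h t) * \<i> * rt)\<^sup>2 = of_real (\<sigma>\<^sup>2 * (h t)\<^sup>2) * (- 1) * rt\<^sup>2"
        by (simp add: power_mult_distrib)
      then show ?thesis unfolding sig h2 rt2 by simp
    qed
    also have "?z\<^sup>2 * K = of_real (t\<^sup>2) * (- of_real \<theta>)"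
      unfolding z02[symmetric] by (simp add: power_mult_distrib)
    also have "of_real \<theta> + of_real (t\<^sup>2) * (- of_real \<theta>) + A / 2 * (- of_real (2 * \<theta> * (1 - t\<^sup>2)) / A) = 0"
      using A0 by (simp add: field_simps)
    finally show ?thesis .
  qed
  have Imsc: "Im (sc t) = t * m + \<sigma> * (h t * Re rt)" for t
  proof -
    have "sc t = of_real t * (- z0 * B / A) + of_real (\<sigma> * h t) * (\<i> * rt)" by (simp add: sc_def)
    then have "Im (sc t) = t * Im (- z0 * B / A) + \<sigma> * h t * Im (\<i> * rt)"
      by (simp only: plus_complex.sel times_complex.sel(2)[of "of_real _"] Re_complex_of_real Im_complex_of_real mult_zero_left add_0_right)
    moreover have "Im (\<i> * rt) = Re rt" by simp
    ultimately show ?thesis unfolding m_def by (simp only: mult.assoc)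
  qed
  have cont: "continuous_on {0..1} (\<lambda>t. t * (\<bar>m\<bar>) - h t * Re rt)"
    unfolding h_def by (intro continuous_intros)
  have "\<exists>t\<ge>0. t \<le> 1 \<and> t * \<bar>m\<bar> - h t * Re rt = 0"
  proof (rule IVT'[OF _ _ _ cont])
    show "0 * \<bar>m\<bar> - h 0 * Re rt \<le> 0" using rtp th by (simp add: h_def)
    show "0 \<le> 1 * \<bar>m\<bar> - h 1 * Re rt" by (simp add: h_def)
  qed simp
  then obtain t where t: "0 \<le> t" "t \<le> 1" "t * \<bar>m\<bar> - h t * Re rt = 0" by blast
  have "Im (sc t) = 0" unfolding Imsc using t(3) by (auto simp: \<sigma>_def abs_if split: if_splits)
  then have "sc t = of_real (Re (sc t))" by (simp add: complex_eq_iff)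
  moreover have "cmod (of_real t * z0) \<le> 1" using t z0n by (simp add: norm_mult mult_le_one)
  ultimately show False using nz[of "of_real t * z0" "Re (sc t)"] root[OF t(1,2)] by simp
qed

text \<open>The complex analytic part on its own: \<open>h s z\<close> will be \<open>Z\<close>
  times the T-transform of \<open>E s\<close> at z \<xi>. Holomorphy in \<open>z\<close> and the
  germ at z = 0 are the data; how \<open>h\<close> depends on \<open>s\<close> has to be
  deduced.\<close>

locale donsker_core =
  fixes \<rho> \<theta> R :: real and A B X :: complex and h :: "real \<Rightarrow> complex \<Rightarrow> complex"
  assumes rho: "0 < \<rho>" "\<rho> < 1" and th: "\<theta> > 0" and R: "R > 1" and A: "Re A > 0"
    and hol: "\<And>s. h s holomorphic_on ball 0 R"
    and near: "\<And>s. \<forall>\<^sub>F z in nhds 0. h s z = upper_Gamma (of_real \<rho>) (quad_arg (of_real \<theta>) A B X (of_real s) z)"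
begin

abbreviation w :: "real \<Rightarrow> complex \<Rightarrow> complex" where
  "w s z \<equiv> quad_arg (of_real \<theta>) A B X (of_real s) z"

lemma Re_w_0: "Re (w s 0) > 0"
proof -
  have "Re (w s 0) = \<theta> + s\<^sup>2 * Re A / 2"
    by (simp add: quad_arg_def flip: of_real_power)
  also have "\<dots> > 0" using th A by (simp add: add_pos_nonneg)
  finally show ?thesis .
qed

lemma w_nonzero:
  assumes "cmod z < R"
  shows "w s z \<noteq> 0"
proof
  assume "w s z = 0"
  then obtain s1 z1 where z1: "cmod z1 < R" "w s1 z1 = 0" "z1 * X + of_real s1 * B \<noteq> 0"
    using quad_arg_simple_zero_nearby[OF th A assms] by blast
  show False
  proof (rule upper_Gamma_no_simple_zero[OF rho, of "ball 0 R" z1 "h s1" "w s1"])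
    show "w s1 0 \<notin> \<real>\<^sub>\<le>\<^sub>0" using Re_w_0[of s1] by (auto simp: complex_nonpos_Reals_iff)
    show "deriv (w s1) z1 \<noteq> 0" using z1(3) by (simp add: deriv_quad_arg_z)
  qed (use R z1 hol near quad_arg_holomorphic_z in auto)
qed

lemma k_bound: "cmod ((X - B\<^sup>2 / A) / 2) < \<theta>"
  using w_nonzero R by (intro Re_k_pos th A) auto

lemma h_eq_of_Re_pos:
  assumes r: "0 < r" "r \<le> R" and pos: "\<And>z. cmod z < r \<Longrightarrow> Re (w s z) > 0" and z: "cmod z < r"
  shows "h s z = upper_Gamma (of_real \<rho>) (w s z)"
proof -
  let ?U = "\<lambda>z. upper_Gamma (of_real \<rho>) (w s z)"
  have nr: "w s z \<notin> \<real>\<^sub>\<le>\<^sub>0" if "z \<in> ball 0 r" for z using pos[of z] that by (auto simp: complex_nonpos_Reals_iff)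
  have hU: "?U holomorphic_on ball 0 r"
    using nr by (intro holomorphic_on_compose_gen[OF quad_arg_holomorphic_z upper_Gamma_holomorphic[OF rho], unfolded o_def]) auto
  from near[of s] obtain e where e: "e > 0" "\<And>z. dist z 0 < e \<Longrightarrow> h s z = ?U z" unfolding eventually_nhds_metric by blast
  show ?thesis
  proof (rule analytic_continuation_open[of "ball 0 (min e r)" "ball 0 r" "h s" ?U])
    show "h s holomorphic_on ball 0 r" by (rule holomorphic_on_subset[OF hol]) (use r in auto)
    show "\<And>z. z \<in> ball 0 (min e r) \<Longrightarrow> h s z = ?U z" using e(2) by auto
  qed (use r e z hU in auto)
qed

text \<open>The product domain is convex, so the zero-free \<open>w\<close> has a logarithm
  continuous in (s, z) jointly. The lift composed with it continues the principal value from z = 0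
  no matter where \<open>w\<close> goes, and it is the source of the joint continuity of
  \<open>h\<close>.\<close>

lemma log_w:
  obtains L where "continuous_on (UNIV \<times> ball 0 R) (\<lambda>p. L (fst p) (snd p))"
    "\<And>s z. cmod z < R \<Longrightarrow> h s z = upper_Gamma_lift \<rho> (L s z)"
proof -
  let ?T = "(UNIV :: real set) \<times> ball (0::complex) R"
  have cw: "continuous_on ?T (\<lambda>p. w (fst p) (snd p))"
    unfolding quad_arg_def by (intro continuous_intros) auto
  have ct: "contractible ?T" by (intro convex_imp_contractible convex_Times) auto
  have nz: "w (fst p) (snd p) \<noteq> 0" if "p \<in> ?T" for p using that w_nonzero by auto
  obtain L0 where L0: "continuous_on ?T L0" "\<And>p. p \<in> ?T \<Longrightarrow> w (fst p) (snd p) = exp (L0 p)"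
    using continuous_logarithm_on_contractible[OF cw ct nz] by blast
  define L where "L = (\<lambda>s z. L0 (s, z) - L0 (0, 0) + Ln (of_real \<theta>))"
  have w00: "w 0 0 = of_real \<theta>" by (simp add: quad_arg_def)
  have eL: "exp (L s z) = w s z" if "cmod z < R" for s z
  proof -
    have "exp (L0 (s, z)) = w s z" using L0(2)[of "(s, z)"] that by simp
    moreover have "exp (L0 (0, 0)) = of_real \<theta>" using L0(2)[of "(0, 0)"] R w00 by simp
    ultimately show ?thesis using th by (simp add: L_def exp_add exp_diff)
  qed
  have cL: "continuous_on ?T (\<lambda>p. L (fst p) (snd p))"
    unfolding L_def using L0(1) by (auto intro!: continuous_intros)
  have cLz: "continuous_on (ball 0 R) (L s)" for s
  proof -
    have "continuous_on (ball 0 R) (\<lambda>z. L (fst (s, z)) (snd (s, z)))"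
      by (rule continuous_on_compose2[OF cL]) (auto intro!: continuous_intros)
    then show ?thesis by simp
  qed
  \<comment> \<open>At z = 0 the argument stays in the right half-plane for every \<open>s\<close>;
    continuity in \<open>s\<close> from s = 0 therefore forces the principal logarithm, so that the
    germs at z = 0 can be compared.\<close>
  have L00: "L s 0 = Ln (w s 0)" for s
  proof (rule log_unique[of "UNIV::real set" 0 "\<lambda>s. L s 0" "\<lambda>s. Ln (w s 0)"])
    have "continuous_on UNIV (\<lambda>s. L (fst (s, 0::complex)) (snd (s, 0::complex)))"
      by (rule continuous_on_compose2[OF cL, of UNIV "\<lambda>s. (s, 0)"]) (use R in \<open>auto intro!: continuous_intros\<close>)
    then show "continuous_on UNIV (\<lambda>s. L s 0)" by simp
    have "w s 0 \<notin> \<real>\<^sub>\<le>\<^sub>0" for s using Re_w_0[of s] by (auto simp: complex_nonpos_Reals_iff)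
    then show "continuous_on UNIV (\<lambda>s. Ln (w s 0))"
      unfolding quad_arg_def by (intro continuous_intros) auto
    show "exp (L s 0) = exp (Ln (w s 0))" for s using eL[of 0 s] R w_nonzero[of 0 s] by simp
    show "L 0 0 = Ln (w 0 0)" unfolding w00 by (simp add: L_def)
  qed auto
  have "h s z = upper_Gamma_lift \<rho> (L s z)" if z: "cmod z < R" for s z
  proof -
    have hL: "L s holomorphic_on ball 0 R"
      by (rule continuous_log_holomorphic[OF open_ball quad_arg_holomorphic_z cLz]) (use eL in auto)
    have hG: "upper_Gamma_lift \<rho> holomorphic_on UNIV"
      unfolding holomorphic_on_open[OF open_UNIV] using upper_Gamma_lift_deriv[OF rho] by blast
    have hGL: "(\<lambda>z. upper_Gamma_lift \<rho> (L s z)) holomorphic_on ball 0 R"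
      by (rule holomorphic_on_compose_gen[OF hL hG, unfolded o_def]) auto
    have "isCont (w s) 0" unfolding quad_arg_def by (intro continuous_intros) auto
    then have "((\<lambda>z. Re (w s z)) \<longlongrightarrow> Re (w s 0)) (at 0)" unfolding isCont_def by (rule tendsto_Re)
    then have "\<forall>\<^sub>F z in at 0. Re (w s z) > 0" using Re_w_0 by (rule order_tendstoD(1))
    then have "\<forall>\<^sub>F z in nhds 0. Re (w s z) > 0" using Re_w_0 by (simp add: eventually_nhds_conv_at)
    then obtain e0 where e0: "e0 > 0" "\<And>z. dist z 0 < e0 \<Longrightarrow> Re (w s z) > 0" unfolding eventually_nhds_metric by blast
    define e where "e = min e0 R"
    have e: "e > 0" "e \<le> R" "\<And>z. cmod z < e \<Longrightarrow> Re (w s z) > 0" using e0 R by (auto simp: e_def)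
    have nr: "w s z \<notin> \<real>\<^sub>\<le>\<^sub>0" if "cmod z < e" for z using e(3)[OF that] by (auto simp: complex_nonpos_Reals_iff)
    have LLn: "L s z = Ln (w s z)" if "z \<in> ball 0 e" for z
    proof (rule log_unique[of "ball 0 e" 0 "L s" "\<lambda>z. Ln (w s z)"])
      show "continuous_on (ball 0 e) (L s)" by (rule continuous_on_subset[OF cLz]) (use e in auto)
      show "continuous_on (ball 0 e) (\<lambda>z. Ln (w s z))"
        by (intro continuous_on_Ln' holomorphic_on_imp_continuous_on quad_arg_holomorphic_z) (use nr in auto)
      fix x :: complex assume "x \<in> ball 0 e"
      then have "cmod x < R" using e by auto
      then show "exp (L s x) = exp (Ln (w s x))" using eL w_nonzero by simp
    qed (use e L00 that in auto)
    show ?thesis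
    proof (rule analytic_continuation_open[of "ball 0 e" "ball 0 R" "h s" "\<lambda>z. upper_Gamma_lift \<rho> (L s z)"])
      fix z :: complex assume z: "z \<in> ball 0 e"
      then have "h s z = upper_Gamma (of_real \<rho>) (w s z)" using e by (intro h_eq_of_Re_pos[of e]) auto
      also have "\<dots> = upper_Gamma_lift \<rho> (L s z)" using upper_Gamma_lift_Ln[OF rho nr[of z]] z LLn[OF z] by simp
      finally show "h s z = upper_Gamma_lift \<rho> (L s z)" .
    qed (use e z hol hGL R in auto)
  qed
  with cL that show ?thesis by blast
qed

lemma continuous_h: "continuous_on (UNIV \<times> ball 0 R) (\<lambda>p. h (fst p) (snd p))"
proof -
  obtain L where L: "continuous_on (UNIV \<times> ball 0 R) (\<lambda>p. L (fst p) (snd p))"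
    "\<And>s z. cmod z < R \<Longrightarrow> h s z = upper_Gamma_lift \<rho> (L s z)" using log_w by blast
  have "continuous_on UNIV (upper_Gamma_lift \<rho>)"
    using upper_Gamma_lift_deriv[OF rho] by (intro continuous_at_imp_continuous_on ballI DERIV_isCont)
  then have "continuous_on (UNIV \<times> ball 0 R) (\<lambda>p. upper_Gamma_lift \<rho> (L (fst p) (snd p)))"
    by (rule continuous_on_compose2[OF _ L(1)]) auto
  also have "?this \<longleftrightarrow> ?thesis" using L(2) by (intro continuous_on_cong) auto
  finally show ?thesis .
qed

text \<open>For |s| \<ge> S the argument has real part at least 1 + c s^2 on the whole disc, so
  \<open>h\<close> is the principal value there and decays like a Gaussian. For the remaining
  \<open>s\<close> its joint continuity gives a bound on a compact set.\<close>

lemma integral_h_holomorphic: "(\<lambda>z. LINT s|lborel. h s z) holomorphic_on ball 0 R"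
proof (rule holomorphic_integral_dominated[OF open_ball])
  show "(\<lambda>s. h s u) \<in> borel_measurable lborel" if u: "u \<in> ball 0 R" for u
  proof -
    have "continuous_on UNIV (\<lambda>s. h (fst (s, u)) (snd (s, u)))"
      by (rule continuous_on_compose2[OF continuous_h]) (use u in \<open>auto intro!: continuous_intros\<close>)
    then show ?thesis by (simp add: borel_measurable_continuous_onI)
  qed
  show "(\<lambda>u. h s u) holomorphic_on ball 0 R" for s by (rule hol)
  fix z0 :: complex assume z0: "z0 \<in> ball 0 R"
  define r where "r = (R - cmod z0) / 2"
  have r: "r > 0" using z0 by (simp add: r_def)
  have sub: "cball z0 r \<subseteq> ball 0 R"
  proof
    fix u assume "u \<in> cball z0 r"
    then have "cmod u \<le> cmod z0 + r" using norm_triangle_sub[of u z0] by (simp add: dist_norm norm_minus_commute)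
    then show "u \<in> ball 0 R" using z0 by (simp add: r_def field_simps)
  qed
  define M where "M = R\<^sup>2 * ((cmod B)\<^sup>2 / Re A + cmod X / 2)"
  have M: "M \<ge> 0" using A by (simp add: M_def)
  \<comment> \<open>\<open>Re_quad_arg_ge\<close> offers the coefficient Re A / 4 = 2 c: one half
    outweighs the constant M + 1 once |s| \<ge> S, the other half is left as decay.\<close>
  define c where "c = Re A / 8"
  have c: "c > 0" using A by (simp add: c_def)
  define S where "S = sqrt ((M + 1) / c)"
  have big: "1 + c * s\<^sup>2 \<le> Re (w s z)" if s: "\<bar>s\<bar> \<ge> S" and z: "cmod z < R" for s z
  proof -
    have "0 \<le> S" using M c by (simp add: S_def)
    then have "S\<^sup>2 \<le> s\<^sup>2" using s by (metis abs_le_square_iff abs_of_nonneg)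
    moreover have "S\<^sup>2 = (M + 1) / c" using M c by (simp add: S_def)
    ultimately have "M + 1 \<le> c * s\<^sup>2" using c by (simp add: divide_le_eq mult.commute)
    moreover have "(cmod z)\<^sup>2 * ((cmod B)\<^sup>2 / Re A + cmod X / 2) \<le> M"
      unfolding M_def using z A by (intro mult_right_mono power_mono) auto
    moreover have "(Re A / 4) * s\<^sup>2 = 2 * (c * s\<^sup>2)" by (simp add: c_def)
    ultimately show ?thesis using Re_quad_arg_ge[OF A, of \<theta> z B X s] th by linarith
  qed
  have "bounded ((\<lambda>p. h (fst p) (snd p)) ` ({-S..S} \<times> cball z0 r))"
    by (intro compact_imp_bounded compact_continuous_image continuous_on_subset[OF continuous_h] compact_Times) (use sub in auto)
  then obtain K where K0: "K > 0" and K': "\<forall>x\<in>(\<lambda>p. h (fst p) (snd p)) ` ({-S..S} \<times> cball z0 r). cmod x \<le> K"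
    unfolding bounded_pos by blast
  have K: "cmod (h s z) \<le> K" if "s \<in> {-S..S}" "z \<in> cball z0 r" for s z
    using K' that by (auto simp del: atLeastAtMost_iff mem_cball)
  \<comment> \<open>The factor exp(c S^2) lifts the Gaussian to at least 1 for |s| \<le> S, so one
    majorant serves both ranges.\<close>
  let ?g = "\<lambda>s. (K * exp (c * S\<^sup>2) + 1) * exp (- c * s\<^sup>2)"
  have "integrable lborel ?g" using integrable_gaussian[OF c] by (rule integrable_mult_right)
  moreover have "cmod (h s u) \<le> ?g s" if u: "u \<in> ball 0 R" "dist z0 u < r" for u s
  proof (cases "\<bar>s\<bar> \<ge> S")
    case True
    have "h s u = upper_Gamma (of_real \<rho>) (w s u)"
      using R u(1) big[OF True] c by (intro h_eq_of_Re_pos[of R]) (auto intro!: less_le_trans[OF _ big[OF True]] add_pos_nonneg)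
    moreover have b: "1 + c * s\<^sup>2 \<le> Re (w s u)" using big[OF True, of u] u(1) by simp
    have "0 \<le> c * s\<^sup>2" using c by simp
    then have "1 \<le> Re (w s u)" using b by linarith
    then have "cmod (upper_Gamma (of_real \<rho>) (w s u)) \<le> exp (- Re (w s u)) * 1 powr (\<rho> - 1)"
      by (intro norm_upper_Gamma_le[OF rho]) auto
    ultimately have "cmod (h s u) \<le> exp (- Re (w s u))" by simp
    also have "\<dots> \<le> exp (- c * s\<^sup>2)" using b by simp
    also have "\<dots> \<le> ?g s" using K0 by (simp add: distrib_right)
    finally show ?thesis .
  next
    case False
    then have "cmod (h s u) \<le> K" using u(2) by (intro K) auto
    also have "K \<le> K * (exp (c * S\<^sup>2) * exp (- c * s\<^sup>2))"
    proof -
      have "s\<^sup>2 \<le> S\<^sup>2" using False abs_le_square_iff[of s S] by auto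
      then have "c * s\<^sup>2 \<le> c * S\<^sup>2" using c by (intro mult_left_mono) auto
      then have "1 \<le> exp (c * S\<^sup>2) * exp (- c * s\<^sup>2)" by (simp add: exp_add[symmetric])
      then show ?thesis using K0 by (metis mult.right_neutral mult_le_cancel_left_pos)
    qed
    also have "\<dots> \<le> ?g s" by (simp add: distrib_right mult.assoc)
    finally show ?thesis .
  qed
  ultimately show "\<exists>r>0. \<exists>g. integrable lborel g \<and> (\<forall>u\<in>ball 0 R. dist z0 u < r \<longrightarrow> (\<forall>x\<in>space lborel. cmod (h x u) \<le> g x))"
    using r by blast
qed

text \<open>For small \<open>z\<close> the argument has real part at least \<theta>/2 + (Re A / 4)
  s^2 for all \<open>s\<close>, so \<open>h\<close> is the principal value throughout and the
  Gaussian computation applies, with constant term \<theta> + z^2 X / 2 and linear coefficient z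
  B.\<close>

lemma integral_h_small:
  "\<exists>r>0. \<forall>z. cmod z < r \<longrightarrow> of_real (Gamma (1 - \<rho>)) * (LINT s|lborel. h s z) =
     csqrt (2 * of_real pi / A) * exp (- (of_real \<theta> + z\<^sup>2 * ((X - B\<^sup>2 / A) / 2))) * tricomi_integral (1 - \<rho>) (3/2) (of_real \<theta> + z\<^sup>2 * ((X - B\<^sup>2 / A) / 2))"
proof -
  define M where "M = (cmod B)\<^sup>2 / Re A + cmod X / 2"
  have M: "M \<ge> 0" using A by (simp add: M_def)
  define r where "r = min R (sqrt (\<theta> / (2 * (M + 1))))"
  have r: "r > 0" "r \<le> R" using th M R by (auto simp: r_def)
  have big: "\<theta> / 2 + (Re A / 4) * s\<^sup>2 \<le> Re (w s z)" if z: "cmod z < r" for s z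
  proof -
    have "cmod z \<le> sqrt (\<theta> / (2 * (M + 1)))" using z by (simp add: r_def)
    then have "(cmod z)\<^sup>2 \<le> (sqrt (\<theta> / (2 * (M + 1))))\<^sup>2" by (intro power_mono) auto
    also have "\<dots> = \<theta> / (2 * (M + 1))" using th M by simp
    finally have "(cmod z)\<^sup>2 * (M + 1) \<le> \<theta> / (2 * (M + 1)) * (M + 1)" using M by (intro mult_right_mono) auto
    also have "\<dots> = \<theta> / 2"
    proof -
      have "x / (2 * N) * N = x / 2" if "N \<noteq> 0" for x N :: real using that by simp
      moreover have "M + 1 \<noteq> 0" using M by simp
      ultimately show ?thesis by blast
    qed
    finally have "(cmod z)\<^sup>2 * M \<le> \<theta> / 2" by (simp add: distrib_left) (smt (verit) zero_le_power2)
    then show ?thesis using Re_quad_arg_ge[OF A, of \<theta> z B X s] unfolding M_def by linarith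
  qed
  show ?thesis
  proof (intro exI[of _ r] conjI allI impI)
    fix z :: complex assume z: "cmod z < r"
    have A0: "A \<noteq> 0" using A by auto
    have pos: "Re (w s z) > 0" if "cmod z < r" for s z
    proof -
      have "0 \<le> (Re A / 4) * s\<^sup>2" using A by simp
      then show ?thesis using big[OF that, of s] th by linarith
    qed
    let ?C = "of_real \<theta> + z\<^sup>2 * X / 2"
    have weq: "w s z = ?C + of_real s * (z * B) + (of_real s)\<^sup>2 * A / 2" for s
      by (simp add: quad_arg_def field_simps)
    have "(LINT s|lborel. h s z) = (LINT s|lborel. upper_Gamma (of_real \<rho>) (?C + of_real s * (z * B) + (of_real s)\<^sup>2 * A / 2))"
      using h_eq_of_Re_pos[OF r pos z] unfolding weq by simp
    moreover have "of_real (Gamma (1 - \<rho>)) * (LINT s|lborel. upper_Gamma (of_real \<rho>) (?C + of_real s * (z * B) + (of_real s)\<^sup>2 * A / 2))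
       = csqrt (2 * of_real pi / A) * exp (- (?C - (z * B)\<^sup>2 / (2 * A))) * tricomi_integral (1 - \<rho>) (3/2) (?C - (z * B)\<^sup>2 / (2 * A))"
      by (rule integral_upper_Gamma_quadratic[OF rho A, of "\<theta> / 2" "Re A / 4"]) (use th A big[OF z] weq in auto)
    moreover have "?C - (z * B)\<^sup>2 / (2 * A) = of_real \<theta> + z\<^sup>2 * ((X - B\<^sup>2 / A) / 2)"
      using A0 by (simp add: power_mult_distrib field_simps)
    ultimately show "of_real (Gamma (1 - \<rho>)) * (LINT s|lborel. h s z) =
       csqrt (2 * of_real pi / A) * exp (- (of_real \<theta> + z\<^sup>2 * ((X - B\<^sup>2 / A) / 2))) * tricomi_integral (1 - \<rho>) (3/2) (of_real \<theta> + z\<^sup>2 * ((X - B\<^sup>2 / A) / 2))"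
      by simp
  qed (rule r)
qed

theorem integral_h:
  defines "k \<equiv> of_real \<theta> + (X - B\<^sup>2 / A) / 2"
  shows "Re k > 0"
    and "(LINT s|lborel. h s 1) = csqrt (2 * of_real pi / A) * exp (- k) * tricomi (1 - of_real \<rho>) (1/2 - of_real \<rho>) k"
proof -
  define K where "K = (X - B\<^sup>2 / A) / 2"
  define c where "c = cmod K"
  have c: "0 \<le> c" "c < \<theta>" using k_bound by (auto simp: c_def K_def)
  \<comment> \<open>With c = |K| < \<theta> the number 2 \<theta> / (\<theta> + c) exceeds 1, while
    its product with \<open>c\<close> is below \<theta>. So \<theta> + z^2 K stays in the right
    half-plane on a disc that contains z = 1.\<close>
  define R1 where "R1 = min R (sqrt (2 * \<theta> / (\<theta> + c)))"
  have q: "2 * \<theta> / (\<theta> + c) > 1" using c th by (simp add: less_divide_eq)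
  have R1: "R1 > 1" "R1 \<le> R" using q R by (auto simp: R1_def)
  have Rek: "Re (of_real \<theta> + z\<^sup>2 * K) > 0" if z: "cmod z < R1" for z
  proof -
    have "cmod z \<le> sqrt (2 * \<theta> / (\<theta> + c))" using z by (simp add: R1_def)
    then have "(cmod z)\<^sup>2 \<le> (sqrt (2 * \<theta> / (\<theta> + c)))\<^sup>2" by (intro power_mono) auto
    also have "\<dots> = 2 * \<theta> / (\<theta> + c)" using q by simp
    finally have "(cmod z)\<^sup>2 * c \<le> 2 * \<theta> / (\<theta> + c) * c" using c by (intro mult_right_mono) auto
    also have "\<dots> < \<theta>"
    proof -
      have "2 * c < \<theta> + c" using c by simp
      then have "\<theta> * (2 * c) < \<theta> * (\<theta> + c)" using th by simp
      then show ?thesis using c th by (simp add: divide_less_eq algebra_simps)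
    qed
    finally have "cmod (z\<^sup>2 * K) < \<theta>" by (simp add: norm_mult norm_power c_def)
    then show ?thesis using abs_Re_le_cmod[of "z\<^sup>2 * K"] by (simp only: plus_complex.sel Re_complex_of_real)
  qed
  have k: "k = of_real \<theta> + 1\<^sup>2 * K" by (simp add: k_def K_def)
  show Rk: "Re k > 0" using Rek[of 1] R1 unfolding k by simp
  have a: "1 - \<rho> > 0" using rho by simp
  let ?J = "\<lambda>z. of_real (Gamma (1 - \<rho>)) * (LINT s|lborel. h s z)"
  let ?F = "\<lambda>z. csqrt (2 * of_real pi / A) * exp (- (of_real \<theta> + z\<^sup>2 * K)) * tricomi_integral (1 - \<rho>) (3/2) (of_real \<theta> + z\<^sup>2 * K)"
  obtain r where r: "r > 0" "\<And>z. cmod z < r \<Longrightarrow> ?J z = ?F z"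
    using integral_h_small unfolding K_def by blast
  have hT: "(\<lambda>z. tricomi_integral (1 - \<rho>) (3/2) (of_real \<theta> + z\<^sup>2 * K)) holomorphic_on ball 0 R1"
    by (rule holomorphic_on_compose_gen[of "\<lambda>z. of_real \<theta> + z\<^sup>2 * K" _ "tricomi_integral (1 - \<rho>) (3/2)" "{k. 0 < Re k}", unfolded o_def])
       (use Rek tricomi_integral_holomorphic_k[OF a] in \<open>auto intro!: holomorphic_intros\<close>)
  have "?J 1 = ?F 1"
  proof (rule analytic_continuation_open[of "ball 0 (min r R1)" "ball 0 R1" ?J ?F])
    show "?J holomorphic_on ball 0 R1"
      by (intro holomorphic_intros holomorphic_on_subset[OF integral_h_holomorphic]) (use R1 in auto)
    show "?F holomorphic_on ball 0 R1" by (intro holomorphic_intros hT)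
  qed (use r R1 in auto)
  then have "of_real (Gamma (1 - \<rho>)) * (LINT s|lborel. h s 1) = csqrt (2 * of_real pi / A) * exp (- k) * tricomi_integral (1 - \<rho>) (3/2) k"
    unfolding k by simp
  also have "tricomi_integral (1 - \<rho>) (3/2) k = of_real (Gamma (1 - \<rho>)) * tricomi (1 - of_real \<rho>) (1/2 - of_real \<rho>) k"
    using tricomi_eq_integral[OF a Rk, of "1/2 - of_real \<rho>"] by simp
  finally have "of_real (Gamma (1 - \<rho>)) * (LINT s|lborel. h s 1) = of_real (Gamma (1 - \<rho>)) * (csqrt (2 * of_real pi / A) * exp (- k) * tricomi (1 - of_real \<rho>) (1/2 - of_real \<rho>) k)"
    by (simp only: mult_ac)
  moreover have "complex_of_real (Gamma (1 - \<rho>)) \<noteq> 0" using Gamma_real_pos[OF a] by simp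
  ultimately show "(LINT s|lborel. h s 1) = csqrt (2 * of_real pi / A) * exp (- k) * tricomi (1 - of_real \<rho>) (1/2 - of_real \<rho>) k"
    by (rule mult_left_cancel[THEN iffD1, rotated])
qed

end


section \<open>Schwartz functions and exponential moments\<close>

lemma schwartz_deriv_lin:
  assumes "f \<in> schwartz" "g \<in> schwartz"
  shows "(deriv ^^ n) (\<lambda>x. a * f x + g x) = (\<lambda>x. a * (deriv ^^ n) f x + (deriv ^^ n) g x)"
proof (induction n)
  case (Suc n)
  have d: "((deriv ^^ n) F has_field_derivative (deriv ^^ Suc n) F x) (at x)" if "F \<in> schwartz" for F x
    using that by (simp add: schwartz_def DERIV_deriv_iff_field_differentiable)
  show ?case
  proof
    fix x
    have "((\<lambda>x. a * (deriv ^^ n) f x + (deriv ^^ n) g x) has_field_derivative a * (deriv ^^ Suc n) f x + (deriv ^^ Suc n) g x) (at x)"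
      by (intro DERIV_add DERIV_cmult d assms)
    then show "(deriv ^^ Suc n) (\<lambda>x. a * f x + g x) x = a * (deriv ^^ Suc n) f x + (deriv ^^ Suc n) g x"
      using Suc by (simp add: DERIV_imp_deriv)
  qed
qed simp

lemma schwartz_lin:
  assumes f: "f \<in> schwartz" and g: "g \<in> schwartz"
  shows "(\<lambda>x. a * f x + g x) \<in> schwartz"
  unfolding schwartz_def mem_Collect_eq schwartz_deriv_lin[OF assms]
proof (intro allI conjI)
  fix n x
  show "(\<lambda>x. a * (deriv ^^ n) f x + (deriv ^^ n) g x) field_differentiable at x"
    using f g by (intro derivative_intros) (auto simp: schwartz_def)
next
  fix n m
  obtain B C where B: "\<And>x. \<bar>x ^ m * (deriv ^^ n) f x\<bar> \<le> B" and C: "\<And>x. \<bar>x ^ m * (deriv ^^ n) g x\<bar> \<le> C"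
    using f g unfolding schwartz_def bounded_iff by (auto simp del: funpow.simps) metis
  show "bounded (range (\<lambda>x. x ^ m * (a * (deriv ^^ n) f x + (deriv ^^ n) g x)))"
    unfolding bounded_iff
  proof (intro exI ballI)
    fix y assume "y \<in> range (\<lambda>x. x ^ m * (a * (deriv ^^ n) f x + (deriv ^^ n) g x))"
    then obtain x where "y = a * (x ^ m * (deriv ^^ n) f x) + x ^ m * (deriv ^^ n) g x" by (auto simp: algebra_simps)
    then have "\<bar>y\<bar> \<le> \<bar>a\<bar> * \<bar>x ^ m * (deriv ^^ n) f x\<bar> + \<bar>x ^ m * (deriv ^^ n) g x\<bar>"
      by (metis abs_mult abs_triangle_ineq)
    also have "\<dots> \<le> \<bar>a\<bar> * B + C" using B C by (intro add_mono mult_left_mono) auto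
    finally show "norm y \<le> \<bar>a\<bar> * B + C" by simp
  qed
qed

lemma zero_schwartz: "(\<lambda>x. 0) \<in> schwartz"
proof -
  have "(deriv ^^ n) (\<lambda>x::real. 0::real) = (\<lambda>x. 0)" for n by (induction n) auto
  then show ?thesis by (simp add: schwartz_def bounded_iff) blast
qed

lemma schwartz_scale: "f \<in> schwartz \<Longrightarrow> (\<lambda>x. a * f x) \<in> schwartz"
  using schwartz_lin[OF _ zero_schwartz, of f a] by simp

text \<open>Bounds for f and for x f give (1 + x^2) f^2 \<le> B^2 + C^2, and 1/(1 + x^2) is
  integrable.\<close>

lemma schwartz_L2:
  assumes "f \<in> schwartz"
  shows "f \<in> L2"
proof -
  have "(deriv ^^ 0) f field_differentiable at x" for x using assms unfolding schwartz_def by blast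
  then have "isCont f x" for x by (simp add: field_differentiable_imp_continuous_at)
  then have m: "f \<in> borel_measurable borel" by (intro borel_measurable_continuous_onI continuous_at_imp_continuous_on) auto
  have "bounded (range (\<lambda>x. x ^ 0 * (deriv ^^ 0) f x))" "bounded (range (\<lambda>x. x ^ 1 * (deriv ^^ 0) f x))"
    using assms unfolding schwartz_def by blast+
  then obtain B C where B: "\<And>x. \<bar>f x\<bar> \<le> B" and C: "\<And>x. \<bar>x * f x\<bar> \<le> C"
    unfolding bounded_iff by auto
  have i: "integrable lborel (\<lambda>x::real. (B\<^sup>2 + C\<^sup>2) * inverse (1 + x\<^sup>2))"
    using integrable_inverse_1_plus_square by (simp add: set_integrable_def einterval_eq)
  have "integrable lborel (\<lambda>x. (f x)\<^sup>2)"
  proof (rule Bochner_Integration.integrable_bound[OF i])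
    show "AE x in lborel. norm ((f x)\<^sup>2) \<le> norm ((B\<^sup>2 + C\<^sup>2) * inverse (1 + x\<^sup>2))"
    proof (intro AE_I2)
      fix x :: real
      have p: "1 + x\<^sup>2 > 0" by (simp add: add_pos_nonneg)
      have "(f x)\<^sup>2 \<le> B\<^sup>2" using B[of x] by (metis abs_ge_zero power2_abs power_mono)
      moreover have "(x * f x)\<^sup>2 \<le> C\<^sup>2" using C[of x] by (metis abs_ge_zero power2_abs power_mono)
      ultimately have "(1 + x\<^sup>2) * (f x)\<^sup>2 \<le> B\<^sup>2 + C\<^sup>2" by (simp add: algebra_simps power_mult_distrib)
      then have "(f x)\<^sup>2 \<le> (B\<^sup>2 + C\<^sup>2) * inverse (1 + x\<^sup>2)" using p by (simp add: field_simps)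
      then show "norm ((f x)\<^sup>2) \<le> norm ((B\<^sup>2 + C\<^sup>2) * inverse (1 + x\<^sup>2))" using p by (simp add: abs_mult)
    qed
  qed (use m in measurable)
  then show ?thesis using m by (simp add: L2_def)
qed

lemma integrable_L2_mult:
  assumes "f \<in> L2" "g \<in> L2"
  shows "integrable lborel (\<lambda>x. f x * g x)"
proof (rule Bochner_Integration.integrable_bound[of _ "\<lambda>x. (f x)\<^sup>2 + (g x)\<^sup>2"])
  show "integrable lborel (\<lambda>x. (f x)\<^sup>2 + (g x)\<^sup>2)" using assms by (auto simp: L2_def)
  show "(\<lambda>x. f x * g x) \<in> borel_measurable lborel" using assms by (auto simp: L2_def)
  show "AE x in lborel. norm (f x * g x) \<le> norm ((f x)\<^sup>2 + (g x)\<^sup>2)"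
  proof (intro AE_I2)
    fix x
    have "2 * \<bar>f x\<bar> * \<bar>g x\<bar> \<le> (\<bar>f x\<bar>)\<^sup>2 + (\<bar>g x\<bar>)\<^sup>2" by (rule sum_squares_bound)
    moreover have "0 \<le> \<bar>f x\<bar> * \<bar>g x\<bar>" by simp
    ultimately have "\<bar>f x\<bar> * \<bar>g x\<bar> \<le> (\<bar>f x\<bar>)\<^sup>2 + (\<bar>g x\<bar>)\<^sup>2" by linarith
    then show "norm (f x * g x) \<le> norm ((f x)\<^sup>2 + (g x)\<^sup>2)" by (simp add: abs_mult)
  qed
qed

lemma L2_lin:
  assumes "f \<in> L2" "g \<in> L2"
  shows "(\<lambda>x. a * f x + g x) \<in> L2"
proof -
  have "integrable lborel (\<lambda>x. a\<^sup>2 * (f x)\<^sup>2 + 2 * a * (f x * g x) + (g x)\<^sup>2)"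
    using assms integrable_L2_mult[OF assms] by (auto simp: L2_def)
  also have "(\<lambda>x. a\<^sup>2 * (f x)\<^sup>2 + 2 * a * (f x * g x) + (g x)\<^sup>2) = (\<lambda>x. (a * f x + g x)\<^sup>2)"
    by (simp add: power2_eq_square algebra_simps fun_eq_iff)
  finally show ?thesis using assms by (auto simp: L2_def)
qed

lemma L2_diff: "f \<in> L2 \<Longrightarrow> g \<in> L2 \<Longrightarrow> (\<lambda>x. f x - g x) \<in> L2"
  using L2_lin[of g f "-1"] by simp

lemma LINT_sq_lin:
  assumes "f \<in> L2" "g \<in> L2"
  shows "(LINT x|lborel. (a * f x + g x)\<^sup>2) = a\<^sup>2 * (LINT x|lborel. (f x)\<^sup>2) + 2 * a * (LINT x|lborel. f x * g x) + (LINT x|lborel. (g x)\<^sup>2)"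
proof -
  have "(LINT x|lborel. (a * f x + g x)\<^sup>2) = (LINT x|lborel. a\<^sup>2 * (f x)\<^sup>2 + 2 * a * (f x * g x) + (g x)\<^sup>2)"
    by (intro Bochner_Integration.integral_cong) (auto simp: power2_eq_square algebra_simps)
  then show ?thesis using assms integrable_L2_mult[OF assms] by (simp add: L2_def)
qed

lemma L2_norm_sq: "(L2_norm f)\<^sup>2 = (LINT x|lborel. (f x)\<^sup>2)"
  by (simp add: L2_norm_def)

lemma LINT_sq_tendsto:
  assumes f: "f \<in> L2" and phi: "\<And>n. \<phi> n \<in> L2" and lim: "(\<lambda>n. L2_norm (\<lambda>x. \<phi> n x - f x)) \<longlonglongrightarrow> 0"
  shows "(\<lambda>n. LINT x|lborel. (\<phi> n x)\<^sup>2) \<longlonglongrightarrow> (LINT x|lborel. (f x)\<^sup>2)"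
proof -
  define a where "a = (\<lambda>n. LINT x|lborel. (\<phi> n x - f x)\<^sup>2)"
  have a0: "a n \<ge> 0" for n by (simp add: a_def)
  have al: "a \<longlonglongrightarrow> 0" using tendsto_power[OF lim, of 2] by (simp add: L2_norm_sq a_def[abs_def])
  \<comment> \<open>The mixed term is estimated as in Cauchy-Schwarz, from the nonnegativity of the
    integral of (b u + f)^2 with b = 1/e and b = -1/e. The summand 1/(n+1) keeps \<open>e\<close>
    positive even where \<open>a n\<close> = 0.\<close>
  define e where "e = (\<lambda>n. sqrt (a n + 1 / (real n + 1)))"
  have e0: "e n > 0" for n using a0[of n] by (simp add: e_def add_nonneg_pos)
  have "(\<lambda>n. 1 / (real n + 1)) \<longlonglongrightarrow> 0" by real_asymp
  then have "(\<lambda>n. sqrt (a n + 1 / (real n + 1))) \<longlonglongrightarrow> sqrt (0 + 0)" by (intro tendsto_intros al)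
  then have el: "e \<longlonglongrightarrow> 0" by (simp add: e_def[abs_def])
  define F where "F = (LINT x|lborel. (f x)\<^sup>2)"
  have bd: "\<bar>(LINT x|lborel. (\<phi> n x)\<^sup>2) - F\<bar> \<le> e n * F + e n + a n" for n
  proof -
    have u: "(\<lambda>x. \<phi> n x - f x) \<in> L2" by (rule L2_diff[OF phi f])
    let ?c = "LINT x|lborel. (\<phi> n x - f x) * f x"
    have "(LINT x|lborel. (\<phi> n x)\<^sup>2) = (LINT x|lborel. (1 * (\<phi> n x - f x) + f x)\<^sup>2)" by simp
    also have "\<dots> = a n + 2 * ?c + F" unfolding LINT_sq_lin[OF u f] by (simp add: a_def F_def)
    finally have 1: "(LINT x|lborel. (\<phi> n x)\<^sup>2) - F = a n + 2 * ?c" by simp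
    have gen: "(LINT x|lborel. (b * (\<phi> n x - f x) + f x)\<^sup>2) \<ge> 0" for b by simp
    have "0 \<le> (1 / e n)\<^sup>2 * a n + 2 * (1 / e n) * ?c + F" "0 \<le> (- 1 / e n)\<^sup>2 * a n + 2 * (- 1 / e n) * ?c + F"
      using gen[of "1 / e n"] gen[of "- 1 / e n"] unfolding LINT_sq_lin[OF u f] a_def F_def by auto
    then have "0 \<le> e n * ((1 / e n)\<^sup>2 * a n + 2 * (1 / e n) * ?c + F)" "0 \<le> e n * ((- 1 / e n)\<^sup>2 * a n + 2 * (- 1 / e n) * ?c + F)"
      using e0[of n] by (auto intro: mult_nonneg_nonneg)
    then have "0 \<le> a n / e n + 2 * ?c + e n * F" "0 \<le> a n / e n - 2 * ?c + e n * F"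
      using e0[of n] by (simp_all add: power2_eq_square distrib_left right_diff_distrib)
    then have 2: "\<bar>2 * ?c\<bar> \<le> a n / e n + e n * F" by linarith
    have "a n \<le> (e n)\<^sup>2" using a0[of n] by (simp add: e_def)
    then have "a n / e n \<le> e n" using e0[of n] by (simp add: power2_eq_square divide_le_eq)
    with 1 2 a0[of n] show ?thesis by linarith
  qed
  have "(\<lambda>n. e n * F + e n + a n) \<longlonglongrightarrow> 0 * F + 0 + 0" by (intro tendsto_intros el al)
  then have lim0: "(\<lambda>n. e n * F + e n + a n) \<longlonglongrightarrow> 0" by simp
  have "\<forall>\<^sub>F n in sequentially. norm ((LINT x|lborel. (\<phi> n x)\<^sup>2) - F) \<le> e n * F + e n + a n"
    using bd by (intro always_eventually allI) (simp only: real_norm_def)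
  then have "(\<lambda>n. (LINT x|lborel. (\<phi> n x)\<^sup>2) - F) \<longlonglongrightarrow> 0"
    by (rule Lim_null_comparison) (rule lim0)
  then show ?thesis unfolding F_def by (rule LIM_zero_cancel)
qed

section \<open>Exponential moments of the pairing\<close>

lemma mgf_std_normal: "(\<integral>\<^sup>+x. ennreal (exp (b * x)) \<partial>std_normal_distribution) = ennreal (exp (b\<^sup>2 / 2))"
proof -
  have e: "std_normal_density x * exp (b * x) = 1 / sqrt (2 * pi) * exp (- 1 * x\<^sup>2 / 2 + b * x)" for x
    by (simp add: std_normal_density_def exp_add[symmetric])
  have "(\<integral>\<^sup>+x. ennreal (exp (b * x)) \<partial>std_normal_distribution) = (\<integral>\<^sup>+x. ennreal (std_normal_density x) * ennreal (exp (b * x)) \<partial>lborel)"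
    by (subst nn_integral_density) auto
  also have "\<dots> = (\<integral>\<^sup>+x. ennreal (1 / sqrt (2 * pi) * exp (- 1 * x\<^sup>2 / 2 + b * x)) \<partial>lborel)"
    unfolding e[symmetric] by (intro nn_integral_cong) (simp add: ennreal_mult)
  also have "\<dots> = ennreal (LINT x|lborel. 1 / sqrt (2 * pi) * exp (- 1 * x\<^sup>2 / 2 + b * x))"
    by (intro nn_integral_eq_integral integrable_mult_right gaussian_integral_real(1)) auto
  also have "(LINT x|lborel. 1 / sqrt (2 * pi) * exp (- 1 * x\<^sup>2 / 2 + b * x)) = exp (b\<^sup>2 / 2)"
    unfolding integral_mult_right_zero gaussian_integral_real(2)[of 1 b, simplified]
    using gaussian_integral_real(2)[of 1 b] by simp
  finally show ?thesis .
qed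

text \<open>By the uniqueness of characteristic functions \<open>Y\<close> is distributed like \<open>sqrt (v * (1 + t)) * x\<close> with a standard
  normal \<open>x\<close> and an independent \<open>t\<close> whose density comes from the Laplace transform representation of the incomplete Gamma function.\<close>

lemma gamma_grey_exp_moment:
  fixes Y :: "'a \<Rightarrow> real"
  assumes rho: "0 < \<rho>" "\<rho> < 1" and th: "\<theta> > 0" and nu: "prob_space \<nu>" and Y[measurable]: "Y \<in> borel_measurable \<nu>" and v: "v \<ge> 0"
    and cf: "\<And>t::real. (CLINT \<omega>|\<nu>. exp (\<i> * of_real (t * Y \<omega>))) = upper_Gamma (of_real \<rho>) (of_real (\<theta> + t\<^sup>2 * v / 2)) / upper_Gamma (of_real \<rho>) (of_real \<theta>)"
    and Z0: "upper_Gamma (of_real \<rho>) (of_real \<theta>) \<noteq> 0"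
    and c: "c\<^sup>2 * v < 2 * \<theta>"
  shows "integrable \<nu> (\<lambda>\<omega>. exp (c * Y \<omega>))"
proof -
  interpret nu: prob_space \<nu> by fact
  note [measurable] = measurable_pos_lborel_ident
  \<comment> \<open>The Laplace integrand, of total mass \<Gamma>(1-\<rho>) \<Gamma>(\<rho>,
    \<kappa>). A factor exp(-x (1+t)) shifts \<kappa> by x: x = s^2 v / 2 yields the characteristic
    function, x = -c^2 v / 2 the exponential moment.\<close>
  define q where "q = (\<lambda>\<kappa> t::real. exp (- (\<kappa> * (1 + t))) * t powr (- \<rho>) * (1 + t) powr (- 1))"
  have q0: "q \<kappa> t \<ge> 0" for \<kappa> t by (simp add: q_def)
  have iq: "integrable pos_lborel (q \<kappa>)" if "\<kappa> > 0" for \<kappa>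
  proof -
    have "integrable pos_lborel (\<lambda>t. exp (- \<kappa>) * (exp (- (\<kappa> * t)) * t powr ((1 - \<rho>) - 1) * (1 + t) powr (- 1)))"
      using rho that by (intro integrable_mult_right integrable_tricomi_kernel) auto
    also have "(\<lambda>t. exp (- \<kappa>) * (exp (- (\<kappa> * t)) * t powr ((1 - \<rho>) - 1) * (1 + t) powr (- 1))) = q \<kappa>"
    proof
      fix t
      have "exp (- (\<kappa> * (1 + t))) = exp (- \<kappa>) * exp (- (\<kappa> * t))"
        unfolding exp_add[symmetric] by (simp add: distrib_left)
      then show "exp (- \<kappa>) * (exp (- (\<kappa> * t)) * t powr ((1 - \<rho>) - 1) * (1 + t) powr (- 1)) = q \<kappa> t"
        by (simp add: q_def)
    qed
    finally show ?thesis .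
  qed
  define I where "I = (\<lambda>\<kappa>. LINT t|pos_lborel. q \<kappa> t)"
  have Iug: "of_real (I \<kappa>) = of_real (Gamma (1 - \<rho>)) * upper_Gamma (of_real \<rho>) (of_real \<kappa>)" if k: "\<kappa> > 0" for \<kappa>
  proof -
    have "of_real (Gamma (1 - \<rho>)) * upper_Gamma (of_real \<rho>) (of_real \<kappa>) = exp (- of_real \<kappa>) * tricomi_integral (1 - \<rho>) 1 (of_real \<kappa>)"
      using upper_Gamma_eq_tricomi_integral[OF rho, of "of_real \<kappa>"] k by simp
    also have "\<dots> = (LINT t|pos_lborel. complex_of_real (q \<kappa> t))"
      unfolding tricomi_integral_def integral_mult_right_zero[symmetric]
    proof (rule Bochner_Integration.integral_cong)
      fix t assume "t \<in> space pos_lborel"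
      then have t: "t > 0" by simp
      have "complex_of_real (1 + t) powr (- 1) = of_real ((1 + t) powr (- 1))" using t powr_of_real[of "1 + t" "- 1"] by simp
      moreover have "exp (- complex_of_real \<kappa>) * exp (- (of_real \<kappa> * of_real t)) = of_real (exp (- (\<kappa> * (1 + t))))"
        by (simp add: exp_of_real[symmetric] exp_add[symmetric] distrib_left)
      ultimately show "exp (- complex_of_real \<kappa>) * tricomi_kernel (1 - \<rho>) 1 (of_real \<kappa>) t = complex_of_real (q \<kappa> t)"
        unfolding tricomi_kernel_def q_def by (simp only: mult.assoc[symmetric] of_real_mult) simp
    qed simp
    finally show ?thesis unfolding I_def by (simp only: integral_complex_of_real)
  qed
  have G0: "Gamma (1 - \<rho>) > 0" using rho by (intro Gamma_real_pos) auto
  define N where "N = I \<theta>"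
  have "complex_of_real N \<noteq> 0" unfolding N_def Iug[OF th] using Z0 G0 by simp
  moreover have "N \<ge> 0" unfolding N_def I_def using q0 by (intro Bochner_Integration.integral_nonneg) auto
  ultimately have N: "N > 0" by auto
  define P where "P = density pos_lborel (\<lambda>t. ennreal (q \<theta> t / N))"
  have qm[measurable]: "q \<kappa> \<in> borel_measurable pos_lborel" for \<kappa> unfolding q_def by measurable
  have nnq: "(\<integral>\<^sup>+t. ennreal (q \<kappa> t / N) \<partial>pos_lborel) = ennreal (I \<kappa> / N)" if "\<kappa> > 0" for \<kappa>
    unfolding I_def using iq[OF that] q0 N by (subst nn_integral_eq_integral) auto
  have prP: "prob_space P"
  proof (rule prob_spaceI)
    have "emeasure P (space P) = (\<integral>\<^sup>+t. ennreal (q \<theta> t / N) * indicator (space P) t \<partial>pos_lborel)"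
      unfolding P_def by (subst emeasure_density) (auto simp: sets_restrict_space_iff)
    also have "\<dots> = (\<integral>\<^sup>+t. ennreal (q \<theta> t / N) \<partial>pos_lborel)"
      by (intro nn_integral_cong) (simp add: P_def)
    also have "\<dots> = 1" unfolding nnq[OF th] using N by (simp add: N_def)
    finally show "emeasure P (space P) = 1" .
  qed
  have gen: "a * x * y / N * E = b * x * y / N" if "a * E = b" for a x y E b
    unfolding that[symmetric] by simp
  interpret G: prob_space std_normal_distribution using prob_space_normal_density[of 1 0] by simp
  interpret P: prob_space P by (rule prP)
  interpret PG: pair_prob_space P std_normal_distribution ..
  define W where "W = (\<lambda>z::real \<times> real. sqrt (v * (1 + fst z)) * snd z)"
  have P_ident: "(\<lambda>x. x) \<in> measurable P borel" unfolding P_def by simp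
  have fstP: "fst \<in> measurable (P \<Otimes>\<^sub>M std_normal_distribution) borel" using measurable_compose[OF measurable_fst P_ident] .
  have sndP: "snd \<in> measurable (P \<Otimes>\<^sub>M std_normal_distribution) borel"
    using measurable_compose[OF measurable_snd, of "\<lambda>x. x" P std_normal_distribution borel] by simp
  have W[measurable]: "W \<in> borel_measurable (P \<Otimes>\<^sub>M std_normal_distribution)"
    unfolding W_def using fstP sndP by measurable
  have "char (distr \<nu> borel Y) = char (distr (P \<Otimes>\<^sub>M std_normal_distribution) borel W)"
  proof
    fix s :: real
    let ?f = "\<lambda>z. iexp (s * W z)"
    have th': "\<theta> + s\<^sup>2 * v / 2 > 0" using th v by (simp add: add_pos_nonneg)
    have "char (distr (P \<Otimes>\<^sub>M std_normal_distribution) borel W) s = (CLINT z|(P \<Otimes>\<^sub>M std_normal_distribution). ?f z)"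
      unfolding char_def by (subst integral_distr) auto
    also have "\<dots> = (CLINT t|P. CLINT x|std_normal_distribution. ?f (t, x))"
      by (rule PG.integral_fst'[symmetric], rule PG.integrable_const_bound[of _ 1]) auto
    also have "\<dots> = (CLINT t|P. of_real (exp (- (s\<^sup>2 * v / 2 * (1 + t)))))"
    proof (rule Bochner_Integration.integral_cong)
      fix t assume "t \<in> space P"
      then have t: "t > 0" by (simp add: P_def)
      have "(CLINT x|std_normal_distribution. ?f (t, x)) = char std_normal_distribution (s * sqrt (v * (1 + t)))"
        by (simp add: char_def W_def mult.assoc)
      also have "\<dots> = of_real (exp (- (s\<^sup>2 * v / 2 * (1 + t))))"
        using t v by (simp add: char_std_normal_distribution power_mult_distrib mult_ac)
      finally show "(CLINT x|std_normal_distribution. ?f (t, x)) = of_real (exp (- (s\<^sup>2 * v / 2 * (1 + t))))" .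
    qed simp
    also have "\<dots> = of_real (LINT t|P. exp (- (s\<^sup>2 * v / 2 * (1 + t))))" by (rule integral_complex_of_real)
    also have "(LINT t|P. exp (- (s\<^sup>2 * v / 2 * (1 + t)))) = (LINT t|pos_lborel. (q \<theta> t / N) * exp (- (s\<^sup>2 * v / 2 * (1 + t))))"
      unfolding P_def using q0 N by (subst integral_density) auto
    also have "\<dots> = (LINT t|pos_lborel. (1 / N) * q (\<theta> + s\<^sup>2 * v / 2) t)"
    proof (rule Bochner_Integration.integral_cong)
      fix t
      have "exp (- (\<theta> * (1 + t))) * exp (- (s\<^sup>2 * v / 2 * (1 + t))) = exp (- ((\<theta> + s\<^sup>2 * v / 2) * (1 + t)))"
        unfolding exp_add[symmetric] by (rule arg_cong[of _ _ exp]) (simp only: distrib_right minus_add_distrib)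
      then show "q \<theta> t / N * exp (- (s\<^sup>2 * v / 2 * (1 + t))) = (1 / N) * q (\<theta> + s\<^sup>2 * v / 2) t"
        unfolding q_def by (subst gen) auto
    qed simp
    also have "\<dots> = I (\<theta> + s\<^sup>2 * v / 2) / N" unfolding integral_mult_right_zero I_def by simp
    finally have "char (distr (P \<Otimes>\<^sub>M std_normal_distribution) borel W) s = of_real (I (\<theta> + s\<^sup>2 * v / 2)) / of_real N" by simp
    also have "\<dots> = upper_Gamma (of_real \<rho>) (of_real (\<theta> + s\<^sup>2 * v / 2)) / upper_Gamma (of_real \<rho>) (of_real \<theta>)"
      unfolding N_def Iug[OF th] Iug[OF th'] using G0 by (simp del: of_real_add)
    also have "\<dots> = char (distr \<nu> borel Y) s"
      unfolding char_def cf[symmetric] by (subst integral_distr) auto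
    finally show "char (distr \<nu> borel Y) s = char (distr (P \<Otimes>\<^sub>M std_normal_distribution) borel W) s" by simp
  qed
  \<comment> \<open>Equality in law carries over the nonnegative integral of exp(c Y), whose
    finiteness is still open; for the mixture it is computable.\<close>
  then have D: "distr \<nu> borel Y = distr (P \<Otimes>\<^sub>M std_normal_distribution) borel W"
    by (intro Levy_uniqueness nu.real_distribution_distr PG.real_distribution_distr Y W)
  define \<kappa> where "\<kappa> = \<theta> - c\<^sup>2 * v / 2"
  have k: "\<kappa> > 0" using c by (simp add: \<kappa>_def)
  have "(\<integral>\<^sup>+\<omega>. ennreal (exp (c * Y \<omega>)) \<partial>\<nu>) = (\<integral>\<^sup>+y. ennreal (exp (c * y)) \<partial>distr \<nu> borel Y)"
    by (subst nn_integral_distr) auto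
  also have "\<dots> = (\<integral>\<^sup>+z. ennreal (exp (c * W z)) \<partial>(P \<Otimes>\<^sub>M std_normal_distribution))"
    unfolding D by (subst nn_integral_distr) auto
  also have "\<dots> = (\<integral>\<^sup>+t. \<integral>\<^sup>+x. ennreal (exp (c * W (t, x))) \<partial>std_normal_distribution \<partial>P)"
    by (rule G.nn_integral_fst[symmetric]) simp
  also have "\<dots> = (\<integral>\<^sup>+t. ennreal (exp (c\<^sup>2 * v / 2 * (1 + t))) \<partial>P)"
  proof (rule nn_integral_cong)
    fix t assume "t \<in> space P"
    then have t: "t > 0" by (simp add: P_def)
    have "(\<integral>\<^sup>+x. ennreal (exp (c * W (t, x))) \<partial>std_normal_distribution) = (\<integral>\<^sup>+x. ennreal (exp ((c * sqrt (v * (1 + t))) * x)) \<partial>std_normal_distribution)"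
      by (simp add: W_def mult.assoc)
    also have "\<dots> = ennreal (exp (c\<^sup>2 * v / 2 * (1 + t)))"
      unfolding mgf_std_normal using t v by (simp add: power_mult_distrib mult_ac)
    finally show "(\<integral>\<^sup>+x. ennreal (exp (c * W (t, x))) \<partial>std_normal_distribution) = ennreal (exp (c\<^sup>2 * v / 2 * (1 + t)))" .
  qed
  also have "\<dots> = (\<integral>\<^sup>+t. ennreal (q \<theta> t / N) * ennreal (exp (c\<^sup>2 * v / 2 * (1 + t))) \<partial>pos_lborel)"
    unfolding P_def by (subst nn_integral_density) auto
  also have "\<dots> = (\<integral>\<^sup>+t. ennreal (q \<kappa> t / N) \<partial>pos_lborel)"
  proof (rule nn_integral_cong)
    fix t
    have "exp (- (\<theta> * (1 + t))) * exp (c\<^sup>2 * v / 2 * (1 + t)) = exp (- (\<kappa> * (1 + t)))"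
      unfolding exp_add[symmetric] \<kappa>_def by (rule arg_cong[of _ _ exp]) (simp add: algebra_simps)
    then have "q \<theta> t / N * exp (c\<^sup>2 * v / 2 * (1 + t)) = q \<kappa> t / N"
      unfolding q_def by (rule gen)
    then show "ennreal (q \<theta> t / N) * ennreal (exp (c\<^sup>2 * v / 2 * (1 + t))) = ennreal (q \<kappa> t / N)"
      using q0[of \<theta> t] N by (subst ennreal_mult'[symmetric]) auto
  qed
  also have "\<dots> < \<infinity>" unfolding nnq[OF k] by simp
  finally show ?thesis by (intro integrableI_nonneg) auto
qed


section \<open>The Gamma-grey measure\<close>

locale gamma_grey =
  fixes \<rho> \<theta> :: real and \<nu> :: "((real \<Rightarrow> real) \<Rightarrow> real) measure"
  assumes rho: "0 < \<rho>" "\<rho> < 1" and th: "0 < \<theta>" and grey: "gamma_grey_measure \<rho> \<theta> \<nu>"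
begin

abbreviation "UG \<equiv> upper_Gamma (of_real \<rho>)"

definition Z :: complex where "Z = UG (of_real \<theta>)"

sublocale nu: prob_space \<nu>
  using grey by (simp add: gamma_grey_measure_def)

lemma sets_nu: "sets \<nu> = sets schwartz_dual_algebra"
  using grey by (simp add: gamma_grey_measure_def)

lemma space_nu: "space \<nu> = schwartz_dual"
proof -
  have "space \<nu> = space schwartz_dual_algebra" using sets_nu by (rule sets_eq_imp_space_eq)
  also have "\<dots> = schwartz_dual" unfolding schwartz_dual_algebra_def by (rule space_measure_of) auto
  finally show ?thesis .
qed

lemma schwartz_dual_lin:
  "\<omega> \<in> space \<nu> \<Longrightarrow> f \<in> schwartz \<Longrightarrow> g \<in> schwartz \<Longrightarrow> \<omega> (\<lambda>x. a * f x + g x) = a * \<omega> f + \<omega> g"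
  unfolding space_nu schwartz_dual_def by blast

lemma schwartz_dual_0: "\<omega> \<in> space \<nu> \<Longrightarrow> \<omega> (\<lambda>x. 0) = 0"
  using schwartz_dual_lin[of \<omega> "\<lambda>x. 0" "\<lambda>x. 0" 1] zero_schwartz by simp

lemma measurable_eval:
  assumes "f \<in> schwartz"
  shows "(\<lambda>\<omega>. \<omega> f) \<in> borel_measurable \<nu>"
proof (rule measurableI)
  fix B :: "real set" assume B: "B \<in> sets borel"
  have "{\<omega> \<in> schwartz_dual. \<omega> f \<in> B} \<in> sets schwartz_dual_algebra"
    unfolding schwartz_dual_algebra_def using assms B by (subst sets_measure_of) (auto intro!: sigma_sets.Basic)
  moreover have "(\<lambda>\<omega>. \<omega> f) -` B \<inter> space \<nu> = {\<omega> \<in> schwartz_dual. \<omega> f \<in> B}" unfolding space_nu by auto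
  ultimately show "(\<lambda>\<omega>. \<omega> f) -` B \<inter> space \<nu> \<in> sets \<nu>" unfolding sets_nu by simp
qed simp

lemma cf_schwartz:
  assumes "\<phi> \<in> schwartz"
  shows "(CLINT \<omega>|\<nu>. exp (\<i> * of_real (\<omega> \<phi>))) = UG (of_real (\<theta> + (LINT x|lborel. (\<phi> x)\<^sup>2) / 2)) / Z"
  using grey assms by (simp add: gamma_grey_measure_def Z_def power2_eq_square)

text \<open>Division by zero gives 0, so Z = 0 would make the characteristic function vanish at the
  zero function, where it is the total mass 1.\<close>

lemma Z_nonzero: "Z \<noteq> 0"
proof
  assume "Z = 0"
  then have "(CLINT \<omega>|\<nu>. exp (\<i> * of_real (\<omega> (\<lambda>x. 0)))) = 0" using cf_schwartz[OF zero_schwartz] by simp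
  moreover have "(CLINT \<omega>|\<nu>. exp (\<i> * of_real (\<omega> (\<lambda>x. 0)))) = (CLINT \<omega>|\<nu>. 1)"
    by (intro Bochner_Integration.integral_cong) (auto simp: schwartz_dual_0)
  ultimately show False using nu.prob_space by simp
qed

text \<open>Membership in \<open>L2\<close> has to be asked for: the integral of a function that is
  not integrable is 0 by convention, so \<open>real_L2_pairing\<close> says little about an
  arbitrary \<open>f\<close>.\<close>

definition PL :: "(real \<Rightarrow> real) \<Rightarrow> (((real \<Rightarrow> real) \<Rightarrow> real) \<Rightarrow> real) \<Rightarrow> bool" where
  "PL f Y \<longleftrightarrow> f \<in> L2 \<and> real_L2_pairing \<nu> f Y"

lemma PL_measurable: "PL f Y \<Longrightarrow> Y \<in> borel_measurable \<nu>"
  by (simp add: PL_def real_L2_pairing_def)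

lemma PL_L2: "PL f Y \<Longrightarrow> f \<in> L2"
  by (simp add: PL_def)

lemma PL_schwartz:
  assumes "\<phi> \<in> schwartz"
  shows "PL \<phi> (\<lambda>\<omega>. \<omega> \<phi>)"
  unfolding PL_def real_L2_pairing_def using assms
  by (intro conjI schwartz_L2 measurable_eval exI[of _ "\<lambda>_. \<phi>"]) (auto simp: L2_norm_def)

lemma PL_seq:
  assumes "PL f Y"
  obtains \<phi> where "\<And>n. \<phi> n \<in> schwartz" "(\<lambda>n. L2_norm (\<lambda>x. \<phi> n x - f x)) \<longlonglongrightarrow> 0"
    "\<And>n. integrable \<nu> (\<lambda>\<omega>. (\<omega> (\<phi> n) - Y \<omega>)\<^sup>2)" "(\<lambda>n. LINT \<omega>|\<nu>. (\<omega> (\<phi> n) - Y \<omega>)\<^sup>2) \<longlonglongrightarrow> 0"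
  using assms unfolding PL_def real_L2_pairing_def by blast

lemma sq_lin_le: "(a * u + v)\<^sup>2 \<le> 2 * a\<^sup>2 * u\<^sup>2 + 2 * (v::real)\<^sup>2"
proof -
  have "0 \<le> (a * u - v)\<^sup>2" by simp
  then show ?thesis by (simp add: power2_eq_square algebra_simps)
qed

lemma PL_lin:
  assumes f: "PL f Y" and g: "PL g V"
  shows "PL (\<lambda>x. a * f x + g x) (\<lambda>\<omega>. a * Y \<omega> + V \<omega>)"
proof -
  obtain \<phi> where p: "\<And>n. \<phi> n \<in> schwartz" "(\<lambda>n. L2_norm (\<lambda>x. \<phi> n x - f x)) \<longlonglongrightarrow> 0"
    "\<And>n. integrable \<nu> (\<lambda>\<omega>. (\<omega> (\<phi> n) - Y \<omega>)\<^sup>2)" "(\<lambda>n. LINT \<omega>|\<nu>. (\<omega> (\<phi> n) - Y \<omega>)\<^sup>2) \<longlonglongrightarrow> 0"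
    using PL_seq[OF f] by blast
  obtain \<psi> where q: "\<And>n. \<psi> n \<in> schwartz" "(\<lambda>n. L2_norm (\<lambda>x. \<psi> n x - g x)) \<longlonglongrightarrow> 0"
    "\<And>n. integrable \<nu> (\<lambda>\<omega>. (\<omega> (\<psi> n) - V \<omega>)\<^sup>2)" "(\<lambda>n. LINT \<omega>|\<nu>. (\<omega> (\<psi> n) - V \<omega>)\<^sup>2) \<longlonglongrightarrow> 0"
    using PL_seq[OF g] by blast
  note fL = PL_L2[OF f] and gL = PL_L2[OF g]
  note [measurable] = PL_measurable[OF f] PL_measurable[OF g]
  define \<tau> where "\<tau> = (\<lambda>n x. a * \<phi> n x + \<psi> n x)"
  have chi: "\<tau> n \<in> schwartz" for n unfolding \<tau>_def by (rule schwartz_lin[OF p(1) q(1)])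
  note [measurable] = measurable_eval[OF chi]
  have "(\<lambda>n. L2_norm (\<lambda>x. \<tau> n x - (a * f x + g x))) \<longlonglongrightarrow> 0"
  proof -
    have bd: "(L2_norm (\<lambda>x. \<tau> n x - (a * f x + g x)))\<^sup>2 \<le> 2 * a\<^sup>2 * (L2_norm (\<lambda>x. \<phi> n x - f x))\<^sup>2 + 2 * (L2_norm (\<lambda>x. \<psi> n x - g x))\<^sup>2" for n
    proof -
      have u: "(\<lambda>x. \<phi> n x - f x) \<in> L2" and v: "(\<lambda>x. \<psi> n x - g x) \<in> L2"
        by (intro L2_diff schwartz_L2 p q fL gL)+
      have e: "(\<lambda>x. \<tau> n x - (a * f x + g x)) = (\<lambda>x. a * (\<phi> n x - f x) + (\<psi> n x - g x))"
        by (simp add: \<tau>_def fun_eq_iff algebra_simps)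
      have "(LINT x|lborel. (a * (\<phi> n x - f x) + (\<psi> n x - g x))\<^sup>2) \<le> (LINT x|lborel. 2 * a\<^sup>2 * (\<phi> n x - f x)\<^sup>2 + 2 * (\<psi> n x - g x)\<^sup>2)"
        using L2_lin[OF u v, of a] u v sq_lin_le by (intro integral_mono) (auto simp: L2_def)
      also have "\<dots> = 2 * a\<^sup>2 * (LINT x|lborel. (\<phi> n x - f x)\<^sup>2) + 2 * (LINT x|lborel. (\<psi> n x - g x)\<^sup>2)"
        using u v by (simp add: L2_def)
      finally show ?thesis unfolding L2_norm_sq e .
    qed
    have "(\<lambda>n. 2 * a\<^sup>2 * (L2_norm (\<lambda>x. \<phi> n x - f x))\<^sup>2 + 2 * (L2_norm (\<lambda>x. \<psi> n x - g x))\<^sup>2) \<longlonglongrightarrow> 2 * a\<^sup>2 * 0\<^sup>2 + 2 * 0\<^sup>2"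
      by (intro tendsto_intros p q)
    then have "(\<lambda>n. 2 * a\<^sup>2 * (L2_norm (\<lambda>x. \<phi> n x - f x))\<^sup>2 + 2 * (L2_norm (\<lambda>x. \<psi> n x - g x))\<^sup>2) \<longlonglongrightarrow> 0" by simp
    then have "(\<lambda>n. (L2_norm (\<lambda>x. \<tau> n x - (a * f x + g x)))\<^sup>2) \<longlonglongrightarrow> 0"
      by (rule tendsto_sandwich[OF always_eventually always_eventually tendsto_const, rotated 2]) (use bd in auto)
    then have "(\<lambda>n. sqrt ((L2_norm (\<lambda>x. \<tau> n x - (a * f x + g x)))\<^sup>2)) \<longlonglongrightarrow> sqrt 0" by (rule tendsto_real_sqrt)
    then show ?thesis by (simp add: L2_norm_def)
  qed
  moreover have sq: "(\<omega> (\<tau> n) - (a * Y \<omega> + V \<omega>))\<^sup>2 \<le> 2 * a\<^sup>2 * (\<omega> (\<phi> n) - Y \<omega>)\<^sup>2 + 2 * (\<omega> (\<psi> n) - V \<omega>)\<^sup>2"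
    if "\<omega> \<in> space \<nu>" for n \<omega>
  proof -
    have "\<omega> (\<tau> n) - (a * Y \<omega> + V \<omega>) = a * (\<omega> (\<phi> n) - Y \<omega>) + (\<omega> (\<psi> n) - V \<omega>)"
      unfolding \<tau>_def schwartz_dual_lin[OF that p(1) q(1)] by (simp add: algebra_simps)
    then show ?thesis by (simp only: sq_lin_le)
  qed
  have ib: "integrable \<nu> (\<lambda>\<omega>. 2 * a\<^sup>2 * (\<omega> (\<phi> n) - Y \<omega>)\<^sup>2 + 2 * (\<omega> (\<psi> n) - V \<omega>)\<^sup>2)" for n
    using p(3) q(3) by auto
  have ii: "integrable \<nu> (\<lambda>\<omega>. (\<omega> (\<tau> n) - (a * Y \<omega> + V \<omega>))\<^sup>2)" for n
    by (rule Bochner_Integration.integrable_bound[OF ib[of n]]) (use sq[of _ n] in auto)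
  moreover have "(\<lambda>n. LINT \<omega>|\<nu>. (\<omega> (\<tau> n) - (a * Y \<omega> + V \<omega>))\<^sup>2) \<longlonglongrightarrow> 0"
  proof (rule tendsto_sandwich[OF always_eventually always_eventually tendsto_const])
    show "\<forall>n. 0 \<le> (LINT \<omega>|\<nu>. (\<omega> (\<tau> n) - (a * Y \<omega> + V \<omega>))\<^sup>2)" by simp
    show "\<forall>n. (LINT \<omega>|\<nu>. (\<omega> (\<tau> n) - (a * Y \<omega> + V \<omega>))\<^sup>2) \<le> 2 * a\<^sup>2 * (LINT \<omega>|\<nu>. (\<omega> (\<phi> n) - Y \<omega>)\<^sup>2) + 2 * (LINT \<omega>|\<nu>. (\<omega> (\<psi> n) - V \<omega>)\<^sup>2)"
    proof
      fix n
      have "(LINT \<omega>|\<nu>. (\<omega> (\<tau> n) - (a * Y \<omega> + V \<omega>))\<^sup>2) \<le> (LINT \<omega>|\<nu>. 2 * a\<^sup>2 * (\<omega> (\<phi> n) - Y \<omega>)\<^sup>2 + 2 * (\<omega> (\<psi> n) - V \<omega>)\<^sup>2)"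
        by (intro integral_mono ii ib sq)
      then show "(LINT \<omega>|\<nu>. (\<omega> (\<tau> n) - (a * Y \<omega> + V \<omega>))\<^sup>2) \<le> 2 * a\<^sup>2 * (LINT \<omega>|\<nu>. (\<omega> (\<phi> n) - Y \<omega>)\<^sup>2) + 2 * (LINT \<omega>|\<nu>. (\<omega> (\<psi> n) - V \<omega>)\<^sup>2)"
        using p(3) q(3) by simp
    qed
    have "(\<lambda>n. 2 * a\<^sup>2 * (LINT \<omega>|\<nu>. (\<omega> (\<phi> n) - Y \<omega>)\<^sup>2) + 2 * (LINT \<omega>|\<nu>. (\<omega> (\<psi> n) - V \<omega>)\<^sup>2)) \<longlonglongrightarrow> 2 * a\<^sup>2 * 0 + 2 * 0"
      by (intro tendsto_intros p q)
    then show "(\<lambda>n. 2 * a\<^sup>2 * (LINT \<omega>|\<nu>. (\<omega> (\<phi> n) - Y \<omega>)\<^sup>2) + 2 * (LINT \<omega>|\<nu>. (\<omega> (\<psi> n) - V \<omega>)\<^sup>2)) \<longlonglongrightarrow> 0" by simp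
  qed
  moreover have "(\<lambda>x. a * f x + g x) \<in> L2" by (rule L2_lin[OF fL gL])
  moreover have "(\<lambda>\<omega>. a * Y \<omega> + V \<omega>) \<in> borel_measurable \<nu>" by measurable
  ultimately show ?thesis unfolding PL_def real_L2_pairing_def using chi by blast
qed

lemma PL_scale: "PL f Y \<Longrightarrow> PL (\<lambda>x. a * f x) (\<lambda>\<omega>. a * Y \<omega>)"
  using PL_lin[of f Y f Y "a - 1"] by (simp add: algebra_simps)

text \<open>As |exp(iu) - exp(iv)| \<le> |u - v| and the mean of a nonnegative variable is at most
  its root mean square, the integrals pass to the limit; on the other side the squared norms
  converge and the incomplete gamma function is continuous.\<close>

lemma PL_cf:
  assumes PL: "PL f Y"
  shows "(CLINT \<omega>|\<nu>. exp (\<i> * of_real (Y \<omega>))) = UG (of_real (\<theta> + (LINT x|lborel. (f x)\<^sup>2) / 2)) / Z"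
proof -
  obtain \<phi> where p: "\<And>n. \<phi> n \<in> schwartz" "(\<lambda>n. L2_norm (\<lambda>x. \<phi> n x - f x)) \<longlonglongrightarrow> 0"
    "\<And>n. integrable \<nu> (\<lambda>\<omega>. (\<omega> (\<phi> n) - Y \<omega>)\<^sup>2)" "(\<lambda>n. LINT \<omega>|\<nu>. (\<omega> (\<phi> n) - Y \<omega>)\<^sup>2) \<longlonglongrightarrow> 0"
    using PL_seq[OF PL] by blast
  note [measurable] = PL_measurable[OF PL] measurable_eval[OF p(1)]
  have b1: "integrable \<nu> (\<lambda>\<omega>. exp (\<i> * of_real (U \<omega>)))" if "U \<in> borel_measurable \<nu>" for U :: "_ \<Rightarrow> real"
    by (rule nu.integrable_const_bound[of _ 1]) (use that in auto)
  have "(\<lambda>n. (CLINT \<omega>|\<nu>. exp (\<i> * of_real (\<omega> (\<phi> n)))) - (CLINT \<omega>|\<nu>. exp (\<i> * of_real (Y \<omega>)))) \<longlonglongrightarrow> 0"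
  proof (rule Lim_null_comparison)
    show "\<forall>\<^sub>F n in sequentially. norm ((CLINT \<omega>|\<nu>. exp (\<i> * of_real (\<omega> (\<phi> n)))) - (CLINT \<omega>|\<nu>. exp (\<i> * of_real (Y \<omega>)))) \<le> sqrt (LINT \<omega>|\<nu>. (\<omega> (\<phi> n) - Y \<omega>)\<^sup>2)"
    proof (intro always_eventually allI)
      fix n
      let ?d = "\<lambda>\<omega>. \<bar>\<omega> (\<phi> n) - Y \<omega>\<bar>"
      have i2: "integrable \<nu> (\<lambda>\<omega>. (?d \<omega>)\<^sup>2)" using p(3)[of n] by simp
      have i1: "integrable \<nu> ?d"
      proof (rule Bochner_Integration.integrable_bound[of _ "\<lambda>\<omega>. 1 + (?d \<omega>)\<^sup>2"])
        show "integrable \<nu> (\<lambda>\<omega>. 1 + (?d \<omega>)\<^sup>2)" using i2 by simp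
        have "\<bar>u\<bar> \<le> 1 + u\<^sup>2" for u :: real
        proof -
          have "0 \<le> (\<bar>u\<bar> - 1)\<^sup>2" by simp
          then have "2 * \<bar>u\<bar> \<le> 1 + u\<^sup>2" by (simp add: power2_diff)
          then show ?thesis using abs_ge_zero[of u] by linarith
        qed
        then show "AE \<omega> in \<nu>. norm (?d \<omega>) \<le> norm (1 + (?d \<omega>)\<^sup>2)" by (intro AE_I2) (simp add: abs_of_nonneg)
      qed measurable
      have "norm ((CLINT \<omega>|\<nu>. exp (\<i> * of_real (\<omega> (\<phi> n)))) - (CLINT \<omega>|\<nu>. exp (\<i> * of_real (Y \<omega>))))
         = norm (CLINT \<omega>|\<nu>. exp (\<i> * of_real (\<omega> (\<phi> n))) - exp (\<i> * of_real (Y \<omega>)))"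
        by (subst Bochner_Integration.integral_diff) (auto intro!: b1)
      also have "\<dots> \<le> (LINT \<omega>|\<nu>. norm (exp (\<i> * of_real (\<omega> (\<phi> n))) - exp (\<i> * complex_of_real (Y \<omega>))))"
        by (rule integral_norm_bound)
      also have "\<dots> \<le> (LINT \<omega>|\<nu>. ?d \<omega>)"
      proof (rule integral_mono)
        show "integrable \<nu> (\<lambda>\<omega>. norm (exp (\<i> * of_real (\<omega> (\<phi> n))) - exp (\<i> * complex_of_real (Y \<omega>))))"
          by (intro integrable_norm Bochner_Integration.integrable_diff b1) measurable
        fix \<omega>
        have "exp (\<i> * of_real (\<omega> (\<phi> n))) - exp (\<i> * complex_of_real (Y \<omega>)) = exp (\<i> * of_real (Y \<omega>)) * (iexp (\<omega> (\<phi> n) - Y \<omega>) - 1)"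
          by (simp add: algebra_simps exp_add[symmetric])
        then have "norm (exp (\<i> * of_real (\<omega> (\<phi> n))) - exp (\<i> * complex_of_real (Y \<omega>))) = norm (iexp (\<omega> (\<phi> n) - Y \<omega>) - 1)"
          by (simp add: norm_mult)
        also have "\<dots> \<le> ?d \<omega>" using iexp_approx1[of "\<omega> (\<phi> n) - Y \<omega>" 0] by simp
        finally show "norm (exp (\<i> * of_real (\<omega> (\<phi> n))) - exp (\<i> * complex_of_real (Y \<omega>))) \<le> ?d \<omega>" .
      qed (rule i1)
      also have "\<dots> \<le> sqrt (LINT \<omega>|\<nu>. (?d \<omega>)\<^sup>2)"
      proof (rule real_le_rsqrt)
        have "0 \<le> nu.variance ?d" by (rule nu.variance_positive)
        also have "nu.variance ?d = (LINT \<omega>|\<nu>. (?d \<omega>)\<^sup>2) - (LINT \<omega>|\<nu>. ?d \<omega>)\<^sup>2" by (rule nu.variance_eq[OF i1 i2])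
        finally show "(LINT \<omega>|\<nu>. ?d \<omega>)\<^sup>2 \<le> (LINT \<omega>|\<nu>. (?d \<omega>)\<^sup>2)" by simp
      qed
      finally show "norm ((CLINT \<omega>|\<nu>. exp (\<i> * of_real (\<omega> (\<phi> n)))) - (CLINT \<omega>|\<nu>. exp (\<i> * of_real (Y \<omega>)))) \<le> sqrt (LINT \<omega>|\<nu>. (\<omega> (\<phi> n) - Y \<omega>)\<^sup>2)"
        by simp
    qed
    show "(\<lambda>n. sqrt (LINT \<omega>|\<nu>. (\<omega> (\<phi> n) - Y \<omega>)\<^sup>2)) \<longlonglongrightarrow> 0"
      using tendsto_real_sqrt[OF p(4)] by simp
  qed
  then have l1: "(\<lambda>n. CLINT \<omega>|\<nu>. exp (\<i> * of_real (\<omega> (\<phi> n)))) \<longlonglongrightarrow> (CLINT \<omega>|\<nu>. exp (\<i> * of_real (Y \<omega>)))"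
    by (rule LIM_zero_cancel)
  let ?v = "LINT x|lborel. (f x)\<^sup>2"
  have lv: "(\<lambda>n. LINT x|lborel. (\<phi> n x)\<^sup>2) \<longlonglongrightarrow> ?v"
    by (rule LINT_sq_tendsto[OF PL_L2[OF PL] schwartz_L2[OF p(1)] p(2)])
  have "0 \<le> ?v" by simp
  then have "\<theta> + ?v / 2 > 0" using th by (intro add_pos_nonneg) auto
  then have "complex_of_real (\<theta> + ?v / 2) \<notin> \<real>\<^sub>\<le>\<^sub>0" by (simp only: complex_nonpos_Reals_iff Re_complex_of_real Im_complex_of_real) simp
  then have cU: "isCont UG (of_real (\<theta> + ?v / 2))" by (rule DERIV_isCont[OF upper_Gamma_deriv[OF rho]])
  have "(\<lambda>n. complex_of_real (\<theta> + (LINT x|lborel. (\<phi> n x)\<^sup>2) / 2)) \<longlonglongrightarrow> of_real (\<theta> + ?v / 2)"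
    by (intro tendsto_intros lv) auto
  then have "(\<lambda>n. UG (of_real (\<theta> + (LINT x|lborel. (\<phi> n x)\<^sup>2) / 2)) / Z) \<longlonglongrightarrow> UG (of_real (\<theta> + ?v / 2)) / Z"
    using Z_nonzero by (intro tendsto_divide tendsto_const isCont_tendsto_compose[OF cU]) auto
  then have "(\<lambda>n. CLINT \<omega>|\<nu>. exp (\<i> * of_real (\<omega> (\<phi> n)))) \<longlonglongrightarrow> UG (of_real (\<theta> + ?v / 2)) / Z"
    unfolding cf_schwartz[OF p(1)] .
  with l1 show ?thesis by (rule LIMSEQ_unique)
qed

lemma PL_exp_integrable:
  assumes PL: "PL f Y" and c: "c\<^sup>2 * (LINT x|lborel. (f x)\<^sup>2) < 2 * \<theta>"
  shows "integrable \<nu> (\<lambda>\<omega>. exp (c * Y \<omega>))"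
proof (rule gamma_grey_exp_moment[OF rho th nu.prob_space_axioms PL_measurable[OF PL] _ _ _ c])
  show "0 \<le> (LINT x|lborel. (f x)\<^sup>2)" by simp
  show "UG (of_real \<theta>) \<noteq> 0" using Z_nonzero by (simp add: Z_def)
  fix t :: real
  show "(CLINT \<omega>|\<nu>. exp (\<i> * of_real (t * Y \<omega>))) = UG (of_real (\<theta> + t\<^sup>2 * (LINT x|lborel. (f x)\<^sup>2) / 2)) / UG (of_real \<theta>)"
    using PL_cf[OF PL_scale[OF PL, of t]] by (simp add: Z_def power_mult_distrib)
qed

lemma PL_exp_abs_integrable:
  assumes PL: "PL f Y" and c: "c\<^sup>2 * (LINT x|lborel. (f x)\<^sup>2) < 2 * \<theta>"
  shows "integrable \<nu> (\<lambda>\<omega>. exp (c * \<bar>Y \<omega>\<bar>))"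
proof -
  note [measurable] = PL_measurable[OF PL]
  have "integrable \<nu> (\<lambda>\<omega>. exp (c * Y \<omega>) + exp (- c * Y \<omega>))"
    using PL_exp_integrable[OF PL, of c] PL_exp_integrable[OF PL, of "- c"] c by simp
  then show ?thesis
  proof (rule Bochner_Integration.integrable_bound)
    show "AE \<omega> in \<nu>. norm (exp (c * \<bar>Y \<omega>\<bar>)) \<le> norm (exp (c * Y \<omega>) + exp (- c * Y \<omega>))"
    proof (intro AE_I2)
      fix \<omega>
      have "exp (c * \<bar>Y \<omega>\<bar>) \<le> exp (c * Y \<omega>) + exp (- c * Y \<omega>)" by (simp add: abs_if)
      then show "norm (exp (c * \<bar>Y \<omega>\<bar>)) \<le> norm (exp (c * Y \<omega>) + exp (- c * Y \<omega>))"
        by simp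
    qed
  qed measurable
qed

text \<open>Continuation with a parameter l in place of the imaginary unit: for real l the variable
  Yf + l Yg is a real pairing, and l = i is the case wanted. The exponential moment of
  \<open>Yg\<close> gives holomorphy on a disc of radius r > 1.\<close>

lemma PL_complex_cf:
  assumes f: "PL f Yf" and g: "PL g Yg" and small: "(LINT x|lborel. (g x)\<^sup>2) < 2 * \<theta>"
  shows "(CLINT \<omega>|\<nu>. exp (\<i> * (of_real (Yf \<omega>) + \<i> * of_real (Yg \<omega>)))) =
     UG (of_real \<theta> + (of_real (LINT x|lborel. (f x)\<^sup>2) + 2 * \<i> * of_real (LINT x|lborel. g x * f x) - of_real (LINT x|lborel. (g x)\<^sup>2)) / 2) / Z"
proof -
  note [measurable] = PL_measurable[OF f] PL_measurable[OF g]
  define vf vg c where "vf = (LINT x|lborel. (f x)\<^sup>2)" and "vg = (LINT x|lborel. (g x)\<^sup>2)" and "c = (LINT x|lborel. g x * f x)"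
  have vg0: "vg \<ge> 0" by (simp add: vg_def)
  \<comment> \<open>The denominator is the midpoint of \<open>vg\<close> and 2 \<theta>. Hence r > 1
    and r^2 vg < 2 \<theta>, also when vg = 0.\<close>
  define r where "r = sqrt (2 * \<theta> / (vg + (2 * \<theta> - vg) / 2))"
  have vgt: "vg < 2 * \<theta>" using small by (simp add: vg_def)
  have den: "vg + (2 * \<theta> - vg) / 2 > 0" using vg0 vgt by (simp add: field_simps)
  have r2: "r\<^sup>2 = 2 * \<theta> / (vg + (2 * \<theta> - vg) / 2)" using th den by (simp add: r_def)
  have "vg + (2 * \<theta> - vg) / 2 < 2 * \<theta>" using vgt by (simp add: field_simps)
  then have r1: "r > 1" unfolding r_def using den by (simp add: less_divide_eq)
  have rv: "r\<^sup>2 * vg < 2 * \<theta>"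
  proof -
    have "vg < vg + (2 * \<theta> - vg) / 2" using vgt by simp
    then have "2 * \<theta> * vg < 2 * \<theta> * (vg + (2 * \<theta> - vg) / 2)" using th by simp
    then show ?thesis unfolding r2 using den by (simp add: divide_less_eq)
  qed
  let ?h = "\<lambda>l \<omega>. exp (\<i> * (of_real (Yf \<omega>) + l * of_real (Yg \<omega>)))"
  let ?Q = "\<lambda>l. of_real \<theta> + (of_real vf + 2 * l * of_real c + l\<^sup>2 * of_real vg) / 2"
  let ?D = "ball (0::complex) r"
  have hL: "(\<lambda>l. CLINT \<omega>|\<nu>. ?h l \<omega>) holomorphic_on ?D"
  proof (rule holomorphic_integral_dominated[OF open_ball])
    show "(\<lambda>l. ?h l \<omega>) holomorphic_on ?D" for \<omega> by (intro holomorphic_intros)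
    fix z assume "z \<in> ?D"
    have ig: "integrable \<nu> (\<lambda>\<omega>. exp (r * \<bar>Yg \<omega>\<bar>))" using PL_exp_abs_integrable[OF g, of r] rv by (simp add: vg_def)
    have bd: "cmod (?h u \<omega>) \<le> exp (r * \<bar>Yg \<omega>\<bar>)" if "u \<in> ?D" for u \<omega>
    proof -
      have "- (Im u * Yg \<omega>) \<le> \<bar>Im u\<bar> * \<bar>Yg \<omega>\<bar>" by (metis abs_ge_minus_self abs_mult)
      also have "\<dots> \<le> r * \<bar>Yg \<omega>\<bar>" using that abs_Im_le_cmod[of u] by (intro mult_right_mono) auto
      finally show ?thesis by simp
    qed
    show "\<exists>r'>0. \<exists>g. integrable \<nu> g \<and> (\<forall>u\<in>?D. dist z u < r' \<longrightarrow> (\<forall>x\<in>space \<nu>. cmod (?h u x) \<le> g x))"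
      using ig bd zero_less_one by blast
  qed measurable
  \<comment> \<open>Re Q is \<theta> plus half the squared norm of (Re l) g + f minus (Im l)^2 vg /
    2, and the subtracted term is below \<theta>.\<close>
  have ReQ: "Re (?Q l) > 0" if l: "l \<in> ?D" for l
  proof -
    have "0 \<le> (LINT x|lborel. (Re l * g x + f x)\<^sup>2)" by simp
    also have "\<dots> = (Re l)\<^sup>2 * vg + 2 * Re l * c + vf"
      unfolding LINT_sq_lin[OF PL_L2[OF g] PL_L2[OF f]] vf_def vg_def c_def ..
    finally have 1: "0 \<le> (Re l)\<^sup>2 * vg + 2 * Re l * c + vf" .
    have "\<bar>Im l\<bar> \<le> r" using l abs_Im_le_cmod[of l] by simp
    then have "(Im l)\<^sup>2 \<le> r\<^sup>2" by (metis abs_ge_zero power2_abs power_mono)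
    then have "(Im l)\<^sup>2 * vg \<le> r\<^sup>2 * vg" using vg0 by (rule mult_right_mono)
    then have 2: "(Im l)\<^sup>2 * vg < 2 * \<theta>" using rv by simp
    have "Re (?Q l) = \<theta> + (vf + 2 * Re l * c + ((Re l)\<^sup>2 - (Im l)\<^sup>2) * vg) / 2"
      unfolding Re_power2[symmetric] by simp
    also have "\<dots> = \<theta> + ((Re l)\<^sup>2 * vg + 2 * Re l * c + vf) / 2 - (Im l)\<^sup>2 * vg / 2"
      by (simp add: field_simps)
    finally have E: "Re (?Q l) = \<theta> + ((Re l)\<^sup>2 * vg + 2 * Re l * c + vf) / 2 - (Im l)\<^sup>2 * vg / 2" .
    show ?thesis unfolding E using 1 2 by argo
  qed
  have hR: "(\<lambda>l. UG (?Q l) / Z) holomorphic_on ?D"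
  proof -
    have "(\<lambda>l. UG (?Q l)) holomorphic_on ?D"
      by (rule holomorphic_on_compose_gen[of ?Q ?D UG "- \<real>\<^sub>\<le>\<^sub>0", unfolded o_def])
         (use ReQ upper_Gamma_holomorphic[OF rho] in \<open>force intro!: holomorphic_intros simp: complex_nonpos_Reals_iff\<close>)+
    then show ?thesis using Z_nonzero by (intro holomorphic_intros) auto
  qed
  have real: "(CLINT \<omega>|\<nu>. ?h (of_real l) \<omega>) = UG (?Q (of_real l)) / Z" for l :: real
  proof -
    have "(CLINT \<omega>|\<nu>. ?h (of_real l) \<omega>) = (CLINT \<omega>|\<nu>. exp (\<i> * of_real (l * Yg \<omega> + Yf \<omega>)))"
      by (simp add: add.commute)
    also have "\<dots> = UG (of_real (\<theta> + (LINT x|lborel. (l * g x + f x)\<^sup>2) / 2)) / Z"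
      by (rule PL_cf[OF PL_lin[OF g f]])
    also have "(LINT x|lborel. (l * g x + f x)\<^sup>2) = l\<^sup>2 * vg + 2 * l * c + vf"
      unfolding LINT_sq_lin[OF PL_L2[OF g] PL_L2[OF f]] vf_def vg_def c_def ..
    finally show ?thesis by (simp add: add_ac)
  qed
  have "(CLINT \<omega>|\<nu>. ?h \<i> \<omega>) - UG (?Q \<i>) / Z = 0"
  proof (rule analytic_continuation[of "\<lambda>l. (CLINT \<omega>|\<nu>. ?h l \<omega>) - UG (?Q l) / Z" ?D "complex_of_real ` {-r<..<r}" 0])
    show "(\<lambda>l. (CLINT \<omega>|\<nu>. ?h l \<omega>) - UG (?Q l) / Z) holomorphic_on ?D" by (intro holomorphic_intros hL hR)
    show "complex_of_real ` {-r<..<r} \<subseteq> ?D" by auto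
    show "0 islimpt complex_of_real ` {-r<..<r}"
      unfolding islimpt_sequential
    proof (intro exI[of _ "\<lambda>n. complex_of_real (1 / (1 + real n))"] conjI allI)
      have "(\<lambda>n. complex_of_real (1 / (1 + real n))) \<longlonglongrightarrow> of_real 0" by (rule tendsto_of_real) real_asymp
      then show "(\<lambda>n. complex_of_real (1 / (1 + real n))) \<longlonglongrightarrow> 0" by (simp only: of_real_0)
      fix n
      have "0 < 1 / (1 + real n)" "1 / (1 + real n) \<le> 1" by (auto simp: field_simps)
      then have "1 / (1 + real n) \<in> {-r<..<r}" "complex_of_real (1 / (1 + real n)) \<noteq> 0"
        using r1 unfolding greaterThanLessThan_iff of_real_eq_0_iff by linarith+
      then show "complex_of_real (1 / (1 + real n)) \<in> complex_of_real ` {-r<..<r} - {0}" by blast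
    qed
    show "\<And>z. z \<in> complex_of_real ` {-r<..<r} \<Longrightarrow> (CLINT \<omega>|\<nu>. ?h z \<omega>) - UG (?Q z) / Z = 0"
      using real by auto
  qed (use r1 in auto)
  then have "(CLINT \<omega>|\<nu>. ?h \<i> \<omega>) = UG (?Q \<i>) / Z" by simp
  then show ?thesis by (simp add: vf_def vg_def c_def)
qed

end


section \<open>Appell expansions and the T-transform\<close>

lemma bilin_sq_lin:
  assumes F: "F \<in> complexify L2" and G: "G \<in> complexify L2"
  shows "bilin (\<lambda>x. a * F x + b * G x) (\<lambda>x. a * F x + b * G x) = a\<^sup>2 * bilin F F + 2 * a * b * bilin F G + b\<^sup>2 * bilin G G"
proof -
  have i: "integrable lborel (\<lambda>x. F x * G x)" if "F \<in> complexify L2" "G \<in> complexify L2" for F G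
  proof -
    have c: "Re \<circ> F \<in> L2" "Im \<circ> F \<in> L2" "Re \<circ> G \<in> L2" "Im \<circ> G \<in> L2" using that by (auto simp: complexify_def)
    have "integrable lborel (\<lambda>x. complex_of_real ((Re \<circ> F) x * (Re \<circ> G) x) - of_real ((Im \<circ> F) x * (Im \<circ> G) x)
       + \<i> * (of_real ((Re \<circ> F) x * (Im \<circ> G) x) + of_real ((Im \<circ> F) x * (Re \<circ> G) x)))"
      by (intro Bochner_Integration.integrable_add Bochner_Integration.integrable_diff integrable_mult_right integrable_of_real integrable_L2_mult c)
    also have "(\<lambda>x. complex_of_real ((Re \<circ> F) x * (Re \<circ> G) x) - of_real ((Im \<circ> F) x * (Im \<circ> G) x)
       + \<i> * (of_real ((Re \<circ> F) x * (Im \<circ> G) x) + of_real ((Im \<circ> F) x * (Re \<circ> G) x))) = (\<lambda>x. F x * G x)"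
      by (auto simp: complex_eq_iff)
    finally show ?thesis .
  qed
  have "bilin (\<lambda>x. a * F x + b * G x) (\<lambda>x. a * F x + b * G x)
     = (CLINT x|lborel. a\<^sup>2 * (F x * F x) + 2 * a * b * (F x * G x) + b\<^sup>2 * (G x * G x))"
    unfolding bilin_def by (intro Bochner_Integration.integral_cong) (auto simp: power2_eq_square algebra_simps)
  then show ?thesis using i[OF F F] i[OF F G] i[OF G G] by (simp add: bilin_def)
qed

lemma complexify_lin:
  assumes "\<And>f g a. f \<in> S \<Longrightarrow> g \<in> S \<Longrightarrow> (\<lambda>x. a * f x + g x) \<in> S" and "F \<in> complexify S" "G \<in> complexify S"
  shows "(\<lambda>x. a * F x + G x) \<in> complexify S"
proof -
  have "Re \<circ> (\<lambda>x. a * F x + G x) = (\<lambda>x. Re a * (Re \<circ> F) x + (- Im a * (Im \<circ> F) x + (Re \<circ> G) x))"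
    "Im \<circ> (\<lambda>x. a * F x + G x) = (\<lambda>x. Re a * (Im \<circ> F) x + (Im a * (Re \<circ> F) x + (Im \<circ> G) x))" by auto
  moreover have c: "Re \<circ> F \<in> S" "Im \<circ> F \<in> S" "Re \<circ> G \<in> S" "Im \<circ> G \<in> S" using assms(2,3) by (auto simp: complexify_def)
  have "(\<lambda>x. Re a * (Re \<circ> F) x + (- Im a * (Im \<circ> F) x + (Re \<circ> G) x)) \<in> S"
    by (rule assms(1)[OF c(1) assms(1)[OF c(2) c(3)]])
  moreover have "(\<lambda>x. Re a * (Im \<circ> F) x + (Im a * (Re \<circ> F) x + (Im \<circ> G) x)) \<in> S"
    by (rule assms(1)[OF c(2) assms(1)[OF c(1) c(4)]])
  ultimately show ?thesis by (simp only: complexify_def mem_Collect_eq)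
qed

lemma complexify_mono: "S \<subseteq> T \<Longrightarrow> complexify S \<subseteq> complexify T"
  by (auto simp: complexify_def)

lemma complexify_schwartz_L2: "F \<in> complexify schwartz \<Longrightarrow> F \<in> complexify L2"
  using complexify_mono[of schwartz L2] schwartz_L2 by blast

lemma zero_complexify_schwartz: "(\<lambda>x. 0) \<in> complexify schwartz"
  using zero_schwartz by (simp add: complexify_def o_def)

lemma complexify_schwartz_scale:
  assumes "F \<in> complexify schwartz"
  shows "(\<lambda>x. a * F x) \<in> complexify schwartz"
proof -
  have "(\<lambda>x. a * F x + 0) \<in> complexify schwartz"
    by (rule complexify_lin[OF _ assms zero_complexify_schwartz]) (rule schwartz_lin)
  then show ?thesis by simp
qed

context gamma_grey
begin

definition CPL :: "(real \<Rightarrow> complex) \<Rightarrow> (((real \<Rightarrow> real) \<Rightarrow> real) \<Rightarrow> complex) \<Rightarrow> bool" where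
  "CPL F Y \<longleftrightarrow> PL (Re \<circ> F) (Re \<circ> Y) \<and> PL (Im \<circ> F) (Im \<circ> Y)"

lemma CPL_measurable:
  assumes "CPL F Y"
  shows "Y \<in> borel_measurable \<nu>"
proof -
  have [measurable]: "(\<lambda>\<omega>. Re (Y \<omega>)) \<in> borel_measurable \<nu>" "(\<lambda>\<omega>. Im (Y \<omega>)) \<in> borel_measurable \<nu>"
    using PL_measurable[of "Re \<circ> F" "Re \<circ> Y"] PL_measurable[of "Im \<circ> F" "Im \<circ> Y"] assms unfolding CPL_def o_def by blast+
  have "(\<lambda>\<omega>. complex_of_real (Re (Y \<omega>)) + \<i> * of_real (Im (Y \<omega>))) \<in> borel_measurable \<nu>" by measurable
  then show ?thesis by (simp add: complex_eq[symmetric])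
qed

lemma CPL_lin:
  assumes F: "CPL F Y" and G: "CPL G V"
  shows "CPL (\<lambda>x. a * F x + G x) (\<lambda>\<omega>. a * Y \<omega> + V \<omega>)"
proof -
  have e: "Re \<circ> (\<lambda>x. a * F x + G x) = (\<lambda>x. Re a * (Re \<circ> F) x + (- Im a * (Im \<circ> F) x + (Re \<circ> G) x))"
    "Im \<circ> (\<lambda>x. a * F x + G x) = (\<lambda>x. Re a * (Im \<circ> F) x + (Im a * (Re \<circ> F) x + (Im \<circ> G) x))"
    "Re \<circ> (\<lambda>\<omega>. a * Y \<omega> + V \<omega>) = (\<lambda>x. Re a * (Re \<circ> Y) x + (- Im a * (Im \<circ> Y) x + (Re \<circ> V) x))"
    "Im \<circ> (\<lambda>\<omega>. a * Y \<omega> + V \<omega>) = (\<lambda>x. Re a * (Im \<circ> Y) x + (Im a * (Re \<circ> Y) x + (Im \<circ> V) x))"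
    by auto
  show ?thesis
    unfolding CPL_def e using assms by (intro conjI PL_lin) (auto simp only: CPL_def)
qed

lemma CPL_scale:
  assumes "CPL F Y"
  shows "CPL (\<lambda>x. a * F x) (\<lambda>\<omega>. a * Y \<omega>)"
  using CPL_lin[OF assms assms, of "a - 1"] by (simp add: algebra_simps)

lemma CPL_schwartz:
  assumes "\<xi> \<in> complexify schwartz"
  shows "CPL \<xi> (\<lambda>\<omega>. dual_pair \<omega> \<xi>)"
proof -
  have "Re \<circ> (\<lambda>\<omega>. dual_pair \<omega> \<xi>) = (\<lambda>\<omega>. \<omega> (Re \<circ> \<xi>))" "Im \<circ> (\<lambda>\<omega>. dual_pair \<omega> \<xi>) = (\<lambda>\<omega>. \<omega> (Im \<circ> \<xi>))"
    by (auto simp: dual_pair_def)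
  moreover have "Re \<circ> \<xi> \<in> schwartz" "Im \<circ> \<xi> \<in> schwartz" using assms by (auto simp: complexify_def)
  ultimately show ?thesis unfolding CPL_def using PL_schwartz[of "Re \<circ> \<xi>"] PL_schwartz[of "Im \<circ> \<xi>"] by simp
qed

lemma CPL_cf:
  assumes F: "CPL F Y" and small: "(LINT x|lborel. (Im (F x))\<^sup>2) < 2 * \<theta>"
  shows "(CLINT \<omega>|\<nu>. exp (\<i> * Y \<omega>)) = UG (of_real \<theta> + bilin F F / 2) / Z"
proof -
  have f: "PL (\<lambda>x. Re (F x)) (\<lambda>\<omega>. Re (Y \<omega>))" and g: "PL (\<lambda>x. Im (F x)) (\<lambda>\<omega>. Im (Y \<omega>))"
    using F by (auto simp: CPL_def o_def)
  have fL: "(\<lambda>x. Re (F x)) \<in> L2" and gL: "(\<lambda>x. Im (F x)) \<in> L2" using PL_L2[OF f] PL_L2[OF g] by auto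
  have "(CLINT \<omega>|\<nu>. exp (\<i> * Y \<omega>)) = (CLINT \<omega>|\<nu>. exp (\<i> * (of_real (Re (Y \<omega>)) + \<i> * of_real (Im (Y \<omega>)))))"
    by (simp add: complex_eq[symmetric])
  also have "\<dots> = UG (of_real \<theta> + (of_real (LINT x|lborel. (Re (F x))\<^sup>2) + 2 * \<i> * of_real (LINT x|lborel. Im (F x) * Re (F x)) - of_real (LINT x|lborel. (Im (F x))\<^sup>2)) / 2) / Z"
    by (rule PL_complex_cf[OF f g small])
  also have "of_real (LINT x|lborel. (Re (F x))\<^sup>2) + 2 * \<i> * of_real (LINT x|lborel. Im (F x) * Re (F x)) - of_real (LINT x|lborel. (Im (F x))\<^sup>2) = bilin F F"
  proof -
    have "bilin F F = (CLINT x|lborel. of_real ((Re (F x))\<^sup>2) + 2 * \<i> * of_real (Im (F x) * Re (F x)) - of_real ((Im (F x))\<^sup>2))"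
      unfolding bilin_def
      by (intro Bochner_Integration.integral_cong) (auto simp: complex_eq_iff power2_eq_square)
    also have "\<dots> = of_real (LINT x|lborel. (Re (F x))\<^sup>2) + 2 * \<i> * of_real (LINT x|lborel. Im (F x) * Re (F x)) - of_real (LINT x|lborel. (Im (F x))\<^sup>2)"
    proof -
      have i1: "integrable lborel (\<lambda>x. complex_of_real ((Re (F x))\<^sup>2))" "integrable lborel (\<lambda>x. complex_of_real ((Im (F x))\<^sup>2))"
        using fL gL by (auto simp only: L2_def mem_Collect_eq intro!: integrable_of_real)
      have i2: "integrable lborel (\<lambda>x. 2 * \<i> * complex_of_real (Im (F x) * Re (F x)))"
        by (intro integrable_mult_right integrable_of_real integrable_L2_mult[OF gL fL])
      show ?thesis
        by (simp only: Bochner_Integration.integral_diff[OF Bochner_Integration.integrable_add[OF i1(1) i2] i1(2)]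
            Bochner_Integration.integral_add[OF i1(1) i2] integral_mult_right_zero integral_complex_of_real)
    qed
    finally show ?thesis by (rule sym)
  qed
  finally show ?thesis .
qed

lemma dual_pair_scale:
  assumes "\<omega> \<in> space \<nu>" and "\<xi> \<in> complexify schwartz"
  shows "dual_pair \<omega> (\<lambda>x. z * \<xi> x) = z * dual_pair \<omega> \<xi>"
proof -
  have s: "Re \<circ> \<xi> \<in> schwartz" "Im \<circ> \<xi> \<in> schwartz" using assms(2) by (auto simp: complexify_def)
  have e: "Re \<circ> (\<lambda>x. z * \<xi> x) = (\<lambda>x. Re z * (Re \<circ> \<xi>) x + (- Im z) * (Im \<circ> \<xi>) x)"
    "Im \<circ> (\<lambda>x. z * \<xi> x) = (\<lambda>x. Re z * (Im \<circ> \<xi>) x + Im z * (Re \<circ> \<xi>) x)" by auto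
  have m: "\<omega> (\<lambda>x. a * f x) = a * \<omega> f" if "f \<in> schwartz" for a f
    using schwartz_dual_lin[OF assms(1) that zero_schwartz, of a] schwartz_dual_0[OF assms(1)] by simp
  have l: "\<omega> (\<lambda>x. a * f x + b * g x) = a * \<omega> f + b * \<omega> g" if "f \<in> schwartz" "g \<in> schwartz" for a b f g
    using schwartz_dual_lin[OF assms(1) that(1) schwartz_scale[OF that(2)], of a b] m[OF that(2)] by simp
  show ?thesis unfolding dual_pair_def e l[OF s] l[OF s(2,1)] by (simp add: complex_eq_iff)
qed

lemma laplace_eq:
  assumes xi: "\<xi> \<in> complexify schwartz" and small: "(LINT x|lborel. (Im (z * \<xi> x))\<^sup>2) < 2 * \<theta>"
  shows "laplace \<nu> (\<lambda>x. \<i> * (z * \<xi> x)) = UG (of_real \<theta> + z\<^sup>2 * bilin \<xi> \<xi> / 2) / Z"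
proof -
  have "laplace \<nu> (\<lambda>x. \<i> * (z * \<xi> x)) = (CLINT \<omega>|\<nu>. exp (\<i> * dual_pair \<omega> (\<lambda>x. z * \<xi> x)))"
    unfolding laplace_def
    by (intro Bochner_Integration.integral_cong refl arg_cong[of _ _ exp] dual_pair_scale complexify_schwartz_scale xi)
  also have "\<dots> = UG (of_real \<theta> + bilin (\<lambda>x. z * \<xi> x) (\<lambda>x. z * \<xi> x) / 2) / Z"
    by (rule CPL_cf[OF CPL_schwartz[OF complexify_schwartz_scale[OF xi]] small])
  also have "bilin (\<lambda>x. z * \<xi> x) (\<lambda>x. z * \<xi> x) = z\<^sup>2 * bilin \<xi> \<xi>"
    using bilin_sq_lin[OF complexify_schwartz_L2[OF xi] complexify_schwartz_L2[OF xi], of z 0] by simp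
  finally show ?thesis .
qed

end

lemma herm_scale:
  assumes H: "hilbertian_family ip" and xi: "\<xi> \<in> complexify schwartz" and ze: "\<zeta> \<in> complexify schwartz"
  shows "herm ip p (\<lambda>x. z * \<xi> x) \<zeta> = z * herm ip p \<xi> \<zeta>"
    and "herm ip p \<xi> (\<lambda>x. z * \<zeta> x) = cnj z * herm ip p \<xi> \<zeta>"
proof -
  have sym: "ip p f g = ip p g f" if "f \<in> schwartz" "g \<in> schwartz" for f g
    using H that unfolding hilbertian_family_def by blast
  have lin: "ip p (\<lambda>x. a * f x + g x) h = a * ip p f h + ip p g h" if "f \<in> schwartz" "g \<in> schwartz" "h \<in> schwartz" for a f g h
    using H that unfolding hilbertian_family_def by blast
  have z: "ip p (\<lambda>x. 0) h = 0" if "h \<in> schwartz" for h using lin[OF zero_schwartz zero_schwartz that, of 1] by simp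
  have lin1: "ip p (\<lambda>x. a * f x + b * g x) h = a * ip p f h + b * ip p g h" if "f \<in> schwartz" "g \<in> schwartz" "h \<in> schwartz" for a b f g h
    using lin[OF that(1) schwartz_scale[OF that(2)] that(3)] lin[OF that(2) zero_schwartz that(3)] z[OF that(3)] by simp
  have lin2: "ip p h (\<lambda>x. a * f x + b * g x) = a * ip p h f + b * ip p h g" if "f \<in> schwartz" "g \<in> schwartz" "h \<in> schwartz" for a b f g h
    using lin1[OF that, of a b] sym[OF that(3) schwartz_lin[OF that(1) schwartz_scale[OF that(2)]], of a b] sym[OF that(1,3)] sym[OF that(2,3)] by simp
  have s: "Re \<circ> \<xi> \<in> schwartz" "Im \<circ> \<xi> \<in> schwartz" "Re \<circ> \<zeta> \<in> schwartz" "Im \<circ> \<zeta> \<in> schwartz"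
    using xi ze by (auto simp: complexify_def)
  have e: "Re \<circ> (\<lambda>x. z * F x) = (\<lambda>x. Re z * (Re \<circ> F) x + (- Im z) * (Im \<circ> F) x)"
    "Im \<circ> (\<lambda>x. z * F x) = (\<lambda>x. Re z * (Im \<circ> F) x + Im z * (Re \<circ> F) x)" for F :: "real \<Rightarrow> complex" by auto
  show "herm ip p (\<lambda>x. z * \<xi> x) \<zeta> = z * herm ip p \<xi> \<zeta>"
    unfolding herm_def e lin1[OF s(1,2,3)] lin1[OF s(1,2,4)] lin1[OF s(2,1,3)] lin1[OF s(2,1,4)]
    by (simp add: complex_eq_iff algebra_simps)
  show "herm ip p \<xi> (\<lambda>x. z * \<zeta> x) = cnj z * herm ip p \<xi> \<zeta>"
    unfolding herm_def e lin2[OF s(3,4,1)] lin2[OF s(3,4,2)] lin2[OF s(4,3,1)] lin2[OF s(4,3,2)]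
    by (simp add: complex_eq_iff algebra_simps)
qed

lemma herm_self:
  assumes H: "hilbertian_family ip" and xi: "\<xi> \<in> complexify schwartz"
  shows "herm ip p \<xi> \<xi> = of_real (Re (herm ip p \<xi> \<xi>))" and "Re (herm ip p \<xi> \<xi>) \<ge> 0"
proof -
  have s: "Re \<circ> \<xi> \<in> schwartz" "Im \<circ> \<xi> \<in> schwartz" using xi by (auto simp: complexify_def)
  have sym: "ip p f g = ip p g f" if "f \<in> schwartz" "g \<in> schwartz" for f g
    using H that unfolding hilbertian_family_def by blast
  have pos: "ip p f f \<ge> 0" if "f \<in> schwartz" for f
  proof -
    have "L2_norm f \<le> sqrt (ip p f f)" using H that unfolding hilbertian_family_def by blast
    moreover have "0 \<le> L2_norm f" by (simp add: L2_norm_def)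
    ultimately have "0 \<le> sqrt (ip p f f)" by linarith
    then show ?thesis by simp
  qed
  show "herm ip p \<xi> \<xi> = of_real (Re (herm ip p \<xi> \<xi>))" unfolding herm_def by (simp add: complex_eq_iff sym[OF s])
  show "Re (herm ip p \<xi> \<xi>) \<ge> 0" unfolding herm_def using pos[OF s(1)] pos[OF s(2)] by simp
qed

lemma herm_self_scale:
  assumes H: "hilbertian_family ip" and xi: "\<xi> \<in> complexify schwartz"
  shows "Re (herm ip p (\<lambda>x. z * \<xi> x) (\<lambda>x. z * \<xi> x)) = (cmod z)\<^sup>2 * Re (herm ip p \<xi> \<xi>)"
proof -
  have "herm ip p (\<lambda>x. z * \<xi> x) (\<lambda>x. z * \<xi> x) = (z * cnj z) * herm ip p \<xi> \<xi>"
    using herm_scale(1)[OF H xi complexify_schwartz_scale[OF xi]] herm_scale(2)[OF H xi xi] by (simp add: mult.assoc)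
  also have "\<dots> = of_real ((cmod z)\<^sup>2) * herm ip p \<xi> \<xi>" by (simp only: complex_norm_square)
  finally show ?thesis by simp
qed

text \<open>The strict inequality in \<open>U_nbhd\<close> leaves room beyond z = 1, both for z
  \<xi> to remain in the neighbourhood and for the Appell series to be dominated by a geometric one
  of ratio below 1.\<close>

lemma U_nbhd_scale:
  assumes H: "hilbertian_family ip" and xi: "\<xi> \<in> U_nbhd ip p q"
  shows "\<exists>R>1. \<forall>z. cmod z < R \<longrightarrow> (\<lambda>x. z * \<xi> x) \<in> U_nbhd ip p q \<and> R * sqrt (2 ^ q * Re (herm ip p \<xi> \<xi>)) < 1"
proof -
  have xs: "\<xi> \<in> complexify schwartz" using xi by (simp add: U_nbhd_def)
  define k where "k = 2 ^ q * Re (herm ip p \<xi> \<xi>)"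
  have k: "0 \<le> k" "k < 1" using xi herm_self(2)[OF H xs] by (auto simp: k_def U_nbhd_def)
  \<comment> \<open>For 0 \<le> k < 1 this gives R > 1 and R^2 k = 2 k / (1 + k) < 1, including k =
    0.\<close>
  define R where "R = sqrt (2 / (1 + k))"
  have R: "R > 1" using k by (simp add: R_def less_divide_eq)
  have Rk: "R\<^sup>2 * k < 1" using k by (simp add: R_def divide_less_eq)
  have "(R * sqrt k)\<^sup>2 < 1" using Rk k by (simp add: power_mult_distrib)
  then have "R * sqrt k < 1" by (simp add: abs_square_less_1)
  moreover have "(\<lambda>x. z * \<xi> x) \<in> U_nbhd ip p q" if z: "cmod z < R" for z
  proof -
    have "(cmod z)\<^sup>2 \<le> R\<^sup>2" using z by (intro power_mono) auto
    then have "(cmod z)\<^sup>2 * k \<le> R\<^sup>2 * k" using k by (intro mult_right_mono)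
    moreover have "2 ^ q * ((cmod z)\<^sup>2 * Re (herm ip p \<xi> \<xi>)) = (cmod z)\<^sup>2 * k" by (simp add: k_def)
    ultimately have "2 ^ q * ((cmod z)\<^sup>2 * Re (herm ip p \<xi> \<xi>)) < 1" using Rk by linarith
    then show ?thesis unfolding U_nbhd_def by (simp add: complexify_schwartz_scale[OF xs] herm_self_scale[OF H xs])
  qed
  ultimately show ?thesis using R by (auto simp: k_def)
qed

text \<open>The encoding of a tensor that lives in degree \<open>n\<close> alone: the empty lists in
  front fill the lower degrees with 0.\<close>

lemma single_kernel:
  assumes "\<forall>(c, \<zeta>)\<in>set k. \<zeta> \<in> complexify schwartz"
  shows "replicate n [] @ [k] \<in> kernels"
    "appell_poly \<nu> (replicate n [] @ [k]) \<omega> = (\<Sum>(c, \<zeta>)\<leftarrow>k. c * appell \<nu> n \<zeta> \<omega>)"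
    "test_norm ip p q (replicate n [] @ [k]) = sqrt ((fact n)\<^sup>2 * 2 ^ (n * q) * kernel_norm_sq ip p n k)"
proof -
  show "replicate n [] @ [k] \<in> kernels" using assms by (auto simp: kernels_def)
  have "(\<Sum>m<n. \<Sum>(c, \<xi>)\<leftarrow>(replicate n [] @ [k]) ! m. c * appell \<nu> m \<xi> \<omega>) = 0"
    by (intro sum.neutral) (auto simp: nth_append)
  then show "appell_poly \<nu> (replicate n [] @ [k]) \<omega> = (\<Sum>(c, \<zeta>)\<leftarrow>k. c * appell \<nu> n \<zeta> \<omega>)"
    by (simp add: appell_poly_def nth_append)
  have "(\<Sum>m<n. (fact m)\<^sup>2 * 2 ^ (m * q) * kernel_norm_sq ip p m ((replicate n [] @ [k]) ! m)) = 0"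
    by (intro sum.neutral) (auto simp: nth_append kernel_norm_sq_def)
  then show "test_norm ip p q (replicate n [] @ [k]) = sqrt ((fact n)\<^sup>2 * 2 ^ (n * q) * kernel_norm_sq ip p n k)"
    by (simp add: test_norm_def nth_append)
qed

context
  fixes \<nu> ip p q \<Phi>
  assumes H: "hilbertian_family ip" and Phi: "\<Phi> \<in> distrib_pq \<nu> ip p q"
begin

lemma distrib_lin: "f \<in> polys \<nu> \<Longrightarrow> g \<in> polys \<nu> \<Longrightarrow> \<Phi> (\<lambda>\<omega>. a * f \<omega> + g \<omega>) = a * \<Phi> f + \<Phi> g"
  using Phi unfolding distrib_pq_def by blast

lemma appell_in_polys:
  assumes "\<zeta> \<in> complexify schwartz"
  shows "appell \<nu> n \<zeta> \<in> polys \<nu>"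
proof -
  have k: "\<forall>(c, \<zeta>')\<in>set [(1 :: complex, \<zeta>)]. \<zeta>' \<in> complexify schwartz" using assms by auto
  have "appell \<nu> n \<zeta> = appell_poly \<nu> (replicate n [] @ [[(1, \<zeta>)]])"
    using single_kernel(2)[OF k] by (simp add: fun_eq_iff)
  then show ?thesis unfolding polys_def using single_kernel(1)[OF k] by blast
qed

text \<open>The factor n! of the norm is what the division by n! in the exponential series removes
  later, leaving a geometric series.\<close>

lemma distrib_appell_bound:
  assumes "\<zeta> \<in> complexify schwartz"
  shows "\<exists>C. \<forall>n. cmod (\<Phi> (appell \<nu> n \<zeta>)) \<le> C * (fact n * sqrt (2 ^ q * Re (herm ip p \<zeta> \<zeta>)) ^ n)"
proof -
  obtain C where C: "\<And>K. K \<in> kernels \<Longrightarrow> cmod (\<Phi> (appell_poly \<nu> K)) \<le> C * test_norm ip p q K"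
    using Phi unfolding distrib_pq_def by blast
  have k: "\<forall>(c, \<zeta>')\<in>set [(1 :: complex, \<zeta>)]. \<zeta>' \<in> complexify schwartz" using assms by auto
  define r where "r = Re (herm ip p \<zeta> \<zeta>)"
  have hr: "herm ip p \<zeta> \<zeta> = of_real r" using herm_self(1)[OF H assms] by (simp add: r_def)
  show ?thesis
  proof (intro exI allI)
    fix n
    have "appell \<nu> n \<zeta> = appell_poly \<nu> (replicate n [] @ [[(1, \<zeta>)]])"
      using single_kernel(2)[OF k] by (simp add: fun_eq_iff)
    then have "cmod (\<Phi> (appell \<nu> n \<zeta>)) \<le> C * sqrt ((fact n)\<^sup>2 * 2 ^ (n * q) * kernel_norm_sq ip p n [(1, \<zeta>)])"
      using C[OF single_kernel(1)[OF k, of n]] single_kernel(3)[OF k] by simp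
    also have "kernel_norm_sq ip p n [(1, \<zeta>)] = r ^ n"
      by (simp add: kernel_norm_sq_def hr flip: of_real_power)
    also have "sqrt ((fact n)\<^sup>2 * 2 ^ (n * q) * r ^ n) = fact n * sqrt (2 ^ q * r) ^ n"
      by (simp add: real_sqrt_mult real_sqrt_power power_mult_distrib power_mult[symmetric] mult.commute)
    finally show "cmod (\<Phi> (appell \<nu> n \<zeta>)) \<le> C * (fact n * sqrt (2 ^ q * Re (herm ip p \<zeta> \<zeta>)) ^ n)" by (simp add: r_def)
  qed
qed

text \<open>As functions of all \<open>\<omega>\<close>, linear or not, \<open>appell \<nu> n (\<lambda>x. z * \<zeta> x)\<close> and \<open>z ^ n * appell \<nu> n \<zeta>\<close> are different,
  but the kernel of their difference has norm zero.\<close>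

lemma distrib_appell_scale:
  assumes ze: "\<zeta> \<in> complexify schwartz"
  shows "\<Phi> (appell \<nu> n (\<lambda>x. z * \<zeta> x)) = z ^ n * \<Phi> (appell \<nu> n \<zeta>)"
proof -
  note zs = complexify_schwartz_scale[OF ze, of z]
  obtain C where C: "\<And>K. K \<in> kernels \<Longrightarrow> cmod (\<Phi> (appell_poly \<nu> K)) \<le> C * test_norm ip p q K"
    using Phi unfolding distrib_pq_def by blast
  let ?k = "[(1, \<lambda>x. z * \<zeta> x), (- (z ^ n), \<zeta>)]"
  have k: "\<forall>(c, \<zeta>')\<in>set ?k. \<zeta>' \<in> complexify schwartz" using ze zs by auto
  have "kernel_norm_sq ip p n ?k = 0"
    unfolding kernel_norm_sq_def using herm_scale(1)[OF H ze zs, of p z] herm_scale(1)[OF H ze ze, of p z] herm_scale(2)[OF H ze ze, of p z]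
    by (simp add: power_mult_distrib algebra_simps)
  then have "cmod (\<Phi> (appell_poly \<nu> (replicate n [] @ [?k]))) \<le> 0"
    using C[OF single_kernel(1)[OF k, of n]] single_kernel(3)[OF k] by simp
  moreover have "appell_poly \<nu> (replicate n [] @ [?k]) = (\<lambda>\<omega>. (- (z ^ n)) * appell \<nu> n \<zeta> \<omega> + appell \<nu> n (\<lambda>x. z * \<zeta> x) \<omega>)"
    using single_kernel(2)[OF k] by (simp add: fun_eq_iff)
  ultimately have "\<Phi> (\<lambda>\<omega>. (- (z ^ n)) * appell \<nu> n \<zeta> \<omega> + appell \<nu> n (\<lambda>x. z * \<zeta> x) \<omega>) = 0" by simp
  moreover have "\<Phi> (\<lambda>\<omega>. (- (z ^ n)) * appell \<nu> n \<zeta> \<omega> + appell \<nu> n (\<lambda>x. z * \<zeta> x) \<omega>) =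
      (- (z ^ n)) * \<Phi> (appell \<nu> n \<zeta>) + \<Phi> (appell \<nu> n (\<lambda>x. z * \<zeta> x))"
    by (rule distrib_lin[OF appell_in_polys[OF ze] appell_in_polys[OF zs]])
  ultimately have "(- (z ^ n)) * \<Phi> (appell \<nu> n \<zeta>) + \<Phi> (appell \<nu> n (\<lambda>x. z * \<zeta> x)) = 0" by (simp only:)
  then show ?thesis by (simp add: add_eq_0_iff)
qed

lemma distrib_partial_sum:
  assumes ze: "\<zeta> \<in> complexify schwartz"
  shows "\<Phi> (\<lambda>\<omega>. L * (\<Sum>n<N. appell \<nu> n \<zeta> \<omega> / fact n)) = L * (\<Sum>n<N. \<Phi> (appell \<nu> n \<zeta>) / fact n)"
proof -
  have pol: "(\<lambda>\<omega>. L * (\<Sum>n<N. appell \<nu> n \<zeta> \<omega> / fact n)) \<in> polys \<nu>" for N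
  proof -
    let ?K = "map (\<lambda>n. [(L / fact n, \<zeta>)]) [0..<N]"
    have "?K \<in> kernels" using ze by (auto simp: kernels_def)
    moreover have "appell_poly \<nu> ?K = (\<lambda>\<omega>. L * (\<Sum>n<N. appell \<nu> n \<zeta> \<omega> / fact n))"
      by (auto simp: appell_poly_def sum_distrib_left fun_eq_iff intro!: sum.cong)
    ultimately show ?thesis unfolding polys_def by (intro image_eqI[of _ _ ?K]) auto
  qed
  show ?thesis
  proof (induction N)
    case 0
    have "(\<lambda>\<omega>. 0) \<in> polys \<nu>" using pol[of 0] by simp
    then have "\<Phi> (\<lambda>\<omega>. 0) = 0" using distrib_lin[of "\<lambda>_. 0" "\<lambda>_. 0" 1] by simp
    then show ?case by simp
  next
    case (Suc N)
    have "\<Phi> (\<lambda>\<omega>. (L / fact N) * appell \<nu> N \<zeta> \<omega> + L * (\<Sum>n<N. appell \<nu> n \<zeta> \<omega> / fact n)) =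
       (L / fact N) * \<Phi> (appell \<nu> N \<zeta>) + \<Phi> (\<lambda>\<omega>. L * (\<Sum>n<N. appell \<nu> n \<zeta> \<omega> / fact n))"
      by (rule distrib_lin[OF appell_in_polys[OF ze] pol])
    then show ?case using Suc by (simp add: algebra_simps)
  qed
qed

text \<open>Homogeneity of the Appell terms under \<Phi> turns the limit that defines the
  T-transform into a power series in \<open>z\<close>, with coefficients bounded by C k^n. The
  normalising factor \<open>laplace\<close> stays outside.\<close>

lemma T_transform_scale:
  assumes xs: "\<xi> \<in> complexify schwartz" and R: "R > 1" "R * sqrt (2 ^ q * Re (herm ip p \<xi> \<xi>)) < 1"
  defines "F \<equiv> Abs_fps (\<lambda>n. \<Phi> (appell \<nu> n (\<lambda>x. \<i> * \<xi> x)) / fact n)"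
  shows "ereal R \<le> fps_conv_radius F"
    and "cmod z < R \<Longrightarrow> T_transform \<nu> \<Phi> (\<lambda>x. z * \<xi> x) = laplace \<nu> (\<lambda>x. \<i> * (z * \<xi> x)) * eval_fps F z"
proof -
  note ixs = complexify_schwartz_scale[OF xs, of \<i>]
  define k where "k = sqrt (2 ^ q * Re (herm ip p \<xi> \<xi>))"
  have k0: "k \<ge> 0" using herm_self(2)[OF H xs] by (simp add: k_def)
  have Rk: "R * k < 1" using R(2) by (simp add: k_def)
  obtain C where C: "\<And>n. cmod (\<Phi> (appell \<nu> n (\<lambda>x. \<i> * \<xi> x))) \<le> C * (fact n * k ^ n)"
    using distrib_appell_bound[OF ixs] unfolding herm_self_scale[OF H xs] k_def by auto
  have sm: "summable (\<lambda>n. fps_nth F n * z ^ n)" if z: "cmod z \<le> R" for z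
  proof (rule summable_comparison_test[OF _ summable_mult[OF summable_geometric[of "R * k"], of C]], intro exI allI impI)
    show "norm (R * k) < 1" using Rk R(1) k0 by simp
    fix n
    have "cmod (fps_nth F n) \<le> C * k ^ n" using C[of n] by (simp add: F_def norm_divide divide_le_eq mult_ac)
    moreover have "cmod z ^ n \<le> R ^ n" using z by (intro power_mono) auto
    ultimately have "cmod (fps_nth F n) * cmod z ^ n \<le> C * k ^ n * R ^ n"
      by (intro mult_mono) (auto intro: order_trans[OF norm_ge_zero])
    then show "norm (fps_nth F n * z ^ n) \<le> C * (R * k) ^ n" by (simp add: norm_mult norm_power power_mult_distrib mult_ac)
  qed
  show "ereal R \<le> fps_conv_radius F"
    unfolding fps_conv_radius_def
    using conv_radius_geI[OF sm[of "of_real R"]] R(1) by simp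
  show "T_transform \<nu> \<Phi> (\<lambda>x. z * \<xi> x) = laplace \<nu> (\<lambda>x. \<i> * (z * \<xi> x)) * eval_fps F z" if z: "cmod z < R"
  proof -
    let ?L = "laplace \<nu> (\<lambda>x. \<i> * (z * \<xi> x))"
    have e: "(\<lambda>x. \<i> * (z * \<xi> x)) = (\<lambda>x. z * (\<i> * \<xi> x))" by (auto simp: mult_ac)
    have "\<Phi> (\<lambda>\<omega>. ?L * (\<Sum>n<N. appell \<nu> n (\<lambda>x. \<i> * (z * \<xi> x)) \<omega> / fact n)) = ?L * (\<Sum>n<N. fps_nth F n * z ^ n)" for N
    proof -
      have "\<Phi> (\<lambda>\<omega>. ?L * (\<Sum>n<N. appell \<nu> n (\<lambda>x. z * (\<i> * \<xi> x)) \<omega> / fact n)) = ?L * (\<Sum>n<N. \<Phi> (appell \<nu> n (\<lambda>x. z * (\<i> * \<xi> x))) / fact n)"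
        by (rule distrib_partial_sum[OF complexify_schwartz_scale[OF ixs]])
      then show ?thesis unfolding e distrib_appell_scale[OF ixs] by (simp add: F_def mult_ac)
    qed
    moreover have "(\<lambda>N. ?L * (\<Sum>n<N. fps_nth F n * z ^ n)) \<longlonglongrightarrow> ?L * eval_fps F z"
      unfolding eval_fps_def using summable_LIMSEQ[OF sm[of z]] z by (intro tendsto_intros) auto
    ultimately show ?thesis unfolding T_transform_def by (intro limI) simp
  qed
qed

end


section \<open>The exponential family\<close>

lemma islimpt_of_real_interval:
  assumes t: "t > 0"
  shows "0 islimpt complex_of_real ` {-t<..<t}"
  unfolding islimpt_sequential
proof (intro exI[of _ "\<lambda>n. complex_of_real (t / (2 + real n))"] conjI allI)
  have "(\<lambda>n. t / (2 + real n)) \<longlonglongrightarrow> 0" by real_asymp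
  then have "(\<lambda>n. complex_of_real (t / (2 + real n))) \<longlonglongrightarrow> of_real 0" by (rule tendsto_of_real)
  then show "(\<lambda>n. complex_of_real (t / (2 + real n))) \<longlonglongrightarrow> 0" by (simp only: of_real_0)
  fix n
  have p: "0 < t / (2 + real n)" using t by simp
  have "t / (2 + real n) < t" using t by (simp add: divide_less_eq)
  then have "t / (2 + real n) \<in> {-t<..<t}" "complex_of_real (t / (2 + real n)) \<noteq> 0"
    using p t unfolding greaterThanLessThan_iff of_real_eq_0_iff by linarith+
  then show "complex_of_real (t / (2 + real n)) \<in> complex_of_real ` {-t<..<t} - {0}" by blast
qed

lemma analytic_on_Reals_eq:
  assumes f: "f analytic_on \<real>" and g: "g analytic_on \<real>" and t: "t > 0"
    and eq: "\<And>s::real. \<bar>s\<bar> < t \<Longrightarrow> f (of_real s) = g (of_real s)"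
  shows "f (of_real s) = g (of_real s)"
    and "\<exists>S. open S \<and> connected S \<and> \<real> \<subseteq> S \<and> f holomorphic_on S"
proof -
  have *: "\<exists>S. open S \<and> connected S \<and> \<real> \<subseteq> S \<and> h holomorphic_on S" if h: "h analytic_on \<real>" for h :: "complex \<Rightarrow> complex"
  proof -
    obtain S where S: "open S" "\<real> \<subseteq> S" "h holomorphic_on S" using h unfolding analytic_on_holomorphic by blast
    \<comment> \<open>The neighbourhood supplied by analyticity may be disconnected; the component
      of 0 contains the whole real line.\<close>
    let ?C = "connected_component_set S 0"
    have cR: "connected (\<real> :: complex set)"
    proof -
      have "connected (complex_of_real ` UNIV)" by (intro connected_continuous_image continuous_intros) auto
      then show ?thesis by (simp add: Reals_def)
    qed
    have "\<real> \<subseteq> ?C" by (rule connected_component_maximal[OF _ cR S(2)]) auto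
    moreover have "open ?C" by (rule open_connected_component[OF S(1)])
    moreover have "h holomorphic_on ?C" by (rule holomorphic_on_subset[OF S(3) connected_component_subset])
    ultimately show ?thesis using connected_connected_component by blast
  qed
  show "\<exists>S. open S \<and> connected S \<and> \<real> \<subseteq> S \<and> f holomorphic_on S" by (rule *[OF f])
  have "(\<lambda>z. f z - g z) analytic_on \<real>" by (intro analytic_intros f g)
  then obtain S where S: "open S" "connected S" "\<real> \<subseteq> S" "(\<lambda>z. f z - g z) holomorphic_on S" using * by blast
  have "f (of_real s) - g (of_real s) = 0"
  proof (rule analytic_continuation[OF S(4,1,2), of "complex_of_real ` {-t<..<t}" 0])
    show "complex_of_real ` {- t<..<t} \<subseteq> S" using S(3) by auto
    show "0 \<in> S" "of_real s \<in> S" using S(3) by auto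
    show "0 islimpt complex_of_real ` {-t<..<t}" by (rule islimpt_of_real_interval[OF t])
    show "\<And>z. z \<in> complex_of_real ` {- t<..<t} \<Longrightarrow> f z - g z = 0" using eq by auto
  qed
  then show "f (of_real s) = g (of_real s)" by simp
qed

lemma quad_arg_0: "quad_arg C A B X s 0 = C + s\<^sup>2 * A / 2"
  by (simp add: quad_arg_def)

text \<open>About C + s^2 A / 2 the remainder of the argument is a polynomial in \<open>z\<close>
  without constant term. So the n-th coefficient is a finite sum of derivatives of \<Gamma>(\<rho>,
  .) at that point times polynomials in \<open>s\<close>, holomorphic wherever the point avoids the
  slit.\<close>

lemma quad_arg_coeff_analytic:
  assumes rho: "0 < \<rho>" "\<rho> < 1" and nr: "\<And>s::real. C + (of_real s)\<^sup>2 * A / 2 \<notin> \<real>\<^sub>\<le>\<^sub>0"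
  shows "(\<lambda>s. fps_nth (fps_expansion (\<lambda>z. upper_Gamma (of_real \<rho>) (quad_arg C A B X s z)) 0) n) analytic_on \<real>"
proof -
  let ?U = "upper_Gamma (of_real \<rho>)"
  define w0 where "w0 = (\<lambda>s. C + s\<^sup>2 * A / 2)"
  define \<Omega> where "\<Omega> = w0 -` (- \<real>\<^sub>\<le>\<^sub>0)"
  define P where "P = (\<lambda>s. fps_const (s * B) * fps_X + fps_const (X / 2) * fps_X ^ 2)"
  have o: "open (- \<real>\<^sub>\<le>\<^sub>0 :: complex set)" by (simp add: open_Compl)
  have hw: "w0 holomorphic_on UNIV" unfolding w0_def by (intro holomorphic_intros) auto
  have oO: "open \<Omega>" unfolding \<Omega>_def by (intro open_vimage o holomorphic_on_imp_continuous_on[OF hw])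
  have RO: "\<real> \<subseteq> \<Omega>" using nr by (auto simp: \<Omega>_def w0_def Reals_def)
  have coeff: "fps_nth (fps_expansion (\<lambda>z. ?U (quad_arg C A B X s z)) 0) n = (\<Sum>i=0..n. (deriv ^^ i) ?U (w0 s) / fact i * fps_nth (P s ^ i) n)"
    if s: "s \<in> \<Omega>" for s
  proof -
    have an: "?U analytic_on {w0 s}" unfolding analytic_at using upper_Gamma_holomorphic[OF rho] o s by (auto simp: \<Omega>_def)
    have 1: "(\<lambda>x. ?U (w0 s + x)) has_fps_expansion fps_expansion ?U (w0 s)" by (rule analytic_at_imp_has_fps_expansion[OF an])
    have 2: "(\<lambda>z. (s * B) * z + (X / 2) * z ^ 2) has_fps_expansion P s" unfolding P_def by (intro fps_expansion_intros)
    have "((\<lambda>x. ?U (w0 s + x)) \<circ> (\<lambda>z. (s * B) * z + (X / 2) * z ^ 2)) has_fps_expansion (fps_expansion ?U (w0 s) oo P s)"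
      by (rule has_fps_expansion_compose[OF 1 2]) (simp add: P_def)
    also have "(\<lambda>x. ?U (w0 s + x)) \<circ> (\<lambda>z. (s * B) * z + (X / 2) * z ^ 2) = (\<lambda>z. ?U (quad_arg C A B X s z))"
    proof
      fix z
      have "w0 s + ((s * B) * z + (X / 2) * z ^ 2) = quad_arg C A B X s z"
        by (simp add: w0_def quad_arg_def field_simps)
      then show "((\<lambda>x. ?U (w0 s + x)) \<circ> (\<lambda>z. (s * B) * z + (X / 2) * z ^ 2)) z = ?U (quad_arg C A B X s z)" by simp
    qed
    finally have "fps_nth (fps_expansion (\<lambda>z. ?U (quad_arg C A B X s z)) 0) n = fps_nth (fps_expansion ?U (w0 s) oo P s) n"
      by (simp add: fps_nth_fps_expansion fps_expansion_def)
    then show ?thesis by (simp add: fps_compose_nth fps_expansion_def)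
  qed
  have hP: "(\<lambda>s. fps_nth (P s ^ i) n) holomorphic_on UNIV" for i n
  proof (induction i arbitrary: n)
    case (Suc i)
    have 1: "(\<lambda>s. fps_nth (P s) m) holomorphic_on UNIV" for m
      unfolding P_def fps_add_nth fps_mult_left_const_nth by (intro holomorphic_intros)
    have "(\<lambda>s. \<Sum>j=0..n. fps_nth (P s) j * fps_nth (P s ^ i) (n - j)) holomorphic_on UNIV"
      by (intro holomorphic_on_sum holomorphic_on_mult 1 Suc.IH)
    then show ?case by (simp add: fps_mult_nth)
  qed (cases "n = 0"; simp)
  have hU: "(\<lambda>s. (deriv ^^ i) ?U (w0 s)) holomorphic_on \<Omega>" for i
    by (rule holomorphic_on_compose_gen[OF holomorphic_on_subset[OF hw] holomorphic_higher_deriv[OF upper_Gamma_holomorphic[OF rho] o], unfolded o_def])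
       (auto simp: \<Omega>_def)
  have "(\<lambda>s. \<Sum>i=0..n. (deriv ^^ i) ?U (w0 s) / fact i * fps_nth (P s ^ i) n) holomorphic_on \<Omega>"
    by (intro holomorphic_on_sum holomorphic_on_mult holomorphic_on_divide hU holomorphic_on_const holomorphic_on_subset[OF hP]) auto
  also have "?this \<longleftrightarrow> (\<lambda>s. fps_nth (fps_expansion (\<lambda>z. ?U (quad_arg C A B X s z)) 0) n) holomorphic_on \<Omega>"
    by (rule holomorphic_cong[OF refl]) (simp add: coeff)
  finally show ?thesis unfolding analytic_on_holomorphic using oO RO by blast
qed

locale donsker_exp = gamma_grey +
  fixes ip :: "nat \<Rightarrow> (real \<Rightarrow> real) \<Rightarrow> (real \<Rightarrow> real) \<Rightarrow> real" and p q :: nat and \<eta> :: "real \<Rightarrow> complex"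
    and E :: "real \<Rightarrow> (((real \<Rightarrow> real) \<Rightarrow> real) \<Rightarrow> complex) \<Rightarrow> complex"
  assumes H: "hilbertian_family ip" and UU: "U_nbhd ip p q \<subseteq> U_theta \<theta>"
    and eta: "\<eta> \<in> complexify L2" and ex: "exp_family \<nu> ip p q \<eta> E"
begin

definition A :: complex where "A = bilin \<eta> \<eta>"

lemma E_distrib: "E s \<in> distrib_pq \<nu> ip p q"
  using ex by (simp add: exp_family_def)

lemma E_pairing:
  "\<exists>X. CPL \<eta> X \<and> (\<forall>s \<phi>. integrable \<nu> (\<lambda>\<omega>. (cmod (exp (\<i> * of_real s * X \<omega>)))\<^sup>2) \<longrightarrow> \<phi> \<in> polys \<nu> \<longrightarrow>
    E s \<phi> = (CLINT \<omega>|\<nu>. exp (\<i> * of_real s * X \<omega>) * \<phi> \<omega>))"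
proof -
  obtain X where X: "L2_pairing \<nu> \<eta> X"
    "\<forall>s. integrable \<nu> (\<lambda>\<omega>. (cmod (exp (\<i> * of_real s * X \<omega>)))\<^sup>2) \<longrightarrow> (\<forall>\<phi>\<in>polys \<nu>. E s \<phi> = (CLINT \<omega>|\<nu>. exp (\<i> * of_real s * X \<omega>) * \<phi> \<omega>))"
    using ex unfolding exp_family_def by blast
  have "CPL \<eta> X" using X(1) eta by (simp add: L2_pairing_def CPL_def PL_def complexify_def)
  then show ?thesis using X(2) by blast
qed

lemma E_analytic:
  assumes "\<phi> \<in> polys \<nu>"
  obtains f where "f analytic_on \<real>" "\<And>s. E s \<phi> = f (of_real s)"
  using ex assms unfolding exp_family_def by blast

lemma U_theta_bound:
  assumes "\<xi> \<in> U_nbhd ip p q"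
  shows "(LINT x|lborel. (Im (\<xi> x))\<^sup>2) < \<theta>"
proof -
  have "L2_norm (Im \<circ> \<xi>) < sqrt \<theta>" using assms UU by (auto simp: U_theta_def)
  then show ?thesis by (simp add: L2_norm_def)
qed

lemma bilin_U_theta:
  assumes xi: "\<xi> \<in> U_nbhd ip p q"
  shows "Re (of_real \<theta> + bilin \<xi> \<xi> / 2) > 0"
proof -
  have xs: "\<xi> \<in> complexify schwartz" using xi by (simp add: U_nbhd_def)
  have L: "Re \<circ> \<xi> \<in> L2" "Im \<circ> \<xi> \<in> L2" using complexify_schwartz_L2[OF xs] by (auto simp: complexify_def)
  have i: "integrable lborel (\<lambda>x. (Re (\<xi> x))\<^sup>2)" "integrable lborel (\<lambda>x. (Im (\<xi> x))\<^sup>2)" using L by (auto simp: L2_def o_def)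
  have ic: "integrable lborel (\<lambda>x. \<xi> x * \<xi> x)"
  proof -
    have "integrable lborel (\<lambda>x. complex_of_real ((Re (\<xi> x))\<^sup>2) - of_real ((Im (\<xi> x))\<^sup>2) + 2 * \<i> * of_real (Re (\<xi> x) * Im (\<xi> x)))"
      using integrable_L2_mult[OF L] i by (intro Bochner_Integration.integrable_add Bochner_Integration.integrable_diff integrable_of_real integrable_mult_right) (auto simp: o_def)
    also have "(\<lambda>x. complex_of_real ((Re (\<xi> x))\<^sup>2) - of_real ((Im (\<xi> x))\<^sup>2) + 2 * \<i> * of_real (Re (\<xi> x) * Im (\<xi> x))) = (\<lambda>x. \<xi> x * \<xi> x)"
      by (auto simp: complex_eq_iff power2_eq_square fun_eq_iff)
    finally show ?thesis .
  qed
  have "Re (bilin \<xi> \<xi>) = (LINT x|lborel. Re (\<xi> x * \<xi> x))" unfolding bilin_def by (rule integral_Re[symmetric]) (rule ic)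
  also have "\<dots> = (LINT x|lborel. (Re (\<xi> x))\<^sup>2 - (Im (\<xi> x))\<^sup>2)" by (simp add: power2_eq_square)
  also have "\<dots> = (LINT x|lborel. (Re (\<xi> x))\<^sup>2) - (LINT x|lborel. (Im (\<xi> x))\<^sup>2)" using i by simp
  finally have e: "Re (bilin \<xi> \<xi>) = (LINT x|lborel. (Re (\<xi> x))\<^sup>2) - (LINT x|lborel. (Im (\<xi> x))\<^sup>2)" .
  have "0 \<le> (LINT x|lborel. (Re (\<xi> x))\<^sup>2)" by simp
  then have "Re (bilin \<xi> \<xi>) > - \<theta>" using e U_theta_bound[OF xi] by linarith
  then show ?thesis using th by simp
qed

text \<open>The Appell coefficients of \<open>E s\<close> along i \<xi>: the T-transform of
  \<open>E s\<close> at z \<xi> is \<open>L \<xi> z\<close> times the value of this series at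
  \<open>z\<close>.\<close>

definition F :: "(real \<Rightarrow> complex) \<Rightarrow> real \<Rightarrow> complex fps" where
  "F \<xi> s = Abs_fps (\<lambda>n. E s (appell \<nu> n (\<lambda>x. \<i> * \<xi> x)) / fact n)"

definition L :: "(real \<Rightarrow> complex) \<Rightarrow> complex \<Rightarrow> complex" where
  "L \<xi> z = laplace \<nu> (\<lambda>x. \<i> * (z * \<xi> x))"

abbreviation W :: "(real \<Rightarrow> complex) \<Rightarrow> complex \<Rightarrow> complex \<Rightarrow> complex" where
  "W \<xi> s z \<equiv> quad_arg (of_real \<theta>) A (bilin \<eta> \<xi>) (bilin \<xi> \<xi>) s z"

lemma T_transform_disc:
  assumes xi: "\<xi> \<in> U_nbhd ip p q"
  shows "\<exists>R>1. L \<xi> holomorphic_on ball 0 R \<and> L \<xi> 0 = 1 \<and> (\<forall>s. ereal R \<le> fps_conv_radius (F \<xi> s)) \<and>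
    (\<forall>s z. cmod z < R \<longrightarrow> (\<lambda>x. z * \<xi> x) \<in> U_nbhd ip p q \<and> T_transform \<nu> (E s) (\<lambda>x. z * \<xi> x) = L \<xi> z * eval_fps (F \<xi> s) z)"
proof -
  have xs: "\<xi> \<in> complexify schwartz" using xi by (simp add: U_nbhd_def)
  obtain R where R: "R > 1" "\<And>z. cmod z < R \<Longrightarrow> (\<lambda>x. z * \<xi> x) \<in> U_nbhd ip p q \<and> R * sqrt (2 ^ q * Re (herm ip p \<xi> \<xi>)) < 1"
    using U_nbhd_scale[OF H xi] by blast
  have Rk: "R * sqrt (2 ^ q * Re (herm ip p \<xi> \<xi>)) < 1" using R(1) R(2)[of 0] by simp
  have LU: "L \<xi> z = UG (of_real \<theta> + z\<^sup>2 * bilin \<xi> \<xi> / 2) / Z" if "cmod z < R" for z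
    unfolding L_def using U_theta_bound[of "\<lambda>x. z * \<xi> x"] R(2)[OF that] th by (intro laplace_eq[OF xs]) auto
  have nr: "of_real \<theta> + z\<^sup>2 * bilin \<xi> \<xi> / 2 \<notin> \<real>\<^sub>\<le>\<^sub>0" if "cmod z < R" for z
  proof -
    have "bilin (\<lambda>x. z * \<xi> x) (\<lambda>x. z * \<xi> x) = z\<^sup>2 * bilin \<xi> \<xi>"
      using bilin_sq_lin[OF complexify_schwartz_L2[OF xs] complexify_schwartz_L2[OF xs], of z 0] by simp
    then have "Re (of_real \<theta> + z\<^sup>2 * bilin \<xi> \<xi> / 2) > 0" using bilin_U_theta[of "\<lambda>x. z * \<xi> x"] R(2)[OF that] by simp
    then show ?thesis by (simp only: complex_nonpos_Reals_iff) linarith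
  qed
  have "(\<lambda>z. UG (of_real \<theta> + z\<^sup>2 * bilin \<xi> \<xi> / 2)) holomorphic_on ball 0 R"
    by (rule holomorphic_on_compose_gen[of "\<lambda>z. of_real \<theta> + z\<^sup>2 * bilin \<xi> \<xi> / 2" _ UG "- \<real>\<^sub>\<le>\<^sub>0", unfolded o_def])
       (use nr upper_Gamma_holomorphic[OF rho] in \<open>auto intro!: holomorphic_intros\<close>)
  then have "(\<lambda>z. UG (of_real \<theta> + z\<^sup>2 * bilin \<xi> \<xi> / 2) / Z) holomorphic_on ball 0 R"
    using Z_nonzero by (intro holomorphic_intros) auto
  also have "?this \<longleftrightarrow> L \<xi> holomorphic_on ball 0 R" by (rule holomorphic_cong[OF refl]) (simp add: LU)
  finally have hL: "L \<xi> holomorphic_on ball 0 R" .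
  have "L \<xi> 0 = 1" using LU[of 0] R(1) Z_nonzero by (simp add: Z_def)
  moreover have "ereal R \<le> fps_conv_radius (F \<xi> s)" for s
    unfolding F_def by (rule T_transform_scale(1)[OF H E_distrib xs R(1) Rk])
  moreover have "T_transform \<nu> (E s) (\<lambda>x. z * \<xi> x) = L \<xi> z * eval_fps (F \<xi> s) z" if "cmod z < R" for s z
    unfolding F_def L_def by (rule T_transform_scale(2)[OF H E_distrib xs R(1) Rk that])
  ultimately show ?thesis using R hL by blast
qed

lemma L_analytic:
  assumes xi: "\<xi> \<in> U_nbhd ip p q"
  shows "L \<xi> has_fps_expansion fps_expansion (L \<xi>) 0"
proof -
  obtain R where R: "R > 1" "L \<xi> holomorphic_on ball 0 R" using T_transform_disc[OF xi] by blast
  have "L \<xi> analytic_on {0}" unfolding analytic_at using R by (intro exI[of _ "ball 0 R"]) auto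
  then show ?thesis by (rule analytic_at_imp_has_fps_expansion_0)
qed

text \<open>For small \<open>s\<close> the functional \<open>E s\<close> is a true integral. The
  integral of exp(isX) exp(izD) is expanded in two ways: as a series in \<open>z\<close>, which the
  generating function of the Appell polynomials links to \<open>F\<close> and \<open>L\<close>, and
  in closed form as a characteristic function of s X + z D.\<close>

lemma fps_identity_small:
  assumes xi: "\<xi> \<in> U_nbhd ip p q"
  shows "\<exists>t>0. \<forall>s::real. \<bar>s\<bar> < t \<longrightarrow>
    fps_const Z * fps_expansion (L \<xi>) 0 * F \<xi> s = fps_expansion (\<lambda>z. UG (W \<xi> (of_real s) z)) 0"
proof -
  have xs: "\<xi> \<in> complexify schwartz" using xi by (simp add: U_nbhd_def)
  note ixs = complexify_schwartz_scale[OF xs, of \<i>]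
  obtain X where X: "CPL \<eta> X"
    "\<And>s \<phi>. integrable \<nu> (\<lambda>\<omega>. (cmod (exp (\<i> * of_real s * X \<omega>)))\<^sup>2) \<Longrightarrow> \<phi> \<in> polys \<nu> \<Longrightarrow> E s \<phi> = (CLINT \<omega>|\<nu>. exp (\<i> * of_real s * X \<omega>) * \<phi> \<omega>)"
    using E_pairing by blast
  define D where "D = (\<lambda>\<omega>. dual_pair \<omega> \<xi>)"
  have D: "CPL \<xi> D" unfolding D_def by (rule CPL_schwartz[OF xs])
  have [measurable]: "X \<in> borel_measurable \<nu>" "D \<in> borel_measurable \<nu>" using CPL_measurable[OF X(1)] CPL_measurable[OF D] by auto
  have pX: "PL (\<lambda>x. Im (\<eta> x)) (\<lambda>\<omega>. Im (X \<omega>))" and pD1: "PL (\<lambda>x. Re (\<xi> x)) (\<lambda>\<omega>. Re (D \<omega>))" and pD2: "PL (\<lambda>x. Im (\<xi> x)) (\<lambda>\<omega>. Im (D \<omega>))"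
    using X(1) D by (auto simp: CPL_def o_def)
  define va vb vc where "va = (LINT x|lborel. (Im (\<eta> x))\<^sup>2)" and "vb = (LINT x|lborel. (Re (\<xi> x))\<^sup>2)" and "vc = (LINT x|lborel. (Im (\<xi> x))\<^sup>2)"
  have v0: "va \<ge> 0" "vb \<ge> 0" "vc \<ge> 0" by (auto simp: va_def vb_def vc_def)
  define V where "V = va + vb + vc"
  \<comment> \<open>The bounds needed below are 4 t^2 va, 16 t^2 vb, 16 t^2 vc and 3 t^2 V against 2
    \<theta>; the constant 36 leaves ample room for all of them, and V + 1 avoids a division by
    0.\<close>
  define t where "t = sqrt (\<theta> / (36 * (V + 1)))"
  have V0: "V \<ge> 0" using v0 by (simp add: V_def)
  have t0: "t > 0" using th V0 by (simp add: t_def)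
  have tV: "t\<^sup>2 * V < \<theta> / 36"
  proof -
    have "t\<^sup>2 = \<theta> / (36 * (V + 1))" using th V0 by (simp add: t_def)
    moreover have "\<theta> / (36 * (V + 1)) * V < \<theta> / 36" using th V0 by (simp add: field_simps)
    ultimately show ?thesis by simp
  qed
  have tv: "t\<^sup>2 * va < \<theta> / 36" "t\<^sup>2 * vb < \<theta> / 36" "t\<^sup>2 * vc < \<theta> / 36"
  proof -
    have "va \<le> V" "vb \<le> V" "vc \<le> V" using v0 by (auto simp: V_def)
    then have "t\<^sup>2 * va \<le> t\<^sup>2 * V" "t\<^sup>2 * vb \<le> t\<^sup>2 * V" "t\<^sup>2 * vc \<le> t\<^sup>2 * V" by (auto intro: mult_left_mono)
    then show "t\<^sup>2 * va < \<theta> / 36" "t\<^sup>2 * vb < \<theta> / 36" "t\<^sup>2 * vc < \<theta> / 36" using tV by auto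
  qed
  \<comment> \<open>A single majorant of exp(isX) times every partial sum of exp(izD), for all |s| <
    t and |z| \<le> t. It is integrable by splitting products into squares, which explains the
    exponents 2 t and 4 t.\<close>
  define g where "g = (\<lambda>\<omega>. exp (t * \<bar>Im (X \<omega>)\<bar>) * exp (t * (\<bar>Re (D \<omega>)\<bar> + \<bar>Im (D \<omega>)\<bar>)))"
  have gi: "integrable \<nu> g"
  proof -
    have i1: "integrable \<nu> (\<lambda>\<omega>. exp (2 * t * \<bar>Im (X \<omega>)\<bar>))"
    proof (rule PL_exp_abs_integrable[OF pX])
      have "(2 * t)\<^sup>2 * va = 4 * (t\<^sup>2 * va)" by (simp add: power_mult_distrib)
      then show "(2 * t)\<^sup>2 * (LINT x|lborel. (Im (\<eta> x))\<^sup>2) < 2 * \<theta>" using tv(1) th unfolding va_def[symmetric] by linarith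
    qed
    have i2: "integrable \<nu> (\<lambda>\<omega>. exp (4 * t * \<bar>Re (D \<omega>)\<bar>))"
    proof (rule PL_exp_abs_integrable[OF pD1])
      have "(4 * t)\<^sup>2 * vb = 16 * (t\<^sup>2 * vb)" by (simp add: power_mult_distrib)
      then show "(4 * t)\<^sup>2 * (LINT x|lborel. (Re (\<xi> x))\<^sup>2) < 2 * \<theta>" using tv(2) th unfolding vb_def[symmetric] by linarith
    qed
    have i3: "integrable \<nu> (\<lambda>\<omega>. exp (4 * t * \<bar>Im (D \<omega>)\<bar>))"
    proof (rule PL_exp_abs_integrable[OF pD2])
      have "(4 * t)\<^sup>2 * vc = 16 * (t\<^sup>2 * vc)" by (simp add: power_mult_distrib)
      then show "(4 * t)\<^sup>2 * (LINT x|lborel. (Im (\<xi> x))\<^sup>2) < 2 * \<theta>" using tv(3) th unfolding vc_def[symmetric] by linarith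
    qed
    show ?thesis
    proof (rule Bochner_Integration.integrable_bound[OF Bochner_Integration.integrable_add[OF i1 Bochner_Integration.integrable_add[OF i2 i3]]])
      show "g \<in> borel_measurable \<nu>" unfolding g_def by measurable
      have ab: "a * b \<le> a\<^sup>2 + b\<^sup>2" if "a > 0" "b > 0" for a b :: real
        using sum_squares_bound[of a b] mult_pos_pos[OF that] by linarith
      show "AE \<omega> in \<nu>. norm (g \<omega>) \<le> norm (exp (2 * t * \<bar>Im (X \<omega>)\<bar>) + (exp (4 * t * \<bar>Re (D \<omega>)\<bar>) + exp (4 * t * \<bar>Im (D \<omega>)\<bar>)))"
      proof (intro AE_I2)
        fix \<omega>
        let ?x = "\<bar>Im (X \<omega>)\<bar>" and ?a = "\<bar>Re (D \<omega>)\<bar>" and ?b = "\<bar>Im (D \<omega>)\<bar>"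
        have "(exp (t * (?a + ?b)))\<^sup>2 = exp (2 * t * ?a) * exp (2 * t * ?b)"
          by (simp add: power2_eq_square exp_add[symmetric] distrib_left)
        also have "\<dots> \<le> (exp (2 * t * ?a))\<^sup>2 + (exp (2 * t * ?b))\<^sup>2" by (rule ab) auto
        also have "\<dots> = exp (4 * t * ?a) + exp (4 * t * ?b)" by (simp add: power2_eq_square exp_add[symmetric] mult.assoc)
        finally have 1: "(exp (t * (?a + ?b)))\<^sup>2 \<le> exp (4 * t * ?a) + exp (4 * t * ?b)" .
        have "g \<omega> \<le> (exp (t * ?x))\<^sup>2 + (exp (t * (?a + ?b)))\<^sup>2" unfolding g_def by (rule ab) auto
        also have "(exp (t * ?x))\<^sup>2 = exp (2 * t * ?x)" by (simp add: power2_eq_square exp_add[symmetric])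
        finally have "g \<omega> \<le> exp (2 * t * ?x) + (exp (4 * t * ?a) + exp (4 * t * ?b))" using 1 by linarith
        moreover have "g \<omega> > 0" by (simp add: g_def)
        ultimately show "norm (g \<omega>) \<le> norm (exp (2 * t * ?x) + (exp (4 * t * ?a) + exp (4 * t * ?b)))" by simp
      qed
    qed
  qed
  let ?Lf = "fps_expansion (L \<xi>) 0"
  have Lf: "L \<xi> has_fps_expansion ?Lf" by (rule L_analytic[OF xi])
  have Lf0: "fps_nth ?Lf 0 \<noteq> 0" using T_transform_disc[OF xi] by (auto simp: fps_expansion_def)
  \<comment> \<open>The Appell polynomials are the coefficients of exp(izD) / L(z). This holds on
    the space of \<nu>, where \<omega> is linear and so pairs homogeneously with z \<xi>.\<close>
  have appell: "appell \<nu> n (\<lambda>x. \<i> * \<xi> x) \<omega> / fact n = (\<Sum>j=0..n. (\<i> * D \<omega>) ^ j / fact j * fps_nth (inverse ?Lf) (n - j))"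
    if w: "\<omega> \<in> space \<nu>" for n \<omega>
  proof -
    have e: "(\<lambda>x. z * (\<i> * \<xi> x)) = (\<lambda>x. \<i> * (z * \<xi> x))" for z by (auto simp: mult_ac)
    have "(\<lambda>z. exp ((\<i> * D \<omega>) * z) * inverse (L \<xi> z)) has_fps_expansion fps_exp (\<i> * D \<omega>) * inverse ?Lf"
      by (intro has_fps_expansion_mult has_fps_expansion_exp has_fps_expansion_inverse Lf Lf0)
    also have "(\<lambda>z. exp ((\<i> * D \<omega>) * z) * inverse (L \<xi> z)) = (\<lambda>z. exp (z * dual_pair \<omega> (\<lambda>x. \<i> * \<xi> x)) / laplace \<nu> (\<lambda>x. z * (\<i> * \<xi> x)))"
      unfolding e dual_pair_scale[OF w xs] by (simp add: L_def D_def divide_inverse mult_ac)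
    finally have "appell \<nu> n (\<lambda>x. \<i> * \<xi> x) \<omega> / fact n = fps_nth (fps_exp (\<i> * D \<omega>) * inverse ?Lf) n"
      by (simp add: fps_nth_fps_expansion appell_def)
    then show ?thesis by (simp add: fps_mult_nth)
  qed
  show ?thesis
  proof (intro exI[of _ t] conjI allI impI t0)
    fix s :: real assume s: "\<bar>s\<bar> < t"
    define e where "e = (\<lambda>\<omega>. exp (\<i> * of_real s * X \<omega>))"
    have em[measurable]: "e \<in> borel_measurable \<nu>" unfolding e_def by measurable
    have ne: "cmod (e \<omega>) \<le> exp (t * \<bar>Im (X \<omega>)\<bar>)" for \<omega>
    proof -
      have "- (s * Im (X \<omega>)) \<le> \<bar>s\<bar> * \<bar>Im (X \<omega>)\<bar>" by (metis abs_ge_minus_self abs_mult)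
      also have "\<dots> \<le> t * \<bar>Im (X \<omega>)\<bar>" using s by (intro mult_right_mono) auto
      finally show ?thesis by (simp add: e_def)
    qed
    have nD: "cmod (\<i> * D \<omega>) \<le> \<bar>Re (D \<omega>)\<bar> + \<bar>Im (D \<omega>)\<bar>" for \<omega> by (simp add: norm_mult cmod_le)
    have powle: "x ^ j / fact j \<le> exp x" if "x \<ge> 0" for x :: real and j
    proof -
      have "x ^ j / fact j = (\<Sum>i\<in>{j}. x ^ i /\<^sub>R fact i)" by (simp add: divide_inverse)
      also have "\<dots> \<le> (\<Sum>i. x ^ i /\<^sub>R fact i)" using that summable_exp_generic[of x] by (intro sum_le_suminf) auto
      finally show ?thesis by (simp add: exp_def)
    qed
    have bj: "cmod (e \<omega> * (z * (\<i> * D \<omega>)) ^ j / fact j) \<le> g \<omega>" if z: "cmod z \<le> t" for z j \<omega>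
    proof -
      have "cmod (z * (\<i> * D \<omega>)) \<le> t * (\<bar>Re (D \<omega>)\<bar> + \<bar>Im (D \<omega>)\<bar>)"
        unfolding norm_mult[of z] using z nD[of \<omega>] t0 by (intro mult_mono) auto
      then have "cmod (z * (\<i> * D \<omega>)) ^ j / fact j \<le> (t * (\<bar>Re (D \<omega>)\<bar> + \<bar>Im (D \<omega>)\<bar>)) ^ j / fact j"
        by (intro divide_right_mono power_mono) auto
      also have "\<dots> \<le> exp (t * (\<bar>Re (D \<omega>)\<bar> + \<bar>Im (D \<omega>)\<bar>))" using t0 by (intro powle) auto
      finally have "cmod (e \<omega>) * (cmod (z * (\<i> * D \<omega>)) ^ j / fact j) \<le> g \<omega>"
        unfolding g_def by (intro mult_mono ne) auto
      then show ?thesis by (simp add: norm_mult norm_divide norm_power)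
    qed
    define c where "c = (\<lambda>j. CLINT \<omega>|\<nu>. e \<omega> * (\<i> * D \<omega>) ^ j / fact j)"
    have ij: "integrable \<nu> (\<lambda>\<omega>. e \<omega> * (z * (\<i> * D \<omega>)) ^ j / fact j)" if "cmod z \<le> t" for z j
      by (rule Bochner_Integration.integrable_bound[OF gi]) (use order_trans[OF bj[OF that] abs_ge_self] in auto)
    \<comment> \<open>Obtained at z = t, where the majorant applies, and divided by t^j.\<close>
    have ij1: "integrable \<nu> (\<lambda>\<omega>. e \<omega> * (\<i> * D \<omega>) ^ j / fact j)" for j
    proof -
      have "integrable \<nu> (\<lambda>\<omega>. (1 / of_real t ^ j) * (e \<omega> * (of_real t * (\<i> * D \<omega>)) ^ j / fact j))"
        using t0 by (intro integrable_mult_right ij) auto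
      then show ?thesis using t0 by (simp add: power_mult_distrib)
    qed
    \<comment> \<open>The squared modulus of exp(isX) is exp(-2 s Im X), integrable by the choice of
      \<open>t\<close>; this is the condition under which \<open>exp_family\<close> prescribes
      \<open>E s\<close> as an integral.\<close>
    have Es: "E s \<phi> = (CLINT \<omega>|\<nu>. e \<omega> * \<phi> \<omega>)" if "\<phi> \<in> polys \<nu>" for \<phi>
      unfolding e_def
    proof (rule X(2)[OF _ that])
      have "integrable \<nu> (\<lambda>\<omega>. exp ((- 2 * s) * Im (X \<omega>)))"
      proof (rule PL_exp_integrable[OF pX])
        have "s\<^sup>2 \<le> t\<^sup>2" using s t0 abs_le_square_iff[of s t] by simp
        then have "s\<^sup>2 * va \<le> t\<^sup>2 * va" using v0 by (intro mult_right_mono)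
        then have "4 * (s\<^sup>2 * va) < 2 * \<theta>" using tv(1) th by linarith
        then show "(- 2 * s)\<^sup>2 * (LINT x|lborel. (Im (\<eta> x))\<^sup>2) < 2 * \<theta>" unfolding va_def[symmetric] by (simp add: power_mult_distrib)
      qed
      then show "integrable \<nu> (\<lambda>\<omega>. (cmod (exp (\<i> * of_real s * X \<omega>)))\<^sup>2)"
        by (simp add: power2_eq_square exp_add[symmetric] mult.assoc)
    qed
    have Fn: "fps_nth (F \<xi> s) n = fps_nth (Abs_fps c * inverse ?Lf) n" for n
    proof -
      have "fps_nth (F \<xi> s) n = (CLINT \<omega>|\<nu>. e \<omega> * appell \<nu> n (\<lambda>x. \<i> * \<xi> x) \<omega>) / fact n"
        unfolding F_def using Es[OF appell_in_polys[OF H E_distrib ixs]] by simp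
      also have "\<dots> = (CLINT \<omega>|\<nu>. e \<omega> * appell \<nu> n (\<lambda>x. \<i> * \<xi> x) \<omega> / fact n)" by simp
      also have "\<dots> = (CLINT \<omega>|\<nu>. (\<Sum>j=0..n. (e \<omega> * (\<i> * D \<omega>) ^ j / fact j) * fps_nth (inverse ?Lf) (n - j)))"
      proof (rule Bochner_Integration.integral_cong)
        fix \<omega> assume w: "\<omega> \<in> space \<nu>"
        have "e \<omega> * appell \<nu> n (\<lambda>x. \<i> * \<xi> x) \<omega> / fact n = e \<omega> * (appell \<nu> n (\<lambda>x. \<i> * \<xi> x) \<omega> / fact n)" by simp
        also have "\<dots> = (\<Sum>j=0..n. e \<omega> * ((\<i> * D \<omega>) ^ j / fact j * fps_nth (inverse ?Lf) (n - j)))"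
          unfolding appell[OF w] sum_distrib_left ..
        also have "\<dots> = (\<Sum>j=0..n. (e \<omega> * (\<i> * D \<omega>) ^ j / fact j) * fps_nth (inverse ?Lf) (n - j))"
          by (intro sum.cong) auto
        finally show "e \<omega> * appell \<nu> n (\<lambda>x. \<i> * \<xi> x) \<omega> / fact n = (\<Sum>j=0..n. (e \<omega> * (\<i> * D \<omega>) ^ j / fact j) * fps_nth (inverse ?Lf) (n - j))" .
      qed simp
      also have "\<dots> = (\<Sum>j=0..n. CLINT \<omega>|\<nu>. (e \<omega> * (\<i> * D \<omega>) ^ j / fact j) * fps_nth (inverse ?Lf) (n - j))"
        by (intro Bochner_Integration.integral_sum integrable_mult_left ij1)
      also have "\<dots> = (\<Sum>j=0..n. c j * fps_nth (inverse ?Lf) (n - j))"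
        by (simp only: c_def integral_mult_left_zero)
      finally show ?thesis by (simp add: fps_mult_nth)
    qed
    have FC: "?Lf * F \<xi> s = Abs_fps c"
    proof -
      have "F \<xi> s = Abs_fps c * inverse ?Lf" by (rule fps_ext) (rule Fn)
      then have "?Lf * F \<xi> s = Abs_fps c * (inverse ?Lf * ?Lf)" by (simp only: mult_ac)
      then show ?thesis using inverse_mult_eq_1[OF Lf0] by simp
    qed
    \<comment> \<open>Summation under the integral gives the mean of exp(i (s X + z D)), which
      \<open>CPL_cf\<close> evaluates once the imaginary part of s \<eta> + z \<xi> is small in
      norm.\<close>
    have sums: "(\<lambda>n. fps_nth (fps_const Z * Abs_fps c) n * z ^ n) sums UG (W \<xi> (of_real s) z)" if z: "cmod z < t" for z
    proof -
      have "(\<lambda>N. CLINT \<omega>|\<nu>. (\<Sum>j<N. e \<omega> * (z * (\<i> * D \<omega>)) ^ j / fact j)) \<longlonglongrightarrow> (CLINT \<omega>|\<nu>. e \<omega> * exp (z * (\<i> * D \<omega>)))"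
      proof (rule integral_dominated_convergence[OF _ _ gi])
        show "AE \<omega> in \<nu>. (\<lambda>N. \<Sum>j<N. e \<omega> * (z * (\<i> * D \<omega>)) ^ j / fact j) \<longlonglongrightarrow> e \<omega> * exp (z * (\<i> * D \<omega>))"
        proof (intro AE_I2)
          fix \<omega>
          have "(\<lambda>j. e \<omega> * ((z * (\<i> * D \<omega>)) ^ j /\<^sub>R fact j)) sums (e \<omega> * exp (z * (\<i> * D \<omega>)))"
            by (intro sums_mult exp_converges)
          then show "(\<lambda>N. \<Sum>j<N. e \<omega> * (z * (\<i> * D \<omega>)) ^ j / fact j) \<longlonglongrightarrow> e \<omega> * exp (z * (\<i> * D \<omega>))"
            by (simp add: sums_def scaleR_conv_of_real divide_inverse mult_ac)
        qed
        fix N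
        show "AE \<omega> in \<nu>. norm (\<Sum>j<N. e \<omega> * (z * (\<i> * D \<omega>)) ^ j / fact j) \<le> g \<omega>"
        proof (intro AE_I2)
          fix \<omega>
          have p: "cmod (z * (\<i> * D \<omega>)) \<le> t * (\<bar>Re (D \<omega>)\<bar> + \<bar>Im (D \<omega>)\<bar>)"
            unfolding norm_mult[of z] using z nD[of \<omega>] t0 by (intro mult_mono) auto
          have "norm (\<Sum>j<N. e \<omega> * (z * (\<i> * D \<omega>)) ^ j / fact j) \<le> (\<Sum>j<N. norm (e \<omega> * (z * (\<i> * D \<omega>)) ^ j / fact j))" by (rule norm_sum)
          also have "\<dots> = cmod (e \<omega>) * (\<Sum>j<N. cmod (z * (\<i> * D \<omega>)) ^ j / fact j)"
            unfolding sum_distrib_left by (intro sum.cong) (auto simp: norm_mult norm_divide norm_power)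
          also have "(\<Sum>j<N. cmod (z * (\<i> * D \<omega>)) ^ j / fact j) \<le> exp (cmod (z * (\<i> * D \<omega>)))"
          proof -
            have "(\<Sum>j<N. cmod (z * (\<i> * D \<omega>)) ^ j / fact j) = (\<Sum>j<N. cmod (z * (\<i> * D \<omega>)) ^ j /\<^sub>R fact j)" by (simp add: divide_inverse mult.commute)
            also have "\<dots> \<le> (\<Sum>j. cmod (z * (\<i> * D \<omega>)) ^ j /\<^sub>R fact j)"
              using summable_exp_generic[of "cmod (z * (\<i> * D \<omega>))"] by (intro sum_le_suminf) auto
            finally show ?thesis by (simp add: exp_def)
          qed
          also have "exp (cmod (z * (\<i> * D \<omega>))) \<le> exp (t * (\<bar>Re (D \<omega>)\<bar> + \<bar>Im (D \<omega>)\<bar>))" using p by simp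
          finally have "norm (\<Sum>j<N. e \<omega> * (z * (\<i> * D \<omega>)) ^ j / fact j) \<le> cmod (e \<omega>) * exp (t * (\<bar>Re (D \<omega>)\<bar> + \<bar>Im (D \<omega>)\<bar>))"
            by (simp add: mult_left_mono)
          also have "\<dots> \<le> g \<omega>" unfolding g_def by (intro mult_right_mono ne) auto
          finally show "norm (\<Sum>j<N. e \<omega> * (z * (\<i> * D \<omega>)) ^ j / fact j) \<le> g \<omega>" .
        qed
      qed measurable
      moreover have "(CLINT \<omega>|\<nu>. (\<Sum>j<N. e \<omega> * (z * (\<i> * D \<omega>)) ^ j / fact j)) = (\<Sum>j<N. c j * z ^ j)" for N
      proof -
        have "(CLINT \<omega>|\<nu>. (\<Sum>j<N. e \<omega> * (z * (\<i> * D \<omega>)) ^ j / fact j)) = (\<Sum>j<N. CLINT \<omega>|\<nu>. e \<omega> * (z * (\<i> * D \<omega>)) ^ j / fact j)"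
          using ij[of z] z by (intro Bochner_Integration.integral_sum) auto
        also have "\<dots> = (\<Sum>j<N. c j * z ^ j)"
        proof (rule sum.cong[OF refl])
          fix j
          have "(CLINT \<omega>|\<nu>. e \<omega> * (z * (\<i> * D \<omega>)) ^ j / fact j) = (CLINT \<omega>|\<nu>. z ^ j * (e \<omega> * (\<i> * D \<omega>) ^ j / fact j))"
            by (intro Bochner_Integration.integral_cong) (auto simp: power_mult_distrib)
          then show "(CLINT \<omega>|\<nu>. e \<omega> * (z * (\<i> * D \<omega>)) ^ j / fact j) = c j * z ^ j"
            unfolding c_def integral_mult_right_zero by (simp only: mult.commute)
        qed
        finally show ?thesis .
      qed
      ultimately have s1: "(\<lambda>j. c j * z ^ j) sums (CLINT \<omega>|\<nu>. e \<omega> * exp (z * (\<i> * D \<omega>)))" by (simp add: sums_def)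
      have "CPL (\<lambda>x. of_real s * \<eta> x + z * \<xi> x) (\<lambda>\<omega>. of_real s * X \<omega> + z * D \<omega>)"
        by (rule CPL_lin[OF X(1) CPL_scale[OF D]])
      moreover have "(LINT x|lborel. (Im (of_real s * \<eta> x + z * \<xi> x))\<^sup>2) < 2 * \<theta>"
      proof -
        have i: "integrable lborel (\<lambda>x. (Im (\<eta> x))\<^sup>2)" "integrable lborel (\<lambda>x. (Re (\<xi> x))\<^sup>2)" "integrable lborel (\<lambda>x. (Im (\<xi> x))\<^sup>2)"
          using PL_L2[OF pX] PL_L2[OF pD1] PL_L2[OF pD2] by (auto simp: L2_def)
        have st: "s\<^sup>2 \<le> t\<^sup>2" using s t0 abs_le_square_iff[of s t] by simp
        have zt: "(Re z)\<^sup>2 \<le> t\<^sup>2" "(Im z)\<^sup>2 \<le> t\<^sup>2"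
          using abs_Re_le_cmod[of z] abs_Im_le_cmod[of z] z abs_le_square_iff[of "Re z" t] abs_le_square_iff[of "Im z" t] t0 by auto
        have "(LINT x|lborel. (Im (of_real s * \<eta> x + z * \<xi> x))\<^sup>2) \<le> (LINT x|lborel. 3 * t\<^sup>2 * ((Im (\<eta> x))\<^sup>2 + (Re (\<xi> x))\<^sup>2 + (Im (\<xi> x))\<^sup>2))"
        proof (rule integral_mono')
          show "integrable lborel (\<lambda>x. 3 * t\<^sup>2 * ((Im (\<eta> x))\<^sup>2 + (Re (\<xi> x))\<^sup>2 + (Im (\<xi> x))\<^sup>2))" using i by auto
          fix x
          have sq3: "(a + b + c)\<^sup>2 \<le> 3 * (a\<^sup>2 + b\<^sup>2 + c\<^sup>2)" for a b c :: real
          proof -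
            have "0 \<le> (a - b)\<^sup>2 + (b - c)\<^sup>2 + (a - c)\<^sup>2" by simp
            then show ?thesis by (simp add: power2_eq_square algebra_simps)
          qed
          have "Im (of_real s * \<eta> x + z * \<xi> x) = s * Im (\<eta> x) + Im z * Re (\<xi> x) + Re z * Im (\<xi> x)" by simp
          then have "(Im (of_real s * \<eta> x + z * \<xi> x))\<^sup>2 \<le> 3 * (s\<^sup>2 * (Im (\<eta> x))\<^sup>2 + (Im z)\<^sup>2 * (Re (\<xi> x))\<^sup>2 + (Re z)\<^sup>2 * (Im (\<xi> x))\<^sup>2)"
            using sq3[of "s * Im (\<eta> x)" "Im z * Re (\<xi> x)" "Re z * Im (\<xi> x)"] by (simp only: power_mult_distrib)
          also have "\<dots> \<le> 3 * (t\<^sup>2 * (Im (\<eta> x))\<^sup>2 + t\<^sup>2 * (Re (\<xi> x))\<^sup>2 + t\<^sup>2 * (Im (\<xi> x))\<^sup>2)"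
            using st zt by (intro mult_left_mono add_mono mult_right_mono) auto
          also have "\<dots> = 3 * t\<^sup>2 * ((Im (\<eta> x))\<^sup>2 + (Re (\<xi> x))\<^sup>2 + (Im (\<xi> x))\<^sup>2)" by (simp only: distrib_left mult.assoc)
          finally show "(Im (of_real s * \<eta> x + z * \<xi> x))\<^sup>2 \<le> 3 * t\<^sup>2 * ((Im (\<eta> x))\<^sup>2 + (Re (\<xi> x))\<^sup>2 + (Im (\<xi> x))\<^sup>2)" .
        qed simp
        also have "\<dots> = 3 * (t\<^sup>2 * V)" using i by (simp add: V_def va_def vb_def vc_def)
        also have "\<dots> < 2 * \<theta>" using tV th by linarith
        finally show ?thesis .
      qed
      ultimately have "(CLINT \<omega>|\<nu>. exp (\<i> * (of_real s * X \<omega> + z * D \<omega>))) = UG (of_real \<theta> + bilin (\<lambda>x. of_real s * \<eta> x + z * \<xi> x) (\<lambda>x. of_real s * \<eta> x + z * \<xi> x) / 2) / Z"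
        by (rule CPL_cf)
      also have "of_real \<theta> + bilin (\<lambda>x. of_real s * \<eta> x + z * \<xi> x) (\<lambda>x. of_real s * \<eta> x + z * \<xi> x) / 2 = W \<xi> (of_real s) z"
        unfolding bilin_sq_lin[OF eta complexify_schwartz_L2[OF xs]] quad_arg_def A_def by (simp add: algebra_simps)
      also have "(CLINT \<omega>|\<nu>. exp (\<i> * (of_real s * X \<omega> + z * D \<omega>))) = (CLINT \<omega>|\<nu>. e \<omega> * exp (z * (\<i> * D \<omega>)))"
        unfolding e_def exp_add[symmetric] by (simp add: algebra_simps)
      finally have "(\<lambda>j. Z * (c j * z ^ j)) sums (Z * (UG (W \<xi> (of_real s) z) / Z))" using sums_mult[OF s1, of Z] by simp
      then show ?thesis using Z_nonzero by (simp add: mult.assoc)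
    qed
    have "(\<lambda>z. UG (W \<xi> (of_real s) z)) has_fps_expansion fps_const Z * Abs_fps c"
    proof (rule has_fps_expansionI)
      have "\<forall>\<^sub>F z in nhds 0. z \<in> ball 0 t" using t0 by (intro eventually_nhds_in_open) auto
      then show "\<forall>\<^sub>F z in nhds 0. (\<lambda>n. fps_nth (fps_const Z * Abs_fps c) n * z ^ n) sums UG (W \<xi> (of_real s) z)"
        by eventually_elim (rule sums, simp)
    qed
    then have "fps_expansion (\<lambda>z. UG (W \<xi> (of_real s) z)) 0 = fps_const Z * Abs_fps c"
      by (intro fps_ext) (simp add: fps_nth_fps_expansion[of _ "fps_const Z * Abs_fps c", symmetric] fps_expansion_def del: fps_mult_left_const_nth)
    then show "fps_const Z * ?Lf * F \<xi> s = fps_expansion (\<lambda>z. UG (W \<xi> (of_real s) z)) 0"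
      using FC by (simp only: mult.assoc)
  qed
qed

end


section \<open>Weak integrability and the delta function\<close>

text \<open>For nonreal \<open>A\<close> the term s^2 Im A / 2 dominates everything else. The
  summand \<open>s\<close> on the left makes the imaginary part nonzero and divergent, the multiple
  of the modulus confines the argument to a sector off the real axis.\<close>

lemma quad_arg_Im_large:
  assumes A: "Im A \<noteq> 0" and R: "R \<ge> 0"
  shows "\<exists>c>0. \<exists>S\<ge>1. \<forall>s\<ge>S. \<forall>z. cmod z \<le> R \<longrightarrow>
    s + c * cmod (quad_arg C A B X (of_real s) z) \<le> \<bar>Im (quad_arg C A B X (of_real s) z)\<bar>"
proof -
  \<comment> \<open>The leading imaginary part has size \<alpha> s^2. As c |A| \<le> \<alpha>, the
    leading part of c |W| takes at most half of it; for s \<ge> S the other half covers the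
    contributions of size s (M + c M + 1).\<close>
  define \<alpha> where "\<alpha> = \<bar>Im A\<bar> / 2"
  define c where "c = \<alpha> / (1 + cmod A)"
  define M where "M = cmod C + R\<^sup>2 * cmod X / 2 + R * cmod B"
  define S where "S = max 1 (2 * (M + c * M + 1) / \<alpha>)"
  have a0: "\<alpha> > 0" using A by (simp add: \<alpha>_def)
  have n1: "1 + cmod A > 0" by (rule add_pos_nonneg) auto
  have c0: "c > 0" using a0 n1 by (simp add: c_def)
  have cA: "c * cmod A \<le> \<alpha>" using a0 n1 by (simp add: c_def divide_le_eq)
  show ?thesis
  proof (rule exI[of _ c], rule conjI[OF c0], rule exI[of _ S], intro conjI allI impI)
    show "1 \<le> S" by (simp add: S_def)
    fix s :: real and z assume s: "S \<le> s" and z: "cmod z \<le> R"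
    have s1: "1 \<le> s" using s by (simp add: S_def)
    define V where "V = C + z\<^sup>2 * X / 2 + of_real s * z * B"
    have W: "quad_arg C A B X (of_real s) z = V + of_real (s\<^sup>2 / 2) * A"
      by (simp add: quad_arg_def V_def field_simps)
    have zB: "cmod (of_real s * z * B) \<le> s * (R * cmod B)"
      using z s1 by (simp add: norm_mult mult.assoc mult_right_mono)
    have zX: "cmod (z\<^sup>2 * X / 2) \<le> s * (R\<^sup>2 * cmod X / 2)"
    proof -
      have "cmod (z\<^sup>2 * X / 2) \<le> R\<^sup>2 * cmod X / 2"
        using power_mono[OF z, of 2] by (simp add: norm_mult norm_power norm_divide mult_right_mono)
      also have "\<dots> \<le> s * (R\<^sup>2 * cmod X / 2)" using mult_right_mono[OF s1, of "R\<^sup>2 * cmod X / 2"] by simp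
      finally show ?thesis .
    qed
    have zC: "cmod C \<le> s * cmod C" using mult_right_mono[OF s1, of "cmod C"] by simp
    have "cmod V \<le> cmod C + cmod (z\<^sup>2 * X / 2) + cmod (of_real s * z * B)"
      unfolding V_def by (rule order_trans[OF norm_triangle_ineq add_right_mono[OF norm_triangle_ineq]])
    also have "\<dots> \<le> s * M" using zB zX zC unfolding M_def distrib_left by linarith
    finally have V: "cmod V \<le> s * M" .
    have "cmod (V + of_real (s\<^sup>2 / 2) * A) \<le> cmod V + cmod (of_real (s\<^sup>2 / 2) * A)" by (rule norm_triangle_ineq)
    also have "cmod (of_real (s\<^sup>2 / 2) * A) = s\<^sup>2 / 2 * cmod A" by (simp only: norm_mult norm_of_real) simp
    finally have "cmod (V + of_real (s\<^sup>2 / 2) * A) \<le> s * M + s\<^sup>2 / 2 * cmod A" using V by linarith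
    then have "c * cmod (V + of_real (s\<^sup>2 / 2) * A) \<le> c * (s * M + s\<^sup>2 / 2 * cmod A)" using c0 by (intro mult_left_mono) auto
    also have "\<dots> = s * (c * M) + s\<^sup>2 / 2 * (c * cmod A)" by (simp add: algebra_simps)
    also have "\<dots> \<le> s * (c * M) + s\<^sup>2 / 2 * \<alpha>" using cA by (intro add_left_mono mult_left_mono) auto
    finally have 1: "c * cmod (V + of_real (s\<^sup>2 / 2) * A) \<le> s * (c * M) + s\<^sup>2 / 2 * \<alpha>" .
    have "2 * (M + c * M + 1) / \<alpha> \<le> s" using s by (simp add: S_def)
    then have "M + c * M + 1 \<le> s * \<alpha> / 2" using a0 by (simp add: divide_le_eq)
    then have "s * (M + c * M + 1) \<le> s * (s * \<alpha> / 2)" using s1 by (intro mult_left_mono) auto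
    then have 2: "s * M + s * (c * M) + s \<le> s\<^sup>2 / 2 * \<alpha>" by (simp add: algebra_simps power2_eq_square)
    have "\<bar>Im (V + of_real (s\<^sup>2 / 2) * A)\<bar> \<ge> s\<^sup>2 * \<alpha> - cmod V"
    proof -
      have "Im (V + of_real (s\<^sup>2 / 2) * A) = Im V + s\<^sup>2 / 2 * Im A"
        by (simp only: plus_complex.sel times_complex.sel Re_complex_of_real Im_complex_of_real)
      moreover have "\<bar>s\<^sup>2 / 2 * Im A\<bar> = s\<^sup>2 * \<alpha>" by (simp add: \<alpha>_def abs_mult)
      ultimately show ?thesis using abs_Im_le_cmod[of V] by linarith
    qed
    then show "s + c * cmod (quad_arg C A B X (of_real s) z) \<le> \<bar>Im (quad_arg C A B X (of_real s) z)\<bar>"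
      unfolding W using 1 2 V by linarith
  qed
qed

lemma not_integrable_lborel_bounded_below:
  fixes g :: "real \<Rightarrow> complex"
  assumes ev: "\<forall>\<^sub>F s in at_top. 1 \<le> cmod (g s)"
  shows "\<not> integrable lborel g"
proof
  assume g: "integrable lborel g"
  obtain S where S: "\<And>s. S \<le> s \<Longrightarrow> 1 \<le> cmod (g s)" using ev unfolding eventually_at_top_linorder by blast
  have "integrable lborel (indicator {S..} :: real \<Rightarrow> real)"
    by (rule Bochner_Integration.integrable_bound[OF g]) (use S in \<open>auto simp: indicator_def\<close>)
  then have "emeasure lborel {S..} < \<infinity>" by (simp add: integrable_indicator_iff)
  then have fin: "{S..} \<in> fmeasurable lborel" by (simp add: fmeasurable_def)
  define r where "r = measure lborel {S..}"
  have r0: "r \<ge> 0" by (simp add: r_def)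
  have "measure lborel {S..S + (r + 1)} \<le> measure lborel {S..}"
    using fin by (intro measure_mono_fmeasurable) auto
  then show False using r0 by (simp add: r_def)
qed

text \<open>By the asymptotic formula the size is that of exp(-W) W^(\<rho>-1). With Re A \<le> 0
  and Re B < 0 the real part of \<open>W\<close> tends to minus infinity at least linearly, while
  |W| grows at most quadratically.\<close>

lemma upper_Gamma_quad_arg_large:
  assumes rho: "0 < \<rho>" "\<rho> < 1" and A: "Im A \<noteq> 0" "Re A \<le> 0" and B: "Re B < 0"
  shows "filterlim (\<lambda>s. cmod (upper_Gamma (of_real \<rho>) (quad_arg C A B X (of_real s) 1))) at_top at_top"
proof -
  define W where "W = (\<lambda>s. quad_arg C A B X (of_real s) 1)"
  obtain c S where c: "c > 0" "S \<ge> 1" "\<And>s. s \<ge> S \<Longrightarrow> s + c * cmod (W s) \<le> \<bar>Im (W s)\<bar>"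
    using quad_arg_Im_large[OF A(1), of 1 C B X] unfolding W_def by (auto; force)
  \<comment> \<open>Freezing the argument below \<open>S\<close> makes the sector estimate valid for
    every \<open>s\<close>, so that \<open>upper_Gamma_asymptotic\<close> applies to arbitrary
    sequences.\<close>
  define V where "V = (\<lambda>s. W (max s S))"
  have V: "max s S + c * cmod (V s) \<le> \<bar>Im (V s)\<bar>" for s unfolding V_def by (rule c(3)) simp
  have lim: "((\<lambda>s. exp (V s) * V s powr (1 - of_real \<rho>) * upper_Gamma (of_real \<rho>) (V s)) \<longlongrightarrow> 1) at_top"
  proof (rule tendsto_at_topI_sequentially)
    fix Y :: "nat \<Rightarrow> real" assume Y: "filterlim Y at_top sequentially"
    show "(\<lambda>n. exp (V (Y n)) * V (Y n) powr (1 - of_real \<rho>) * upper_Gamma (of_real \<rho>) (V (Y n))) \<longlonglongrightarrow> 1"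
    proof (rule upper_Gamma_asymptotic[OF rho _ c(1)])
      show "filterlim (\<lambda>n. \<bar>Im (V (Y n))\<bar>) at_top sequentially"
      proof (rule filterlim_at_top_mono[OF Y], intro always_eventually allI)
        fix n
        have "0 \<le> c * cmod (V (Y n))" using c(1) by simp
        then show "Y n \<le> \<bar>Im (V (Y n))\<bar>" using V[of "Y n"] by linarith
      qed
      fix n
      have m: "max (Y n) S > 0" using c(2) by linarith
      show "c * cmod (V (Y n)) \<le> \<bar>Im (V (Y n))\<bar>" using V[of "Y n"] m by linarith
      have "0 \<le> c * cmod (V (Y n))" using c(1) by simp
      then have "\<bar>Im (V (Y n))\<bar> > 0" using V[of "Y n"] m by linarith
      then show "Im (V (Y n)) \<noteq> 0" by simp
    qed
  qed
  define M where "M = cmod C + cmod X / 2 + cmod B + cmod A / 2"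
  have small: "cmod (exp (W s) * W s powr (1 - of_real \<rho>)) \<le> exp (cmod C + cmod X / 2 + s * Re B) * (M * s\<^sup>2)"
    if s: "s \<ge> S" for s
  proof -
    have s1: "s \<ge> 1" using s c(2) by linarith
    have We: "W s = C + X / 2 + of_real s * B + of_real (s\<^sup>2 / 2) * A" by (simp add: W_def quad_arg_def field_simps)
    have "Re (W s) = Re C + Re X / 2 + s * Re B + s\<^sup>2 / 2 * Re A"
      unfolding We by (simp only: plus_complex.sel times_complex.sel Re_complex_of_real Im_complex_of_real Re_divide_numeral)
    moreover have "s\<^sup>2 / 2 * Re A \<le> 0" using A(2) by (intro mult_nonneg_nonpos) auto
    ultimately have ReW: "Re (W s) \<le> cmod C + cmod X / 2 + s * Re B"
      using complex_Re_le_cmod[of C] complex_Re_le_cmod[of X] by linarith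
    have "cmod (W s) \<le> cmod C + cmod (X / 2) + cmod (of_real s * B) + cmod (of_real (s\<^sup>2 / 2) * A)"
      unfolding We by (intro order_trans[OF norm_triangle_ineq] add_mono norm_triangle_ineq order_refl)
    also have "\<dots> = 1 * cmod C + 1 * (cmod X / 2) + s * cmod B + s\<^sup>2 * (cmod A / 2)"
      using s1 by (simp add: norm_mult norm_divide norm_power)
    also have "\<dots> \<le> s\<^sup>2 * cmod C + s\<^sup>2 * (cmod X / 2) + s\<^sup>2 * cmod B + s\<^sup>2 * (cmod A / 2)"
      using s1 power_increasing[of 1 2 s] power_increasing[of 0 2 s]
      by (intro add_mono mult_right_mono order_refl) auto
    also have "\<dots> = M * s\<^sup>2" by (simp add: M_def algebra_simps)
    finally have WM: "cmod (W s) \<le> M * s\<^sup>2" .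
    have W1: "1 \<le> cmod (W s)"
    proof -
      have "0 \<le> c * cmod (W s)" using c(1) by simp
      then show ?thesis using c(3)[OF s] abs_Im_le_cmod[of "W s"] s1 by linarith
    qed
    then have W0: "W s \<noteq> 0" by auto
    have "cmod (W s powr (1 - of_real \<rho>)) = exp ((1 - \<rho>) * ln (cmod (W s)))"
      using W0 by (simp add: powr_def Re_Ln)
    also have "\<dots> \<le> exp (1 * ln (cmod (W s)))"
      using rho W1 unfolding exp_le_cancel_iff by (intro mult_right_mono) auto
    also have "\<dots> = cmod (W s)" using W0 by simp
    finally have "cmod (W s powr (1 - of_real \<rho>)) \<le> M * s\<^sup>2" using WM by linarith
    then show ?thesis unfolding norm_mult norm_exp_eq_Re using ReW by (intro mult_mono) auto
  qed
  have "((\<lambda>s. exp (cmod C + cmod X / 2 + s * Re B) * (M * s\<^sup>2)) \<longlongrightarrow> 0) at_top"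
    using B by real_asymp
  then have zero: "((\<lambda>s. exp (W s) * W s powr (1 - of_real \<rho>)) \<longlongrightarrow> 0) at_top"
    by (rule Lim_null_comparison[rotated]) (use small in \<open>auto simp: eventually_at_top_linorder\<close>)
  have lim2: "((\<lambda>s. exp (W s) * W s powr (1 - of_real \<rho>) * upper_Gamma (of_real \<rho>) (W s)) \<longlongrightarrow> 1) at_top"
    by (rule Lim_transform_eventually[OF lim]) (auto simp: eventually_at_top_linorder V_def max_def intro!: exI[of _ S])
  have "filterlim (\<lambda>s. cmod (upper_Gamma (of_real \<rho>) (W s))) at_top at_top"
  proof (rule filterlim_at_top[THEN iffD2], intro allI)
    fix K :: real
    define K' where "K' = max K 1"
    have K': "K' > 0" by (simp add: K'_def)
    have 1: "\<forall>\<^sub>F s in at_top. cmod (exp (W s) * W s powr (1 - of_real \<rho>)) < 1 / (2 * K')"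
      using order_tendstoD(2)[OF tendsto_norm[OF zero], of "1 / (2 * K')"] K' by simp
    have 2: "\<forall>\<^sub>F s in at_top. 1 / 2 < cmod (exp (W s) * W s powr (1 - of_real \<rho>) * upper_Gamma (of_real \<rho>) (W s))"
      using order_tendstoD(1)[OF tendsto_norm[OF lim2], of "1 / 2"] by simp
    show "\<forall>\<^sub>F s in at_top. K \<le> cmod (upper_Gamma (of_real \<rho>) (W s))"
      using 1 2
    proof eventually_elim
      case (elim s)
      let ?u = "cmod (upper_Gamma (of_real \<rho>) (W s))"
      have "1 / 2 < cmod (exp (W s) * W s powr (1 - of_real \<rho>)) * ?u" using elim(2) by (simp only: norm_mult)
      also have "\<dots> \<le> 1 / (2 * K') * ?u" using elim(1) by (intro mult_right_mono) auto
      finally have "K' \<le> ?u" using K' by (simp add: field_simps)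
      then show ?case by (simp add: K'_def)
    qed
  qed
  then show ?thesis by (simp only: W_def)
qed

context donsker_exp
begin

text \<open>Analyticity in \<open>s\<close> is given for \<open>E s\<close> on single polynomials,
  hence coefficient by coefficient in \<open>z\<close>. So power series are continued in
  \<open>s\<close>, and the resulting identity of functions holds near z = 0 in a neighbourhood that
  may depend on \<open>s\<close>.\<close>

lemma transform_near_0:
  assumes xi: "\<xi> \<in> U_nbhd ip p q" and nr: "\<And>s::real. of_real \<theta> + (of_real s)\<^sup>2 * A / 2 \<notin> \<real>\<^sub>\<le>\<^sub>0"
  shows "\<forall>\<^sub>F z in nhds 0. Z * (L \<xi> z * eval_fps (F \<xi> s) z) = UG (W \<xi> (of_real s) z)"
proof -
  have xs: "\<xi> \<in> complexify schwartz" using xi by (simp add: U_nbhd_def)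
  note ixs = complexify_schwartz_scale[OF xs, of \<i>]
  let ?Lf = "fps_const Z * fps_expansion (L \<xi>) 0"
  have "\<exists>f. f analytic_on \<real> \<and> (\<forall>s. fps_nth (F \<xi> s) n = f (of_real s))" for n
  proof -
    obtain f where f: "f analytic_on \<real>" "\<And>s. E s (appell \<nu> n (\<lambda>x. \<i> * \<xi> x)) = f (of_real s)"
      using E_analytic[OF appell_in_polys[OF H E_distrib ixs]] by blast
    have "(\<lambda>s. f s / fact n) analytic_on \<real>" using f(1) by (intro analytic_intros) auto
    then show ?thesis using f(2) by (intro exI[of _ "\<lambda>s. f s / fact n"]) (simp add: F_def)
  qed
  then obtain f where f: "\<And>n. f n analytic_on \<real>" "\<And>n s. fps_nth (F \<xi> s) n = f n (of_real s)" by metis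
  obtain t where t: "t > 0" "\<And>s::real. \<bar>s\<bar> < t \<Longrightarrow> ?Lf * F \<xi> s = fps_expansion (\<lambda>z. UG (W \<xi> (of_real s) z)) 0"
    using fps_identity_small[OF xi] by blast
  have eq: "?Lf * F \<xi> s = fps_expansion (\<lambda>z. UG (W \<xi> (of_real s) z)) 0"
  proof (rule fps_ext)
    fix n
    let ?f = "\<lambda>s. \<Sum>j=0..n. fps_nth ?Lf j * f (n - j) s"
    let ?g = "\<lambda>s. fps_nth (fps_expansion (\<lambda>z. UG (W \<xi> s z)) 0) n"
    have F: "?f (of_real s) = fps_nth (?Lf * F \<xi> s) n" for s :: real by (simp only: fps_mult_nth[of ?Lf] f(2))
    have "?f (of_real s) = ?g (of_real s)"
    proof (rule analytic_on_Reals_eq(1)[OF _ _ t(1)])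
      show "?f analytic_on \<real>" by (intro analytic_intros f)
      show "?g analytic_on \<real>" by (rule quad_arg_coeff_analytic[OF rho nr])
      show "?f (of_real u) = ?g (of_real u)" if "\<bar>u\<bar> < t" for u :: real unfolding F t(2)[OF that] ..
    qed
    then show "fps_nth (?Lf * F \<xi> s) n = fps_nth (fps_expansion (\<lambda>z. UG (W \<xi> (of_real s) z)) 0) n" unfolding F .
  qed
  have 1: "(\<lambda>z. UG (W \<xi> (of_real s) z)) has_fps_expansion fps_expansion (\<lambda>z. UG (W \<xi> (of_real s) z)) 0"
  proof (rule analytic_at_imp_has_fps_expansion_0)
    have "(UG \<circ> W \<xi> (of_real s)) analytic_on {0}"
    proof (rule analytic_on_compose_gen[where T = "- \<real>\<^sub>\<le>\<^sub>0"])
      show "W \<xi> (of_real s) analytic_on {0}" using analytic_on_open[of UNIV] quad_arg_holomorphic_z analytic_on_subset by blast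
      show "UG analytic_on - \<real>\<^sub>\<le>\<^sub>0" using upper_Gamma_holomorphic[OF rho] by (simp add: analytic_on_open open_Compl)
      show "\<And>z. z \<in> {0} \<Longrightarrow> W \<xi> (of_real s) z \<in> - \<real>\<^sub>\<le>\<^sub>0" using nr[of s] by (simp add: quad_arg_0)
    qed
    then show "(\<lambda>z. UG (W \<xi> (of_real s) z)) analytic_on {0}" by (simp add: o_def)
  qed
  obtain R where R: "R > 1" "\<And>s. ereal R \<le> fps_conv_radius (F \<xi> s)" using T_transform_disc[OF xi] by blast
  have "0 < fps_conv_radius (F \<xi> s)" using R(1) order_less_le_trans[OF _ R(2), of 0] by simp
  then have "eval_fps (F \<xi> s) has_fps_expansion F \<xi> s" by (simp add: has_fps_expansion_def)
  then have "(\<lambda>z. Z * (L \<xi> z * eval_fps (F \<xi> s) z)) has_fps_expansion fps_const Z * (fps_expansion (L \<xi>) 0 * F \<xi> s)"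
    by (intro fps_expansion_intros L_analytic[OF xi])
  then have "(\<lambda>z. Z * (L \<xi> z * eval_fps (F \<xi> s) z)) has_fps_expansion fps_expansion (\<lambda>z. UG (W \<xi> (of_real s) z)) 0"
    using eq by (simp add: mult.assoc)
  then have "\<forall>\<^sub>F z in nhds 0. eval_fps (fps_expansion (\<lambda>z. UG (W \<xi> (of_real s) z)) 0) z = Z * (L \<xi> z * eval_fps (F \<xi> s) z)"
    by (simp add: has_fps_expansion_def)
  moreover have "\<forall>\<^sub>F z in nhds 0. eval_fps (fps_expansion (\<lambda>z. UG (W \<xi> (of_real s) z)) 0) z = UG (W \<xi> (of_real s) z)"
    using 1 by (simp add: has_fps_expansion_def)
  ultimately show ?thesis by eventually_elim metis
qed

lemma zero_U_nbhd: "(\<lambda>x. 0) \<in> U_nbhd ip p q"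
proof -
  have "Re (herm ip p (\<lambda>x. 0 * 0) (\<lambda>x. 0 * 0)) = 0"
    by (subst herm_self_scale[OF H zero_complexify_schwartz, of p 0]) simp
  then show ?thesis by (simp add: U_nbhd_def zero_complexify_schwartz)
qed

text \<open>Otherwise \<open>A\<close> is a negative real number. For \<xi> = 0 the coefficient of
  order 0 is analytic in \<open>s\<close> along the whole real line and equals \<Gamma>(\<rho>,
  \<theta> + s^2 A / 2) / Z near 0, so it would continue the incomplete gamma function through a
  simple zero of its argument. Here \<open>s\<close>, not \<open>z\<close>, is the variable of the
  continuation.\<close>

lemma arg_not_nonpos: "of_real \<theta> + (of_real s)\<^sup>2 * A / 2 \<notin> \<real>\<^sub>\<le>\<^sub>0" for s :: real
proof
  assume "of_real \<theta> + (of_real s)\<^sup>2 * A / 2 \<in> \<real>\<^sub>\<le>\<^sub>0"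
  then obtain r where r: "r \<le> 0" "of_real \<theta> + (of_real s)\<^sup>2 * A / 2 = of_real r" by (auto simp: nonpos_Reals_def)
  define a where "a = 2 * (r - \<theta>) / s\<^sup>2"
  have s0: "s \<noteq> 0" using r th by (auto simp flip: of_real_add)
  have "(of_real s)\<^sup>2 * A = 2 * (of_real \<theta> + (of_real s)\<^sup>2 * A / 2) - 2 * of_real \<theta>" by simp
  then have "(of_real s)\<^sup>2 * A = of_real (2 * (r - \<theta>))" unfolding r(2) by simp
  then have A: "A = of_real a" using s0 by (simp add: a_def field_simps)
  have a: "a < 0" using r(1) th s0 by (simp add: a_def divide_less_0_iff)
  \<comment> \<open>The positive zero of \<theta> + s^2 a / 2; it is simple because its derivative
    s0 a is nonzero.\<close>
  define s0 where "s0 = sqrt (2 * \<theta> / (- a))"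
  have pos: "2 * \<theta> / (- a) > 0" using a th by (intro divide_pos_pos) auto
  have "s0\<^sup>2 = 2 * \<theta> / (- a)" unfolding s0_def using pos by (intro real_sqrt_pow2) simp
  then have s0: "s0 > 0" "s0\<^sup>2 * a / 2 = - \<theta>" using a pos by (auto simp: s0_def)
  let ?x = "\<lambda>x::real. 0::complex"
  let ?W = "\<lambda>z. of_real \<theta> + z\<^sup>2 * A / 2"
  note ixs = complexify_schwartz_scale[OF zero_complexify_schwartz, of \<i>]
  obtain f where f: "f analytic_on \<real>" "\<And>s. E s (appell \<nu> 0 (\<lambda>x. \<i> * ?x x)) = f (of_real s)"
    using E_analytic[OF appell_in_polys[OF H E_distrib ixs]] by blast
  obtain t where t: "t > 0" "\<And>s::real. \<bar>s\<bar> < t \<Longrightarrow> fps_const Z * fps_expansion (L ?x) 0 * F ?x s = fps_expansion (\<lambda>z. UG (W ?x (of_real s) z)) 0"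
    using fps_identity_small[OF zero_U_nbhd] by blast
  have small: "Z * f (of_real s) = UG (?W (of_real s))" if "\<bar>s\<bar> < t" for s :: real
  proof -
    have "fps_nth (fps_const Z * fps_expansion (L ?x) 0 * F ?x s) 0 = UG (?W (of_real s))"
      unfolding t(2)[OF that] by (simp add: fps_expansion_def quad_arg_0)
    moreover have "L ?x 0 = 1" using T_transform_disc[OF zero_U_nbhd] by blast
    ultimately show ?thesis by (simp add: fps_expansion_def F_def f(2)[symmetric])
  qed
  obtain S where S: "open S" "connected S" "\<real> \<subseteq> S" "f holomorphic_on S"
    using analytic_on_Reals_eq(2)[OF f(1) f(1) zero_less_one] by blast
  have hW: "?W holomorphic_on UNIV" by (intro holomorphic_intros) auto
  have "open (S \<inter> ?W -` (- \<real>\<^sub>\<le>\<^sub>0))"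
    by (intro open_Int S open_vimage holomorphic_on_imp_continuous_on[OF hW]) (simp add: open_Compl)
  moreover have "0 \<in> S \<inter> ?W -` (- \<real>\<^sub>\<le>\<^sub>0)" using S(3) th by auto
  ultimately obtain e where e: "e > 0" "ball 0 e \<subseteq> S \<inter> ?W -` (- \<real>\<^sub>\<le>\<^sub>0)" by (meson open_contains_ball)
  \<comment> \<open>So far the equality is known on a real interval; both sides are holomorphic in a
    disc about 0, which extends it to complex arguments.\<close>
  have near: "\<forall>\<^sub>F z in nhds 0. Z * f z = UG (?W z)"
  proof -
    have "\<forall>\<^sub>F z in nhds 0. z \<in> ball 0 e" using e(1) by (intro eventually_nhds_in_open) auto
    then show ?thesis
    proof eventually_elim
      case (elim z)
      have "(\<lambda>z. Z * f z - UG (?W z)) holomorphic_on ball 0 e"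
        by (intro holomorphic_on_diff holomorphic_on_mult holomorphic_on_const holomorphic_on_subset[OF S(4)]
            holomorphic_on_compose_gen[OF holomorphic_on_subset[OF hW] upper_Gamma_holomorphic[OF rho], unfolded o_def])
           (use e in auto)
      then have "Z * f z - UG (?W z) = 0"
      proof (rule analytic_continuation[where U = "complex_of_real ` {- min t e<..<min t e}" and \<xi> = 0])
        show "0 islimpt complex_of_real ` {- min t e<..<min t e}"
          by (rule islimpt_of_real_interval) (use t(1) e(1) in auto)
        show "complex_of_real ` {- min t e<..<min t e} \<subseteq> ball 0 e" by auto
        show "Z * f z - UG (?W z) = 0" if "z \<in> complex_of_real ` {- min t e<..<min t e}" for z
          using that small by (auto simp: abs_less_iff)
      qed (use elim e(1) in auto)
      then show ?case by simp
    qed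
  qed
  show False
  proof (rule upper_Gamma_no_simple_zero[OF rho S(1,2) _ _ _ holomorphic_on_subset[OF hW] _ near])
    show "0 \<in> S" "of_real s0 \<in> S" using S(3) by auto
    show "(\<lambda>z. Z * f z) holomorphic_on S" by (intro holomorphic_intros S)
    show "of_real \<theta> + 0\<^sup>2 * A / 2 \<notin> \<real>\<^sub>\<le>\<^sub>0" using th by simp
    have "of_real \<theta> + (of_real s0)\<^sup>2 * A / 2 = complex_of_real (\<theta> + s0\<^sup>2 * a / 2)" unfolding A by simp
    then show "of_real \<theta> + (of_real s0)\<^sup>2 * A / 2 = 0" using s0(2) by simp
    have "deriv ?W (of_real s0) = of_real s0 * A"
      by (rule DERIV_imp_deriv) (auto intro!: derivative_eq_intros)
    then show "deriv ?W (of_real s0) \<noteq> 0" using s0(1) a A by simp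
  qed simp
qed

lemma T_transform_scale_near:
  assumes xi: "\<xi> \<in> U_nbhd ip p q"
  shows "\<exists>R>1. (\<forall>s. (\<lambda>z. Z * T_transform \<nu> (E s) (\<lambda>x. z * \<xi> x)) holomorphic_on ball 0 R) \<and>
    (\<forall>s. \<forall>\<^sub>F z in nhds 0. Z * T_transform \<nu> (E s) (\<lambda>x. z * \<xi> x) = UG (W \<xi> (of_real s) z))"
proof -
  obtain R where R: "R > 1" "L \<xi> holomorphic_on ball 0 R" "\<And>s. ereal R \<le> fps_conv_radius (F \<xi> s)"
    "\<And>s z. cmod z < R \<Longrightarrow> T_transform \<nu> (E s) (\<lambda>x. z * \<xi> x) = L \<xi> z * eval_fps (F \<xi> s) z"
    using T_transform_disc[OF xi] by blast
  have sub: "ball (0::complex) R \<subseteq> eball 0 (fps_conv_radius (F \<xi> s))" for s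
  proof
    fix z :: complex assume "z \<in> ball 0 R"
    then have "ereal (norm z) < ereal R" by simp
    also have "\<dots> \<le> fps_conv_radius (F \<xi> s)" by (rule R(3))
    finally show "z \<in> eball 0 (fps_conv_radius (F \<xi> s))" by (simp add: in_eball_iff)
  qed
  have "eval_fps (F \<xi> s) holomorphic_on ball 0 R" for s by (rule holomorphic_on_eval_fps[OF sub])
  then have "(\<lambda>z. Z * (L \<xi> z * eval_fps (F \<xi> s) z)) holomorphic_on ball 0 R" for s
    by (intro holomorphic_on_mult holomorphic_on_const R(2))
  moreover have "((\<lambda>z. Z * (L \<xi> z * eval_fps (F \<xi> s) z)) holomorphic_on ball 0 R) = ((\<lambda>z. Z * T_transform \<nu> (E s) (\<lambda>x. z * \<xi> x)) holomorphic_on ball 0 R)" for s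
    by (rule holomorphic_cong[OF refl]) (simp add: R(4))
  moreover have "\<forall>\<^sub>F z in nhds 0. Z * T_transform \<nu> (E s) (\<lambda>x. z * \<xi> x) = UG (W \<xi> (of_real s) z)" for s
  proof -
    have "\<forall>\<^sub>F z in nhds 0. z \<in> ball 0 R" using R(1) by (intro eventually_nhds_in_open) auto
    with transform_near_0[OF xi arg_not_nonpos, of s] show ?thesis
      by eventually_elim (simp add: R(4))
  qed
  ultimately show ?thesis using R(1) by blast
qed

section \<open>Nondegeneracy of the pairing with \<open>\<eta>\<close> and positivity of Re
  A\<close>

lemma bilin_real:
  assumes f: "f \<in> complexify L2" and g: "g \<in> L2"
  shows "bilin f (\<lambda>x. of_real (g x)) = of_real (LINT x|lborel. Re (f x) * g x) + \<i> * of_real (LINT x|lborel. Im (f x) * g x)"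
proof -
  have fL: "(\<lambda>x. Re (f x)) \<in> L2" "(\<lambda>x. Im (f x)) \<in> L2" using f by (auto simp: complexify_def o_def)
  note i = integrable_L2_mult[OF fL(1) g] integrable_L2_mult[OF fL(2) g]
  have "bilin f (\<lambda>x. of_real (g x)) = (CLINT x|lborel. of_real (Re (f x) * g x) + \<i> * of_real (Im (f x) * g x))"
    unfolding bilin_def by (intro Bochner_Integration.integral_cong) (auto simp: complex_eq_iff)
  also have "\<dots> = (CLINT x|lborel. of_real (Re (f x) * g x)) + (CLINT x|lborel. \<i> * of_real (Im (f x) * g x))"
    using i by (intro Bochner_Integration.integral_add integrable_mult_right integrable_of_real)
  finally show ?thesis by (simp only: integral_mult_right_zero integral_complex_of_real)
qed

text \<open>The pairing \<open>Y\<close> comes with Schwartz functions that approximate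
  \<open>f\<close>. By orthogonality the squared distance of each of them from \<open>f\<close> is
  the sum of the two squared norms, hence at least that of \<open>f\<close>.\<close>

lemma L2_orthogonal_schwartz:
  assumes PL: "PL f Y" and orth: "\<And>\<phi>. \<phi> \<in> schwartz \<Longrightarrow> (LINT x|lborel. f x * \<phi> x) = 0"
  shows "(LINT x|lborel. (f x)\<^sup>2) = 0"
proof -
  obtain \<phi> where \<phi>: "\<And>n. \<phi> n \<in> schwartz" "(\<lambda>n. L2_norm (\<lambda>x. \<phi> n x - f x)) \<longlonglongrightarrow> 0"
    by (rule PL_seq[OF PL]) (rule that)
  have fL: "f \<in> L2" by (rule PL_L2[OF PL])
  have le: "(LINT x|lborel. (f x)\<^sup>2) \<le> (L2_norm (\<lambda>x. \<phi> n x - f x))\<^sup>2" for n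
  proof -
    have "(LINT x|lborel. (- 1 * f x + \<phi> n x)\<^sup>2) = (- 1)\<^sup>2 * (LINT x|lborel. (f x)\<^sup>2) + 2 * (- 1) * (LINT x|lborel. f x * \<phi> n x) + (LINT x|lborel. (\<phi> n x)\<^sup>2)"
      by (rule LINT_sq_lin[OF fL schwartz_L2[OF \<phi>(1)]])
    moreover have "(LINT x|lborel. (- 1 * f x + \<phi> n x)\<^sup>2) = (L2_norm (\<lambda>x. \<phi> n x - f x))\<^sup>2"
      unfolding L2_norm_sq by simp
    ultimately have "(L2_norm (\<lambda>x. \<phi> n x - f x))\<^sup>2 = (LINT x|lborel. (f x)\<^sup>2) + (LINT x|lborel. (\<phi> n x)\<^sup>2)"
      unfolding orth[OF \<phi>(1)[of n]] by simp
    moreover have "0 \<le> (LINT x|lborel. (\<phi> n x)\<^sup>2)" by simp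
    ultimately show ?thesis by linarith
  qed
  have "(\<lambda>n. (L2_norm (\<lambda>x. \<phi> n x - f x))\<^sup>2) \<longlonglongrightarrow> 0\<^sup>2" by (rule tendsto_power[OF \<phi>(2)])
  then have "(LINT x|lborel. (f x)\<^sup>2) \<le> 0\<^sup>2" by (rule LIMSEQ_le_const) (rule exI[of _ 0], intro allI impI le)
  then have "(LINT x|lborel. (f x)\<^sup>2) \<le> 0" by simp
  then show ?thesis by (intro antisym) auto
qed

text \<open>If \<eta> annihilated all Schwartz functions, its real and imaginary parts would have
  norm 0, and with them all terms of <\<eta>, \<eta>>.\<close>

lemma ex_schwartz_pairing_nonzero:
  assumes "A \<noteq> 0"
  shows "\<exists>\<phi>\<in>schwartz. bilin \<eta> (\<lambda>x. of_real (\<phi> x)) \<noteq> 0"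
proof (rule ccontr)
  assume "\<not> ?thesis"
  then have z: "bilin \<eta> (\<lambda>x. of_real (\<phi> x)) = 0" if "\<phi> \<in> schwartz" for \<phi> using that by blast
  obtain X where X: "CPL \<eta> X" using E_pairing by blast
  define f g where "f = (\<lambda>x. Re (\<eta> x))" and "g = (\<lambda>x. Im (\<eta> x))"
  have PL: "PL f (\<lambda>\<omega>. Re (X \<omega>))" "PL g (\<lambda>\<omega>. Im (X \<omega>))" using X by (auto simp: CPL_def o_def f_def g_def)
  have fL: "f \<in> L2" and gL: "g \<in> L2" using PL_L2[OF PL(1)] PL_L2[OF PL(2)] by auto
  have "(LINT x|lborel. f x * \<phi> x) = 0 \<and> (LINT x|lborel. g x * \<phi> x) = 0" if "\<phi> \<in> schwartz" for \<phi>
    using z[OF that] bilin_real[OF eta schwartz_L2[OF that]] by (simp add: f_def g_def complex_eq_iff)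
  then have n: "(LINT x|lborel. (f x)\<^sup>2) = 0" "(LINT x|lborel. (g x)\<^sup>2) = 0"
    using L2_orthogonal_schwartz[OF PL(1)] L2_orthogonal_schwartz[OF PL(2)] by auto
  \<comment> \<open>Both squared norms are 0, so the squared norm of -b f + g is -2 b^2, which
    forces b = 0: Cauchy-Schwarz in the degenerate case.\<close>
  define b where "b = (LINT x|lborel. f x * g x)"
  have "(LINT x|lborel. (- b * f x + g x)\<^sup>2) = - 2 * b\<^sup>2"
    using LINT_sq_lin[OF fL gL, of "- b"] n by (simp add: b_def[symmetric] power2_eq_square)
  moreover have "0 \<le> (LINT x|lborel. (- b * f x + g x)\<^sup>2)" by simp
  ultimately have b0: "b = 0" by simp
  let ?f = "\<lambda>x. complex_of_real (f x)" and ?g = "\<lambda>x. complex_of_real (g x)"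
  have zL: "(\<lambda>x. 0) \<in> L2" by (simp add: L2_def)
  have c: "?f \<in> complexify L2" "?g \<in> complexify L2" using fL gL zL by (auto simp: complexify_def o_def)
  have "\<eta> = (\<lambda>x. 1 * ?f x + \<i> * ?g x)" by (auto simp: f_def g_def complex_eq_iff)
  then have "A = bilin (\<lambda>x. 1 * ?f x + \<i> * ?g x) (\<lambda>x. 1 * ?f x + \<i> * ?g x)" unfolding A_def by simp
  also have "\<dots> = 1\<^sup>2 * bilin ?f ?f + 2 * 1 * \<i> * bilin ?f ?g + \<i>\<^sup>2 * bilin ?g ?g" by (rule bilin_sq_lin[OF c])
  also have "\<dots> = 0" unfolding bilin_real[OF c(1) fL] bilin_real[OF c(1) gL] bilin_real[OF c(2) gL]
    using n b0 by (simp add: power2_eq_square b_def)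
  finally show False using assms by simp
qed

lemma ex_U_nbhd_Re_neg:
  assumes "A \<noteq> 0"
  shows "\<exists>\<xi>\<in>U_nbhd ip p q. Re (bilin \<eta> \<xi>) < 0"
proof -
  obtain \<phi> where \<phi>: "\<phi> \<in> schwartz" "bilin \<eta> (\<lambda>x. of_real (\<phi> x)) \<noteq> 0" using ex_schwartz_pairing_nonzero[OF assms] by blast
  define \<xi> where "\<xi> = (\<lambda>x. complex_of_real (\<phi> x))"
  define b where "b = bilin \<eta> \<xi>"
  have b0: "b \<noteq> 0" using \<phi>(2) by (simp add: b_def \<xi>_def)
  have xs: "\<xi> \<in> complexify schwartz" using \<phi>(1) zero_schwartz by (simp add: \<xi>_def complexify_def o_def)
  define m where "m = 2 ^ q * Re (herm ip p \<xi> \<xi>)"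
  have m0: "m \<ge> 0" using herm_self(2)[OF H xs] by (simp add: m_def)
  \<comment> \<open>The phase turns z b into a negative real number; the modulus 1/(1 + m) brings z
    \<xi> into the neighbourhood, since m / (1 + m)^2 < 1.\<close>
  define z where "z = - cnj b / of_real (cmod b * (1 + m))"
  have zb: "z * b = - of_real (cmod b / (1 + m))"
  proof -
    have "z * b = - (b * cnj b) / of_real (cmod b * (1 + m))" by (simp add: z_def)
    also have "b * cnj b = of_real ((cmod b)\<^sup>2)" by (simp only: complex_norm_square)
    also have "- of_real ((cmod b)\<^sup>2) / complex_of_real (cmod b * (1 + m)) = of_real (- ((cmod b)\<^sup>2 / (cmod b * (1 + m))))" by simp
    also have "(cmod b)\<^sup>2 / (cmod b * (1 + m)) = cmod b / (1 + m)" using b0 by (simp add: power2_eq_square)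
    finally show ?thesis by simp
  qed
  have "cmod z = cmod b / \<bar>cmod b * (1 + m)\<bar>" by (simp only: z_def norm_divide norm_minus_cancel complex_mod_cnj norm_of_real)
  then have cz: "cmod z = 1 / (1 + m)" using b0 m0 by (simp add: abs_mult)
  have "2 ^ q * ((cmod z)\<^sup>2 * Re (herm ip p \<xi> \<xi>)) = m / (1 + m)\<^sup>2" unfolding cz by (simp add: m_def power_divide)
  also have "\<dots> < 1"
  proof -
    have "m < (1 + m)\<^sup>2" using m0 zero_le_power2[of m] by (simp add: power2_sum add_strict_increasing)
    moreover have "0 < (1 + m)\<^sup>2" using m0 by simp
    ultimately show ?thesis by (simp only: divide_less_eq_1_pos)
  qed
  finally have "(\<lambda>x. z * \<xi> x) \<in> U_nbhd ip p q"
    unfolding U_nbhd_def by (simp add: complexify_schwartz_scale[OF xs] herm_self_scale[OF H xs])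
  moreover have "bilin \<eta> (\<lambda>x. z * \<xi> x) = z * b" unfolding bilin_def b_def by (simp add: mult.left_commute)
  moreover have "Re (z * b) < 0" unfolding zb using b0 m0 by simp
  ultimately show ?thesis by (intro bexI[of _ "\<lambda>x. z * \<xi> x"]) simp_all
qed

text \<open>If A = 0, the T-transform at \<xi> = 0 is constantly 1 in \<open>s\<close>. A negative
  real \<open>A\<close> contradicts \<open>arg_not_nonpos\<close>. A nonreal \<open>A\<close> with
  Re A \<le> 0 and a \<xi> with Re <\<eta>, \<xi>> < 0 make the T-transform unbounded as
  \<open>s\<close> grows. None of these is integrable.\<close>

lemma Re_A_pos:
  assumes int: "\<And>\<xi>. \<xi> \<in> U_nbhd ip p q \<Longrightarrow> integrable lborel (\<lambda>s. T_transform \<nu> (E s) \<xi>)"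
  shows "Re A > 0"
proof (rule ccontr)
  assume "\<not> Re A > 0"
  then have Re: "Re A \<le> 0" by simp
  show False
  proof (cases "A = 0")
    case True
    have R: "\<forall>\<^sub>F z in nhds 0. Z * T_transform \<nu> (E s) (\<lambda>x. z * 0) = UG (W (\<lambda>x. 0) (of_real s) z)" for s
      using T_transform_scale_near[OF zero_U_nbhd] by blast
    have "T_transform \<nu> (E s) (\<lambda>x. 0) = 1" for s
    proof -
      have "Z * T_transform \<nu> (E s) (\<lambda>x. 0 * 0) = UG (W (\<lambda>x. 0) (of_real s) 0)"
        using R[of s] by (rule eventually_nhds_x_imp_x)
      then show ?thesis using Z_nonzero True by (simp add: quad_arg_0 Z_def)
    qed
    then have "\<not> integrable lborel (\<lambda>s. T_transform \<nu> (E s) (\<lambda>x. 0))"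
      using not_integrable_lborel_bounded_below[of "\<lambda>s. 1"] by simp
    then show False using int[OF zero_U_nbhd] by blast
  next
    case False
    have Im: "Im A \<noteq> 0"
    proof
      assume "Im A = 0"
      then have A: "A = of_real (Re A)" "Re A < 0" using Re False by (auto simp: complex_eq_iff)
      define s where "s = sqrt (2 * \<theta> / (- Re A))"
      have "2 * \<theta> / (- Re A) > 0" using A(2) th by (intro divide_pos_pos) auto
      then have "s\<^sup>2 = 2 * \<theta> / (- Re A)" unfolding s_def by (intro real_sqrt_pow2) simp
      then have "s\<^sup>2 * Re A / 2 = - \<theta>" using A(2) by simp
      then have "complex_of_real (\<theta> + s\<^sup>2 * Re A / 2) = 0" by simp
      then have "of_real \<theta> + (of_real s)\<^sup>2 * of_real (Re A) / 2 = (0 :: complex)" by simp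
      then show False using arg_not_nonpos[of s] A(1) by simp
    qed
    obtain \<xi> where xi: "\<xi> \<in> U_nbhd ip p q" "Re (bilin \<eta> \<xi>) < 0" using ex_U_nbhd_Re_neg[OF False] by blast
    obtain R where R: "R > 1" "\<And>s. (\<lambda>z. Z * T_transform \<nu> (E s) (\<lambda>x. z * \<xi> x)) holomorphic_on ball 0 R"
      "\<And>s. \<forall>\<^sub>F z in nhds 0. Z * T_transform \<nu> (E s) (\<lambda>x. z * \<xi> x) = UG (W \<xi> (of_real s) z)"
      using T_transform_scale_near[OF xi(1)] by blast
    obtain c S where S: "c > 0" "S \<ge> 1" "\<And>s z. s \<ge> S \<Longrightarrow> cmod z \<le> R \<Longrightarrow> s + c * cmod (W \<xi> (of_real s) z) \<le> \<bar>Im (W \<xi> (of_real s) z)\<bar>"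
      using quad_arg_Im_large[OF Im, of R "of_real \<theta>" "bilin \<eta> \<xi>" "bilin \<xi> \<xi>"] R(1) by auto
    \<comment> \<open>For large \<open>s\<close> the imaginary part of the argument has no zero on
      the whole disc, so the identity of germs extends to z = 1 with the principal branch.\<close>
    have eq: "Z * T_transform \<nu> (E s) \<xi> = UG (W \<xi> (of_real s) 1)" if s: "s \<ge> S" for s
    proof -
      have nr: "W \<xi> (of_real s) z \<in> - \<real>\<^sub>\<le>\<^sub>0" if "z \<in> ball 0 R" for z
      proof -
        have "0 \<le> c * cmod (W \<xi> (of_real s) z)" using S(1) by simp
        then have "\<bar>Im (W \<xi> (of_real s) z)\<bar> > 0" using S(3)[OF s, of z] that s S(2) by simp
        then show ?thesis by (auto simp: complex_nonpos_Reals_iff)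
      qed
      obtain T where T: "open T" "0 \<in> T" "\<And>z. z \<in> T \<Longrightarrow> Z * T_transform \<nu> (E s) (\<lambda>x. z * \<xi> x) = UG (W \<xi> (of_real s) z)"
        using R(3)[of s] unfolding eventually_nhds by blast
      have "Z * T_transform \<nu> (E s) (\<lambda>x. 1 * \<xi> x) = UG (W \<xi> (of_real s) 1)"
      proof (rule analytic_continuation_open[of "T \<inter> ball 0 R" "ball 0 R" "\<lambda>z. Z * T_transform \<nu> (E s) (\<lambda>x. z * \<xi> x)" "\<lambda>z. UG (W \<xi> (of_real s) z)"])
        show "(\<lambda>z. UG (W \<xi> (of_real s) z)) holomorphic_on ball 0 R"
          by (rule holomorphic_on_compose_gen[OF quad_arg_holomorphic_z upper_Gamma_holomorphic[OF rho], unfolded o_def])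
             (use nr in auto)
        have "0 \<in> T \<inter> ball 0 R" using T(2) R(1) by simp
        then show "T \<inter> ball 0 R \<noteq> {}" by blast
        show "open (T \<inter> ball 0 R)" using T(1) by (intro open_Int) auto
        show "Z * T_transform \<nu> (E s) (\<lambda>x. z * \<xi> x) = UG (W \<xi> (of_real s) z)" if "z \<in> T \<inter> ball 0 R" for z
          using that by (intro T(3)) simp
        show "(1::complex) \<in> ball 0 R" "connected (ball (0::complex) R)" using R(1) by (simp_all add: dist_norm)
      qed (use R(2) in auto)
      then show ?thesis by simp
    qed
    have "filterlim (\<lambda>s. cmod (UG (W \<xi> (of_real s) 1))) at_top at_top"
      by (rule upper_Gamma_quad_arg_large[OF rho Im Re xi(2)])
    then have "\<forall>\<^sub>F s in at_top. cmod Z \<le> cmod (UG (W \<xi> (of_real s) 1))" by (simp add: filterlim_at_top)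
    then have "\<forall>\<^sub>F s in at_top. 1 \<le> cmod (T_transform \<nu> (E s) \<xi>)"
      using eventually_ge_at_top[of S]
    proof eventually_elim
      case (elim s)
      then have "cmod Z \<le> cmod Z * cmod (T_transform \<nu> (E s) \<xi>)" using eq[of s] by (simp add: norm_mult[symmetric])
      then show ?case using Z_nonzero by simp
    qed
    then show False using int[OF xi(1)] by (rule not_integrable_lborel_bounded_below[THEN notE])
  qed
qed

lemma integral_T_transform:
  assumes int: "\<And>\<xi>. \<xi> \<in> U_nbhd ip p q \<Longrightarrow> integrable lborel (\<lambda>s. T_transform \<nu> (E s) \<xi>)"
    and xi: "\<xi> \<in> U_nbhd ip p q"
  defines "k \<equiv> of_real \<theta> + (bilin \<xi> \<xi> - (bilin \<eta> \<xi>)\<^sup>2 / A) / 2"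
  shows "(CLINT s|lborel. T_transform \<nu> (E s) \<xi>) = csqrt (2 * of_real pi / A) * exp (- k) * tricomi (1 - of_real \<rho>) (1/2 - of_real \<rho>) k / Z"
proof -
  obtain R where R: "R > 1" "\<And>s. (\<lambda>z. Z * T_transform \<nu> (E s) (\<lambda>x. z * \<xi> x)) holomorphic_on ball 0 R"
    "\<And>s. \<forall>\<^sub>F z in nhds 0. Z * T_transform \<nu> (E s) (\<lambda>x. z * \<xi> x) = UG (W \<xi> (of_real s) z)"
    using T_transform_scale_near[OF xi] by blast
  interpret core: donsker_core \<rho> \<theta> R A "bilin \<eta> \<xi>" "bilin \<xi> \<xi>" "\<lambda>s z. Z * T_transform \<nu> (E s) (\<lambda>x. z * \<xi> x)"
    using rho th R Re_A_pos[OF int] by unfold_locales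
  have "(CLINT s|lborel. Z * T_transform \<nu> (E s) (\<lambda>x. 1 * \<xi> x)) = csqrt (2 * of_real pi / A) * exp (- k) * tricomi (1 - of_real \<rho>) (1/2 - of_real \<rho>) k"
    unfolding k_def by (rule core.integral_h(2))
  then have "Z * (CLINT s|lborel. T_transform \<nu> (E s) \<xi>) = csqrt (2 * of_real pi / A) * exp (- k) * tricomi (1 - of_real \<rho>) (1/2 - of_real \<rho>) k"
    by simp
  then show ?thesis using Z_nonzero by (metis nonzero_mult_div_cancel_left)
qed

end

text \<open>Product rules for the principal square root hold only up to sign. For Re A > 0 the root
  u of 2 pi A has positive real part, and so has 2 pi / u, which is therefore the principal root of
  2 pi / A.\<close>

lemma csqrt_divide_pos:
  assumes "Re A > 0"
  shows "csqrt (2 * of_real pi / A) / (2 * of_real pi) = 1 / csqrt (2 * of_real pi * A)"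
proof -
  define u where "u = csqrt (2 * of_real pi * A)"
  have u2: "u\<^sup>2 = 2 * of_real pi * A" by (simp add: u_def)
  have A0: "A \<noteq> 0" using assms by auto
  have "Re u > 0"
  proof (rule ccontr)
    assume "\<not> Re u > 0"
    then have "Re u = 0" using csqrt_principal[of "2 * of_real pi * A"] by (auto simp: u_def)
    then have "Re (u\<^sup>2) \<le> 0" by (simp add: power2_eq_square)
    moreover have "Re (2 * of_real pi * A) = 2 * pi * Re A" by simp
    moreover have "2 * pi * Re A > 0" using assms by simp
    ultimately show False using u2 by simp
  qed
  moreover from this have "u \<noteq> 0" by auto
  moreover have "(2 * of_real pi / u)\<^sup>2 = 2 * of_real pi / A" unfolding power_divide u2 using A0 by (simp add: power2_eq_square)
  moreover have "Re (2 * of_real pi / u) = 2 * pi * Re u / (cmod u)\<^sup>2" by (simp add: Re_divide cmod_power2)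
  ultimately have "csqrt (2 * of_real pi / A) = 2 * of_real pi / u" by (intro csqrt_unique) auto
  then show ?thesis by (simp add: u_def)
qed

theorem theorem3p2:
  fixes \<rho> \<theta> :: real
    and \<nu> :: "((real \<Rightarrow> real) \<Rightarrow> real) measure"
    and ip :: "nat \<Rightarrow> (real \<Rightarrow> real) \<Rightarrow> (real \<Rightarrow> real) \<Rightarrow> real"
    and p q :: nat
    and \<eta> \<xi> :: "real \<Rightarrow> complex"
    and \<Delta> :: "(((real \<Rightarrow> real) \<Rightarrow> real) \<Rightarrow> complex) \<Rightarrow> complex"
  assumes "0 < \<rho>" and "\<rho> < 1" and "0 < \<theta>"
    and "gamma_grey_measure \<rho> \<theta> \<nu>"
    and "hilbertian_family ip"
    and "U_nbhd ip p q \<subseteq> U_theta \<theta>"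
    and "\<eta> \<in> complexify L2"
    and "donsker_delta \<nu> ip p q \<eta> \<Delta>"
    and "\<xi> \<in> U_nbhd ip p q"
  shows "let k = of_real \<theta> + 1/2 * (bilin \<xi> \<xi> - (bilin \<eta> \<xi>)\<^sup>2 / bilin \<eta> \<eta>)
    in T_transform \<nu> \<Delta> \<xi> =
         exp (- k) / (csqrt (2 * of_real pi * bilin \<eta> \<eta>) * upper_Gamma (of_real \<rho>) (of_real \<theta>))
         * tricomi (1 - of_real \<rho>) (1/2 - of_real \<rho>) k"
proof -
  obtain E where E: "exp_family \<nu> ip p q \<eta> E"
    and int: "\<And>\<xi>. \<xi> \<in> U_nbhd ip p q \<Longrightarrow> integrable lborel (\<lambda>s. T_transform \<nu> (E s) \<xi>)"
    and T: "T_transform \<nu> \<Delta> \<xi> = 1 / (2 * of_real pi) * (CLINT s|lborel. T_transform \<nu> (E s) \<xi>)"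
    using assms(8,9) unfolding donsker_delta_def by blast
  interpret donsker_exp \<rho> \<theta> \<nu> ip p q \<eta> E
    using assms E by unfold_locales
  define k where "k = of_real \<theta> + 1/2 * (bilin \<xi> \<xi> - (bilin \<eta> \<xi>)\<^sup>2 / bilin \<eta> \<eta>)"
  have k: "of_real \<theta> + (bilin \<xi> \<xi> - (bilin \<eta> \<xi>)\<^sup>2 / A) / 2 = k" by (simp add: k_def A_def)
  have pos: "Re A > 0" by (rule Re_A_pos) (rule int)
  have "(CLINT s|lborel. T_transform \<nu> (E s) \<xi>) = csqrt (2 * of_real pi / A) * exp (- k) * tricomi (1 - of_real \<rho>) (1/2 - of_real \<rho>) k / Z"
    unfolding k[symmetric] by (rule integral_T_transform[OF _ assms(9)]) (rule int)
  then have "T_transform \<nu> \<Delta> \<xi> = (csqrt (2 * of_real pi / A) / (2 * of_real pi)) * (exp (- k) * tricomi (1 - of_real \<rho>) (1/2 - of_real \<rho>) k / Z)"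
    unfolding T by simp
  also have "\<dots> = exp (- k) / (csqrt (2 * of_real pi * bilin \<eta> \<eta>) * upper_Gamma (of_real \<rho>) (of_real \<theta>)) * tricomi (1 - of_real \<rho>) (1/2 - of_real \<rho>) k"
    unfolding csqrt_divide_pos[OF pos] unfolding A_def Z_def by simp
  finally show ?thesis unfolding Let_def k_def .
qed

end
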